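(* Let $\varepsilon>0$. There exist $c_1=c_1(\varepsilon)>0$ and $C=C(\varepsilon)>0$ depending only on $\varepsilon$ such that for all $\vartheta\in\mathbb R$ and all real $x\ge1$ we have \[ \sum_{1\le d\le D}\ \max_{\substack{y,z\ge0\\ z-y\le x}}\ \max_{0\le a<d}\ \left|\sum_{\substack{y\le n<z\\ n\equiv a\bmod d}}\mathrm e\bigl(\vartheta\,\mathsf z(n)\bigr)\right|\le C\,(\log^+x)^{11/4}\,x^{1-c_1\lVert\vartheta\rVert^2}, \] where $D=x^{1-\varepsilon}$. (Here $d,a,n$ are integers and $y,z$ are real numbers.)
   Context: $\mathrm e(x)=\exp(2\pi ix)$; $\lVert x\rVert=\min_{n\in\mathbb Z}|x-n|$; $\log^+(0)=1$ and $\log^+(x)=\max(1,\log x)$ for $x>0$. Fibonacci numbers: $F_0=0$, $F_1=1$, $F_{i+2}=F_{i+1}+F_i$ for $i\ge0$. Every nonnegative integer $n$ has a unique (Zeckendorf) representation $n=\sum_{i\ge 2}\delta_i(n)F_i$ (finite sum) with $\delta_i(n)\in\{0,1\}$ and such that $\delta_{i+1}(n)=1$ implies $\delta_i(n)=0$ for all $i\ge 2$. The Zeckendorf sum-of-digits function is $\mathsf z(n)=\sum_{i\ge2}\delta_i(n)$. *)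

theory Defs
  imports Complex_Main "HOL-Number_Theory.Number_Theory"
begin

definition e2pi :: "real \<Rightarrow> complex" where
  "e2pi x = exp (2 * of_real pi * \<i> * of_real x)"

definition dist_nearest_int :: "real \<Rightarrow> real" where
  "dist_nearest_int x = (INF n::int. \<bar>x - of_int n\<bar>)"

text \<open>The infimum above is a minimum.\<close>

lemma dist_nearest_int_eq: "dist_nearest_int x = \<bar>x - of_int (round x)\<bar>"
  unfolding dist_nearest_int_def
  by (rule cInf_eq_minimum) (auto intro: round_diff_minimal)

definition log_plus :: "real \<Rightarrow> real" where
  "log_plus x = (if x = 0 then 1 else max 1 (ln x))"

text \<open>The digits are indexed by \<open>i \<ge> 2\<close>; a digit sequence is totalised by
  the value 0 at the indices 0 and 1, so that it is determined by \<open>n\<close>.\<close>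

definition is_zeckendorf :: "(nat \<Rightarrow> nat) \<Rightarrow> nat \<Rightarrow> bool" where
  "is_zeckendorf \<delta> n \<longleftrightarrow>
     (\<forall>i. \<delta> i \<in> {0, 1}) \<and> \<delta> 0 = 0 \<and> \<delta> 1 = 0 \<and>
     (\<forall>i\<ge>2. \<delta> (i + 1) = 1 \<longrightarrow> \<delta> i = 0) \<and>
     finite {i. 2 \<le> i \<and> \<delta> i \<noteq> 0} \<and>
     n = (\<Sum>i | 2 \<le> i \<and> \<delta> i \<noteq> 0. \<delta> i * fib i)"

definition zeckendorf_digit :: "nat \<Rightarrow> nat \<Rightarrow> nat" where
  "zeckendorf_digit n = (THE \<delta>. is_zeckendorf \<delta> n)"

definition zeckendorf_sum :: "nat \<Rightarrow> nat" where
  "zeckendorf_sum n = (\<Sum>i | 2 \<le> i \<and> zeckendorf_digit n i \<noteq> 0. zeckendorf_digit n i)"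

text \<open>Zeckendorf's theorem: the digits of \<open>n\<close> exist and are unique.
  The proof works with the sets of indices whose digit is 1.\<close>

definition zeck_set :: "nat set \<Rightarrow> bool" where
  "zeck_set S \<longleftrightarrow> finite S \<and> S \<subseteq> {2..} \<and> (\<forall>i. Suc i \<in> S \<longrightarrow> i \<notin> S)"

lemma zeck_set_sum_less:
  "\<lbrakk>zeck_set S; S \<subseteq> {..k}; 1 \<le> k\<rbrakk> \<Longrightarrow> sum fib S < fib (Suc k)"
proof (induction k arbitrary: S rule: less_induct)
  case (less k)
  show ?case
  proof (cases "k \<in> S")
    case False
    show ?thesis
    proof (cases "k = 1")
      case True
      with less.prems False have "S = {}" by (force simp: zeck_set_def)
      then show ?thesis by (simp add: True)
    next
      case k: False
      then obtain j where j: "k = Suc j" "1 \<le> j"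
        using less.prems by (cases k) auto
      have "S \<subseteq> {..j}" using less.prems(2) False j by (auto simp: le_Suc_eq)
      then have "sum fib S < fib (Suc j)" using less.IH[of j S] less.prems(1) j by auto
      also have "\<dots> \<le> fib (Suc k)" unfolding j by (rule fib_mono) simp
      finally show ?thesis .
    qed
  next
    case True
    let ?T = "S - {k}"
    have fin: "finite S" using less.prems by (simp add: zeck_set_def)
    have T: "zeck_set ?T" using less.prems(1) by (auto simp: zeck_set_def)
    have k2: "2 \<le> k" using True less.prems(1) by (auto simp: zeck_set_def)
    then obtain j where j: "k = Suc (Suc j)" by (metis add_2_eq_Suc le_Suc_ex)
    have "Suc j \<notin> S" using True less.prems(1) j by (auto simp: zeck_set_def)
    then have sub: "?T \<subseteq> {..j}" using less.prems(2) j by (auto simp: le_Suc_eq)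
    have "sum fib ?T < fib (Suc j)"
    proof (cases "j = 0")
      case True
      then have "?T = {}" using sub T by (force simp: zeck_set_def)
      then show ?thesis by (simp only: True sum.empty) simp
    next
      case False
      then show ?thesis using less.IH[of j ?T] T sub j by auto
    qed
    moreover have "sum fib S = fib k + sum fib ?T" by (rule sum.remove[OF fin True])
    ultimately show ?thesis by (simp add: j)
  qed
qed

lemma zeck_set_exists: "\<exists>S. zeck_set S \<and> sum fib S = n"
proof (induction n rule: less_induct)
  case (less n)
  show ?case
  proof (cases "n = 0")
    case True
    then show ?thesis by (intro exI[of _ "{}"]) (auto simp: zeck_set_def)
  next
    case False
    have self: "i \<le> fib (Suc i)" for i
    proof (induction i rule: fib.induct)
      case (3 i)
      have "0 < fib (Suc i)" by (simp add: fib_neq_0_nat)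
      then show ?case using 3 by simp
    qed auto
    define P where "P k \<longleftrightarrow> n < fib (Suc k)" for k
    have ex: "P (Suc n)" using self[of "Suc n"] by (simp add: P_def del: fib.simps)
    define k where "k = (LEAST k. P k)"
    have Pk: "P k" unfolding k_def using ex by (rule LeastI)
    have k2: "2 \<le> k"
    proof (rule ccontr)
      assume "\<not> 2 \<le> k"
      then have "k = 0 \<or> k = 1" by auto
      then show False using Pk False by (auto simp: P_def)
    qed
    then obtain j where j: "k = Suc (Suc j)" by (metis add_2_eq_Suc le_Suc_ex)
    have "\<not> P (Suc j)" using not_less_Least[of "Suc j" P] j k_def by simp
    then have ge: "fib k \<le> n" by (simp add: P_def j)
    have kpos: "0 < fib k" using k2 by (simp add: fib_neq_0_nat)
    then obtain S where S: "zeck_set S" "sum fib S = n - fib k"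
      using less.IH[of "n - fib k"] False by auto
    have lt: "sum fib S < fib (Suc j)" using Pk S(2) ge by (simp add: P_def j)
    have small: "i \<le> j" if "i \<in> S" for i
    proof (rule ccontr)
      assume "\<not> i \<le> j"
      then have "fib (Suc j) \<le> fib i" by (intro fib_mono) simp
      also have "\<dots> \<le> sum fib S"
        using S(1) that by (intro member_le_sum) (auto simp: zeck_set_def)
      finally show False using lt by simp
    qed
    have "k \<notin> S" using small j by force
    then have "sum fib (insert k S) = n" using S ge by (simp add: zeck_set_def)
    moreover have "zeck_set (insert k S)"
      using S(1) k2 j small by (force simp: zeck_set_def)
    ultimately show ?thesis by blast
  qed
qed

lemma zeck_set_Max_le:
  assumes "zeck_set S" "zeck_set T" "sum fib S = sum fib T" "k \<in> S" "T \<subseteq> {..m}" "m < k"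
  shows False
proof -
  have "k \<ge> 2" using assms by (auto simp: zeck_set_def)
  have "T \<subseteq> {..k - 1}" using assms by force
  then have "sum fib T < fib (Suc (k - 1))"
    using \<open>k \<ge> 2\<close> assms by (intro zeck_set_sum_less) auto
  also have "\<dots> \<le> sum fib S"
    using \<open>k \<ge> 2\<close> assms member_le_sum[of k S fib] by (auto simp: zeck_set_def)
  finally show False using assms by simp
qed

lemma zeck_set_unique:
  "\<lbrakk>zeck_set S; zeck_set T; sum fib S = sum fib T\<rbrakk> \<Longrightarrow> S = T"
proof (induction "card S" arbitrary: S T rule: less_induct)
  case less
  have fin: "finite S" "finite T" using less.prems by (auto simp: zeck_set_def)
  have pos: "U = {}" if "sum fib U = 0" "zeck_set U" for U
  proof (rule ccontr)
    assume "U \<noteq> {}"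
    then obtain i where "i \<in> U" by blast
    with that have "fib i = 0" "2 \<le> i" by (auto simp: zeck_set_def)
    then show False using fib_neq_0_nat[of i] by simp
  qed
  show ?case
  proof (cases "S = {} \<or> T = {}")
    case True
    then show ?thesis using pos[of S] pos[of T] less.prems by auto
  next
    case False
    then have ne: "S \<noteq> {}" "T \<noteq> {}" by auto
    have m: "Max S \<in> S" "Max T \<in> T" using fin ne by auto
    have sub: "S \<subseteq> {..Max S}" "T \<subseteq> {..Max T}" using fin by auto
    have eq: "Max S = Max T"
      using zeck_set_Max_le[OF less.prems m(1) sub(2)]
        zeck_set_Max_le[OF less.prems(2,1) less.prems(3)[symmetric] m(2) sub(1)]
      by (meson linorder_neqE_nat)
    let ?k = "Max S"
    have "S - {?k} = T - {?k}"
    proof (rule less.hyps)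
      show "card (S - {?k}) < card S" using fin m by (meson card_Diff1_less)
      show "zeck_set (S - {?k})" "zeck_set (T - {?k})"
        using less.prems by (auto simp: zeck_set_def)
      show "sum fib (S - {?k}) = sum fib (T - {?k})"
        using sum.remove[of S ?k fib] sum.remove[of T ?k fib] fin m eq less.prems(3) by simp
    qed
    then show ?thesis using m eq by (metis insert_Diff)
  qed
qed

lemma is_zeckendorf_iff:
  "is_zeckendorf \<delta> n \<longleftrightarrow>
     (\<exists>S. zeck_set S \<and> sum fib S = n \<and> \<delta> = (\<lambda>i. if i \<in> S then 1 else 0))"
proof
  assume z: "is_zeckendorf \<delta> n"
  define S where "S = {i. 2 \<le> i \<and> \<delta> i \<noteq> 0}"
  have z01: "\<delta> i = 0 \<or> \<delta> i = 1" "\<delta> 0 = 0" "\<delta> 1 = 0" for i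
    using z unfolding is_zeckendorf_def by blast+
  have zadj: "\<delta> i = 0" if "2 \<le> i" "\<delta> (i + 1) = 1" for i
    using z that unfolding is_zeckendorf_def by blast
  have d: "\<delta> i = (if i \<in> S then 1 else 0)" for i
  proof (cases "2 \<le> i")
    case True
    then show ?thesis using z01(1)[of i] by (auto simp: S_def)
  next
    case False
    then have "i = 0 \<or> i = 1" by auto
    then show ?thesis using z01(2,3) by (auto simp: S_def)
  qed
  have n: "n = (\<Sum>i\<in>S. \<delta> i * fib i)" using z unfolding is_zeckendorf_def S_def by blast
  have "sum fib S = n" unfolding n by (rule sum.cong) (simp_all add: d)
  moreover have "zeck_set S"
    unfolding zeck_set_def
  proof (intro conjI allI impI)
    show "finite S" using z unfolding is_zeckendorf_def S_def by blast
    show "S \<subseteq> {2..}" by (auto simp: S_def)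
    fix i assume i: "Suc i \<in> S"
    show "i \<notin> S"
    proof
      assume "i \<in> S"
      then have "2 \<le> i" by (simp add: S_def)
      moreover have "\<delta> i = 1" "\<delta> (i + 1) = 1" using \<open>i \<in> S\<close> i by (simp_all add: d)
      ultimately show False using zadj[of i] by simp
    qed
  qed
  moreover have "\<delta> = (\<lambda>i. if i \<in> S then 1 else 0)" using d by blast
  ultimately show "\<exists>S. zeck_set S \<and> sum fib S = n \<and> \<delta> = (\<lambda>i. if i \<in> S then 1 else 0)"
    by blast
next
  assume "\<exists>S. zeck_set S \<and> sum fib S = n \<and> \<delta> = (\<lambda>i. if i \<in> S then 1 else 0)"
  then obtain S where S: "zeck_set S" "sum fib S = n" "\<delta> = (\<lambda>i. if i \<in> S then 1 else 0)"
    by blast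
  have fin: "finite S" and ge2: "\<And>i. i \<in> S \<Longrightarrow> 2 \<le> i" and adj: "\<And>i. Suc i \<in> S \<Longrightarrow> i \<notin> S"
    using S(1) unfolding zeck_set_def by blast+
  have supp: "{i. 2 \<le> i \<and> \<delta> i \<noteq> 0} = S" unfolding S(3) using ge2 by auto
  have "\<delta> i \<in> {0, 1}" for i by (simp add: S(3))
  moreover have "\<delta> 0 = 0" "\<delta> 1 = 0" using ge2[of 0] ge2[of 1] by (auto simp: S(3))
  moreover have "\<delta> i = 0" if "\<delta> (i + 1) = 1" for i
    using that adj[of i] by (simp add: S(3) split: if_splits)
  moreover have "(\<Sum>i\<in>S. \<delta> i * fib i) = n"
    unfolding S(2)[symmetric] by (rule sum.cong) (simp_all add: S(3))
  ultimately show "is_zeckendorf \<delta> n"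
    unfolding is_zeckendorf_def supp using fin by blast
qed

theorem zeckendorf_ex1: "\<exists>!\<delta>. is_zeckendorf \<delta> n"
  unfolding is_zeckendorf_iff using zeck_set_exists[of n] zeck_set_unique by metis

lemma is_zeckendorf_digit: "is_zeckendorf (zeckendorf_digit n) n"
  unfolding zeckendorf_digit_def by (rule theI'[OF zeckendorf_ex1])

text \<open>The supremum over the real endpoints \<open>y\<close>, \<open>z\<close> of the interval of summation
  is that of a nonempty set of reals bounded by \<open>x + 1\<close>, hence a genuine one.\<close>

lemma bdd_above_zeckendorf_exponential_sums:
  fixes \<theta> x :: real and d :: nat
  assumes "0 \<le> x" "1 \<le> d"
  shows "bdd_above ((\<lambda>(y, z). MAX a\<in>{0..<d}.
           norm (\<Sum>n | y \<le> real n \<and> real n < z \<and> [n = a] (mod d). e2pi (\<theta> * real (zeckendorf_sum n))))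
         ` {(y, z). 0 \<le> y \<and> 0 \<le> z \<and> z - y \<le> x})"
proof (rule bdd_aboveI[where M = "x + 1"])
  fix v
  assume "v \<in> (\<lambda>(y, z). MAX a\<in>{0..<d}.
           norm (\<Sum>n | y \<le> real n \<and> real n < z \<and> [n = a] (mod d). e2pi (\<theta> * real (zeckendorf_sum n))))
         ` {(y, z). 0 \<le> y \<and> 0 \<le> z \<and> z - y \<le> x}"
  then obtain y z where yz: "0 \<le> y" "0 \<le> z" "z - y \<le> x" and v: "v = (MAX a\<in>{0..<d}.
      norm (\<Sum>n | y \<le> real n \<and> real n < z \<and> [n = a] (mod d). e2pi (\<theta> * real (zeckendorf_sum n))))"
    by auto
  have ne: "norm (e2pi t) = 1" for t by (simp add: e2pi_def)
  have "norm (\<Sum>n | y \<le> real n \<and> real n < z \<and> [n = a] (mod d).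
          e2pi (\<theta> * real (zeckendorf_sum n))) \<le> x + 1" for a
  proof -
    let ?A = "{n. y \<le> real n \<and> real n < z \<and> [n = a] (mod d)}"
    let ?B = "{nat \<lceil>y\<rceil>..<nat \<lceil>z\<rceil>}"
    have sub: "?A \<subseteq> ?B"
      using yz by (auto simp: nat_le_iff ceiling_le_iff zless_nat_eq_int_zless less_ceiling_iff)
    have "norm (\<Sum>n\<in>?A. e2pi (\<theta> * real (zeckendorf_sum n))) \<le> (\<Sum>n\<in>?A. 1)"
      by (rule sum_norm_le) (simp add: ne)
    also have "\<dots> \<le> real (card ?B)" using card_mono[OF _ sub] by simp
    also have "\<dots> \<le> x + 1"
    proof (cases "nat \<lceil>y\<rceil> \<le> nat \<lceil>z\<rceil>")
      case True
      then have "real (card ?B) = real (nat \<lceil>z\<rceil>) - real (nat \<lceil>y\<rceil>)" by simp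
      also have "\<dots> = of_int \<lceil>z\<rceil> - of_int \<lceil>y\<rceil>" using yz by simp
      also have "\<dots> \<le> x + 1" using yz by linarith
      finally show ?thesis .
    next
      case False
      then have "card ?B = 0" by (simp only: card_atLeastLessThan)
      then show ?thesis using assms by linarith
    qed
    finally show ?thesis .
  qed
  then show "v \<le> x + 1"
    unfolding v using assms by (subst Max_le_iff) auto
qed

end

theory Submission
  imports Defs "HOL-Analysis.Analysis"
begin

text \<open>Apart from few exceptional moduli \<open>d\<close> in each dyadic range \<open>{D..<2*D}\<close>, the sum of digits is cut
  into windows of digits, which are removed one after the other by van der Corput's inequality: shifting
  \<open>n\<close> by a suitable multiple of \<open>d\<close> leaves all but one window unchanged for most \<open>n\<close>. What remains is
  a box average (a Gowers norm) of the lowest window, whose shifts can be replaced by uniform ones because the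
  multiples used are equidistributed modulo the golden ratio; it decays exponentially in the number of digits
  since inserting one digit \<open>1\<close> at a single vertex of the box multiplies the product by \<open>e(\<theta>)\<close>.
  A modulus is exceptional when a small multiple of it is close to a point of small height in the lattice
  \<open>\<int> + \<int> g\<close>; the lower bound for the norm form and the divisor bound show that there are few of these.\<close>

section \<open>Zeckendorf digits and the rotation by the golden ratio\<close>

text \<open>A progression with difference \<open>d\<close> up to
  \<open>x powr (1 - \<epsilon>)\<close> has only about \<open>x / d\<close> terms, so a shift
  \<open>r * d\<close> is affordable only for \<open>r\<close> below a small power of
  \<open>x\<close>, and no such shift acts in a controlled way on all of the roughly
  \<open>ln x\<close> digits. It suffices that it preserves the single window
  \<open>{L..<L'}\<close> to be removed, whose factor then cancels against its conjugate. This
  happens for most \<open>n\<close> if \<open>r * d = w + h\<close>, where \<open>w\<close> hardly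
  moves the rotation by \<open>gi\<close> (digits below \<open>L'\<close> survive) and
  \<open>h\<close> is small in size (digits from \<open>L\<close> on survive); Dirichlet
  approximation in the lattice finds such an \<open>r\<close> for a short window. The number of
  windows, hence the exponent \<open>2 ^ Suc J\<close> lost to repeated Cauchy-Schwarz, depends on
  \<epsilon> only. Digits are read off two coordinates of \<open>n\<close>, its size and its
  position \<open>- n * gi\<close> modulo 1, and carries occur only near cut points of small height:
  this is why every exceptional set is a fattened Bohr set. The squared distance in the exponent is
  a lower bound for \<open>2 - norm (1 + e2pi \<theta>)\<close>, the loss when two terms of the box
  average differ by the factor e(\<theta>) or its conjugate.\<close>

definition gr :: real where "gr = (1 + sqrt 5) / 2"

definition gi :: real where "gi = (sqrt 5 - 1) / 2"

lemma gi_bounds: "3/5 < gi" "gi < 5/8"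
proof -
  have "11/5 < sqrt 5" by (rule real_less_rsqrt) (simp add: power2_eq_square)
  moreover have "sqrt 5 < 9/4" by (rule real_less_lsqrt) (simp_all add: power2_eq_square)
  ultimately show "3/5 < gi" "gi < 5/8" by (simp_all add: gi_def)
qed

lemma gi_pos: "0 < gi" and gi_less_1: "gi < 1"
  using gi_bounds by linarith+

lemma gr_eq: "gr = 1 + gi"
  by (simp add: gr_def gi_def field_simps)

lemma gi_sq: "gi * gi = 1 - gi"
  by (simp add: gi_def field_simps)

lemma gi_gr: "gi * gr = 1"
  by (simp add: gr_eq algebra_simps gi_sq)

lemma gr_sq: "gr * gr = gr + 1"
  by (simp add: gr_eq algebra_simps gi_sq)

lemma gr_bounds: "8/5 < gr" "gr < 13/8"
  using gi_bounds by (simp_all add: gr_eq)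

lemma gi_power_gr_power: "gi ^ n * gr ^ n = 1"
  by (simp add: power_mult_distrib [symmetric] gi_gr)

lemma gi_power: "gi ^ n = 1 / gr ^ n"
  using gi_power_gr_power[of n] gr_bounds by (simp add: field_simps)

lemma gi_power_Suc_Suc: "gi ^ Suc (Suc n) = gi ^ n - gi ^ Suc n"
proof -
  have "gi ^ Suc (Suc n) = gi ^ n * (gi * gi)" by simp
  also have "\<dots> = gi ^ n - gi ^ Suc n" unfolding gi_sq by (simp add: algebra_simps)
  finally show ?thesis .
qed

lemma gi_power_pos [simp]: "0 < gi ^ n"
  using gi_pos by simp

text \<open>\<open>- gi\<close> is the Galois conjugate of \<open>gr\<close>, so this is the
  conjugate of the corresponding formula for \<open>gr ^ Suc n\<close>. Modulo 1 it says that a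
  shift by a Fibonacci number of index \<open>m\<close> moves the rotation by \<open>gi ^ m\<close>,
  with alternating sign: digit \<open>m\<close> acts on the circle at scale
  \<open>gi ^ m\<close>.\<close>

lemma neg_gi_power_Suc: "(- gi) ^ Suc n = - real (fib (Suc n)) * gi + real (fib n)"
proof (induction n)
  case (Suc n)
  have "(- gi) ^ Suc (Suc n) = (- real (fib (Suc n)) * gi + real (fib n)) * (- gi)"
    using Suc by (simp only: power_Suc2[of "-gi" "Suc n"])
  also have "\<dots> = real (fib (Suc n)) * (gi * gi) - real (fib n) * gi" by (simp add: algebra_simps)
  also have "\<dots> = - real (fib (Suc (Suc n))) * gi + real (fib (Suc n))"
    unfolding gi_sq by (simp add: algebra_simps)
  finally show ?case .
qed simp

lemma gr_power_Suc: "gr ^ Suc n = real (fib (Suc n)) * gr + real (fib n)"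
proof (induction n)
  case (Suc n)
  have "gr ^ Suc (Suc n) = (real (fib (Suc n)) * gr + real (fib n)) * gr"
    using Suc by (simp only: power_Suc2[of gr "Suc n"])
  also have "\<dots> = real (fib (Suc n)) * (gr * gr) + real (fib n) * gr" by (simp add: algebra_simps)
  also have "\<dots> = real (fib (Suc (Suc n))) * gr + real (fib (Suc n))"
    unfolding gr_sq by (simp add: algebra_simps)
  finally show ?case .
qed simp

lemma fib_Suc_le_gr_power: "real (fib (Suc n)) \<le> gr ^ n"
proof (induction n rule: fib.induct)
  case (3 n)
  have "gr ^ Suc (Suc n) = gr ^ n * (gr * gr)" by simp
  also have "\<dots> = gr ^ Suc n + gr ^ n" unfolding gr_sq by (simp add: algebra_simps)
  finally show ?case using 3 by (simp del: power_Suc)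
qed (use gr_bounds in auto)

lemma fib_le_gr_power: "real (fib n) \<le> gr ^ n"
proof -
  have "real (fib n) \<le> real (fib (Suc n))" using fib_Suc_mono[of n] by linarith
  then show ?thesis using fib_Suc_le_gr_power[of n] by linarith
qed

lemma gr_power_le_fib: "gr ^ n \<le> real (fib (n + 2))"
proof (induction n rule: fib.induct)
  case (3 n)
  have "gr ^ Suc (Suc n) = gr ^ n * (gr * gr)" by simp
  also have "\<dots> = gr ^ Suc n + gr ^ n" unfolding gr_sq by (simp add: algebra_simps)
  finally show ?case using 3 by (simp del: power_Suc)
qed (use gr_bounds in auto)

section \<open>Non-adjacent index sets and the conjugate coordinate\<close>

definition nonadj :: "nat set \<Rightarrow> bool" where
  "nonadj S \<longleftrightarrow> (\<forall>i. Suc i \<in> S \<longrightarrow> i \<notin> S)"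

lemma nonadj_subset: "nonadj S \<Longrightarrow> T \<subseteq> S \<Longrightarrow> nonadj T"
  by (auto simp: nonadj_def)

text \<open>The conjugate of the integer \<open>sum fib S\<close>: the power
  \<open>(- gi) ^ i\<close> is congruent to \<open>- fib i * gi\<close> modulo 1 for
  \<open>1 \<le> i\<close>. High digits dominate the size of an integer, low digits dominate this
  coordinate.\<close>

definition conj_sum :: "nat set \<Rightarrow> real" where
  "conj_sum S = (\<Sum>i\<in>S. (- gi) ^ i)"

lemma conj_sum_empty [simp]: "conj_sum {} = 0"
  by (simp add: conj_sum_def)

lemma conj_sum_Un: "finite S \<Longrightarrow> finite T \<Longrightarrow> S \<inter> T = {} \<Longrightarrow> conj_sum (S \<union> T) = conj_sum S + conj_sum T"
  by (simp add: conj_sum_def sum.union_disjoint)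

lemma sign_neg_gi_power: "(-1) ^ m * (- gi) ^ m = gi ^ m"
  by (simp add: power_mult_distrib [symmetric])

text \<open>The bounds are the limits reached by the digits \<open>m, m + 2, ...\<close> and
  \<open>m + 1, m + 3, ...\<close>, geometric series of ratio \<open>gi * gi = 1 - gi\<close>, so
  finite sets stay strictly inside. Since \<open>1 + gi\<close> is \<open>1 / gi\<close>, the upper
  bound is \<open>gi ^ (m - 1)\<close> in a form that makes sense for \<open>m = 0\<close>. If
  \<open>m\<close> is in \<open>S\<close>, non-adjacency lets the induction jump to
  \<open>m + 2\<close>.\<close>

lemma conj_sum_bounds_aux:
  "finite S \<Longrightarrow> nonadj S \<Longrightarrow> S \<subseteq> {m..<m+k} \<Longrightarrow>
     - (gi ^ m) < (-1) ^ m * conj_sum S \<and> (-1) ^ m * conj_sum S < gi ^ m * (1 + gi)"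
proof (induction k arbitrary: m S rule: less_induct)
  case (less k)
  show ?case
  proof (cases "S = {}")
    case True
    then show ?thesis using gi_pos by (simp add: add_pos_pos)
  next
    case ne: False
    then have k: "k \<ge> 1" using less.prems by (cases k) auto
    have g2: "gi ^ Suc (Suc m) = gi ^ m - gi ^ Suc m" by (rule gi_power_Suc_Suc)
    have pm: "0 < gi ^ Suc m" "0 < gi ^ m" by (rule gi_power_pos)+
    show ?thesis
    proof (cases "m \<in> S")
      case False
      have sub: "S \<subseteq> {Suc m..<Suc m + (k - 1)}"
      proof
        fix i assume "i \<in> S"
        then have "i \<noteq> m" "m \<le> i" "i < m + k" using False less.prems by auto
        then show "i \<in> {Suc m..<Suc m + (k - 1)}" by auto
      qed
      from less.IH[OF _ less.prems(1,2) this] k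
      have "- (gi ^ Suc m) < - ((-1) ^ m * conj_sum S)" "- ((-1) ^ m * conj_sum S) < gi ^ Suc m * (1 + gi)"
        by auto
      moreover have "gi ^ Suc m * (1 + gi) = gi ^ m"
        using g2 by (simp add: algebra_simps)
      moreover have "gi ^ m * (1 + gi) = gi ^ m + gi ^ Suc m" by (simp add: algebra_simps)
      ultimately show ?thesis using pm by linarith
    next
      case True
      define S' where "S' = S - {m}"
      have sub: "S' \<subseteq> {Suc (Suc m)..<Suc (Suc m) + (k - 2)}"
      proof
        fix i assume "i \<in> S'"
        then have i: "i \<noteq> m" "m \<le> i" "i < m + k" "i \<in> S" using less.prems by (auto simp: S'_def)
        have "i \<noteq> Suc m" using less.prems(2) i True by (auto simp: nonadj_def)
        then show "i \<in> {Suc (Suc m)..<Suc (Suc m) + (k - 2)}" using i by auto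
      qed
      have "finite S'" "nonadj S'" using less.prems by (auto simp: S'_def intro: nonadj_subset)
      from less.IH[OF _ this sub] k
      have "- (gi ^ Suc (Suc m)) < (-1) ^ m * conj_sum S'" "(-1) ^ m * conj_sum S' < gi ^ Suc (Suc m) * (1 + gi)"
        by auto
      moreover have "gi ^ Suc (Suc m) * (1 + gi) = gi ^ Suc m"
        using gi_power_Suc_Suc[of "Suc m"] by (simp add: algebra_simps)
      moreover have "gi ^ m * (1 + gi) = gi ^ m + gi ^ Suc m" by (simp add: algebra_simps)
      moreover have "conj_sum S = (- gi) ^ m + conj_sum S'"
        unfolding conj_sum_def S'_def using True less.prems(1) by (rule sum.remove[rotated])
      then have "(-1) ^ m * conj_sum S = gi ^ m + (-1) ^ m * conj_sum S'"
        by (simp add: distrib_left sign_neg_gi_power)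
      ultimately show ?thesis using pm g2 by linarith
    qed
  qed
qed

lemma conj_sum_bounds:
  assumes "finite S" "nonadj S" "S \<subseteq> {m..}"
  shows "- (gi ^ m) < (-1) ^ m * conj_sum S" "(-1) ^ m * conj_sum S < gi ^ m * (1 + gi)"
proof -
  have "S \<subseteq> {m..<m + Suc (Max S)}"
  proof
    fix i assume "i \<in> S"
    then have "i \<le> Max S" "m \<le> i" using assms by auto
    then show "i \<in> {m..<m + Suc (Max S)}" by simp
  qed
  from conj_sum_bounds_aux[OF assms(1,2) this]
  show "- (gi ^ m) < (-1) ^ m * conj_sum S" "(-1) ^ m * conj_sum S < gi ^ m * (1 + gi)" by auto
qed

lemma abs_neg_one_power_mult: "\<bar>(-1) ^ m * x\<bar> = \<bar>x\<bar>" for x :: real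
  by (simp add: abs_mult)

lemma abs_conj_sum_less:
  assumes "finite S" "nonadj S" "S \<subseteq> {m..}"
  shows "\<bar>conj_sum S\<bar> < gi ^ m * (1 + gi)"
proof -
  have "gi ^ m \<le> gi ^ m * (1 + gi)" using gi_pos by simp
  then have "\<bar>(-1) ^ m * conj_sum S\<bar> < gi ^ m * (1 + gi)"
    using conj_sum_bounds[OF assms] by linarith
  then show ?thesis by (simp add: abs_neg_one_power_mult)
qed

text \<open>The lowest digit dominates: the others start at \<open>m + 2\<close> and cancel less
  than \<open>gi ^ (m + 2)\<close>, and \<open>gi ^ m - gi ^ (m + 2) = gi ^ (m + 1)\<close>.\<close>

lemma abs_conj_sum_greater:
  assumes "finite S" "nonadj S" "S \<subseteq> {m..}" "m \<in> S"
  shows "gi ^ Suc m < \<bar>conj_sum S\<bar>"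
proof -
  have sub: "S - {m} \<subseteq> {Suc (Suc m)..}"
  proof
    fix i assume "i \<in> S - {m}"
    then have "i \<noteq> m" "m \<le> i" "i \<noteq> Suc m" using assms by (auto simp: nonadj_def)
    then show "i \<in> {Suc (Suc m)..}" by simp
  qed
  have "nonadj (S - {m})" using assms(2) by (rule nonadj_subset) auto
  then have "- (gi ^ Suc (Suc m)) < (-1) ^ m * conj_sum (S - {m})"
    using conj_sum_bounds(1)[OF _ _ sub] assms by simp
  moreover have "conj_sum S = (- gi) ^ m + conj_sum (S - {m})"
    unfolding conj_sum_def using assms by (intro sum.remove) auto
  then have "(-1) ^ m * conj_sum S = gi ^ m + (-1) ^ m * conj_sum (S - {m})"
    by (simp add: distrib_left sign_neg_gi_power)
  ultimately have "gi ^ Suc m < (-1) ^ m * conj_sum S"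
    using gi_power_Suc_Suc[of m] by linarith
  then show ?thesis by (metis abs_ge_self abs_neg_one_power_mult order_less_le_trans)
qed

text \<open>The digit at which the sets first differ contributes
  \<open>gi ^ i = gi ^ (i + 1) + gi ^ (i + 2)\<close>. Giving one part to each set writes the signed
  difference as a sum of two positive terms, one depending only on the tail of \<open>S\<close> and
  the other only on the tail of \<open>T\<close>. They are the distances of the two points from the
  cut between them, so closeness of the points bounds each distance separately.\<close>

lemma conj_sum_first_difference:
  assumes "finite S" "nonadj S" "finite T" "nonadj T"
    and "i \<in> S" "i \<notin> T" "S \<inter> {..<i} = T \<inter> {..<i}"
  shows "0 < (-1) ^ i * (conj_sum (S \<inter> {Suc i..}) + (- gi) ^ (i + 2))"
    and "0 < - ((-1) ^ i * (conj_sum (T \<inter> {i..}) + (- gi) ^ (i + 1)))"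
    and "(-1) ^ i * (conj_sum S - conj_sum T) =
      (-1) ^ i * (conj_sum (S \<inter> {Suc i..}) + (- gi) ^ (i + 2)) +
      (- ((-1) ^ i * (conj_sum (T \<inter> {i..}) + (- gi) ^ (i + 1))))"
proof -
  have subS: "S \<inter> {Suc i..} \<subseteq> {Suc (Suc i)..}"
  proof
    fix k assume "k \<in> S \<inter> {Suc i..}"
    then have "Suc i \<le> k" "k \<noteq> Suc i" using assms by (auto simp: nonadj_def)
    then show "k \<in> {Suc (Suc i)..}" by simp
  qed
  have subT: "T \<inter> {i..} \<subseteq> {Suc i..}"
    using assms(6) by (auto simp: Suc_le_eq order_le_less)
  have na: "nonadj (S \<inter> {Suc i..})" "nonadj (T \<inter> {i..})"
    using assms by (auto intro: nonadj_subset)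
  have s2: "(-1) ^ i * (- gi) ^ (i + 2) = gi ^ Suc (Suc i)"
    using sign_neg_gi_power[of "i + 2"] by simp
  have s1: "(-1) ^ i * (- gi) ^ (i + 1) = - (gi ^ Suc i)"
    using sign_neg_gi_power[of "i + 1"] by simp
  show "0 < (-1) ^ i * (conj_sum (S \<inter> {Suc i..}) + (- gi) ^ (i + 2))"
    using conj_sum_bounds(1)[OF _ na(1) subS] assms(1) unfolding distrib_left s2 by simp
  have "gi ^ Suc i * (1 + gi) = gi ^ i" using gi_power_Suc_Suc[of i] by (simp add: algebra_simps)
  then have "- (gi ^ i) < (-1) ^ i * conj_sum (T \<inter> {i..})" "(-1) ^ i * conj_sum (T \<inter> {i..}) < gi ^ Suc i"
    using conj_sum_bounds[OF finite_Int[OF disjI1[OF assms(3)]] na(2) subT] by (auto simp del: power_Suc simp: power_Suc[of "-1"])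
  then show "0 < - ((-1) ^ i * (conj_sum (T \<inter> {i..}) + (- gi) ^ (i + 1)))"
    unfolding distrib_left s1 by linarith
  have "S = (S \<inter> {..<i}) \<union> ({i} \<union> (S \<inter> {Suc i..}))"
    using assms(5) by (auto simp: not_less)
  then have "conj_sum S = conj_sum ((S \<inter> {..<i}) \<union> ({i} \<union> (S \<inter> {Suc i..})))" by simp
  also have "\<dots> = conj_sum (S \<inter> {..<i}) + (conj_sum {i} + conj_sum (S \<inter> {Suc i..}))"
    using assms(1) conj_sum_Un[of "{i}" "S \<inter> {Suc i..}"]
    by (subst conj_sum_Un) (auto simp del: Un_insert_left)
  finally have cS: "conj_sum S = conj_sum (S \<inter> {..<i}) + ((- gi) ^ i + conj_sum (S \<inter> {Suc i..}))"
    by (simp add: conj_sum_def)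
  have "T = (T \<inter> {..<i}) \<union> (T \<inter> {i..})" by auto
  then have "conj_sum T = conj_sum ((T \<inter> {..<i}) \<union> (T \<inter> {i..}))" by simp
  also have "\<dots> = conj_sum (T \<inter> {..<i}) + conj_sum (T \<inter> {i..})"
    using assms(3) by (subst conj_sum_Un) auto
  finally have cT: "conj_sum T = conj_sum (S \<inter> {..<i}) + conj_sum (T \<inter> {i..})"
    using assms(7) by simp
  have s0: "(-1) ^ i * (- gi) ^ i = gi ^ i" by (rule sign_neg_gi_power)
  show "(-1) ^ i * (conj_sum S - conj_sum T) =
      (-1) ^ i * (conj_sum (S \<inter> {Suc i..}) + (- gi) ^ (i + 2)) +
      (- ((-1) ^ i * (conj_sum (T \<inter> {i..}) + (- gi) ^ (i + 1))))"
    unfolding cS cT distrib_left right_diff_distrib s0 s1 s2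
    using gi_power_Suc_Suc[of i] by linarith
qed

section \<open>Zeckendorf index sets, splitting at a digit, and the position on the circle\<close>

definition zset :: "nat \<Rightarrow> nat set" where
  "zset n = (SOME S. zeck_set S \<and> sum fib S = n)"

lemma zset: "zeck_set (zset n)" "sum fib (zset n) = n"
  using someI_ex[OF zeck_set_exists[of n]] unfolding zset_def by blast+

lemma zset_props: "finite (zset n)" "nonadj (zset n)" "zset n \<subseteq> {2..}"
  using zset(1)[of n] by (auto simp: zeck_set_def nonadj_def)

lemma zset_sum_fib: "zeck_set S \<Longrightarrow> zset (sum fib S) = S"
  using zeck_set_unique zset by blast

lemma zset_eqI: "zeck_set S \<Longrightarrow> sum fib S = n \<Longrightarrow> zset n = S"
  using zset_sum_fib by blast

lemma zset_0 [simp]: "zset 0 = {}"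
  by (rule zset_eqI) (auto simp: zeck_set_def)

lemma zeck_set_subset: "zeck_set S \<Longrightarrow> T \<subseteq> S \<Longrightarrow> zeck_set T"
  unfolding zeck_set_def using finite_subset by blast

lemma zeck_set_iff: "zeck_set S \<longleftrightarrow> finite S \<and> nonadj S \<and> S \<subseteq> {2..}"
  by (auto simp: zeck_set_def nonadj_def)

lemma zeckendorf_sum_eq_card: "zeckendorf_sum n = card (zset n)"
proof -
  obtain S where S: "zeck_set S" "sum fib S = n" "zeckendorf_digit n = (\<lambda>i. if i \<in> S then 1 else 0)"
    using is_zeckendorf_digit[of n] unfolding is_zeckendorf_iff by blast
  then have "zset n = S" by (simp add: zset_eqI)
  moreover have "{i. 2 \<le> i \<and> zeckendorf_digit n i \<noteq> 0} = S"
    using S by (auto simp: zeck_set_def)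
  ultimately show ?thesis using S by (simp add: zeckendorf_sum_def)
qed

definition low :: "nat \<Rightarrow> nat \<Rightarrow> nat" where
  "low k n = sum fib (zset n \<inter> {..<k})"

definition high :: "nat \<Rightarrow> nat \<Rightarrow> nat" where
  "high k n = sum fib (zset n \<inter> {k..})"

lemma low_high: "low k n + high k n = n"
proof -
  have "zset n = (zset n \<inter> {..<k}) \<union> (zset n \<inter> {k..})" by auto
  then have "n = sum fib ((zset n \<inter> {..<k}) \<union> (zset n \<inter> {k..}))" using zset(2) by metis
  also have "\<dots> = low k n + high k n"
    unfolding low_def high_def using zset_props by (intro sum.union_disjoint) auto
  finally show ?thesis ..
qed

lemma zset_high: "zset (high k n) = zset n \<inter> {k..}"
  unfolding high_def by (rule zset_sum_fib) (rule zeck_set_subset[OF zset(1)], auto)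

lemma sum_fib_less:
  assumes "zeck_set S" "S \<subseteq> {..<k}" "2 \<le> k"
  shows "sum fib S < fib k"
proof -
  obtain j where j: "k = Suc j" "1 \<le> j" using assms(3) by (cases k) auto
  have "S \<subseteq> {..j}" using assms(2) j by auto
  then show ?thesis using zeck_set_sum_less[OF assms(1), of j] j by simp
qed

lemma low_less: "2 \<le> k \<Longrightarrow> low k n < fib k"
  unfolding low_def by (rule sum_fib_less) (auto intro: zeck_set_subset[OF zset(1)])

lemma zset_less:
  assumes "n < fib k"
  shows "zset n \<subseteq> {..<k}"
proof
  fix i assume "i \<in> zset n"
  then have "fib i \<le> sum fib (zset n)" using zset_props by (intro member_le_sum) auto
  then have "fib i < fib k" using assms zset(2) by simp
  then show "i \<in> {..<k}" using fib_mono[of k i] by (meson lessThan_iff not_le)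
qed

lemma zset_subset_iff: "2 \<le> k \<Longrightarrow> zset n \<subseteq> {..<k} \<longleftrightarrow> n < fib k"
  using sum_fib_less[OF zset(1), of n k] zset(2) zset_less by metis

text \<open>The free index \<open>k\<close> keeps the two sets non-adjacent, so that no carry
  occurs.\<close>

lemma zset_add:
  assumes "zset u \<subseteq> {..<k}" "zset v \<subseteq> {Suc k..}"
  shows "zset (u + v) = zset u \<union> zset v"
proof (rule zset_eqI)
  show "zeck_set (zset u \<union> zset v)"
    unfolding zeck_set_iff
  proof (intro conjI)
    show "nonadj (zset u \<union> zset v)"
      unfolding nonadj_def
    proof (intro allI impI notI)
      fix i assume i: "Suc i \<in> zset u \<union> zset v" "i \<in> zset u \<union> zset v"
      have "\<not> (Suc i \<in> zset u \<and> i \<in> zset u)" "\<not> (Suc i \<in> zset v \<and> i \<in> zset v)"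
        using zset_props(2) by (auto simp: nonadj_def)
      moreover have "\<not> (Suc i \<in> zset v \<and> i \<in> zset u)" "\<not> (Suc i \<in> zset u \<and> i \<in> zset v)"
        using assms by force+
      ultimately show False using i by auto
    qed
  qed (use zset_props in auto)
  have "zset u \<inter> zset v = {}" using assms by force
  then show "sum fib (zset u \<union> zset v) = u + v"
    using zset_props zset(2) by (simp add: sum.union_disjoint)
qed

text \<open>The point \<open>zpos n\<close> is the representative of \<open>- n * gi\<close> modulo 1 in an interval of length 1.\<close>

definition zpos :: "nat \<Rightarrow> real" where
  "zpos n = conj_sum (zset n)"

lemma zpos_bounds: "- (gi * gi) < zpos n" "zpos n < gi"
proof -
  have "gi * gi * (1 + gi) = gi" "gi ^ 2 = gi * gi"
    using gi_sq by (simp_all add: power2_eq_square algebra_simps)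
  then show "- (gi * gi) < zpos n" "zpos n < gi"
    using conj_sum_bounds[OF zset_props, of n] by (auto simp only: zpos_def power2_minus power_one mult_1)
qed

lemma conj_sum_cong_gi:
  assumes "finite S" "S \<subseteq> {1..}"
  shows "\<exists>k::int. conj_sum S = - real (sum fib S) * gi + of_int k"
proof -
  have "(- gi) ^ i = - real (fib i) * gi + real (fib (i - 1))" if "i \<in> S" for i
  proof -
    from that assms obtain j where "i = Suc j" by (cases i) auto
    then show ?thesis using neg_gi_power_Suc[of j] by simp
  qed
  then have "conj_sum S = (\<Sum>i\<in>S. - real (fib i) * gi + real (fib (i - 1)))"
    unfolding conj_sum_def by (rule sum.cong[OF refl])
  also have "\<dots> = - real (sum fib S) * gi + of_int (int (\<Sum>i\<in>S. fib (i - 1)))"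
    by (simp add: sum_subtractf sum_distrib_right)
  finally show ?thesis by blast
qed

lemma zpos_cong: "\<exists>k::int. zpos n = - real n * gi + of_int k"
  using conj_sum_cong_gi[of "zset n"] zset_props(1,3)[of n] zset(2)[of n]
  unfolding zpos_def by fastforce

lemma zpos_eqI:
  assumes "x = - real n * gi + of_int k" "- (gi * gi) < x" "x < gi"
  shows "zpos n = x"
proof -
  obtain k' where k': "zpos n = - real n * gi + of_int k'" using zpos_cong by blast
  have "\<bar>zpos n - x\<bar> < 1" using zpos_bounds[of n] assms gi_sq by linarith
  then have "\<bar>of_int (k' - k) :: real\<bar> < 1" using k' assms(1) by simp
  then have "k' = k" by linarith
  then show ?thesis using k' assms by simp
qed

lemma least_difference:
  assumes "S \<inter> {..<k} \<noteq> T \<inter> {..<(k::nat)}"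
  obtains i where "i < k" "i \<in> S \<longleftrightarrow> i \<notin> T" "S \<inter> {..<i} = T \<inter> {..<i}"
proof -
  define P where "P i \<longleftrightarrow> (i \<in> S \<longleftrightarrow> i \<notin> T)" for i
  obtain j where j: "j < k" "P j" using assms unfolding P_def by blast
  define i where "i = (LEAST i. P i)"
  have "P i" unfolding i_def using j(2) by (rule LeastI)
  moreover have "i \<le> j" unfolding i_def using j(2) by (rule Least_le)
  moreover have "\<not> P m" if "m < i" for m using that not_less_Least unfolding i_def by blast
  ultimately show ?thesis using j that[of i] unfolding P_def by (auto intro!: that[of i])
qed

lemma zpos_first_difference:
  assumes "i \<in> zset m" "i \<notin> zset n" "zset m \<inter> {..<i} = zset n \<inter> {..<i}"
  shows "0 < (-1) ^ i * (zpos m - zpos n)"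
  using conj_sum_first_difference[OF zset_props(1,2) zset_props(1,2) assms]
  unfolding zpos_def by linarith

text \<open>The integers with prescribed low digits occupy an interval of the circle. If
  \<open>b\<close> differed from the common digits of \<open>a\<close> and \<open>c\<close> first at
  \<open>i\<close>, then by \<open>zpos_first_difference\<close> it would lie on the same side of
  both, the side being fixed by the parity of \<open>i\<close> and by whether \<open>i\<close> is a
  digit of \<open>b\<close>.\<close>

lemma low_digits_convex:
  assumes "zpos a \<le> zpos b" "zpos b \<le> zpos c" "zset a \<inter> {..<k} = zset c \<inter> {..<k}"
  shows "zset b \<inter> {..<k} = zset a \<inter> {..<k}"
proof (rule ccontr)
  assume "\<not> ?thesis"
  then obtain i where i: "i < k" "i \<in> zset b \<longleftrightarrow> i \<notin> zset a" "zset b \<inter> {..<i} = zset a \<inter> {..<i}"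
    by (rule least_difference)
  have mem: "j \<in> zset a \<longleftrightarrow> j \<in> zset c" if "j \<le> i" for j
    using assms(3) i(1) that by (metis IntD1 IntI lessThan_iff order_le_less_trans)
  then have ac: "zset a \<inter> {..<i} = zset c \<inter> {..<i}" "i \<in> zset a \<longleftrightarrow> i \<in> zset c"
    by auto
  show False
  proof (cases "i \<in> zset b")
    case True
    then have "0 < (-1) ^ i * (zpos b - zpos a)" "0 < (-1) ^ i * (zpos b - zpos c)"
      using zpos_first_difference i ac by auto
    then show False using assms by (auto simp: zero_less_mult_iff)
  next
    case False
    then have "0 < (-1) ^ i * (zpos a - zpos b)" "0 < (-1) ^ i * (zpos c - zpos b)"
      using zpos_first_difference i ac by auto
    then show False using assms by (auto simp: zero_less_mult_iff)
  qed
qed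

section \<open>Bohr sets of the rotation and the absence of carries outside them\<close>

definition near :: "real \<Rightarrow> int \<Rightarrow> bool" where
  "near t m \<longleftrightarrow> (\<exists>k::int. \<bar>of_int m * gi - of_int k\<bar> \<le> t)"

text \<open>A Bohr set of the rotation by \<open>gi\<close>, fattened by \<open>H\<close>. It
  contains the integers whose position is within \<open>t\<close> of that of an integer
  \<open>h\<close> of height at most \<open>H\<close>; the cut points between different low digits
  are of this kind, and so are the jumps of the high digits.\<close>

definition bohr :: "real \<Rightarrow> real \<Rightarrow> int \<Rightarrow> bool" where
  "bohr H t m \<longleftrightarrow> (\<exists>h::int. \<bar>of_int h\<bar> \<le> H \<and> near t (m - h))"

lemma near_mono: "near s m \<Longrightarrow> s \<le> t \<Longrightarrow> near t m"
  unfolding near_def by (meson order_trans)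

lemma bohr_mono: "bohr H s m \<Longrightarrow> H \<le> H' \<Longrightarrow> s \<le> t \<Longrightarrow> bohr H' t m"
  unfolding bohr_def by (meson near_mono order_trans)

lemma near_0 [simp]: "0 \<le> t \<Longrightarrow> near t 0"
  unfolding near_def by (intro exI[of _ 0]) simp

lemma near_nonneg: "near t m \<Longrightarrow> 0 \<le> t"
  unfolding near_def by (meson abs_ge_zero order_trans)

lemma near_uminus: "near t m \<Longrightarrow> near t (- m)"
proof -
  assume "near t m"
  then obtain k where "\<bar>of_int m * gi - of_int k\<bar> \<le> t" unfolding near_def by blast
  then have "\<bar>of_int (- m) * gi - of_int (- k)\<bar> \<le> t" by simp
  then show ?thesis unfolding near_def by blast
qed

lemma near_add: "near s m \<Longrightarrow> near t n \<Longrightarrow> near (s + t) (m + n)"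
proof -
  assume "near s m" "near t n"
  then obtain k l where "\<bar>of_int m * gi - of_int k\<bar> \<le> s" "\<bar>of_int n * gi - of_int l\<bar> \<le> t"
    unfolding near_def by blast
  then have "\<bar>of_int (m + n) * gi - of_int (k + l)\<bar> \<le> s + t" by (simp add: algebra_simps)
  then show ?thesis unfolding near_def by blast
qed

lemma near_diff: "near s m \<Longrightarrow> near t n \<Longrightarrow> near (s + t) (m - n)"
  using near_add[of s m t "- n"] near_uminus[of t n] by simp

lemma near_mult: "near t m \<Longrightarrow> near (real q * t) (int q * m)"
proof -
  assume "near t m"
  then obtain k where k: "\<bar>of_int m * gi - of_int k\<bar> \<le> t" unfolding near_def by blast
  have "of_int (int q * m) * gi - of_int (int q * k) = real q * (of_int m * gi - of_int k)"
    by (simp add: algebra_simps)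
  then have "\<bar>of_int (int q * m) * gi - of_int (int q * k)\<bar> \<le> real q * t"
    using k by (simp only: abs_mult abs_of_nat mult_left_mono of_nat_0_le_iff)
  then show ?thesis unfolding near_def by blast
qed

lemma nearI:
  assumes "x = - of_int m * gi + of_int k" "\<bar>x\<bar> \<le> t"
  shows "near t m"
proof -
  have "\<bar>of_int m * gi - of_int k\<bar> \<le> t" using assms by simp
  then show ?thesis unfolding near_def by blast
qed

lemma near_conj_sum:
  assumes "finite S" "S \<subseteq> {1..}" "\<bar>conj_sum S\<bar> \<le> t"
  shows "near t (int (sum fib S))"
proof -
  obtain k :: int where "conj_sum S = - real (sum fib S) * gi + of_int k"
    using conj_sum_cong_gi assms by blast
  then show ?thesis using assms(3) by (intro nearI[of "conj_sum S" _ k]) simp_all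
qed

lemma near_conj_sum_plus:
  assumes "finite S" "S \<subseteq> {1..}" "\<bar>conj_sum S + (- gi) ^ Suc i\<bar> \<le> t"
  shows "near t (int (sum fib S) + int (fib (Suc i)))"
proof -
  obtain k :: int where "conj_sum S = - real (sum fib S) * gi + of_int k"
    using conj_sum_cong_gi assms by blast
  then show ?thesis using assms(3) neg_gi_power_Suc[of i]
    by (intro nearI[of "conj_sum S + (- gi) ^ Suc i" _ "k + int (fib i)"]) (simp_all add: algebra_simps)
qed

lemma zset_Int_subset: "zset n \<inter> A \<subseteq> {1..}"
  using zset_props(3)[of n] by auto

lemma near_zset_subset:
  assumes "zset g \<subseteq> {m..}" "1 \<le> m"
  shows "near (gi ^ m * (1 + gi)) (int g)"
proof -
  have "near (gi ^ m * (1 + gi)) (int (sum fib (zset g)))"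
    using assms abs_conj_sum_less[OF zset_props(1,2) assms(1)] zset_props
    by (intro near_conj_sum) (auto intro: less_imp_le)
  then show ?thesis by (simp add: zset(2))
qed

text \<open>If the digits below \<open>L\<close> first differ at \<open>i\<close>, a cut separates
  the two positions and that of \<open>n\<close> is within \<open>t\<close> of it, by
  \<open>conj_sum_first_difference\<close>. The cut is the position of an integer of absolute value
  at most \<open>fib (i + 2)\<close>, read off the digits of \<open>n\<close> up to
  \<open>i\<close>, which puts \<open>n\<close> into the Bohr set. The bound must involve
  \<open>n\<close> alone, since \<open>m\<close> will vary with the shift.\<close>

lemma low_digits_eq:
  assumes near: "near t (int m - int n)" and "\<not> bohr (fib (L + 1)) t (int n)"
  shows "zset m \<inter> {..<L} = zset n \<inter> {..<L}"
proof (rule ccontr)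
  assume "\<not> ?thesis"
  then obtain i where i: "i < L" "i \<in> zset m \<longleftrightarrow> i \<notin> zset n" "zset m \<inter> {..<i} = zset n \<inter> {..<i}"
    by (rule least_difference)
  have i2: "2 \<le> i" using i(2) zset_props(3) by auto
  obtain j where j: "i = Suc j" using i2 by (cases i) auto
  obtain a b :: int where ab: "zpos m = - real m * gi + of_int a" "zpos n = - real n * gi + of_int b"
    using zpos_cong by metis
  obtain k :: int where k: "\<bar>of_int (int m - int n) * gi - of_int k\<bar> \<le> t"
    using near unfolding near_def by blast
  define e where "e = of_int k - of_int (int m - int n) * gi"
  have e: "\<bar>e\<bar> \<le> t" using k unfolding e_def by linarith
  have d: "zpos m - zpos n = e + of_int (a - b - k)"
    unfolding ab e_def by (simp add: algebra_simps)
  have small: "bohr (fib (L + 1)) t (int n)" if "\<bar>of_int h\<bar> \<le> real (fib (i + 2))" "near t (int n - h)" for h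
  proof -
    have "fib (i + 2) \<le> fib (L + 1)" using i(1) by (intro fib_mono) simp
    then have "\<bar>of_int h\<bar> \<le> real (fib (L + 1))" using that(1) by linarith
    then show ?thesis using that(2) unfolding bohr_def by blast
  qed
  have F: "fib i \<le> fib (i + 1)" "fib (i + 1) \<le> fib (i + 2)" "1 \<le> fib i"
    using i2 fib_neq_0_nat[of i] by (auto intro: fib_mono simp del: fib.simps)
  consider "a - b - k = 0" | "a - b - k \<ge> 1" | "a - b - k \<le> -1" by linarith
  then have "bohr (fib (L + 1)) t (int n)"
  proof cases
    case 1
    then have close: "\<bar>zpos m - zpos n\<bar> \<le> t" using d e by simp
    show ?thesis
    proof (cases "i \<in> zset n")
      case True
      then have im: "i \<notin> zset m" using i(2) by simp
      note fd = conj_sum_first_difference[OF zset_props(1,2) zset_props(1,2) True im i(3)[symmetric]]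
      define X where "X = conj_sum (zset n \<inter> {Suc i..}) + (- gi) ^ (i + 2)"
      have "0 < (-1) ^ i * X" "(-1) ^ i * X < (-1) ^ i * (zpos n - zpos m)"
        using fd unfolding X_def zpos_def by linarith+
      then have "\<bar>(-1) ^ i * X\<bar> \<le> \<bar>(-1) ^ i * (zpos n - zpos m)\<bar>" by linarith
      then have "\<bar>X\<bar> \<le> t" using close unfolding abs_neg_one_power_mult by linarith
      then have "near t (int (high (Suc i) n) + int (fib (Suc (Suc i))))"
        unfolding high_def X_def add_2_eq_Suc' Suc_eq_plus1[symmetric]
        by (intro near_conj_sum_plus finite_Int disjI1 zset_props(1) zset_Int_subset)
      moreover have "int (high (Suc i) n) = int n - int (low (Suc i) n)"
        using low_high[of "Suc i" n] by simp
      ultimately have "near t (int n - (int (low (Suc i) n) - int (fib (i + 2))))"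
        by (simp add: algebra_simps)
      moreover have "low (Suc i) n < fib (i + 1)" using low_less[of "Suc i" n] i2 by simp
      then have "\<bar>real_of_int (int (low (Suc i) n) - int (fib (i + 2)))\<bar> \<le> real (fib (i + 2))"
        using F by linarith
      ultimately show ?thesis by (intro small)
    next
      case False
      then have im: "i \<in> zset m" using i(2) by simp
      note fd = conj_sum_first_difference[OF zset_props(1,2) zset_props(1,2) im False i(3)]
      define X where "X = conj_sum (zset n \<inter> {i..}) + (- gi) ^ (i + 1)"
      have "0 < - ((-1) ^ i * X)" "- ((-1) ^ i * X) < (-1) ^ i * (zpos m - zpos n)"
        using fd unfolding X_def zpos_def by linarith+
      then have "\<bar>(-1) ^ i * X\<bar> \<le> \<bar>(-1) ^ i * (zpos m - zpos n)\<bar>" by linarith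
      then have "\<bar>X\<bar> \<le> t" using close unfolding abs_neg_one_power_mult by linarith
      then have "near t (int (high i n) + int (fib (Suc i)))"
        unfolding high_def X_def add_2_eq_Suc' Suc_eq_plus1[symmetric]
        by (intro near_conj_sum_plus finite_Int disjI1 zset_props(1) zset_Int_subset)
      moreover have "int (high i n) = int n - int (low i n)"
        using low_high[of i n] by simp
      ultimately have "near t (int n - (int (low i n) - int (fib (i + 1))))"
        by (simp add: algebra_simps)
      moreover have "low i n < fib i" using low_less[of i n] i2 by simp
      then have "\<bar>real_of_int (int (low i n) - int (fib (i + 1)))\<bar> \<le> real (fib (i + 2))"
        using F by linarith
      ultimately show ?thesis by (intro small)
    qed
  next
    \<comment> \<open>The positions lie at opposite ends of the interval. Both ends,
      \<open>gi\<close> and \<open>- (gi * gi)\<close>, represent the position of the integer -1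
      because \<open>gi + gi * gi = 1\<close>; hence the witness -1 in this case and in the
      next.\<close>
    case 2
    then have "1 \<le> real_of_int (a - b - k)" by linarith
    then have "zpos m - zpos n \<ge> 1 - t" using d e by linarith
    then have "\<bar>zpos n + gi * gi\<bar> \<le> t"
      using zpos_bounds[of n] zpos_bounds[of m] gi_sq by linarith
    then have "near t (int n + 1)"
      unfolding ab gi_sq by (intro nearI[of "- real n * gi + of_int b + (1 - gi)" _ "b + 1"]) (simp_all add: algebra_simps)
    then show ?thesis using F by (intro small[of "-1"]) simp_all
  next
    case 3
    then have "real_of_int (a - b - k) \<le> -1" by linarith
    then have "zpos n - zpos m \<ge> 1 - t" using d e by linarith
    then have "\<bar>zpos n - gi\<bar> \<le> t"
      using zpos_bounds[of n] zpos_bounds[of m] gi_sq by linarith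
    then have "near t (int n + 1)"
      unfolding ab gi_sq by (intro nearI[of "- real n * gi + of_int b - gi" _ "b"]) (simp_all add: algebra_simps)
    then show ?thesis using F by (intro small[of "-1"]) simp_all
  qed
  then show False using assms(2) by blast
qed

lemma zset_lex_less:
  assumes "i \<in> zset m" "i \<notin> zset n" "zset m \<inter> {Suc i..} = zset n \<inter> {Suc i..}"
  shows "n < m"
proof -
  have i2: "2 \<le> i" using assms(1) zset_props by auto
  have "zset n \<inter> {i..} = zset n \<inter> {Suc i..}" using assms(2) by (auto simp: Suc_le_eq order_le_less)
  then have hn: "high i n = high (Suc i) m" unfolding high_def assms(3) by simp
  have "{i} \<union> (zset m \<inter> {Suc i..}) \<subseteq> zset m" using assms(1) by auto
  then have "sum fib ({i} \<union> (zset m \<inter> {Suc i..})) \<le> sum fib (zset m)"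
    using zset_props by (intro sum_mono2) auto
  moreover have "sum fib ({i} \<union> (zset m \<inter> {Suc i..})) = fib i + high (Suc i) m"
    unfolding high_def using zset_props by (subst sum.union_disjoint) auto
  ultimately show ?thesis using hn zset(2)[of m] low_high[of i n] low_less[OF i2, of n] by linarith
qed

text \<open>Integers are ordered lexicographically by their Zeckendorf digits from the top, so the
  largest index from \<open>L\<close> on where the digits differ decides the comparison both of the
  integers and of their truncations.\<close>

lemma high_mono:
  assumes "m \<le> n"
  shows "high L m \<le> high L n"
proof (rule ccontr)
  assume less: "\<not> high L m \<le> high L n"
  define D where "D = {i\<in>zset m \<union> zset n. L \<le> i \<and> (i \<in> zset m \<longleftrightarrow> i \<notin> zset n)}"
  have fin: "finite D" unfolding D_def using zset_props by auto
  have "D \<noteq> {}"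
  proof
    assume "D = {}"
    then have "zset m \<inter> {L..} = zset n \<inter> {L..}" unfolding D_def by blast
    then show False using less unfolding high_def by simp
  qed
  define i where "i = Max D"
  have iD: "i \<in> D" unfolding i_def using fin \<open>D \<noteq> {}\<close> by simp
  then have Li: "L \<le> i" by (simp add: D_def)
  have above: "k \<in> zset m \<longleftrightarrow> k \<in> zset n" if "k > i" for k
  proof (rule ccontr)
    assume "\<not> ?thesis"
    then have "k \<in> D" using that Li unfolding D_def by auto
    then have "k \<le> i" unfolding i_def using fin by simp
    then show False using that by simp
  qed
  then have ab: "zset m \<inter> {Suc i..} = zset n \<inter> {Suc i..}" by auto
  show False
  proof (cases "i \<in> zset m")
    case True
    then have "n < m" using iD ab by (intro zset_lex_less[of i m n]) (auto simp: D_def)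
    then show False using assms by simp
  next
    case False
    then have "i \<in> zset n" using iD by (auto simp: D_def)
    then have "high L m < high L n" using False ab Li
      by (intro zset_lex_less[of i]) (auto simp: zset_high)
    then show False using less by simp
  qed
qed

text \<open>The witness is \<open>n + h\<close> with the digits below \<open>L\<close> deleted. If
  it were at most \<open>n\<close>, monotonicity of \<open>high\<close> would squeeze the high part
  of \<open>n\<close> to the same value.\<close>

lemma high_digits_change:
  assumes "zset n \<inter> {L..} \<noteq> zset (n + h) \<inter> {L..}"
  obtains g where "zset g \<subseteq> {L..}" "n < g" "g \<le> n + h"
proof -
  define g where "g = high L (n + h)"
  have zg: "zset g = zset (n + h) \<inter> {L..}" unfolding g_def by (rule zset_high)
  have "g \<le> n + h" using low_high[of L "n + h"] unfolding g_def by linarith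
  moreover have "n < g"
  proof (rule ccontr)
    assume "\<not> n < g"
    then have "high L g \<le> high L n" by (intro high_mono) simp
    moreover have "high L n \<le> g" unfolding g_def by (intro high_mono) simp
    moreover have "high L g = g" using zg zset(2)[of g] unfolding high_def by (simp add: Int_assoc)
    ultimately have "high L n = g" by simp
    then show False using zset_high[of L n] zg assms by simp
  qed
  moreover have "zset g \<subseteq> {L..}" using zg by simp
  ultimately show ?thesis using that by blast
qed

text \<open>A change of high digits between \<open>n + w\<close> and \<open>n'\<close> forces an
  integer \<open>g\<close> with digits only from \<open>L\<close> on in between. Such a
  \<open>g\<close> is near 0 on the circle, and so is \<open>g - w\<close>, which differs from
  \<open>n\<close> by \<open>n + w - g\<close>, an integer bounded by \<open>h\<close>. This would
  place \<open>n\<close> in the excluded Bohr set.\<close>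

lemma high_digits_eq:
  assumes n': "int n' = int n + int w + h" and "near t (int w)" and "1 \<le> L"
    and nb: "\<not> bohr \<bar>of_int h\<bar> (gi ^ L * (1 + gi) + t) (int n)"
  shows "zset n' \<inter> {L..} = zset (n + w) \<inter> {L..}"
proof (rule ccontr)
  assume ne: "\<not> ?thesis"
  obtain g where g: "zset g \<subseteq> {L..}" "\<bar>int n + int w - int g\<bar> \<le> \<bar>h\<bar>"
  proof (cases "h \<ge> 0")
    case True
    then have "n' = (n + w) + nat h" using n' by linarith
    then obtain g where "zset g \<subseteq> {L..}" "n + w < g" "g \<le> n + w + nat h"
      using ne high_digits_change[of "n + w" L "nat h"] by metis
    then show ?thesis using True by (intro that[of g]) linarith+
  next
    case False
    then have "n + w = n' + nat (- h)" using n' by linarith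
    then obtain g where "zset g \<subseteq> {L..}" "n' < g" "g \<le> n + w"
      using ne high_digits_change[of n' L "nat (- h)"] by metis
    then show ?thesis using False n' by (intro that[of g]) linarith+
  qed
  have "near (gi ^ L * (1 + gi) + t) (int g - int w)"
    using near_zset_subset[OF g(1) assms(3)] assms(2) by (intro near_diff)
  then have "near (gi ^ L * (1 + gi) + t) (int n - (int n + int w - int g))" by (simp add: algebra_simps)
  moreover have "\<bar>real_of_int (int n + int w - int g)\<bar> \<le> \<bar>real_of_int h\<bar>" using g(2) by linarith
  ultimately show False using nb unfolding bohr_def by blast
qed

text \<open>The shift is performed in two steps. Adding \<open>w\<close> preserves the digits below
  \<open>L'\<close> because it hardly moves the rotation, and adding \<open>h\<close> preserves
  those from \<open>L\<close> on because it is short; only the digits in the window survive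
  both.\<close>

lemma window_digits_eq:
  assumes "int n' = int n + int w + h" "near t (int w)" "1 \<le> L"
    and "\<not> bohr \<bar>of_int h\<bar> (gi ^ L * (1 + gi) + t) (int n)"
    and "\<not> bohr (fib (L' + 1)) t (int n)"
  shows "zset n' \<inter> {L..<L'} = zset n \<inter> {L..<L'}"
proof -
  have "zset n' \<inter> {L..} = zset (n + w) \<inter> {L..}" using assms by (intro high_digits_eq)
  moreover have "zset (n + w) \<inter> {..<L'} = zset n \<inter> {..<L'}"
    using assms by (intro low_digits_eq) simp_all
  moreover have "{L..<L'} = {L..} \<inter> {..<L'}" by auto
  ultimately show ?thesis by blast
qed

text \<open>The norm form \<open>k\<^sup>2 + k m - m\<^sup>2\<close> takes no nonzero value below 1 in modulus.\<close>

lemma near_lower_bound: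
  assumes "near t m" "m \<noteq> 0"
  shows "1 \<le> 3 * t * \<bar>real_of_int m\<bar>"
proof (cases "t \<le> 1/2")
  case False
  moreover have "1 \<le> \<bar>real_of_int m\<bar>" using assms(2) by linarith
  ultimately have "1/2 * 1 \<le> t * \<bar>real_of_int m\<bar>" by (intro mult_mono) auto
  then show ?thesis by linarith
next
  case True
  obtain k :: int where k: "\<bar>of_int m * gi - of_int k\<bar> \<le> t" using assms unfolding near_def by blast
  have m1: "1 \<le> \<bar>real_of_int m\<bar>" using assms(2) by linarith
  have "k * k + k * m - m * m \<noteq> 0"
  proof
    assume 0: "k * k + k * m - m * m = 0"
    \<comment> \<open>Four times the norm form is
      \<open>(2 * k + m)\<^sup>2 - 5 * m\<^sup>2\<close>. The 5-adic valuations of the two squares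
      are even, and the factor 5 makes one side odd.\<close>
    then have "(2 * k + m)\<^sup>2 = 5 * m\<^sup>2" by (simp add: power2_eq_square algebra_simps)
    moreover from this have "2 * k + m \<noteq> 0" using assms(2) by auto
    moreover have p5: "prime_elem (5::int)" by simp
    ultimately have "2 * multiplicity 5 (2 * k + m) = multiplicity 5 (5::int) + 2 * multiplicity 5 m"
      using assms(2) prime_elem_multiplicity_power_distrib[OF p5, of _ 2]
        prime_elem_multiplicity_mult_distrib[OF p5, of 5 "m\<^sup>2"]
      by (metis power_not_zero zero_neq_numeral)
    then have "even (multiplicity 5 (5::int))" by presburger
    then show False by simp
  qed
  then have "1 \<le> \<bar>k * k + k * m - m * m\<bar>" by linarith
  then have "1 \<le> \<bar>real_of_int (k * k + k * m - m * m)\<bar>" by linarith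
  also have "real_of_int (k * k + k * m - m * m) =
      (of_int k - of_int m * gi) * (of_int k + of_int m * (1 + gi))"
  proof -
    have "(of_int k - of_int m * gi) * (of_int k + of_int m * (1 + gi)) =
        of_int k * of_int k + of_int k * of_int m - of_int m * of_int m * (gi + gi * gi)"
      by (simp add: algebra_simps)
    also have "gi + gi * gi = 1" using gi_sq by simp
    finally show ?thesis by simp
  qed
  also have "\<bar>\<dots>\<bar> = \<bar>of_int k - of_int m * gi\<bar> * \<bar>of_int k + of_int m * (1 + gi)\<bar>"
    by (rule abs_mult)
  also have "\<dots> \<le> t * (3 * \<bar>real_of_int m\<bar>)"
  proof (rule mult_mono)
    show "\<bar>of_int k - of_int m * gi\<bar> \<le> t" using k by linarith
    have "of_int k + of_int m * (1 + gi) = (of_int k - of_int m * gi) + of_int m * (1 + 2 * gi)"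
      by (simp add: algebra_simps)
    then have "\<bar>of_int k + of_int m * (1 + gi)\<bar> \<le> \<bar>of_int k - of_int m * gi\<bar> + \<bar>of_int m * (1 + 2 * gi)\<bar>"
      by (metis abs_triangle_ineq)
    also have "\<dots> \<le> 1/2 + \<bar>real_of_int m\<bar> * (1 + 2 * gi)"
      using k True gi_pos by (simp add: abs_mult abs_minus_commute)
    also have "\<dots> \<le> 1/2 + \<bar>real_of_int m\<bar> * (1 + 2 * (5/8))"
      using gi_bounds by (intro add_left_mono mult_left_mono) auto
    also have "\<dots> \<le> 3 * \<bar>real_of_int m\<bar>" using m1 by simp
    finally show "\<bar>of_int k + of_int m * (1 + gi)\<bar> \<le> 3 * \<bar>real_of_int m\<bar>" .
  qed (use near_nonneg[OF assms(1)] in auto)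
  finally show ?thesis by (simp add: algebra_simps)
qed

text \<open>Two such integers differ by at least \<open>1 / (6 * t)\<close>, and the first is at
  least that far from 0, both by \<open>near_lower_bound\<close>; so \<open>6 * t * w\<close> has
  distinct floors, starting at 1. The bound therefore has no additive constant and excludes all
  points once \<open>6 * t * X < 1\<close>.\<close>

lemma card_near_pos:
  assumes "0 \<le> X"
  shows "finite {w::int. 0 < w \<and> of_int w \<le> X \<and> near t w}"
    and "real (card {w::int. 0 < w \<and> of_int w \<le> X \<and> near t w}) \<le> 6 * t * X \<or> t < 0"
proof -
  let ?P = "{w::int. 0 < w \<and> of_int w \<le> X \<and> near t w}"
  have "?P \<subseteq> {0..\<lfloor>X\<rfloor>}" by (auto simp: le_floor_iff)
  then show fin: "finite ?P" by (rule finite_subset) simp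
  show "real (card ?P) \<le> 6 * t * X \<or> t < 0"
  proof (cases "t < 0")
    case False
    define f where "f w = \<lfloor>6 * t * of_int w\<rfloor>" for w :: int
    have step: "f w < f w'" if "w \<in> ?P" "w' \<in> ?P" "w < w'" for w w'
    proof -
      have "near (t + t) (w' - w)" using that by (intro near_diff) auto
      then have "1 \<le> 3 * (t + t) * \<bar>real_of_int (w' - w)\<bar>" using that by (intro near_lower_bound) auto
      then have "6 * t * of_int w + 1 \<le> 6 * t * of_int w'" using that(3) by (simp add: right_diff_distrib)
      then show ?thesis unfolding f_def by linarith
    qed
    have inj: "inj_on f ?P"
    proof (rule inj_onI)
      fix w w' assume "w \<in> ?P" "w' \<in> ?P" "f w = f w'"
      then show "w = w'" using step[of w w'] step[of w' w] by (cases w w' rule: linorder_cases) auto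
    qed
    have "f ` ?P \<subseteq> {1..\<lfloor>6 * t * X\<rfloor>}"
    proof
      fix v assume "v \<in> f ` ?P"
      then obtain w where w: "w \<in> ?P" "v = f w" by blast
      then have "1 \<le> 3 * t * \<bar>real_of_int w\<bar>" by (intro near_lower_bound) auto
      then have "1 \<le> 6 * t * of_int w" using w by simp
      moreover have "6 * t * of_int w \<le> 6 * t * X" using w False by (intro mult_left_mono) auto
      ultimately show "v \<in> {1..\<lfloor>6 * t * X\<rfloor>}" 
        unfolding w f_def atLeastAtMost_iff by (intro conjI floor_mono) (simp_all only: le_floor_iff of_int_1)
    qed
    then have "card ?P \<le> card {1..\<lfloor>6 * t * X\<rfloor>}"
      using card_mono[of "{1..\<lfloor>6 * t * X\<rfloor>}" "f ` ?P"] card_image[OF inj] by simp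
    also have "real (card {1..\<lfloor>6 * t * X\<rfloor>}) \<le> 6 * t * X"
      using False assms by (simp)
    finally show ?thesis by linarith
  qed blast
qed

lemma card_near:
  assumes "0 \<le> X" "0 \<le> t"
  shows "finite {w::int. w \<noteq> 0 \<and> \<bar>of_int w\<bar> \<le> X \<and> near t w}"
    and "real (card {w::int. w \<noteq> 0 \<and> \<bar>of_int w\<bar> \<le> X \<and> near t w}) \<le> 12 * t * X"
proof -
  let ?P = "{w::int. 0 < w \<and> of_int w \<le> X \<and> near t w}"
  let ?Q = "{w::int. w \<noteq> 0 \<and> \<bar>of_int w\<bar> \<le> X \<and> near t w}"
  have sub: "?Q \<subseteq> ?P \<union> uminus ` ?P"
  proof
    fix w assume w: "w \<in> ?Q"
    show "w \<in> ?P \<union> uminus ` ?P"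
    proof (cases "w > 0")
      case False
      then have "- w \<in> ?P" using w near_uminus[of t w] by auto
      then have "- (- w) \<in> uminus ` ?P" by (rule imageI)
      then show ?thesis by simp
    qed (use w in auto)
  qed
  have fin: "finite ?P" using card_near_pos(1)[OF assms(1)] .
  then show "finite ?Q" using sub by (auto intro: finite_subset)
  have "card ?Q \<le> card (?P \<union> uminus ` ?P)" using sub fin by (intro card_mono) auto
  also have "\<dots> \<le> card ?P + card (uminus ` ?P)" by (rule card_Un_le)
  also have "\<dots> \<le> card ?P + card ?P" using fin by (intro add_left_mono card_image_le)
  finally have "real (card ?Q) \<le> 2 * real (card ?P)" by linarith
  then show "real (card ?Q) \<le> 12 * t * X"
    using card_near_pos(2)[OF assms(1), of t] assms(2) by linarith
qed

section \<open>The divisor bound and the number of exceptional moduli\<close>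

lemma card_divisors_prime_power:
  fixes m :: nat
  assumes "prime p" "m > 0"
  shows "card {d. d dvd p ^ a * m} \<le> (a + 1) * card {d. d dvd m}"
proof -
  have "{d. d dvd p ^ a * m} \<subseteq> (\<lambda>(i, e). p ^ i * e) ` ({0..a} \<times> {d. d dvd m})"
  proof
    fix d assume "d \<in> {d. d dvd p ^ a * m}"
    then have "d dvd p ^ a * m" by simp
    then obtain x e where d: "d = x * e" "x dvd p ^ a" "e dvd m" using division_decomp by blast
    then obtain i where "i \<le> a" "x = p ^ i" using divides_primepow_nat[OF assms(1)] by blast
    then show "d \<in> (\<lambda>(i, e). p ^ i * e) ` ({0..a} \<times> {d. d dvd m})" using d by force
  qed
  then have "card {d. d dvd p ^ a * m} \<le> card ({0..a} \<times> {d. d dvd m})"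
    using assms by (intro surj_card_le) auto
  then show ?thesis by (simp add: card_cartesian_product)
qed

text \<open>Prime powers are split off one at a time. A prime from \<open>P\<close> on costs
  nothing, since \<open>a + 1\<close> is already at most its contribution to
  \<open>m powr \<delta>\<close>, and each smaller prime costs at most a factor \<open>K\<close>;
  hence the constant \<open>K ^ P\<close>.\<close>

lemma divisor_bound:
  fixes \<delta> :: real
  assumes "\<delta> > 0"
  shows "\<exists>C>0. \<forall>m::nat. m > 0 \<longrightarrow> real (card {d. d dvd m}) \<le> C * real m powr \<delta>"
proof -
  \<comment> \<open>Chosen so that \<open>p powr \<delta>\<close> is at least 2 for every
    \<open>p\<close> from \<open>P\<close> on, whence \<open>a + 1 \<le> 2 ^ a\<close>
    suffices.\<close>
  define P where "P = nat \<lceil>2 powr (1 / \<delta>)\<rceil>"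
  \<comment> \<open>Comes from \<open>a + 1 \<le> K * (1 + \<delta> * ln 2 * a) \<le> K * 2 powr
    (\<delta> * a)\<close>, the second step being \<open>1 + u \<le> exp u\<close>.\<close>
  define K where "K = 1 + 1 / (\<delta> * ln 2)"
  have K1: "K \<ge> 1" using assms by (simp add: K_def)
  have small: "real a + 1 \<le> K * real p powr (\<delta> * real a)" if "2 \<le> p" for a p :: nat
  proof -
    have "K * (1 + \<delta> * ln 2 * a) = 1 + \<delta> * ln 2 * a + 1 / (\<delta> * ln 2) + a"
      using assms by (simp add: K_def field_simps)
    moreover have "0 \<le> \<delta> * ln 2 * a" "0 \<le> 1 / (\<delta> * ln 2)" using assms by auto
    ultimately have "real a + 1 \<le> K * (1 + \<delta> * ln 2 * a)" by linarith
    also have "\<dots> \<le> K * exp (\<delta> * ln 2 * a)"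
      using K1 exp_ge_add_one_self[of "\<delta> * ln 2 * a"] by (intro mult_left_mono) auto
    also have "exp (\<delta> * ln 2 * a) = 2 powr (\<delta> * a)" by (simp add: powr_def mult_ac)
    also have "\<dots> \<le> real p powr (\<delta> * a)" using that assms by (intro powr_mono2) auto
    finally show ?thesis using K1 by simp
  qed
  have large: "real a + 1 \<le> real p powr (\<delta> * real a)" if "P \<le> p" "2 \<le> p" for a p :: nat
  proof -
    have "2 powr (1 / \<delta>) \<le> real p" using that unfolding P_def by linarith
    then have "(2 powr (1 / \<delta>)) powr (\<delta> * real a) \<le> real p powr (\<delta> * real a)"
      using assms by (intro powr_mono2) auto
    moreover have "(2 powr (1 / \<delta>)) powr (\<delta> * real a) = 2 ^ a"
      using assms by (simp add: powr_powr powr_realpow)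
    moreover have "real a + 1 \<le> 2 ^ a"
      using of_nat_mono[OF Suc_leI[OF less_exp[of a]], where 'a = real] by simp
    ultimately show ?thesis by linarith
  qed
  define S where "S m = {p. prime p \<and> p < P \<and> p dvd m}" for m
  have main: "real (card {d. d dvd m}) \<le> K ^ card (S m) * real m powr \<delta>"
    if "m > 0" for m :: nat
    using that
  proof (induction m rule: less_induct)
    case (less m)
    show ?case
    proof (cases "m = 1")
      case True
      then show ?thesis using K1 by (simp add: one_le_power)
    next
      case False
      then obtain p where p: "prime p" "p dvd m" using prime_factor_nat by blast
      define a where "a = multiplicity p m"
      have nu: "m \<noteq> 0" "\<not> is_unit p" using less.prems p not_prime_unit by auto
      obtain m' where m': "m = p ^ a * m'" "\<not> p dvd m'"
        by (rule multiplicity_decompose'[OF nu]) (auto simp only: a_def)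
      have p2: "2 \<le> p" using p prime_ge_2_nat by blast
      have a1: "a > 0" unfolding a_def using p(2) nu by (simp add: multiplicity_gt_zero_iff)
      have m'0: "m' > 0" using m'(1) less.prems by (cases m') auto
      have "1 < p ^ a" using p2 a1 by (intro one_less_power) auto
      then have "1 * m' < p ^ a * m'" using m'0 by (rule mult_strict_right_mono)
      also have "p ^ a * m' = m" using m'(1) by (rule sym)
      finally have "m' < m" by (simp only: mult_1)
      have fin: "finite (S m)" unfolding S_def by (rule finite_subset[of _ "{..<P}"]) auto
      have "m' dvd m" using m'(1) by (metis dvd_triv_right)
      have sub: "S m' \<subseteq> S m - {p}"
      proof
        fix q assume "q \<in> S m'"
        then have q: "prime q" "q < P" "q dvd m'" by (simp_all add: S_def)
        then have "q dvd m" using \<open>m' dvd m\<close> by (meson dvd_trans)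
        moreover have "q \<noteq> p" using q(3) m'(2) by blast
        ultimately show "q \<in> S m - {p}" using q by (simp add: S_def)
      qed
      have le1: "real (card {d. d dvd m}) \<le> (real a + 1) * real (card {d. d dvd m'})"
      proof -
        have "card {d. d dvd p ^ a * m'} \<le> (a + 1) * card {d. d dvd m'}"
          using card_divisors_prime_power[OF p(1) m'0] .
        then have "card {d. d dvd m} \<le> (a + 1) * card {d. d dvd m'}" by (simp only: m'(1)[symmetric])
        then have "real (card {d. d dvd m}) \<le> real ((a + 1) * card {d. d dvd m'})" by (rule of_nat_mono)
        then show ?thesis by (simp add: algebra_simps)
      qed
      have le2: "(real a + 1) * K ^ card (S m') \<le> K ^ card (S m) * real p powr (\<delta> * a)"
      proof (cases "p < P")
        case True
        then have pin: "p \<in> S m" using p by (simp add: S_def)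
        have "card (S m') \<le> card (S m - {p})" using sub fin by (intro card_mono) auto
        then have "Suc (card (S m')) \<le> card (S m)" using pin fin by (metis card_Suc_Diff1 Suc_le_mono)
        then have "K ^ Suc (card (S m')) \<le> K ^ card (S m)" using K1 by (intro power_increasing)
        then have "real p powr (\<delta> * a) * K ^ Suc (card (S m')) \<le> real p powr (\<delta> * a) * K ^ card (S m)"
          by (intro mult_left_mono) auto
        moreover have "(real a + 1) * K ^ card (S m') \<le> (K * real p powr (\<delta> * a)) * K ^ card (S m')"
          using small[OF p2, of a] K1 by (intro mult_right_mono) auto
        ultimately show ?thesis by (simp add: mult_ac)
      next
        case False
        have "card (S m') \<le> card (S m)" using sub fin by (intro card_mono) auto
        then have "K ^ card (S m') \<le> K ^ card (S m)" using K1 by (intro power_increasing)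
        then have "(real a + 1) * K ^ card (S m') \<le> real p powr (\<delta> * a) * K ^ card (S m)"
          using large[of p a] False p2 K1 by (intro mult_mono) auto
        then show ?thesis by (simp add: mult_ac)
      qed
      have "real p powr (\<delta> * a) = real (p ^ a) powr \<delta>"
        using p2 by (simp add: powr_powr powr_realpow[symmetric] mult.commute)
      then have eq: "real p powr (\<delta> * a) * real m' powr \<delta> = real m powr \<delta>"
        by (subst m'(1)) (simp add: powr_mult)
      have "real (card {d. d dvd m}) \<le> (real a + 1) * (K ^ card (S m') * real m' powr \<delta>)"
        using less.IH[OF \<open>m' < m\<close> m'0] by (intro order_trans[OF le1] mult_left_mono) auto
      also have "\<dots> = ((real a + 1) * K ^ card (S m')) * real m' powr \<delta>" by simp
      also have "\<dots> \<le> (K ^ card (S m) * real p powr (\<delta> * a)) * real m' powr \<delta>"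
        by (intro mult_right_mono le2) simp
      also have "\<dots> = K ^ card (S m) * real m powr \<delta>" by (simp only: mult.assoc eq)
      finally show ?thesis .
    qed
  qed
  have "real (card {d. d dvd m}) \<le> K ^ P * real m powr \<delta>" if "m > 0" for m :: nat
  proof -
    have "card (S m) \<le> card {..<P}" unfolding S_def by (intro card_mono) auto
    then have "K ^ card (S m) \<le> K ^ P" using K1 by (intro power_increasing) auto
    then show ?thesis using main[OF that] by (meson mult_right_mono order_trans powr_ge_zero)
  qed
  then show ?thesis using K1 by (intro exI[of _ "K ^ P"]) auto
qed

text \<open>With \<open>w = r * d - h\<close>, the modulus \<open>d\<close> divides
  \<open>h + w\<close>. There are \<open>card HH\<close> choices of \<open>h\<close>, few near
  integers \<open>w\<close> by \<open>card_near\<close>, and at most \<Delta> divisors for each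
  pair. The condition that \<open>r * d\<close> differs from \<open>h\<close> keeps \<open>w\<close>
  nonzero, where the norm form bound applies.\<close>

lemma card_exceptional_moduli:
  fixes HH :: "int set" and D R :: nat and Hm \<tau> \<Delta> :: real
  assumes "finite HH" "\<And>h. h \<in> HH \<Longrightarrow> \<bar>of_int h\<bar> \<le> Hm" "0 \<le> \<tau>" "0 \<le> Hm" "0 \<le> \<Delta>"
    and div: "\<And>m::nat. 0 < m \<Longrightarrow> m \<le> 2 * D * R \<Longrightarrow> real (card {d. d dvd m}) \<le> \<Delta>"
  shows "real (card {d\<in>{D..<2*D}. \<exists>r\<in>{1..R}. \<exists>h\<in>HH. int (r * d) \<noteq> h \<and> near \<tau> (int (r * d) - h)})
     \<le> real (card HH) * (12 * \<tau> * (2 * real D * real R + Hm)) * \<Delta>"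
    (is "real (card ?B) \<le> _")
proof -
  define X where "X = 2 * real D * real R + Hm"
  have X0: "0 \<le> X" using assms by (simp add: X_def)
  define W where "W = {w::int. w \<noteq> 0 \<and> \<bar>of_int w\<bar> \<le> X \<and> near \<tau> w}"
  have W: "finite W" "real (card W) \<le> 12 * \<tau> * X"
    unfolding W_def using card_near[OF X0 assms(3)] by auto
  define T where "T h w = (if 0 < h + w \<and> h + w \<le> int (2 * D * R) then {d. d dvd nat (h + w)} else {})"
    for h w :: int
  have T: "finite (T h w)" "real (card (T h w)) \<le> \<Delta>" for h w
    unfolding T_def using assms(5) div[of "nat (h + w)"]
    by (auto simp: nat_le_iff simp del: of_nat_mult)
  have sub: "?B \<subseteq> (\<Union>(h, w)\<in>HH \<times> W. T h w)"
  proof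
    fix d assume "d \<in> ?B"
    then obtain r h where d: "D \<le> d" "d < 2 * D" "1 \<le> r" "r \<le> R" "h \<in> HH"
      "int (r * d) \<noteq> h" "near \<tau> (int (r * d) - h)" by auto
    have rd: "r * d \<le> R * (2 * D)" using d by (intro mult_mono) auto
    have rd0: "0 < r * d" using d by simp
    have "real (r * d) \<le> real (R * (2 * D))" using rd by linarith
    then have rdr: "real (r * d) \<le> 2 * real D * real R" by (simp add: mult_ac)
    have "\<bar>real_of_int (int (r * d) - h)\<bar> \<le> real (r * d) + \<bar>real_of_int h\<bar>" by linarith
    also have "\<dots> \<le> X" using rdr assms(2)[OF d(5)] unfolding X_def by linarith
    finally have "int (r * d) - h \<in> W" using d unfolding W_def by simp
    moreover have "d \<in> T h (int (r * d) - h)"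
      using rd rd0 unfolding T_def by (auto simp: mult_ac simp flip: of_nat_mult)
    ultimately show "d \<in> (\<Union>(h, w)\<in>HH \<times> W. T h w)" using d(5) by blast
  qed
  have "card ?B \<le> card (\<Union>(h, w)\<in>HH \<times> W. T h w)"
    using sub assms(1) W(1) T(1) by (intro card_mono) auto
  also have "\<dots> \<le> (\<Sum>(h, w)\<in>HH \<times> W. card (T h w))"
    using card_UN_le[of "HH \<times> W" "\<lambda>(h, w). T h w"] assms(1) W(1) by (simp add: case_prod_unfold)
  finally have "real (card ?B) \<le> real (\<Sum>(h, w)\<in>HH \<times> W. card (T h w))" by linarith
  also have "\<dots> = (\<Sum>p\<in>HH \<times> W. real (card (T (fst p) (snd p))))" by (simp add: case_prod_unfold)
  also have "\<dots> \<le> (\<Sum>p\<in>HH \<times> W. \<Delta>)" by (intro sum_mono T)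
  also have "\<dots> = real (card HH) * real (card W) * \<Delta>" by (simp add: card_cartesian_product)
  also have "\<dots> \<le> real (card HH) * (12 * \<tau> * X) * \<Delta>"
    using W(2) assms(5) by (intro mult_right_mono mult_left_mono) auto
  finally show ?thesis unfolding X_def .
qed

section \<open>Clusters of a progression in a Bohr set\<close>

lemma card_window_le:
  fixes P :: "nat \<Rightarrow> bool"
  assumes gap: "\<And>m n. P m \<Longrightarrow> P n \<Longrightarrow> m < n \<Longrightarrow> n - m < R1 \<or> R2 < n - m"
    and R1: "1 \<le> R1"
  shows "card {n\<in>{k..<k+Suc R2}. P n} \<le> R1"
proof (cases "{n\<in>{k..<k+Suc R2}. P n} = {}")
  case True
  then show ?thesis by (simp only: card.empty)
next
  case False
  define a where "a = Min {n\<in>{k..<k+Suc R2}. P n}"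
  have a: "a \<in> {n\<in>{k..<k+Suc R2}. P n}" unfolding a_def using False by (intro Min_in) auto
  have "{n\<in>{k..<k+Suc R2}. P n} \<subseteq> {a..<a + R1}"
  proof
    fix n assume n: "n \<in> {n\<in>{k..<k+Suc R2}. P n}"
    have "a \<le> n" unfolding a_def using n by (intro Min_le) auto
    moreover have "n - a \<le> R2" using n a by auto
    ultimately show "n \<in> {a..<a + R1}" using gap[of a n] a n R1 by (cases "a = n") auto
  qed
  then have "card {n\<in>{k..<k+Suc R2}. P n} \<le> card {a..<a + R1}" by (intro card_mono) auto
  then show ?thesis by simp
qed

lemma card_separated_le:
  fixes P :: "nat \<Rightarrow> bool"
  assumes gap: "\<And>m n. P m \<Longrightarrow> P n \<Longrightarrow> m < n \<Longrightarrow> n - m < R1 \<or> R2 < n - m" and "1 \<le> R1"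
  shows "card {n\<in>{..<N}. P n} \<le> (N div Suc R2 + 1) * R1"
proof -
  have "card {n\<in>{..<j * Suc R2}. P n} \<le> j * R1" for j
  proof (induction j)
    case (Suc j)
    have "{n\<in>{..<Suc j * Suc R2}. P n} =
        {n\<in>{..<j * Suc R2}. P n} \<union> {n\<in>{j * Suc R2..<j * Suc R2 + Suc R2}. P n}" by auto
    then have "card {n\<in>{..<Suc j * Suc R2}. P n} \<le>
        card {n\<in>{..<j * Suc R2}. P n} + card {n\<in>{j * Suc R2..<j * Suc R2 + Suc R2}. P n}"
      by (metis card_Un_le)
    also have "\<dots> \<le> j * R1 + R1" using Suc card_window_le[OF gap assms(2)] by (intro add_mono) auto
    finally show ?case by simp
  qed simp
  moreover have "card {n\<in>{..<N}. P n} \<le> card {n\<in>{..<(N div Suc R2 + 1) * Suc R2}. P n}"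
  proof (intro card_mono)
    have "N < (N div Suc R2 + 1) * Suc R2"
      using dividend_less_div_times[of "Suc R2" N] by (simp add: algebra_simps)
    then show "{n\<in>{..<N}. P n} \<subseteq> {n\<in>{..<(N div Suc R2 + 1) * Suc R2}. P n}" by auto
  qed auto
  ultimately show ?thesis using order_trans by blast
qed

text \<open>The difference of two hits is a multiple of \<open>d\<close> in the Bohr set with
  doubled parameters. Excluding multipliers from \<open>R1\<close> to \<open>R2\<close> there makes
  the hits form clusters of length at most \<open>R1\<close> separated by gaps longer than
  \<open>R2\<close>.\<close>

lemma card_bohr_progression:
  assumes sep: "\<And>r. R1 \<le> r \<Longrightarrow> r \<le> R2 \<Longrightarrow> \<not> bohr (2 * H) (2 * t) (int (r * d))" and "1 \<le> R1"
  shows "card {n\<in>{..<N}. bohr H t (int (a + n * d))} \<le> (N div Suc R2 + 1) * R1"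
proof (rule card_separated_le)
  fix m n assume mn: "bohr H t (int (a + m * d))" "bohr H t (int (a + n * d))" "m < n"
  then obtain h h' where h: "\<bar>of_int h\<bar> \<le> H" "near t (int (a + m * d) - h)"
    "\<bar>of_int h'\<bar> \<le> H" "near t (int (a + n * d) - h')" unfolding bohr_def by blast
  have "near (t + t) ((int (a + n * d) - h') - (int (a + m * d) - h))" using h by (intro near_diff)
  moreover have "(int (a + n * d) - h') - (int (a + m * d) - h) = int ((n - m) * d) - (h' - h)"
    using mn(3) by (simp add: algebra_simps of_nat_diff)
  moreover have "\<bar>real_of_int (h' - h)\<bar> \<le> 2 * H" using h by simp
  ultimately have "bohr (2 * H) (2 * t) (int ((n - m) * d))" unfolding bohr_def by (metis mult_2)
  then show "n - m < R1 \<or> R2 < n - m" using sep[of "n - m"] by (meson not_le)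
qed fact

section \<open>Box averages and van der Corput's inequality\<close>

text \<open>\<open>box F [(a\<^sub>1,b\<^sub>1),\<dots>] n\<close> is the product over the vertices of a cube of \<open>F\<close> or its conjugate, the
  \<open>j\<close>-th coordinate of a vertex adding either \<open>a\<^sub>j\<close> or \<open>b\<^sub>j\<close> to \<open>n\<close>.\<close>

fun box :: "(nat \<Rightarrow> complex) \<Rightarrow> (nat \<times> nat) list \<Rightarrow> nat \<Rightarrow> complex" where
  "box F [] n = F n"
| "box F ((a, b) # vs) n = box F vs (n + a) * cnj (box F vs (n + b))"

lemma box_mult: "box (\<lambda>n. F n * G n) vs n = box F vs n * box G vs n"
  by (induction F vs n rule: box.induct) simp_all

lemma box_one [simp]: "box (\<lambda>n. 1) vs n = 1"
  by (induction vs arbitrary: n) auto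

lemma box_prod: "box (\<lambda>n. \<Prod>j\<in>A. F j n) vs n = (\<Prod>j\<in>A. box (F j) vs n)"
  by (induction A rule: infinite_finite_induct) (simp_all add: box_mult)

lemma box_shift: "box (\<lambda>n. F (n + c)) vs n = box F vs (n + c)"
  by (induction vs arbitrary: n) (auto simp: add_ac)

lemma box_append: "box F (us @ vs) n = box (box F vs) us n"
  by (induction us arbitrary: n) auto

text \<open>The recursion of \<open>box\<close> applies the first pair outermost; applying it to
  \<open>F\<close> instead turns a box with one more pair into a box of a differenced function. This
  lets inductions over the list pass from \<open>F\<close> to that function.\<close>

lemma box_Cons_inner: "box F ((a, b) # vs) n = box (\<lambda>n. F (n + a) * cnj (F (n + b))) vs n"
proof -
  have cnj: "box (\<lambda>n. cnj (F n)) vs n = cnj (box F vs n)" for F n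
    by (induction vs arbitrary: n) auto
  show ?thesis
    by (simp add: box_mult box_shift[of F] box_shift[of "\<lambda>n. cnj (F n)"] cnj)
qed

lemma norm_box_le: "(\<And>n. norm (F n) \<le> 1) \<Longrightarrow> norm (box F vs n) \<le> 1"
  by (induction vs arbitrary: n) (auto simp: norm_mult intro!: mult_le_one)

lemma norm_box_eq: "(\<And>n. norm (F n) = 1) \<Longrightarrow> norm (box F vs n) = 1"
  by (induction vs arbitrary: n) (auto simp: norm_mult)

section \<open>Averages over pairs of shifts, and van der Corput's inequality\<close>

fun tups :: "nat set list \<Rightarrow> (nat \<times> nat) list set" where
  "tups [] = {[]}"
| "tups (S # Ss) = (\<lambda>(p, vs). p # vs) ` ((S \<times> S) \<times> tups Ss)"

lemma inj_on_tups: "inj_on (\<lambda>(p, vs). p # vs) A"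
  by (auto simp: inj_on_def)

lemma finite_tups: "(\<And>S. S \<in> set Ss \<Longrightarrow> finite S) \<Longrightarrow> finite (tups Ss)"
  by (induction Ss) auto

lemma card_tups_Cons: "card (tups (S # Ss)) = card S ^ 2 * card (tups Ss)"
  by (simp add: card_image[OF inj_on_tups] card_cartesian_product power2_eq_square)

lemma tups_nonempty: "(\<And>S. S \<in> set Ss \<Longrightarrow> S \<noteq> {}) \<Longrightarrow> tups Ss \<noteq> {}"
  by (induction Ss) (auto simp: image_is_empty)

lemma length_tups: "vs \<in> tups Ss \<Longrightarrow> length vs = length Ss"
  by (induction Ss arbitrary: vs) auto

lemma tups_nth: "vs \<in> tups Ss \<Longrightarrow> j < length Ss \<Longrightarrow> fst (vs ! j) \<in> Ss ! j \<and> snd (vs ! j) \<in> Ss ! j"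
proof (induction Ss arbitrary: vs j)
  case (Cons S Ss)
  then show ?case by (cases j) auto
qed simp

definition bavg :: "nat set list \<Rightarrow> ((nat \<times> nat) list \<Rightarrow> complex) \<Rightarrow> complex" where
  "bavg Ss \<Phi> = (\<Sum>vs\<in>tups Ss. \<Phi> vs) / of_nat (card (tups Ss))"

lemma bavg_Nil [simp]: "bavg [] \<Phi> = \<Phi> []"
  by (simp add: bavg_def)

lemma bavg_Cons:
  "bavg (S # Ss) \<Phi> = (\<Sum>p\<in>S \<times> S. bavg Ss (\<lambda>vs. \<Phi> (p # vs))) / of_nat (card S ^ 2)"
proof -
  have "(\<Sum>vs\<in>tups (S # Ss). \<Phi> vs) = (\<Sum>x\<in>(S \<times> S) \<times> tups Ss. \<Phi> (fst x # snd x))"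
    unfolding tups.simps by (subst sum.reindex[OF inj_on_tups]) (simp add: case_prod_unfold)
  also have "\<dots> = (\<Sum>p\<in>S \<times> S. \<Sum>vs\<in>tups Ss. \<Phi> (p # vs))"
    by (simp add: sum.cartesian_product case_prod_unfold)
  finally have "(\<Sum>vs\<in>tups (S # Ss). \<Phi> vs) = (\<Sum>p\<in>S \<times> S. \<Sum>vs\<in>tups Ss. \<Phi> (p # vs))" .
  then show ?thesis
    unfolding bavg_def card_tups_Cons by (simp add: sum_divide_distrib mult.commute)
qed

lemma bavg_snoc:
  "bavg (Ss @ [S]) \<Phi> = (\<Sum>p\<in>S \<times> S. bavg Ss (\<lambda>vs. \<Phi> (vs @ [p]))) / of_nat (card S ^ 2)"
proof (induction Ss arbitrary: \<Phi>)
  case Nil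
  show ?case by (simp only: append_Nil bavg_Cons bavg_Nil)
next
  case (Cons T Ss)
  have "bavg ((T # Ss) @ [S]) \<Phi> =
      (\<Sum>q\<in>T \<times> T. (\<Sum>p\<in>S \<times> S. bavg Ss (\<lambda>vs. \<Phi> (q # vs @ [p]))) / of_nat (card S ^ 2)) / of_nat (card T ^ 2)"
    by (simp only: append_Cons bavg_Cons Cons.IH)
  also have "\<dots> = (\<Sum>q\<in>T \<times> T. \<Sum>p\<in>S \<times> S. bavg Ss (\<lambda>vs. \<Phi> (q # vs @ [p]))) / of_nat (card T ^ 2) / of_nat (card S ^ 2)"
    by (simp add: sum_divide_distrib[symmetric] mult.commute)
  also have "\<dots> = (\<Sum>p\<in>S \<times> S. \<Sum>q\<in>T \<times> T. bavg Ss (\<lambda>vs. \<Phi> (q # vs @ [p]))) / of_nat (card T ^ 2) / of_nat (card S ^ 2)"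
    by (subst sum.swap) (rule refl)
  also have "\<dots> = (\<Sum>p\<in>S \<times> S. bavg (T # Ss) (\<lambda>vs. \<Phi> (vs @ [p]))) / of_nat (card S ^ 2)"
    by (simp only: bavg_Cons sum_divide_distrib append_Cons)
  finally show ?case .
qed

lemma bavg_diff_le:
  assumes "\<And>vs. vs \<in> tups Ss \<Longrightarrow> norm (\<Phi> vs - \<Psi> vs) \<le> e" "0 \<le> e"
  shows "norm (bavg Ss \<Phi> - bavg Ss \<Psi>) \<le> e"
proof (cases "card (tups Ss) = 0")
  case False
  have "norm (bavg Ss \<Phi> - bavg Ss \<Psi>) = norm (\<Sum>vs\<in>tups Ss. \<Phi> vs - \<Psi> vs) / real (card (tups Ss))"
    unfolding bavg_def by (simp add: sum_subtractf norm_divide flip: diff_divide_distrib)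
  also have "norm (\<Sum>vs\<in>tups Ss. \<Phi> vs - \<Psi> vs) \<le> (\<Sum>vs\<in>tups Ss. e)"
    by (intro sum_norm_le assms)
  finally show ?thesis using False by (simp add: divide_right_mono)
qed (use assms in \<open>simp add: bavg_def\<close>)

lemma bavg_sum: "bavg Ss (\<lambda>vs. \<Sum>n\<in>A. \<Phi> n vs) = (\<Sum>n\<in>A. bavg Ss (\<Phi> n))"
  unfolding bavg_def by (subst sum.swap) (simp add: sum_divide_distrib)

lemma bavg_divide: "bavg Ss (\<lambda>vs. \<Phi> vs / c) = bavg Ss \<Phi> / c"
  unfolding bavg_def by (simp add: sum_divide_distrib[symmetric])

text \<open>Jensen's inequality for exponents that are powers of two, by iterating
  Cauchy-Schwarz.\<close>

lemma power_average_le: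
  fixes g :: "'a \<Rightarrow> real"
  assumes "finite P" "P \<noteq> {}" "\<And>p. p \<in> P \<Longrightarrow> 0 \<le> g p"
  shows "((\<Sum>p\<in>P. g p) / card P) ^ (2 ^ k) \<le> (\<Sum>p\<in>P. g p ^ (2 ^ k)) / card P"
proof (induction k)
  case (Suc k)
  have c: "real (card P) > 0" using assms by (simp add: card_gt_0_iff)
  have sq: "(x ^ (2 ^ k))\<^sup>2 = x ^ (2 ^ Suc k)" for x :: real
    by (simp only: power_mult[symmetric] power_Suc2)
  have "((\<Sum>p\<in>P. g p) / card P) ^ (2 ^ Suc k) = (((\<Sum>p\<in>P. g p) / card P) ^ (2 ^ k))\<^sup>2"
    by (rule sq[symmetric])
  also have "\<dots> \<le> ((\<Sum>p\<in>P. g p ^ (2 ^ k)) / card P)\<^sup>2"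
    using Suc assms by (intro power_mono zero_le_power divide_nonneg_nonneg sum_nonneg) auto
  also have "\<dots> = (\<Sum>p\<in>P. g p ^ (2 ^ k) * 1)\<^sup>2 / (card P)\<^sup>2" by (simp add: power_divide)
  also have "\<dots> \<le> ((\<Sum>p\<in>P. (g p ^ (2 ^ k))\<^sup>2) * (\<Sum>p\<in>P. 1\<^sup>2)) / (card P)\<^sup>2"
    by (intro divide_right_mono Cauchy_Schwarz_ineq_sum) auto
  also have "\<dots> = (\<Sum>p\<in>P. g p ^ (2 ^ Suc k)) / card P"
    unfolding sq using c by (simp add: power2_eq_square)
  finally show ?case .
qed simp

lemma power_le_add:
  fixes u y e :: real
  assumes "0 \<le> u" "u \<le> 1" "0 \<le> y" "y \<le> 1" "u \<le> y + e" "0 \<le> e"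
  shows "u ^ p \<le> y ^ p + p * e"
proof (induction p)
  case (Suc p)
  have "u ^ Suc p = u * u ^ p" by simp
  also have "\<dots> \<le> u * (y ^ p + p * e)" using Suc assms by (intro mult_left_mono)
  also have "\<dots> = u * y ^ p + u * (p * e)" by (simp add: algebra_simps)
  also have "\<dots> \<le> (y + e) * y ^ p + 1 * (p * e)"
    using assms by (intro add_mono mult_right_mono) auto
  also have "\<dots> \<le> y ^ Suc p + Suc p * e"
  proof -
    have "e * y ^ p \<le> e * 1" using assms by (intro mult_left_mono power_le_one) auto
    then show ?thesis by (simp add: algebra_simps)
  qed
  finally show ?case .
qed simp

lemma norm_sum_shift_le:
  fixes g :: "nat \<Rightarrow> complex"
  assumes "\<And>n. norm (g n) \<le> 1"
  shows "norm ((\<Sum>n<N. g n) - (\<Sum>n<N. g (n + r))) \<le> 2 * real r"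
proof -
  have "(\<Sum>n<N + r. g n) = (\<Sum>n<N. g n) + (\<Sum>n<r. g (N + n))"
    by (induction r) (auto simp: add_ac)
  moreover have "(\<Sum>n<r + N. g n) = (\<Sum>n<r. g n) + (\<Sum>n<N. g (n + r))"
    by (induction N) (auto simp: add_ac)
  ultimately have "(\<Sum>n<N. g n) - (\<Sum>n<N. g (n + r)) = (\<Sum>n<r. g n) - (\<Sum>n<r. g (N + n))"
    by (simp add: add.commute algebra_simps)
  also have "norm \<dots> \<le> norm (\<Sum>n<r. g n) + norm (\<Sum>n<r. g (N + n))" by (rule norm_triangle_ineq4)
  also have "\<dots> \<le> (\<Sum>n<r. 1) + (\<Sum>n<r. 1)" by (intro add_mono sum_norm_le assms)
  finally show ?thesis by simp
qed

text \<open>Averaging over shifts by at most \<open>L\<close> steps of the progression changes the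
  sum by at most \<open>2 * L\<close> boundary terms, and Cauchy-Schwarz in \<open>n\<close> then
  yields the correlations of pairs of shifts. The shifts form an arbitrary finite set of multiples
  of \<open>d\<close>, since each window needs its own. Normalising by \<open>N\<close> while
  summing to \<open>N'\<close> treats all initial segments at once.\<close>

lemma vdc_single:
  fixes f :: "nat \<Rightarrow> complex" and S :: "nat set" and N N' L d a :: nat
  assumes f: "\<And>n. norm (f n) \<le> 1" and S: "finite S" "S \<noteq> {}"
    and mult: "\<And>s. s \<in> S \<Longrightarrow> \<exists>r\<le>L. s = r * d" and N: "N' \<le> N" "0 < N"
  shows "(norm (\<Sum>n<N'. f (a + n * d)) / N)\<^sup>2 \<le>
    Re ((\<Sum>p\<in>S \<times> S. (\<Sum>n<N'. f (a + n * d + fst p) * cnj (f (a + n * d + snd p))) / N) / of_nat (card S ^ 2))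
    + 4 * real L / real N"
proof -
  define c where "c = real (card S)"
  have c: "c > 0" unfolding c_def using S by (simp add: card_gt_0_iff)
  define x where "x n = (\<Sum>s\<in>S. f (a + n * d + s)) / of_real c" for n
  define A where "A = norm (\<Sum>n<N'. f (a + n * d)) / N"
  define A' where "A' = norm (\<Sum>n<N'. x n) / N"
  have nx: "norm (x n) \<le> 1" for n
  proof -
    have "norm (\<Sum>s\<in>S. f (a + n * d + s)) \<le> (\<Sum>s\<in>S. 1)" by (intro sum_norm_le f)
    then show ?thesis unfolding x_def using c by (simp add: norm_divide c_def divide_le_eq)
  qed
  have sum1: "norm (\<Sum>n<N'. h n) / N \<le> 1" if "\<And>n. norm (h n) \<le> 1" for h :: "nat \<Rightarrow> complex"
  proof -
    have "norm (\<Sum>n<N'. h n) \<le> (\<Sum>n<N'. 1)" by (intro sum_norm_le that)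
    then show ?thesis using N by simp
  qed
  have A1: "A \<le> 1" "A' \<le> 1" "0 \<le> A" "0 \<le> A'" unfolding A_def A'_def using sum1 f nx by auto
  have "norm ((\<Sum>n<N'. f (a + n * d)) - (\<Sum>n<N'. x n)) \<le> 2 * L"
  proof -
    have "(\<Sum>n<N'. x n) = (\<Sum>s\<in>S. \<Sum>n<N'. f (a + n * d + s)) / of_real c"
      unfolding x_def by (subst sum.swap) (simp add: sum_divide_distrib)
    moreover have "(\<Sum>n<N'. f (a + n * d)) = (\<Sum>s\<in>S. \<Sum>n<N'. f (a + n * d)) / of_real c"
      using c by (simp add: c_def)
    ultimately have "(\<Sum>n<N'. f (a + n * d)) - (\<Sum>n<N'. x n) =
        (\<Sum>s\<in>S. (\<Sum>n<N'. f (a + n * d)) - (\<Sum>n<N'. f (a + n * d + s))) / of_real c"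
      by (simp only: sum_subtractf diff_divide_distrib)
    also have "norm \<dots> \<le> (\<Sum>s\<in>S. 2 * real L) / c"
    proof -
      have "norm ((\<Sum>n<N'. f (a + n * d)) - (\<Sum>n<N'. f (a + n * d + s))) \<le> 2 * real L" if s: "s \<in> S" for s
      proof -
        obtain r where r: "r \<le> L" "s = r * d" using mult s by blast
        have "norm ((\<Sum>n<N'. f (a + n * d)) - (\<Sum>n<N'. f (a + (n + r) * d))) \<le> 2 * real r"
          by (rule norm_sum_shift_le[of "\<lambda>n. f (a + n * d)"]) (rule f)
        then show ?thesis using r by (simp add: algebra_simps)
      qed
      then have "norm (\<Sum>s\<in>S. (\<Sum>n<N'. f (a + n * d)) - (\<Sum>n<N'. f (a + n * d + s))) \<le> (\<Sum>s\<in>S. 2 * real L)"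
        by (intro sum_norm_le)
      then show ?thesis using c by (simp add: norm_divide divide_right_mono)
    qed
    finally show ?thesis using c by (simp add: c_def)
  qed
  then have "norm (\<Sum>n<N'. f (a + n * d)) \<le> norm (\<Sum>n<N'. x n) + 2 * L"
    using norm_triangle_ineq2[of "\<Sum>n<N'. f (a + n * d)" "\<Sum>n<N'. x n"] by linarith
  then have "A \<le> A' + 2 * real L / real N" unfolding A_def A'_def using N by (simp add: field_simps)
  then have "A ^ 2 \<le> A' ^ 2 + real 2 * (2 * real L / real N)" using A1 by (intro power_le_add) auto
  moreover have "A' ^ 2 \<le> (\<Sum>n<N'. norm (x n) ^ 2) / N"
  proof -
    have "norm (\<Sum>n<N'. x n) \<le> (\<Sum>n<N'. norm (x n) * 1)" using norm_sum[of x "{..<N'}"] by simp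
    then have "norm (\<Sum>n<N'. x n) ^ 2 \<le> (\<Sum>n<N'. norm (x n) * 1) ^ 2" by (intro power_mono) auto
    also have "\<dots> \<le> (\<Sum>n<N'. norm (x n) ^ 2) * (\<Sum>n<N'. 1 ^ 2)" by (rule Cauchy_Schwarz_ineq_sum)
    also have "\<dots> \<le> (\<Sum>n<N'. norm (x n) ^ 2) * N" using N by (intro mult_left_mono) (auto intro: sum_nonneg)
    finally show ?thesis unfolding A'_def using N by (simp add: power_divide divide_le_eq power2_eq_square)
  qed
  moreover have "(\<Sum>p\<in>S \<times> S. (\<Sum>n<N'. f (a + n * d + fst p) * cnj (f (a + n * d + snd p))) / N) / of_nat (card S ^ 2)
     = of_real ((\<Sum>n<N'. norm (x n) ^ 2) / N)"
  proof -
    have sq: "complex_of_real (norm (x n) ^ 2) =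
        (\<Sum>p\<in>S \<times> S. f (a + n * d + fst p) * cnj (f (a + n * d + snd p))) / of_real (c\<^sup>2)" for n
    proof -
      have "complex_of_real (norm (x n) ^ 2) = x n * cnj (x n)"
        by (simp only: complex_norm_square)
      also have "\<dots> = (\<Sum>s\<in>S. f (a + n * d + s)) * (\<Sum>s\<in>S. cnj (f (a + n * d + s))) / of_real (c\<^sup>2)"
        unfolding x_def by (simp add: power2_eq_square)
      finally show ?thesis by (simp add: sum_product sum.cartesian_product case_prod_unfold)
    qed
    have "complex_of_real ((\<Sum>n<N'. norm (x n) ^ 2) / N) =
        (\<Sum>n<N'. (\<Sum>p\<in>S \<times> S. f (a + n * d + fst p) * cnj (f (a + n * d + snd p)))) / of_real (c\<^sup>2) / N"
      by (simp only: of_real_divide of_real_sum sq sum_divide_distrib of_real_of_nat_eq)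
    also have "\<dots> = (\<Sum>p\<in>S \<times> S. (\<Sum>n<N'. f (a + n * d + fst p) * cnj (f (a + n * d + snd p))) / N) / of_nat (card S ^ 2)"
      by (subst sum.swap) (simp add: sum_divide_distrib[symmetric] c_def)
    finally show ?thesis ..
  qed
  ultimately show ?thesis unfolding A_def[symmetric] by simp
qed

text \<open>Each application squares the left side; raising the resulting bound to the power
  \<open>q\<close> costs \<open>q * e\<close> by \<open>power_le_add\<close> because all quantities
  are at most 1, and the induction hypothesis costs the same again. So the error doubles with each
  coordinate.\<close>

lemma vdc_box:
  fixes f :: "nat \<Rightarrow> complex" and N N' L d a :: nat
  assumes "Ss \<noteq> []" "\<And>n. norm (f n) \<le> 1"
    and "\<And>S. S \<in> set Ss \<Longrightarrow> finite S \<and> S \<noteq> {} \<and> (\<forall>s\<in>S. \<exists>r\<le>L. s = r * d)"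
    and N: "N' \<le> N" "0 < N"
  shows "(norm (\<Sum>n<N'. f (a + n * d)) / N) ^ (2 ^ length Ss) \<le>
    Re (bavg Ss (\<lambda>vs. (\<Sum>n<N'. box f vs (a + n * d)) / N)) + 2 ^ length Ss * (4 * real L / real N)"
  using assms(1-3)
proof (induction Ss arbitrary: f rule: list_nonempty_induct)
  case (single S)
  have box1: "box f [p] n = f (n + fst p) * cnj (f (n + snd p))" for p n by (cases p) simp
  have "(norm (\<Sum>n<N'. f (a + n * d)) / N)\<^sup>2 \<le>
    Re (bavg [S] (\<lambda>vs. (\<Sum>n<N'. box f vs (a + n * d)) / N)) + 4 * real L / real N"
    unfolding bavg_Cons bavg_Nil box1 using single N by (intro vdc_single) auto
  moreover have "0 \<le> 4 * real L / real N" by simp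
  moreover have "(2::nat) ^ length [S] = 2" "(2::real) ^ length [S] = 2" by simp_all
  ultimately show ?case by (simp only:)
next
  case (cons S Ss)
  have S: "finite S" "S \<noteq> {}" using cons.prems by auto
  define X where "X p = (\<Sum>n<N'. f (a + n * d + fst p) * cnj (f (a + n * d + snd p))) / N" for p :: "nat \<times> nat"
  define c where "c = card S ^ 2"
  have c: "c = card (S \<times> S)" "c > 0" unfolding c_def using S by (auto simp: card_cartesian_product power2_eq_square card_gt_0_iff)
  define e where "e = 4 * real L / real N"
  define q where "q = (2::nat) ^ length Ss"
  define u where "u = norm (\<Sum>n<N'. f (a + n * d)) / N"
  define y where "y = (\<Sum>p\<in>S \<times> S. norm (X p)) / c"
  have e: "0 \<le> e" by (simp add: e_def)
  have sum1: "norm (\<Sum>n<N'. h n) / N \<le> 1" if "\<And>n. norm (h n) \<le> 1" for h :: "nat \<Rightarrow> complex"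
  proof -
    have "norm (\<Sum>n<N'. h n) \<le> (\<Sum>n<N'. 1)" by (intro sum_norm_le that)
    then show ?thesis using N by simp
  qed
  have f2: "norm (f i * cnj (f j)) \<le> 1" for i j
    using cons.prems(1) by (simp add: norm_mult mult_le_one)
  have X1: "norm (X p) \<le> 1" for p
    unfolding X_def norm_divide using sum1[OF f2] by simp
  have y: "0 \<le> y" "y \<le> 1"
  proof -
    show "0 \<le> y" unfolding y_def by (intro divide_nonneg_nonneg sum_nonneg) auto
    have "(\<Sum>p\<in>S \<times> S. norm (X p)) \<le> (\<Sum>p\<in>S \<times> S. 1)" by (intro sum_mono X1)
    then show "y \<le> 1" unfolding y_def using c by (simp add: divide_le_eq)
  qed
  have "u\<^sup>2 \<le> Re ((\<Sum>p\<in>S \<times> S. X p) / of_nat c) + e"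
    unfolding u_def X_def c_def e_def using cons.prems N by (intro vdc_single) auto
  also have "Re ((\<Sum>p\<in>S \<times> S. X p) / of_nat c) \<le> norm ((\<Sum>p\<in>S \<times> S. X p) / of_nat c)" by (rule complex_Re_le_cmod)
  also have "\<dots> \<le> y" unfolding y_def norm_divide norm_of_nat by (intro divide_right_mono norm_sum) auto
  finally have "u\<^sup>2 \<le> y + e" by simp
  moreover have "0 \<le> u" "u \<le> 1" unfolding u_def using sum1 cons.prems(1) by auto
  ultimately have "(u\<^sup>2) ^ q \<le> y ^ q + q * e"
    using y e by (intro power_le_add) (auto simp: power_le_one)
  also have "y ^ q \<le> (\<Sum>p\<in>S \<times> S. norm (X p) ^ q) / c"
    unfolding y_def q_def c(1) using S by (intro power_average_le) auto
  also have "(\<Sum>p\<in>S \<times> S. norm (X p) ^ q) \<le>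
      (\<Sum>p\<in>S \<times> S. Re (bavg Ss (\<lambda>vs. (\<Sum>n<N'. box f (p # vs) (a + n * d)) / N)) + q * e)"
  proof (rule sum_mono)
    fix p assume "p \<in> S \<times> S"
    define h where "h n = f (n + fst p) * cnj (f (n + snd p))" for n
    have "norm (\<Sum>n<N'. h (a + n * d)) / N = norm (X p)" unfolding X_def h_def norm_divide by simp
    moreover have "(norm (\<Sum>n<N'. h (a + n * d)) / N) ^ (2 ^ length Ss) \<le>
        Re (bavg Ss (\<lambda>vs. (\<Sum>n<N'. box h vs (a + n * d)) / N)) + 2 ^ length Ss * (4 * real L / real N)"
      using cons.prems f2 unfolding h_def by (intro cons.IH) auto
    moreover have "box h vs n = box f (p # vs) n" for vs n
      unfolding h_def using box_Cons_inner[of f "fst p" "snd p" vs n] by simp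
    ultimately show "norm (X p) ^ q \<le> Re (bavg Ss (\<lambda>vs. (\<Sum>n<N'. box f (p # vs) (a + n * d)) / N)) + q * e"
      unfolding q_def e_def by simp
  qed
  also have "\<dots> / c = Re (bavg (S # Ss) (\<lambda>vs. (\<Sum>n<N'. box f vs (a + n * d)) / N)) + q * e"
    using c unfolding bavg_Cons c_def[symmetric]
    by (simp add: sum.distrib add_divide_distrib c(1)[symmetric] Re_divide_of_nat)
  finally have "(u\<^sup>2) ^ q \<le> Re (bavg (S # Ss) (\<lambda>vs. (\<Sum>n<N'. box f vs (a + n * d)) / N)) + q * e + q * e"
    by (simp add: divide_right_mono)
  moreover have "(u\<^sup>2) ^ q = u ^ (2 ^ length (S # Ss))" by (simp add: q_def power_mult)
  moreover have "q * e + q * e = 2 ^ length (S # Ss) * (4 * real L / real N)" by (simp add: q_def e_def)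
  ultimately show ?case unfolding u_def by simp
qed

text \<open>The bound is uniform in the starting point \<open>a\<close>. Exceptional sets may thus
  be translated freely, which is what a box, evaluating its function at many shifts,
  requires.\<close>

definition hits :: "nat \<Rightarrow> nat \<Rightarrow> nat set \<Rightarrow> nat \<Rightarrow> bool" where
  "hits d N X c \<longleftrightarrow> (\<forall>a. card {n\<in>{..<N}. a + n * d \<in> X} \<le> c)"

lemma hits_mono: "hits d N X c \<Longrightarrow> Y \<subseteq> X \<Longrightarrow> c \<le> c' \<Longrightarrow> hits d N Y c'"
  unfolding hits_def
proof
  fix a assume "\<forall>a. card {n\<in>{..<N}. a + n * d \<in> X} \<le> c" "Y \<subseteq> X" "c \<le> c'"
  moreover have "card {n\<in>{..<N}. a + n * d \<in> Y} \<le> card {n\<in>{..<N}. a + n * d \<in> X}"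
    using \<open>Y \<subseteq> X\<close> by (intro card_mono) auto
  ultimately show "card {n\<in>{..<N}. a + n * d \<in> Y} \<le> c'" by (meson order_trans)
qed

lemma hits_Un:
  assumes "hits d N X b" "hits d N Y c"
  shows "hits d N (X \<union> Y) (b + c)"
  unfolding hits_def
proof
  fix a
  have "{n\<in>{..<N}. a + n * d \<in> X \<union> Y} = {n\<in>{..<N}. a + n * d \<in> X} \<union> {n\<in>{..<N}. a + n * d \<in> Y}" by auto
  then have "card {n\<in>{..<N}. a + n * d \<in> X \<union> Y} \<le>
      card {n\<in>{..<N}. a + n * d \<in> X} + card {n\<in>{..<N}. a + n * d \<in> Y}" by (simp only: card_Un_le)
  also have "\<dots> \<le> b + c" using assms unfolding hits_def by (intro add_mono) auto
  finally show "card {n\<in>{..<N}. a + n * d \<in> X \<union> Y} \<le> b + c" .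
qed

lemma hits_shift: "hits d N X c \<Longrightarrow> hits d N {n. n + s \<in> X} c"
  unfolding hits_def
proof
  fix a assume "\<forall>a. card {n\<in>{..<N}. a + n * d \<in> X} \<le> c"
  then have "card {n\<in>{..<N}. (a + s) + n * d \<in> X} \<le> c" by blast
  then show "card {n\<in>{..<N}. a + n * d \<in> {n. n + s \<in> X}} \<le> c" by (simp add: add_ac)
qed

lemma hits_box:
  assumes "hits d N {n. G n \<noteq> H n} c"
  shows "hits d N {n. box G vs n \<noteq> box H vs n} (2 ^ length vs * c)"
proof (induction vs)
  case (Cons p vs)
  let ?X = "{n. box G vs n \<noteq> box H vs n}"
  have "hits d N ({n. n + fst p \<in> ?X} \<union> {n. n + snd p \<in> ?X}) (2 ^ length vs * c + 2 ^ length vs * c)"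
    using Cons by (intro hits_Un hits_shift)
  then show ?case by (rule hits_mono) (cases p, auto)
qed (use assms in simp)

text \<open>Where \<open>f\<close> does not notice the shifts of one coordinate, the two halves of
  the cube along this coordinate are conjugate to each other, and a unimodular product cancels to
  1.\<close>

lemma hits_box_one:
  assumes f: "\<And>n. norm (f n) = 1"
    and "hits d N {n. f (n + a) \<noteq> f n} c" "hits d N {n. f (n + b) \<noteq> f n} c"
  shows "hits d N {n. box f (us @ (a, b) # vs) n \<noteq> 1} (2 ^ length (us @ (a, b) # vs) * c)"
proof -
  let ?k = "2 ^ length vs * c"
  have h: "hits d N {n. box f vs (n + s) \<noteq> box f vs n} ?k" if "hits d N {n. f (n + s) \<noteq> f n} c" for s
    using hits_box[OF that, of vs] by (simp add: box_shift[of f])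
  have "hits d N ({n. box f vs (n + a) \<noteq> box f vs n} \<union> {n. box f vs (n + b) \<noteq> box f vs n}) (?k + ?k)"
    using assms by (intro hits_Un h)
  then have "hits d N {n. box f ((a, b) # vs) n \<noteq> 1} (?k + ?k)"
  proof (rule hits_mono)
    show "{n. box f ((a, b) # vs) n \<noteq> 1} \<subseteq>
      {n. box f vs (n + a) \<noteq> box f vs n} \<union> {n. box f vs (n + b) \<noteq> box f vs n}"
    proof (rule subsetI, rule ccontr)
      fix n assume "n \<in> {n. box f ((a, b) # vs) n \<noteq> 1}"
        "n \<notin> {n. box f vs (n + a) \<noteq> box f vs n} \<union> {n. box f vs (n + b) \<noteq> box f vs n}"
      then have "box f vs n * cnj (box f vs n) \<noteq> 1" by simp
      then show False using norm_box_eq[of f vs n] f by (simp flip: complex_norm_square)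
    qed
  qed simp
  then have "hits d N {n. box (box f ((a, b) # vs)) us n \<noteq> 1} (2 ^ length us * (?k + ?k))"
    using hits_box[of d N "box f ((a, b) # vs)" "\<lambda>_. 1" "?k + ?k" us] by (simp del: box.simps)
  then show ?thesis
    by (rule hits_mono) (auto simp: box_append power_add simp del: box.simps)
qed

lemma norm_sum_progression_diff_le:
  fixes G H :: "nat \<Rightarrow> complex"
  assumes "hits d N {n. G n \<noteq> H n} c" "N' \<le> N" "\<And>n. norm (G n) \<le> 1" "\<And>n. norm (H n) \<le> 1"
  shows "norm ((\<Sum>n<N'. G (a + n * d)) - (\<Sum>n<N'. H (a + n * d))) \<le> 2 * real c"
proof -
  let ?X = "{n\<in>{..<N}. a + n * d \<in> {n. G n \<noteq> H n}}"
  have "(\<Sum>n<N'. G (a + n * d)) - (\<Sum>n<N'. H (a + n * d)) = (\<Sum>n<N'. G (a + n * d) - H (a + n * d))"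
    by (simp add: sum_subtractf)
  also have "\<dots> = (\<Sum>n\<in>?X \<inter> {..<N'}. G (a + n * d) - H (a + n * d))"
    using assms(2) by (intro sum.mono_neutral_right) auto
  also have "norm \<dots> \<le> (\<Sum>n\<in>?X \<inter> {..<N'}. 2)"
    using assms(3,4) by (intro sum_norm_le) (smt (verit) norm_triangle_ineq4)
  also have "\<dots> = 2 * real (card (?X \<inter> {..<N'}))" by simp
  also have "\<dots> \<le> 2 * real (card ?X)" by (intro mult_left_mono of_nat_mono card_mono) auto
  also have "\<dots> \<le> 2 * real c" using assms(1) unfolding hits_def by simp
  finally show ?thesis .
qed

lemma hits_box_prod:
  assumes "finite A" "\<And>j n. j \<in> A \<Longrightarrow> norm (f j n) = 1"
    and "\<And>j. j \<in> A \<Longrightarrow> hits d N {n. box (f j) vs n \<noteq> 1} c"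
  shows "hits d N {n. box (\<lambda>n. (\<Prod>j\<in>A. f j n) * g n) vs n \<noteq> box g vs n} (card A * c)"
proof -
  have "hits d N {n. (\<Prod>j\<in>A. box (f j) vs n) \<noteq> 1} (card A * c)"
    using assms(1,3)
  proof (induction A rule: finite_induct)
    case empty
    then show ?case by (simp add: hits_def)
  next
    case (insert j A)
    have "hits d N ({n. box (f j) vs n \<noteq> 1} \<union> {n. (\<Prod>j\<in>A. box (f j) vs n) \<noteq> 1}) (c + card A * c)"
      using insert by (intro hits_Un) auto
    then show ?case by (rule hits_mono) (use insert in auto)
  qed
  then show ?thesis by (rule hits_mono) (auto simp: box_mult box_prod)
qed

text \<open>After van der Corput with one coordinate per factor, \<open>f j\<close> cancels because
  coordinate \<open>j\<close> preserves it, and only \<open>g\<close> remains. The last coordinate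
  does double duty: it cancels the last factor, and on \<open>g\<close> its shifts
  \<open>m * t\<close> act like the plain shifts \<open>m\<close>, so that \<open>T\<close> may be
  replaced by an interval.\<close>

lemma box_reduction:
  fixes f :: "nat \<Rightarrow> nat \<Rightarrow> complex" and g :: "nat \<Rightarrow> complex" and t M N N' L d a c :: nat
  defines "T \<equiv> (\<lambda>m. m * t) ` {..<M}"
  assumes f: "\<And>j n. norm (f j n) = 1" and g: "\<And>n. norm (g n) = 1"
    and Ss: "\<And>S. S \<in> set (Ss @ [T]) \<Longrightarrow> finite S \<and> S \<noteq> {} \<and> (\<forall>s\<in>S. \<exists>r\<le>L. s = r * d)"
    and k: "k = Suc (length Ss)" and t: "0 < t" and N: "N' \<le> N" "0 < N"
    and hit: "\<And>j s. j < k \<Longrightarrow> s \<in> (Ss @ [T]) ! j \<Longrightarrow> hits d N {n. f j (n + s) \<noteq> f j n} c"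
    and last: "\<And>m. m < M \<Longrightarrow> hits d N {n. g (n + m * t) \<noteq> g (n + m)} c"
    and bound: "\<And>n. norm (bavg (Ss @ [{..<M}]) (\<lambda>vs. box g vs n)) \<le> B"
  shows "(norm (\<Sum>n<N'. (\<Prod>j<k. f j (a + n * d)) * g (a + n * d)) / N) ^ (2 ^ k) \<le>
    B + 2 * (real (k + 1) * 2 ^ k * c) / N + 2 ^ k * (4 * real L / real N)"
proof -
  define F where "F n = (\<Prod>j<k. f j n) * g n" for n
  have F: "norm (F n) = 1" for n unfolding F_def by (simp add: norm_mult f g flip: prod_norm)
  have injt: "inj_on (\<lambda>(m, m'). (m * t, m' * t)) ({..<M} \<times> {..<M})" using t by (auto simp: inj_on_def)
  have TT: "T \<times> T = (\<lambda>(m, m'). (m * t, m' * t)) ` ({..<M} \<times> {..<M})" unfolding T_def by auto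
  have cT: "card T = M" unfolding T_def using t by (subst card_image) (auto simp: inj_on_def)
  \<comment> \<open>Each of the \<open>k\<close> factors fails to cancel at no more than
    \<open>2 ^ k * c\<close> terms, and replacing the shifts of the last coordinate costs the same
    once more.\<close>
  define C where "C = (k + 1) * 2 ^ k * c"
  define U where "U vs = (\<Sum>n<N'. box F vs (a + n * d)) / complex_of_nat N" for vs
  define V where "V vs = (\<Sum>n<N'. box g vs (a + n * d)) / complex_of_nat N" for vs
  have key: "norm (U (vs @ [(m * t, m' * t)]) - V (vs @ [(m, m')])) \<le> 2 * real C / N"
    if vs: "vs \<in> tups Ss" and m: "m < M" "m' < M" for vs m m'
  proof -
    let ?vt = "vs @ [(m * t, m' * t)]" and ?v1 = "vs @ [(m, m')]"
    have len: "length vs = length Ss" using vs by (rule length_tups)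
    have "hits d N {n. box (f j) ?vt n \<noteq> 1} (2 ^ k * c)" if j: "j < k" for j
    proof (cases "j < length Ss")
      case True
      have sp: "?vt = take j vs @ vs ! j # (drop (Suc j) vs @ [(m * t, m' * t)])"
        using True len by (simp add: Cons_nth_drop_Suc[symmetric] append_take_drop_id[symmetric] del: append_take_drop_id)
          (metis append_Cons append_assoc id_take_nth_drop)
      have "fst (vs ! j) \<in> (Ss @ [T]) ! j" "snd (vs ! j) \<in> (Ss @ [T]) ! j"
        using tups_nth[OF vs True] True by (auto simp: nth_append)
      then have "hits d N {n. box (f j) (take j vs @ (fst (vs ! j), snd (vs ! j)) # (drop (Suc j) vs @ [(m * t, m' * t)])) n \<noteq> 1}
          (2 ^ length (take j vs @ (fst (vs ! j), snd (vs ! j)) # (drop (Suc j) vs @ [(m * t, m' * t)])) * c)"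
        using hit j f by (intro hits_box_one) auto
      moreover have "length (take j vs @ (fst (vs ! j), snd (vs ! j)) # (drop (Suc j) vs @ [(m * t, m' * t)])) = k"
        using True len k by simp
      ultimately show ?thesis using sp by (simp only: prod.collapse)
    next
      case False
      then have "j = length Ss" using j k by simp
      then have "m * t \<in> (Ss @ [T]) ! j" "m' * t \<in> (Ss @ [T]) ! j" using m by (auto simp: T_def)
      then have "hits d N {n. box (f j) (vs @ (m * t, m' * t) # []) n \<noteq> 1} (2 ^ length (vs @ (m * t, m' * t) # []) * c)"
        using hit j f by (intro hits_box_one) auto
      then show ?thesis using len k by simp
    qed
    then have "hits d N {n. box (\<lambda>n. (\<Prod>j\<in>{..<k}. f j n) * g n) ?vt n \<noteq> box g ?vt n} (card {..<k} * (2 ^ k * c))"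
      using f by (intro hits_box_prod) auto
    then have h1: "hits d N {n. box F ?vt n \<noteq> box g ?vt n} (k * (2 ^ k * c))" unfolding F_def by simp
    have "hits d N ({n. g (n + m * t) \<noteq> g (n + m)} \<union> {n. g (n + m' * t) \<noteq> g (n + m')}) (c + c)"
      using m last by (intro hits_Un) auto
    then have "hits d N {n. box g [(m * t, m' * t)] n \<noteq> box g [(m, m')] n} (c + c)"
      by (rule hits_mono) auto
    moreover have "2 ^ length vs * (c + c) = 2 ^ k * c" using len k by simp
    ultimately have h2: "hits d N {n. box g ?vt n \<noteq> box g ?v1 n} (2 ^ k * c)"
      using hits_box[of d N "box g [(m * t, m' * t)]" "box g [(m, m')]" "c + c" vs]
      unfolding box_append by (simp only:)
    have "hits d N ({n. box F ?vt n \<noteq> box g ?vt n} \<union> {n. box g ?vt n \<noteq> box g ?v1 n}) (k * (2 ^ k * c) + 2 ^ k * c)"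
      by (intro hits_Un h1 h2)
    then have "hits d N {n. box F ?vt n \<noteq> box g ?v1 n} C"
      by (rule hits_mono) (auto simp: C_def algebra_simps)
    then have "norm ((\<Sum>n<N'. box F ?vt (a + n * d)) - (\<Sum>n<N'. box g ?v1 (a + n * d))) \<le> 2 * real C"
      using N F g by (intro norm_sum_progression_diff_le norm_box_le) auto
    then show ?thesis unfolding U_def V_def
      by (simp add: norm_divide divide_right_mono flip: diff_divide_distrib)
  qed
  have M0: "M > 0" using Ss[of T] by (auto simp: T_def)
  have "norm (bavg (Ss @ [T]) U - bavg (Ss @ [{..<M}]) V) \<le> 2 * real C / N"
  proof -
    have "bavg (Ss @ [T]) U = (\<Sum>p\<in>{..<M} \<times> {..<M}. bavg Ss (\<lambda>vs. U (vs @ [(fst p * t, snd p * t)]))) / of_nat (M ^ 2)"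
      unfolding bavg_snoc TT cT using injt by (subst sum.reindex) (auto simp: case_prod_unfold)
    moreover have "bavg (Ss @ [{..<M}]) V = (\<Sum>p\<in>{..<M} \<times> {..<M}. bavg Ss (\<lambda>vs. V (vs @ [(fst p, snd p)]))) / of_nat (M ^ 2)"
      unfolding bavg_snoc by simp
    ultimately have "bavg (Ss @ [T]) U - bavg (Ss @ [{..<M}]) V =
       (\<Sum>p\<in>{..<M} \<times> {..<M}. bavg Ss (\<lambda>vs. U (vs @ [(fst p * t, snd p * t)])) - bavg Ss (\<lambda>vs. V (vs @ [(fst p, snd p)]))) / of_nat (M ^ 2)"
      by (simp only: sum_subtractf diff_divide_distrib)
    also have "norm \<dots> \<le> (\<Sum>p\<in>{..<M} \<times> {..<M}. 2 * real C / N) / real (M ^ 2)"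
      unfolding norm_divide norm_of_nat
      by (intro divide_right_mono sum_norm_le bavg_diff_le key) auto
    also have "\<dots> = 2 * real C / N" using M0 by (simp add: power2_eq_square)
    finally show ?thesis .
  qed
  moreover have "norm (bavg (Ss @ [{..<M}]) V) \<le> B"
  proof -
    have B0: "0 \<le> B" using bound[of 0] by (meson norm_ge_zero order_trans)
    have "bavg (Ss @ [{..<M}]) V = (\<Sum>n<N'. bavg (Ss @ [{..<M}]) (\<lambda>vs. box g vs (a + n * d))) / of_nat N"
      unfolding V_def bavg_divide bavg_sum by simp
    also have "norm \<dots> \<le> (\<Sum>n<N'. B) / N"
      unfolding norm_divide norm_of_nat by (intro divide_right_mono sum_norm_le bound) auto
    also have "\<dots> \<le> B" using N B0 by (simp add: divide_le_eq mult.commute mult_left_mono)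
    finally show ?thesis .
  qed
  moreover have "Re (bavg (Ss @ [T]) U) \<le> norm (bavg (Ss @ [T]) U)" by (rule complex_Re_le_cmod)
  moreover have "norm (bavg (Ss @ [T]) U) \<le> norm (bavg (Ss @ [T]) U - bavg (Ss @ [{..<M}]) V) + norm (bavg (Ss @ [{..<M}]) V)"
    by (metis diff_add_cancel norm_triangle_ineq)
  moreover have "(norm (\<Sum>n<N'. F (a + n * d)) / N) ^ (2 ^ length (Ss @ [T])) \<le>
    Re (bavg (Ss @ [T]) (\<lambda>vs. (\<Sum>n<N'. box F vs (a + n * d)) / N)) + 2 ^ length (Ss @ [T]) * (4 * real L / real N)"
    using Ss F N by (intro vdc_box) auto
  moreover have "length (Ss @ [T]) = k" using k by simp
  moreover have "real C = real (k + 1) * 2 ^ k * real c" unfolding C_def by (simp add: distrib_right)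
  ultimately show ?thesis unfolding U_def[symmetric] F_def[symmetric] by (simp only:)
qed

section \<open>Step functions on the circle and equidistribution\<close>

definition zcirc :: "real set" where
  "zcirc = {- (gi * gi)<..<gi}"

lemma zpos_in_zcirc: "zpos n \<in> zcirc"
  using zpos_bounds by (simp add: zcirc_def)

text \<open>Constancy is demanded only at the points \<open>zpos n\<close>. The number
  \<open>K\<close> of intervals is recorded because each contributes its own discrepancy
  error.\<close>

definition cells :: "nat \<Rightarrow> (nat \<Rightarrow> 'a) \<Rightarrow> real set set \<Rightarrow> bool" where
  "cells K H \<P> \<longleftrightarrow> finite \<P> \<and> card \<P> \<le> K \<and> (\<forall>P\<in>\<P>. is_interval P \<and> P \<subseteq> zcirc) \<and>
     (\<forall>P\<in>\<P>. \<forall>Q\<in>\<P>. P \<inter> Q \<noteq> {} \<longrightarrow> P = Q) \<and> (\<forall>n. \<exists>P\<in>\<P>. zpos n \<in> P) \<and>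
     (\<forall>P\<in>\<P>. \<forall>m n. zpos m \<in> P \<longrightarrow> zpos n \<in> P \<longrightarrow> H m = H n)"

definition step_fun :: "nat \<Rightarrow> (nat \<Rightarrow> 'a) \<Rightarrow> bool" where
  "step_fun K H \<longleftrightarrow> (\<exists>\<P>. cells K H \<P>)"

lemma cellsD:
  assumes "cells K H \<P>"
  shows "finite \<P>" "card \<P> \<le> K" "\<And>P. P \<in> \<P> \<Longrightarrow> is_interval P" "\<And>P. P \<in> \<P> \<Longrightarrow> P \<subseteq> zcirc"
    "\<And>P Q x. P \<in> \<P> \<Longrightarrow> Q \<in> \<P> \<Longrightarrow> x \<in> P \<Longrightarrow> x \<in> Q \<Longrightarrow> P = Q" "\<And>n. \<exists>P\<in>\<P>. zpos n \<in> P"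
    "\<And>P m n. P \<in> \<P> \<Longrightarrow> zpos m \<in> P \<Longrightarrow> zpos n \<in> P \<Longrightarrow> H m = H n"
proof -
  note P = assms[unfolded cells_def]
  note P1 = P[THEN conjunct1] and P2 = P[THEN conjunct2, THEN conjunct1]
    and P3 = P[THEN conjunct2, THEN conjunct2, THEN conjunct1]
    and P4 = P[THEN conjunct2, THEN conjunct2, THEN conjunct2, THEN conjunct1]
    and P5 = P[THEN conjunct2, THEN conjunct2, THEN conjunct2, THEN conjunct2, THEN conjunct1]
    and P6 = P[THEN conjunct2, THEN conjunct2, THEN conjunct2, THEN conjunct2, THEN conjunct2]
  show "finite \<P>" "card \<P> \<le> K" by (fact P1 P2)+
  show "is_interval P" "P \<subseteq> zcirc" if "P \<in> \<P>" for P using bspec[OF P3 that] by simp_all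
  show "\<exists>P\<in>\<P>. zpos n \<in> P" for n by (rule P5[rule_format])
  show "H m = H n" if "P \<in> \<P>" "zpos m \<in> P" "zpos n \<in> P" for P m n
    by (rule P6[rule_format, OF that])
  fix P Q x assume *: "P \<in> \<P>" "Q \<in> \<P>" "x \<in> P" "x \<in> Q"
  then have "x \<in> P \<inter> Q" by simp
  then have "P \<inter> Q \<noteq> {}" by fast
  then show "P = Q" by (rule P4[rule_format, OF *(1,2)])
qed

lemma step_funI:
  assumes "finite \<P>" "card \<P> \<le> K" "\<And>P. P \<in> \<P> \<Longrightarrow> is_interval P" "\<And>P. P \<in> \<P> \<Longrightarrow> P \<subseteq> zcirc"
    "\<And>P Q x. P \<in> \<P> \<Longrightarrow> Q \<in> \<P> \<Longrightarrow> x \<in> P \<Longrightarrow> x \<in> Q \<Longrightarrow> P = Q" "\<And>n. \<exists>P\<in>\<P>. zpos n \<in> P"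
    "\<And>P m n. P \<in> \<P> \<Longrightarrow> zpos m \<in> P \<Longrightarrow> zpos n \<in> P \<Longrightarrow> H m = H n"
  shows "step_fun K H"
  unfolding step_fun_def cells_def
proof (intro exI[of _ \<P>] conjI ballI allI impI)
  fix P Q assume PQ: "P \<in> \<P>" "Q \<in> \<P>" "P \<inter> Q \<noteq> {}"
  then obtain x where "x \<in> P" "x \<in> Q" by blast
  then show "P = Q" by (rule assms(5)[OF PQ(1,2)])
next
  fix P m n assume "P \<in> \<P>" "zpos m \<in> P" "zpos n \<in> P"
  then show "H m = H n" by (rule assms(7))
qed (fact assms(1) assms(2) assms(6) | erule assms(3) | erule assms(4))+

lemma step_fun_comp:
  assumes "step_fun K H"
  shows "step_fun K (\<lambda>n. f (H n))"
proof -
  obtain \<P> where "cells K H \<P>"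
    using assms(1) unfolding step_fun_def by blast
  note P = cellsD[OF this]
  show ?thesis
  proof (rule step_funI[where \<P> = \<P>])
    show "f (H m) = f (H n)" if "Q \<in> \<P>" "zpos m \<in> Q" "zpos n \<in> Q" for Q m n
      using P(7)[OF that] by simp
    show "Q = R" if "Q \<in> \<P>" "R \<in> \<P>" "x \<in> Q" "x \<in> R" for Q R x
      by (rule P(5)[OF that])
  qed (fact P(1) P(2) P(6) | erule P(3) | erule P(4))+
qed

lemma step_fun_pair:
  assumes "step_fun K H" "step_fun L G"
  shows "step_fun (K * L) (\<lambda>n. (H n, G n))"
proof -
  obtain \<P> where "cells K H \<P>"
    using assms(1) unfolding step_fun_def by blast
  note P = cellsD[OF this]
  obtain \<Q> where "cells L G \<Q>"
    using assms(2) unfolding step_fun_def by blast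
  note Q = cellsD[OF this]
  let ?R = "(\<lambda>(P, Q). P \<inter> Q) ` (\<P> \<times> \<Q>)"
  show ?thesis
  proof (rule step_funI[of ?R])
    have "card ?R \<le> card (\<P> \<times> \<Q>)" using P(1) Q(1) by (intro card_image_le) auto
    also have "\<dots> \<le> K * L" using P(2) Q(2) by (simp add: card_cartesian_product mult_le_mono)
    finally show "card ?R \<le> K * L" .
    show "finite ?R" using P(1) Q(1) by simp
    have R: thesis if X: "X \<in> ?R" and A: "\<And>A B. A \<in> \<P> \<Longrightarrow> B \<in> \<Q> \<Longrightarrow> X = A \<inter> B \<Longrightarrow> thesis" for X thesis
      using X by (elim imageE SigmaE) (auto intro: A)
    show "is_interval X" if "X \<in> ?R" for X
      using that by (rule R) (simp add: is_interval_Int P(3) Q(3))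
    show "X \<subseteq> zcirc" if "X \<in> ?R" for X
      using that by (rule R) (simp add: le_infI1 P(4))
    show "X = Y" if XY: "X \<in> ?R" "Y \<in> ?R" and x: "x \<in> X" "x \<in> Y" for X Y x
    proof -
      obtain A B where X: "A \<in> \<P>" "B \<in> \<Q>" "X = A \<inter> B" using XY(1) by (rule R)
      obtain C D where Y: "C \<in> \<P>" "D \<in> \<Q>" "Y = C \<inter> D" using XY(2) by (rule R)
      have "A = C" by (rule P(5)[OF X(1) Y(1), of x]) (use x in \<open>simp_all add: X(3) Y(3)\<close>)
      moreover have "B = D" by (rule Q(5)[OF X(2) Y(2), of x]) (use x in \<open>simp_all add: X(3) Y(3)\<close>)
      ultimately show ?thesis unfolding X(3) Y(3) by simp
    qed
    show "\<exists>X\<in>?R. zpos n \<in> X" for n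
    proof -
      obtain A where A: "A \<in> \<P>" "zpos n \<in> A" using P(6)[of n] by blast
      obtain B where B: "B \<in> \<Q>" "zpos n \<in> B" using Q(6)[of n] by blast
      have "A \<inter> B \<in> ?R" using A(1) B(1) by (intro image_eqI[of _ _ "(A, B)"]) simp_all
      then show ?thesis using A(2) B(2) by (intro bexI[where x = "A \<inter> B"] IntI)
    qed
    show "(H m, G m) = (H n, G n)" if X: "X \<in> ?R" and mn: "zpos m \<in> X" "zpos n \<in> X" for X m n
    proof -
      obtain A B where AB: "A \<in> \<P>" "B \<in> \<Q>" "X = A \<inter> B" using X by (rule R)
      have "H m = H n" by (rule P(7)[OF AB(1)]) (use mn in \<open>simp_all add: AB(3)\<close>)
      moreover have "G m = G n" by (rule Q(7)[OF AB(2)]) (use mn in \<open>simp_all add: AB(3)\<close>)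
      ultimately show ?thesis by simp
    qed
  qed
qed

lemma zpos_add_cong:
  obtains k :: int where "k \<in> {-1, 0, 1}" "zpos (m + n) = zpos m + zpos n + of_int k"
proof -
  obtain a b c :: int where abc: "zpos m = - real m * gi + of_int a" "zpos n = - real n * gi + of_int b"
    "zpos (m + n) = - real (m + n) * gi + of_int c" using zpos_cong by metis
  have eq: "zpos (m + n) = zpos m + zpos n + of_int (c - a - b)"
    unfolding abc by (simp add: algebra_simps)
  then have "\<bar>real_of_int (c - a - b)\<bar> < 2"
    using zpos_bounds[of m] zpos_bounds[of n] zpos_bounds[of "m + n"] gi_sq gi_bounds by linarith
  then have "\<bar>c - a - b\<bar> < 2" by linarith
  then have "c - a - b \<in> {-1, 0, 1}" by auto
  then show ?thesis using eq that by blast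
qed

lemma zpos_add_eqI:
  assumes "zpos m + zpos n + of_int k \<in> zcirc"
  shows "zpos (m + n) = zpos m + zpos n + of_int k"
proof -
  obtain a b :: int where ab: "zpos m = - real m * gi + of_int a" "zpos n = - real n * gi + of_int b"
    using zpos_cong by metis
  show ?thesis using assms
    by (intro zpos_eqI[where k = "a + b + k"]) (auto simp: zcirc_def ab algebra_simps)
qed

text \<open>Translating the interval \<open>zcirc\<close> by \<open>zpos c\<close> requires a
  correction by -1, 0 or 1 to return to it, so a cell has at most three pieces as preimage; hence
  the factor 3.\<close>

lemma step_fun_shift:
  assumes "step_fun K H"
  shows "step_fun (3 * K) (\<lambda>n. H (n + c))"
proof -
  obtain \<P> where "cells K H \<P>"
    using assms(1) unfolding step_fun_def by blast
  note P = cellsD[OF this]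
  define T where "T P k = {x \<in> zcirc. x + zpos c + of_int k \<in> P}" for P and k :: int
  let ?R = "(\<lambda>(P, k). T P k) ` (\<P> \<times> {-1, 0, 1})"
  show ?thesis
  proof (rule step_funI[of ?R])
    have "card ?R \<le> card (\<P> \<times> {-1, 0, 1::int})" using P(1) by (intro card_image_le) auto
    also have "\<dots> \<le> 3 * K" using P(2) by (simp add: card_cartesian_product)
    finally show "card ?R \<le> 3 * K" .
    show "finite ?R" using P(1) by simp
    have R: thesis if X: "X \<in> ?R" and A: "\<And>A k. A \<in> \<P> \<Longrightarrow> X = T A k \<Longrightarrow> thesis" for X thesis
      using X by (elim imageE SigmaE) (auto intro: A)
    show "is_interval X" if XR: "X \<in> ?R" for X
    proof -
      obtain A k where X: "A \<in> \<P>" "X = T A k" using XR by (rule R)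
      have mid: "y \<in> A" if "a \<in> A" "b \<in> A" "a \<le> y" "y \<le> b" for a b y
        using P(3)[OF X(1)] that unfolding is_interval_1 by blast
      show ?thesis
        unfolding is_interval_1
      proof (intro ballI allI impI)
        fix a b x assume ab: "a \<in> X" "b \<in> X" and x: "a \<le> x \<and> x \<le> b"
        have "x + zpos c + of_int k \<in> A"
          by (rule mid[of "a + zpos c + of_int k" "b + zpos c + of_int k"])
            (use ab x in \<open>simp_all add: X(2) T_def\<close>)
        moreover have "x \<in> zcirc" using ab x unfolding X(2) T_def zcirc_def by simp
        ultimately show "x \<in> X" unfolding X(2) T_def by simp
      qed
    qed
    show "X \<subseteq> zcirc" if "X \<in> ?R" for X
      using that by (rule R) (simp add: T_def)
    show "X = Y" if XY: "X \<in> ?R" "Y \<in> ?R" and x: "x \<in> X" "x \<in> Y" for X Y x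
    proof -
      obtain A k where X: "A \<in> \<P>" "X = T A k" using XY(1) by (rule R)
      obtain B l where Y: "B \<in> \<P>" "Y = T B l" using XY(2) by (rule R)
      have in': "x + zpos c + of_int k \<in> A" "x + zpos c + of_int l \<in> B"
        using x unfolding X(2) Y(2) T_def by simp_all
      then have "x + zpos c + of_int k \<in> zcirc" "x + zpos c + of_int l \<in> zcirc"
        using P(4)[OF X(1)] P(4)[OF Y(1)] by blast+
      then have "\<bar>real_of_int (k - l)\<bar> < 1" using gi_sq unfolding zcirc_def by simp
      then have kl: "k = l" by linarith
      have "A = B" by (rule P(5)[OF X(1) Y(1) in'(1)]) (use in'(2) kl in simp)
      then show ?thesis unfolding X(2) Y(2) kl by simp
    qed
    show "\<exists>X\<in>?R. zpos n \<in> X" for n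
    proof -
      obtain k :: int where k: "k \<in> {-1, 0, 1}" "zpos (n + c) = zpos n + zpos c + of_int k"
        by (rule zpos_add_cong)
      obtain A where A: "A \<in> \<P>" "zpos (n + c) \<in> A" using P(6)[of "n + c"] by blast
      have "zpos n \<in> T A k" unfolding T_def using k A zpos_in_zcirc by simp
      moreover have "T A k \<in> ?R" using A(1) k(1) by (intro image_eqI[of _ _ "(A, k)"]) simp_all
      ultimately show ?thesis by (intro bexI[where x = "T A k"])
    qed
    show "H (m + c) = H (n + c)" if X: "X \<in> ?R" and mn: "zpos m \<in> X" "zpos n \<in> X" for X m n
    proof -
      obtain A k where A: "A \<in> \<P>" "X = T A k" using X by (rule R)
      have mem: "zpos (i + c) \<in> A" if "zpos i \<in> X" for i
      proof -
        have i: "zpos i + zpos c + of_int k \<in> A" using that unfolding A(2) T_def by simp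
        then have "zpos (i + c) = zpos i + zpos c + of_int k"
          using P(4)[OF A(1)] by (intro zpos_add_eqI) blast
        then show ?thesis using i by simp
      qed
      show ?thesis by (rule P(7)[OF A(1) mem[OF mn(1)] mem[OF mn(2)]])
    qed
  qed
qed

text \<open>The cells are the convex hulls of the positions sharing the same low digits. By
  \<open>low_digits_convex\<close> distinct labels have disjoint hulls, and a label is determined by
  its value, a number below \<open>fib L\<close>.\<close>

lemma step_fun_low_digits:
  assumes "2 \<le> L"
  shows "step_fun (fib L) (\<lambda>n. zset n \<inter> {..<L})"
proof -
  define lab where "lab n = zset n \<inter> {..<L}" for n
  define I where "I A = {x. \<exists>a b. lab a = A \<and> lab b = A \<and> zpos a \<le> x \<and> x \<le> zpos b}" for A
  have sub: "sum fib ` range lab \<subseteq> {..<fib L}"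
    using low_less[OF assms] unfolding lab_def low_def by auto
  have inj: "inj_on (sum fib) (range lab)"
  proof (rule inj_onI)
    fix A B assume "A \<in> range lab" "B \<in> range lab" "sum fib A = sum fib B"
    moreover have "zeck_set A" if "A \<in> range lab" for A
      using that zeck_set_subset[OF zset(1) Int_lower1] unfolding lab_def by auto
    ultimately show "A = B" using zeck_set_unique by blast
  qed
  have fin: "finite (range lab)" using inj sub by (meson finite_lessThan inj_on_finite)
  have "card (range lab) \<le> fib L" using card_inj_on_le[OF inj sub] by simp
  have labI: "lab n = A" if "zpos n \<in> I A" for n A
    using that low_digits_convex unfolding I_def lab_def by (smt (verit) mem_Collect_eq)
  have "step_fun (fib L) lab"
  proof (rule step_funI[of "I ` range lab"])
    show "finite (I ` range lab)" using fin by simp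
    show "card (I ` range lab) \<le> fib L"
      using card_image_le[OF fin, of I] \<open>card (range lab) \<le> fib L\<close> by linarith
    show "is_interval P" if P: "P \<in> I ` range lab" for P
    proof -
      obtain A where A: "P = I A" using P by auto
      show ?thesis unfolding A is_interval_1 I_def by (blast intro: order_trans)
    qed
    show "P \<subseteq> zcirc" if P: "P \<in> I ` range lab" for P
    proof -
      obtain A where A: "P = I A" using P by auto
      show ?thesis
      proof
        fix x assume "x \<in> P"
        then obtain a b where "zpos a \<le> x" "x \<le> zpos b" unfolding A I_def by auto
        then show "x \<in> zcirc" using zpos_bounds[of a] zpos_bounds[of b] by (simp add: zcirc_def)
      qed
    qed
    show "P = Q" if P: "P \<in> I ` range lab" "Q \<in> I ` range lab" "x \<in> P" "x \<in> Q" for P Q x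
    proof -
      obtain A B where AB: "P = I A" "Q = I B" using P by auto
      obtain a b where a: "lab a = A" "lab b = A" "zpos a \<le> x" "x \<le> zpos b" using P AB unfolding I_def by auto
      obtain c d where c: "lab c = B" "lab d = B" "zpos c \<le> x" "x \<le> zpos d" using P AB unfolding I_def by auto
      show ?thesis
      proof (cases "zpos a \<le> zpos c")
        case True
        then have "zpos c \<in> I A" using a c unfolding I_def by (auto intro: order_trans)
        then show ?thesis using labI[of c A] c AB by simp
      next
        case False
        then have "zpos a \<in> I B" using a c unfolding I_def by (intro CollectI exI[of _ c] exI[of _ d]) auto
        then show ?thesis using labI[of a B] a AB by simp
      qed
    qed
    show "\<exists>P\<in>I ` range lab. zpos n \<in> P" for n
      by (intro bexI[of _ "I (lab n)"]) (auto simp: I_def)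
    show "lab m = lab n" if "P \<in> I ` range lab" "zpos m \<in> P" "zpos n \<in> P" for P m n
      using that labI by auto
  qed
  then show ?thesis unfolding lab_def .
qed

text \<open>One more pair combines two shifts, so \<open>k\<close> cells become
  \<open>(3 * k) * (3 * k)\<close>. The factor 9 normalises this recursion to the squaring of
  \<open>9 * k\<close>.\<close>

lemma step_fun_box:
  assumes "step_fun K g"
  shows "\<exists>k. 9 * k \<le> (9 * K) ^ (2 ^ length vs) \<and> step_fun k (\<lambda>n. box g vs n)"
proof (induction vs)
  case Nil
  then show ?case using assms by (intro exI[of _ K]) auto
next
  case (Cons p vs)
  then obtain k where k: "9 * k \<le> (9 * K) ^ (2 ^ length vs)" "step_fun k (\<lambda>n. box g vs n)" by blast
  have "step_fun ((3 * k) * (3 * k)) (\<lambda>n. (box g vs (n + fst p), box g vs (n + snd p)))"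
    by (intro step_fun_pair step_fun_shift k)
  then have "step_fun ((3 * k) * (3 * k)) (\<lambda>n. (\<lambda>(x, y). x * cnj y) (box g vs (n + fst p), box g vs (n + snd p)))"
    by (rule step_fun_comp)
  then have "step_fun ((3 * k) * (3 * k)) (\<lambda>n. box g (p # vs) n)" by (cases p) simp
  moreover have "9 * ((3 * k) * (3 * k)) = (9 * k) * (9 * k)" by simp
  moreover have "\<dots> \<le> (9 * K) ^ (2 ^ length vs) * (9 * K) ^ (2 ^ length vs)" using k(1) by (intro mult_le_mono)
  moreover have "\<dots> = (9 * K) ^ (2 ^ length (p # vs))" by (simp only: list.size power_Suc mult_2 power_add plus_nat.add_0 add_Suc_right Nat.add_0_right)
  ultimately show ?case by (metis (no_types, lifting))
qed

section \<open>Discrepancy of arithmetic progressions on the circle\<close>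

lemma card_int_diameter:
  fixes A :: "int set"
  assumes "finite A" "\<And>x y. x \<in> A \<Longrightarrow> y \<in> A \<Longrightarrow> \<bar>real_of_int x - of_int y\<bar> \<le> v" "0 \<le> v"
  shows "real (card A) \<le> v + 1"
proof (cases "A = {}")
  case False
  have "A \<subseteq> {Min A..Min A + \<lfloor>v\<rfloor>}"
  proof
    fix x assume x: "x \<in> A"
    then have "real_of_int (x - Min A) \<le> v" using assms(2)[OF x Min_in[OF assms(1) False]] by simp
    then have "x - Min A \<le> \<lfloor>v\<rfloor>" by (simp only: le_floor_iff)
    then show "x \<in> {Min A..Min A + \<lfloor>v\<rfloor>}" using assms(1) x by auto
  qed
  then have "card A \<le> card {Min A..Min A + \<lfloor>v\<rfloor>}" by (intro card_mono) auto
  also have "\<dots> = nat (\<lfloor>v\<rfloor> + 1)" by simp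
  finally have "real (card A) \<le> real (nat (\<lfloor>v\<rfloor> + 1))" by (rule of_nat_mono)
  also have "\<dots> \<le> v + 1" using assms(3) by (simp add: of_nat_nat)
  finally show ?thesis .
qed (use assms in simp)

text \<open>Replacing \<alpha> by \<open>p / q\<close> moves each of the \<open>q\<close> points by
  at most \<open>1 / q\<close>. Scaled by \<open>q\<close>, the hits become integers that are
  distinct because \<open>p\<close> is invertible modulo \<open>q\<close>, and they lie within a
  range of length \<open>q * len + 2\<close>.\<close>

lemma rotation_count_le:
  fixes \<alpha> \<beta> len :: real and p :: int and q :: nat
  assumes q: "0 < q" and cop: "coprime p (int q)" and app: "\<bar>\<alpha> - of_int p / q\<bar> \<le> 1 / q ^ 2"
    and diam: "\<And>s t. s \<in> I \<Longrightarrow> t \<in> I \<Longrightarrow> \<bar>s - t\<bar> \<le> len" and "0 \<le> len"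
  shows "real (card {i\<in>{..<q}. \<exists>k::int. real i * \<alpha> + \<beta> + of_int k \<in> I}) \<le> q * len + 3"
proof -
  define S where "S = {i\<in>{..<q}. \<exists>k::int. real i * \<alpha> + \<beta> + of_int k \<in> I}"
  have "\<forall>i\<in>S. \<exists>k::int. real i * \<alpha> + \<beta> + of_int k \<in> I" unfolding S_def by blast
  then obtain k :: "nat \<Rightarrow> int" where k: "\<And>i. i \<in> S \<Longrightarrow> real i * \<alpha> + \<beta> + of_int (k i) \<in> I" by metis
  define X where "X i = int i * p + k i * int q" for i
  have fin: "finite S" unfolding S_def by simp
  have inj: "inj_on X S"
  proof (rule inj_onI)
    fix i j assume ij: "i \<in> S" "j \<in> S" "X i = X j"
    then have "(int i - int j) * p = (k j - k i) * int q" unfolding X_def by (simp add: algebra_simps)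
    then have "int q dvd (int i - int j) * p" by simp
    then have "int q dvd int i - int j" using cop by (simp add: coprime_dvd_mult_left_iff coprime_commute)
    moreover have "\<bar>int i - int j\<bar> < int q" using ij unfolding S_def by auto
    ultimately have "int i - int j = 0" by (meson dvd_imp_le_int not_less abs_of_nat abs_ge_zero order_less_le_trans zdvd_not_zless dvd_imp_le zero_less_abs_iff dvd_abs_iff)
    then show "i = j" by simp
  qed
  have cl: "\<bar>of_int (X i) / q - (real i * \<alpha> + of_int (k i))\<bar> \<le> 1 / q" if "i \<in> S" for i
  proof -
    have "of_int (X i) / q - (real i * \<alpha> + of_int (k i)) = real i * (of_int p / q - \<alpha>)"
      unfolding X_def using q by (simp add: field_simps)
    also have "\<bar>\<dots>\<bar> = real i * \<bar>\<alpha> - of_int p / q\<bar>" by (simp add: abs_mult abs_minus_commute)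
    also have "\<dots> \<le> real q * (1 / q ^ 2)" using app that unfolding S_def by (intro mult_mono) auto
    also have "\<dots> = 1 / q" using q by (simp add: power2_eq_square)
    finally show ?thesis .
  qed
  have d: "\<bar>real_of_int x - of_int y\<bar> \<le> q * len + 2" if xy: "x \<in> X ` S" "y \<in> X ` S" for x y
  proof -
    obtain i j where ij: "i \<in> S" "j \<in> S" "x = X i" "y = X j" using xy by auto
    have "\<bar>(real i * \<alpha> + \<beta> + of_int (k i)) - (real j * \<alpha> + \<beta> + of_int (k j))\<bar> \<le> len"
      using k ij by (intro diam) auto
    then have "\<bar>of_int x / real q - of_int y / real q\<bar> \<le> len + 2 / q"
      using cl[OF ij(1)] cl[OF ij(2)] unfolding ij(3,4) by simp
    then have "real q * \<bar>of_int x / real q - of_int y / real q\<bar> \<le> real q * (len + 2 / q)"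
      by (intro mult_left_mono) auto
    moreover have "real q * \<bar>of_int x / real q - of_int y / real q\<bar> = \<bar>of_int x - of_int y\<bar>"
    proof -
      have "real_of_int x - of_int y = real q * (of_int x / real q - of_int y / real q)"
        using q by (simp add: right_diff_distrib)
      then show ?thesis by (simp only: abs_mult abs_of_nat)
    qed
    moreover have "real q * (len + 2 / q) = q * len + 2" using q by (simp add: algebra_simps)
    ultimately show ?thesis by simp
  qed
  have "real (card (X ` S)) \<le> (q * len + 2) + 1"
    using d fin \<open>0 \<le> len\<close> by (intro card_int_diameter) auto
  then show ?thesis unfolding S_def[symmetric] card_image[OF inj] by simp
qed

definition ilen :: "real set \<Rightarrow> real" where
  "ilen I = (if I = {} then 0 else Sup I - Inf I)"

definition visits :: "nat \<Rightarrow> nat \<Rightarrow> nat \<Rightarrow> real set \<Rightarrow> nat" where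
  "visits n0 t M I = card {m\<in>{..<M}. zpos (n0 + m * t) \<in> I}"

definition rat_approx :: "nat \<Rightarrow> nat \<Rightarrow> bool" where
  "rat_approx t q \<longleftrightarrow> 0 < q \<and> (\<exists>p. coprime p (int q) \<and> \<bar>real t * gi - of_int p / q\<bar> \<le> 1 / q ^ 2)"

lemma visits_block_le:
  assumes "rat_approx t q" "\<And>s t. s \<in> I \<Longrightarrow> t \<in> I \<Longrightarrow> \<bar>s - t\<bar> \<le> len" "0 \<le> len"
  shows "real (visits n0 t q I) \<le> q * len + 3"
proof -
  obtain p where p: "0 < q" "coprime p (int q)" "\<bar>real t * gi - of_int p / q\<bar> \<le> 1 / q ^ 2"
    using assms(1) unfolding rat_approx_def by auto
  have "\<bar>(- real t * gi) - of_int (- p) / q\<bar> = \<bar>real t * gi - of_int p / q\<bar>" by simp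
  then have app: "\<bar>(- real t * gi) - of_int (- p) / q\<bar> \<le> 1 / q ^ 2" using p by simp
  have "{m\<in>{..<q}. zpos (n0 + m * t) \<in> I} \<subseteq>
      {i\<in>{..<q}. \<exists>k::int. real i * (- real t * gi) + (- real n0 * gi) + of_int k \<in> I}"
  proof
    fix m assume m: "m \<in> {m\<in>{..<q}. zpos (n0 + m * t) \<in> I}"
    obtain k :: int where "zpos (n0 + m * t) = - real (n0 + m * t) * gi + of_int k" using zpos_cong by blast
    then have "real m * (- real t * gi) + (- real n0 * gi) + of_int k = zpos (n0 + m * t)"
      by (simp add: algebra_simps)
    then have "real m * (- real t * gi) + (- real n0 * gi) + of_int k \<in> I" using m by simp
    then show "m \<in> {i\<in>{..<q}. \<exists>k::int. real i * (- real t * gi) + (- real n0 * gi) + of_int k \<in> I}"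
      using m by blast
  qed
  then have "visits n0 t q I \<le> card {i\<in>{..<q}. \<exists>k::int. real i * (- real t * gi) + (- real n0 * gi) + of_int k \<in> I}"
    unfolding visits_def by (intro card_mono) auto
  moreover have "real (card {i\<in>{..<q}. \<exists>k::int. real i * (- real t * gi) + (- real n0 * gi) + of_int k \<in> I}) \<le> q * len + 3"
    using p app assms(2,3) by (intro rotation_count_le[of q "- p"]) auto
  ultimately show ?thesis by linarith
qed

lemma interval_bounds:
  assumes "I \<subseteq> zcirc" "I \<noteq> {}"
  shows "- (gi * gi) \<le> Inf I" "Sup I \<le> gi" "Inf I \<le> Sup I" "\<And>x. x \<in> I \<Longrightarrow> Inf I \<le> x \<and> x \<le> Sup I"
proof -
  have W: "- (gi * gi) \<le> x" "x \<le> gi" if "x \<in> I" for x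
    using subsetD[OF assms(1) that] by (simp_all add: zcirc_def)
  have bd: "bdd_below I" "bdd_above I" by (rule bdd_belowI[OF W(1)], assumption) (rule bdd_aboveI[OF W(2)])
  show mem: "\<And>x. x \<in> I \<Longrightarrow> Inf I \<le> x \<and> x \<le> Sup I" using bd by (simp add: cInf_lower cSup_upper)
  show "- (gi * gi) \<le> Inf I" using assms(2) W(1) by (rule cInf_greatest)
  show "Sup I \<le> gi" using assms(2) W(2) by (rule cSup_least)
  show "Inf I \<le> Sup I" using assms(2) mem by (meson ex_in_conv order_trans)
qed

lemma ilen_bounds: "I \<subseteq> zcirc \<Longrightarrow> 0 \<le> ilen I \<and> ilen I \<le> 1"
proof (cases "I = {}")
  case False
  assume "I \<subseteq> zcirc"
  note b = interval_bounds(1-3)[OF this False]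
  have "ilen I = Sup I - Inf I" using False by (simp add: ilen_def)
  then show ?thesis using b gi_sq by linarith
qed (simp add: ilen_def)

text \<open>The lower bound is the upper bound for the two intervals left and right of
  \<open>I\<close>, whose lengths add up to \<open>1 - ilen I\<close>; each of them loses 3. No
  distinction between open and closed ends is needed as they overlap \<open>I\<close>
  harmlessly.\<close>

lemma visits_block:
  assumes ra: "rat_approx t q" and I: "is_interval I" "I \<subseteq> zcirc"
  shows "\<bar>real (visits n0 t q I) - q * ilen I\<bar> \<le> 6"
proof (cases "I = {}")
  case True
  then show ?thesis by (simp add: visits_def ilen_def)
next
  case False
  note b = interval_bounds[OF I(2) False]
  have up: "real (visits n0 t q I) \<le> q * (Sup I - Inf I) + 3"
  proof (rule visits_block_le[OF ra])
    show "\<bar>s - t\<bar> \<le> Sup I - Inf I" if "s \<in> I" "t \<in> I" for s t using b(4)[OF that(1)] b(4)[OF that(2)] by linarith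
  qed (use b in simp)
  let ?L = "{- (gi * gi)..Inf I}" and ?R = "{Sup I..gi}"
  have lo: "real (visits n0 t q ?L) \<le> q * (Inf I + gi * gi) + 3"
    using b by (intro visits_block_le[OF ra]) auto
  have hi: "real (visits n0 t q ?R) \<le> q * (gi - Sup I) + 3"
    using b by (intro visits_block_le[OF ra]) auto
  have "{..<q} \<subseteq> {m\<in>{..<q}. zpos (n0 + m * t) \<in> I} \<union> ({m\<in>{..<q}. zpos (n0 + m * t) \<in> ?L} \<union> {m\<in>{..<q}. zpos (n0 + m * t) \<in> ?R})"
  proof
    fix m assume m: "m \<in> {..<q}"
    define x where "x = zpos (n0 + m * t)"
    have "x \<in> I \<or> x \<in> ?L \<or> x \<in> ?R"
    proof (rule ccontr)
      assume c: "\<not> ?thesis"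
      then have "Inf I < x" "x < Sup I" using zpos_bounds[of "n0 + m * t"] unfolding x_def by auto
      then obtain a b where "a \<in> I" "a < x" "b \<in> I" "x < b"
        using False by (meson cInf_lessD less_cSupD)
      then have "x \<in> I" using I(1) unfolding is_interval_1 by (meson less_imp_le)
      then show False using c by simp
    qed
    then show "m \<in> {m\<in>{..<q}. zpos (n0 + m * t) \<in> I} \<union> ({m\<in>{..<q}. zpos (n0 + m * t) \<in> ?L} \<union> {m\<in>{..<q}. zpos (n0 + m * t) \<in> ?R})"
      using m unfolding x_def by auto
  qed
  then have "card {..<q} \<le> card ({m\<in>{..<q}. zpos (n0 + m * t) \<in> I} \<union> ({m\<in>{..<q}. zpos (n0 + m * t) \<in> ?L} \<union> {m\<in>{..<q}. zpos (n0 + m * t) \<in> ?R}))"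
    by (intro card_mono) auto
  also have "\<dots> \<le> visits n0 t q I + (visits n0 t q ?L + visits n0 t q ?R)"
    unfolding visits_def by (intro order_trans[OF card_Un_le] add_mono order_refl card_Un_le)
  finally have "real q \<le> real (visits n0 t q I) + (real (visits n0 t q ?L) + real (visits n0 t q ?R))"
    by (simp flip: of_nat_add)
  moreover have "q * (Inf I + gi * gi) + q * (gi - Sup I) = q - q * (Sup I - Inf I)"
    unfolding gi_sq by (simp add: algebra_simps)
  ultimately have "real q \<le> real (visits n0 t q I) + (q - q * (Sup I - Inf I) + 6)"
    using lo hi by linarith
  then show ?thesis using up False unfolding ilen_def by auto
qed

lemma visits_add: "visits n0 t (M + N) I = visits n0 t M I + visits (n0 + M * t) t N I"
proof (induction N)
  case 0
  then show ?case by (simp add: visits_def)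
next
  case (Suc N)
  have S: "visits n0 t (Suc M) I = visits n0 t M I + (if zpos (n0 + M * t) \<in> I then 1 else 0)" for n0 M
  proof -
    have "{m\<in>{..<Suc M}. zpos (n0 + m * t) \<in> I} =
        (if zpos (n0 + M * t) \<in> I then insert M {m\<in>{..<M}. zpos (n0 + m * t) \<in> I} else {m\<in>{..<M}. zpos (n0 + m * t) \<in> I})"
      by (auto simp: less_Suc_eq)
    then show ?thesis unfolding visits_def by simp
  qed
  show ?case using Suc S[of n0 "M + N"] S[of "n0 + M * t" N] by (simp add: algebra_simps)
qed

lemma visits_le: "visits n0 t M I \<le> M"
  unfolding visits_def using card_mono[of "{..<M}" "{m\<in>{..<M}. zpos (n0 + m * t) \<in> I}"] by auto

lemma visits_total:
  assumes ra: "rat_approx t q" and I: "is_interval I" "I \<subseteq> zcirc"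
  shows "\<bar>real (visits n0 t M I) - M * ilen I\<bar> \<le> 6 * real (M div q) + real (M mod q)"
proof -
  have blocks: "\<bar>real (visits n0 t (j * q) I) - real (j * q) * ilen I\<bar> \<le> 6 * real j" for j
  proof (induction j)
    case (Suc j)
    have "visits n0 t (Suc j * q) I = visits n0 t (j * q) I + visits (n0 + j * q * t) t q I"
      using visits_add[of n0 t "j * q" q I] by (simp add: add.commute)
    then have "real (visits n0 t (Suc j * q) I) - real (Suc j * q) * ilen I =
       (real (visits n0 t (j * q) I) - real (j * q) * ilen I) + (real (visits (n0 + j * q * t) t q I) - q * ilen I)"
      by (simp add: algebra_simps)
    also have "\<bar>\<dots>\<bar> \<le> \<bar>real (visits n0 t (j * q) I) - real (j * q) * ilen I\<bar> +
        \<bar>real (visits (n0 + j * q * t) t q I) - q * ilen I\<bar>" by (rule abs_triangle_ineq)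
    also have "\<dots> \<le> 6 * real j + 6" by (intro add_mono Suc visits_block[OF ra I])
    also have "\<dots> = 6 * real (Suc j)" by simp
    finally show ?case .
  qed (simp add: visits_def)
  define j r where "j = M div q" and "r = M mod q"
  have M: "M = j * q + r" unfolding j_def r_def by simp
  have "real (visits n0 t M I) - M * ilen I =
     (real (visits n0 t (j * q) I) - real (j * q) * ilen I) + (real (visits (n0 + j * q * t) t r I) - r * ilen I)"
    unfolding M visits_add by (simp add: algebra_simps)
  moreover have "\<bar>real (visits (n0 + j * q * t) t r I) - r * ilen I\<bar> \<le> r"
  proof -
    have "0 \<le> r * ilen I" "r * ilen I \<le> r"
      using ilen_bounds[OF I(2)] by (simp_all add: mult_left_le)
    moreover have "real (visits (n0 + j * q * t) t r I) \<le> r" using visits_le by simp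
    ultimately show ?thesis by (simp add: abs_if)
  qed
  ultimately show ?thesis using blocks[of j] unfolding j_def[symmetric] r_def[symmetric] by linarith
qed

lemma sum_step_fun:
  fixes H :: "nat \<Rightarrow> complex"
  assumes "finite \<P>" "\<And>P Q x. P \<in> \<P> \<Longrightarrow> Q \<in> \<P> \<Longrightarrow> x \<in> P \<Longrightarrow> x \<in> Q \<Longrightarrow> P = Q" "\<And>n. \<exists>P\<in>\<P>. zpos n \<in> P"
    "\<And>P n. P \<in> \<P> \<Longrightarrow> zpos n \<in> P \<Longrightarrow> H n = h P"
  shows "(\<Sum>m<M. H (n0 + m * t)) = (\<Sum>P\<in>\<P>. of_nat (visits n0 t M P) * h P)"
proof -
  have one: "H n = (\<Sum>P\<in>\<P>. if zpos n \<in> P then h P else 0)" for n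
  proof -
    obtain Q where Q: "Q \<in> \<P>" "zpos n \<in> Q" using assms(3) by blast
    have "(\<Sum>P\<in>\<P>. if zpos n \<in> P then h P else 0) = (\<Sum>P\<in>\<P>. if P = Q then h P else 0)"
      by (rule sum.cong[OF refl]) (use assms(2) Q in metis)
    also have "\<dots> = h Q" using Q(1) assms(1) by simp
    finally show ?thesis using assms(4) Q by simp
  qed
  have "(\<Sum>m<M. H (n0 + m * t)) = (\<Sum>P\<in>\<P>. \<Sum>m<M. if zpos (n0 + m * t) \<in> P then h P else 0)"
    unfolding one by (rule sum.swap)
  also have "\<dots> = (\<Sum>P\<in>\<P>. of_nat (visits n0 t M P) * h P)"
    unfolding visits_def by (intro sum.cong[OF refl]) (simp add: sum.If_cases Int_def)
  finally show ?thesis .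
qed

text \<open>Quotients of consecutive Fibonacci numbers are the convergents of \<open>gi\<close>.
  Hence the integers below \<open>fib Y\<close> are equidistributed on the circle and can serve as
  the model of a uniform variable.\<close>

lemma rat_approx_fib:
  assumes "0 < Y"
  shows "rat_approx 1 (fib Y)"
proof -
  obtain j where j: "Y = Suc j" using assms by (cases Y) auto
  have F: "0 < fib Y" using assms by (rule fib_neq_0_nat)
  have "real (fib Y) * gi - real (fib j) = - ((- gi) ^ Y)" unfolding j using neg_gi_power_Suc[of j] by simp
  then have "\<bar>real (fib Y) * gi - real (fib j)\<bar> = gi ^ Y" using gi_pos by (simp add: power_abs)
  moreover have "gi ^ Y \<le> 1 / real (fib Y)"
    using fib_le_gr_power[of Y] F unfolding gi_power by (intro divide_left_mono) auto
  ultimately have "\<bar>real (fib Y) * gi - real (fib j)\<bar> \<le> 1 / real (fib Y)" by simp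
  moreover have "real 1 * gi - of_int (int (fib j)) / real (fib Y) = (real (fib Y) * gi - real (fib j)) / real (fib Y)"
    using F by (simp add: field_simps)
  ultimately have "\<bar>real 1 * gi - of_int (int (fib j)) / real (fib Y)\<bar> \<le> 1 / real (fib Y) ^ 2"
    using F by (simp add: abs_divide power2_eq_square divide_le_eq)
  moreover have "coprime (int (fib j)) (int (fib Y))" unfolding j using coprime_fib_Suc_nat[of j] by simp
  ultimately show ?thesis unfolding rat_approx_def using F by blast
qed

text \<open>Both averages are compared with the integral of the step function, the sum of cell
  length times value. The terms \<open>6 / q + q / M\<close> come from the complete blocks and the
  incomplete block of length \<open>q\<close>, and \<open>6 / fib Y\<close> from the model
  average.\<close>

lemma step_fun_equidistribution:
  fixes H :: "nat \<Rightarrow> complex"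
  assumes "step_fun K H" and H: "\<And>n. norm (H n) \<le> 1" and ra: "rat_approx t q" and "0 < M" "0 < Y"
  shows "norm ((\<Sum>m<M. H (n0 + m * t)) / M - (\<Sum>v<fib Y. H v) / fib Y)
    \<le> K * (6 / q + q / M + 6 / fib Y)"
proof -
  obtain \<P> where "cells K H \<P>"
    using assms(1) unfolding step_fun_def by blast
  note P = cellsD[OF this]
  define h where "h P = (if \<exists>n. zpos n \<in> P then H (SOME n. zpos n \<in> P) else 0)" for P
  have h: "H n = h P" if "P \<in> \<P>" "zpos n \<in> P" for P n
  proof -
    have "zpos (SOME n. zpos n \<in> P) \<in> P" using that(2) by (rule someI)
    then have "H n = H (SOME n. zpos n \<in> P)" by (rule P(7)[OF that])
    moreover have "\<exists>n. zpos n \<in> P" using that(2) by blast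
    then have "h P = H (SOME n. zpos n \<in> P)" unfolding h_def by (rule if_P)
    ultimately show ?thesis by (rule trans[OF _ sym])
  qed
  have h1: "norm (h P) \<le> 1" for P unfolding h_def using H by simp
  have q: "0 < q" using ra unfolding rat_approx_def by simp
  have F: "0 < fib Y" using \<open>0 < Y\<close> by (rule fib_neq_0_nat)
  have v1: "\<bar>real (visits n0 t M P) / M - ilen P\<bar> \<le> 6 / q + q / M" if "P \<in> \<P>" for P
  proof -
    have "\<bar>real (visits n0 t M P) - M * ilen P\<bar> \<le> 6 * real (M div q) + real (M mod q)"
      using that by (intro visits_total[OF ra] P)
    also have "\<dots> \<le> 6 * (real M / q) + q"
      using q by (intro add_mono mult_left_mono) (auto simp: of_nat_div_le_of_nat less_imp_le)
    finally have "\<bar>real (visits n0 t M P) - M * ilen P\<bar> / M \<le> (6 * (real M / q) + q) / M"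
      by (intro divide_right_mono) auto
    moreover have "\<bar>real (visits n0 t M P) - M * ilen P\<bar> / M = \<bar>real (visits n0 t M P) / M - ilen P\<bar>"
    proof -
      have "real (visits n0 t M P) / M - ilen P = (real (visits n0 t M P) - M * ilen P) / M"
        using \<open>0 < M\<close> by (simp add: field_simps)
      then show ?thesis by (simp add: abs_divide)
    qed
    ultimately show ?thesis using \<open>0 < M\<close> by (simp add: add_divide_distrib)
  qed
  have v2: "\<bar>real (visits 0 1 (fib Y) P) / fib Y - ilen P\<bar> \<le> 6 / fib Y" if "P \<in> \<P>" for P
  proof -
    have "\<bar>real (visits 0 1 (fib Y) P) - fib Y * ilen P\<bar> \<le> 6"
      using that visits_block[OF rat_approx_fib[OF \<open>0 < Y\<close>] P(3) P(4)] by blast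
    then have "\<bar>real (visits 0 1 (fib Y) P) - fib Y * ilen P\<bar> / fib Y \<le> 6 / fib Y"
      by (intro divide_right_mono) auto
    moreover have "real (visits 0 1 (fib Y) P) / fib Y - ilen P = (real (visits 0 1 (fib Y) P) - fib Y * ilen P) / fib Y"
      using F by (simp add: field_simps)
    ultimately show ?thesis by (simp add: abs_divide)
  qed
  have s1: "(\<Sum>m<M. H (n0 + m * t)) = (\<Sum>P\<in>\<P>. of_nat (visits n0 t M P) * h P)"
    by (rule sum_step_fun[OF P(1) P(5) P(6) h])
  have s2: "(\<Sum>v<fib Y. H v) = (\<Sum>P\<in>\<P>. of_nat (visits 0 1 (fib Y) P) * h P)"
  proof -
    have "(\<Sum>v<fib Y. H (0 + v * 1)) = (\<Sum>P\<in>\<P>. of_nat (visits 0 1 (fib Y) P) * h P)"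
      by (rule sum_step_fun[OF P(1) P(5) P(6) h])
    then show ?thesis by simp
  qed
  have "(\<Sum>m<M. H (n0 + m * t)) / M - (\<Sum>v<fib Y. H v) / fib Y =
      (\<Sum>P\<in>\<P>. of_real (real (visits n0 t M P) / M - real (visits 0 1 (fib Y) P) / fib Y) * h P)"
    unfolding s1 s2 sum_divide_distrib sum_subtractf[symmetric]
    by (intro sum.cong[OF refl]) (simp add: left_diff_distrib)
  also have "norm \<dots> \<le> (\<Sum>P\<in>\<P>. 6 / q + q / M + 6 / fib Y)"
  proof (rule sum_norm_le)
    fix P assume "P \<in> \<P>"
    have "\<bar>real (visits n0 t M P) / M - real (visits 0 1 (fib Y) P) / fib Y\<bar> \<le> 6 / q + q / M + 6 / fib Y"
      using v1[OF \<open>P \<in> \<P>\<close>] v2[OF \<open>P \<in> \<P>\<close>] by linarith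
    moreover have "norm (of_real (real (visits n0 t M P) / M - real (visits 0 1 (fib Y) P) / fib Y) * h P) \<le>
       \<bar>real (visits n0 t M P) / M - real (visits 0 1 (fib Y) P) / fib Y\<bar>"
      unfolding norm_mult norm_of_real by (simp add: mult_left_le h1)
    ultimately show "norm (of_real (real (visits n0 t M P) / M - real (visits 0 1 (fib Y) P) / fib Y) * h P) \<le> 6 / q + q / M + 6 / fib Y"
      by (rule order_trans[rotated])
  qed
  also have "\<dots> = card \<P> * (6 / q + q / M + 6 / fib Y)" by simp
  also have "\<dots> \<le> K * (6 / q + q / M + 6 / fib Y)" using P(2) by (intro mult_right_mono) auto
  finally show ?thesis .
qed

section \<open>Box averages of the truncated sum of digits\<close>

text \<open>The maps \<sigma> and \<tau> overwrite block \<open>b\<close> by two fixed patterns, and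
  \<open>G\<close> differs by the factor \<open>w\<close> between the results. Pairing the
  configurations that show either pattern in the last block replaces the trivial factor 2 by
  \<open>norm (1 + w)\<close> on a part of \<Omega> of proportion at least \<open>1 / A\<close> per
  pattern, because overwriting is at most \<open>A\<close>-to-one. Repeating this over
  \<open>B\<close> blocks gives the power.\<close>

lemma block_induction:
  fixes G :: "'c \<Rightarrow> complex" and proj :: "nat \<Rightarrow> 'c \<Rightarrow> 'd"
  assumes "finite \<Omega>" and G: "\<And>c. c \<in> \<Omega> \<Longrightarrow> norm (G c) \<le> 1"
    and cl: "\<And>b c. b < B \<Longrightarrow> c \<in> \<Omega> \<Longrightarrow> \<sigma> b c \<in> \<Omega> \<and> \<tau> b c \<in> \<Omega>"
    and other: "\<And>b b' c. b < B \<Longrightarrow> b' < B \<Longrightarrow> b \<noteq> b' \<Longrightarrow> c \<in> \<Omega> \<Longrightarrow>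
        proj b' (\<sigma> b c) = proj b' c \<and> proj b' (\<tau> b c) = proj b' c"
    and same: "\<And>b c. b < B \<Longrightarrow> c \<in> \<Omega> \<Longrightarrow> proj b (\<sigma> b c) = \<beta> b \<and> proj b (\<tau> b c) = \<gamma> b"
    and ne: "\<And>b. b < B \<Longrightarrow> \<beta> b \<noteq> \<gamma> b"
    and fix0: "\<And>b c. b < B \<Longrightarrow> c \<in> \<Omega> \<Longrightarrow> proj b c = \<beta> b \<Longrightarrow> \<sigma> b c = c"
    and fix1: "\<And>b c. b < B \<Longrightarrow> c \<in> \<Omega> \<Longrightarrow> proj b c = \<gamma> b \<Longrightarrow> \<tau> b c = c"
    and comp: "\<And>b c. b < B \<Longrightarrow> c \<in> \<Omega> \<Longrightarrow> \<tau> b (\<sigma> b c) = \<tau> b c \<and> \<sigma> b (\<tau> b c) = \<sigma> b c"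
    and flip: "\<And>b c. b < B \<Longrightarrow> c \<in> \<Omega> \<Longrightarrow> G (\<tau> b c) = w * G (\<sigma> b c)"
    and fibre: "\<And>b c'. b < B \<Longrightarrow> c' \<in> \<Omega> \<Longrightarrow> card {c\<in>\<Omega>. \<sigma> b c = c'} \<le> A"
    and w: "norm (1 + w) \<le> 2" and A: "2 \<le> A"
  shows "norm (\<Sum>c\<in>\<Omega>. G c) \<le> (1 - (2 - norm (1 + w)) / A) ^ B * card \<Omega>"
  using assms(1-11)
proof (induction B arbitrary: \<Omega>)
  case 0
  have "norm (\<Sum>c\<in>\<Omega>. G c) \<le> (\<Sum>c\<in>\<Omega>. 1)" using 0 by (intro sum_norm_le) auto
  then show ?case by simp
next
  case (Suc B)
  define \<rho> where "\<rho> = 1 - (2 - norm (1 + w)) / A"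
  have A0: "0 < real A" using A by simp
  have "(2 - norm (1 + w)) / A \<le> 2 / 2" using A w by (intro frac_le) auto
  then have \<rho>0: "0 \<le> \<rho>" by (simp add: \<rho>_def)
  note fin = Suc.prems(1) and G = Suc.prems(2) and cl = Suc.prems(3) and other = Suc.prems(4)
    and same = Suc.prems(5) and ne = Suc.prems(6) and fix0 = Suc.prems(7) and fix1 = Suc.prems(8)
    and comp = Suc.prems(9) and flip = Suc.prems(10) and fibre = Suc.prems(11)
  \<comment> \<open>Overwriting smaller blocks does not affect block \<open>B\<close>, so any part
    of \<Omega> cut out by a condition on block \<open>B\<close> is again an admissible
    configuration space.\<close>
  have IH: "norm (\<Sum>c\<in>{c\<in>\<Omega>. R (proj B c)}. G c) \<le> \<rho> ^ B * card {c\<in>\<Omega>. R (proj B c)}" for R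
    unfolding \<rho>_def
  proof (rule Suc.IH)
    fix b c assume b: "b < B" and c: "c \<in> {c\<in>\<Omega>. R (proj B c)}"
    then have b': "b < Suc B" "B < Suc B" "b \<noteq> B" and c': "c \<in> \<Omega>" "R (proj B c)" by auto
    show "\<sigma> b c \<in> {c\<in>\<Omega>. R (proj B c)} \<and> \<tau> b c \<in> {c\<in>\<Omega>. R (proj B c)}"
      using cl[OF b'(1) c'(1)] other[OF b' c'(1)] c' by simp
    have "card {c\<in>{c\<in>\<Omega>. R (proj B c)}. \<sigma> b c = c''} \<le> card {c\<in>\<Omega>. \<sigma> b c = c''}" for c''
      using fin by (intro card_mono) auto
    then show "card {c'\<in>{c\<in>\<Omega>. R (proj B c)}. \<sigma> b c' = c} \<le> A"
      using fibre[OF b'(1) c'(1)] order_trans by (meson order_trans)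
    show "proj b (\<sigma> b c) = \<beta> b \<and> proj b (\<tau> b c) = \<gamma> b" using same[OF b'(1) c'(1)] .
    show "proj b c = \<beta> b \<Longrightarrow> \<sigma> b c = c" by (rule fix0[OF b'(1) c'(1)])
    show "proj b c = \<gamma> b \<Longrightarrow> \<tau> b c = c" by (rule fix1[OF b'(1) c'(1)])
    show "\<tau> b (\<sigma> b c) = \<tau> b c \<and> \<sigma> b (\<tau> b c) = \<sigma> b c" using comp[OF b'(1) c'(1)] .
    show "G (\<tau> b c) = w * G (\<sigma> b c)" using flip[OF b'(1) c'(1)] .
  next
    fix b b' c assume "b < B" "b' < B" "b \<noteq> b'" "c \<in> {c\<in>\<Omega>. R (proj B c)}"
    then show "proj b' (\<sigma> b c) = proj b' c \<and> proj b' (\<tau> b c) = proj b' c" by (intro other) auto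
  next
    fix b assume "b < B"
    then show "\<beta> b \<noteq> \<gamma> b" by (intro ne) simp
  qed (use fin G in auto)
  define \<Omega>0 \<Omega>1 \<Omega>2 where "\<Omega>0 = {c\<in>\<Omega>. proj B c = \<beta> B}" and "\<Omega>1 = {c\<in>\<Omega>. proj B c = \<gamma> B}"
    and "\<Omega>2 = {c\<in>\<Omega>. proj B c \<noteq> \<beta> B \<and> proj B c \<noteq> \<gamma> B}"
  have BB: "B < Suc B" by simp
  have fins: "finite \<Omega>0" "finite \<Omega>1" "finite \<Omega>2" using fin unfolding \<Omega>0_def \<Omega>1_def \<Omega>2_def by auto
  have dis: "\<Omega>0 \<inter> \<Omega>1 = {}" "(\<Omega>0 \<union> \<Omega>1) \<inter> \<Omega>2 = {}"
    using ne[OF BB] unfolding \<Omega>0_def \<Omega>1_def \<Omega>2_def by auto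
  have un: "\<Omega> = (\<Omega>0 \<union> \<Omega>1) \<union> \<Omega>2" unfolding \<Omega>0_def \<Omega>1_def \<Omega>2_def by auto
  have bij: "bij_betw (\<tau> B) \<Omega>0 \<Omega>1"
  proof (rule bij_betwI[where g = "\<sigma> B"])
    show "\<tau> B \<in> \<Omega>0 \<rightarrow> \<Omega>1" "\<sigma> B \<in> \<Omega>1 \<rightarrow> \<Omega>0"
      using cl[OF BB] same[OF BB] unfolding \<Omega>0_def \<Omega>1_def by auto
    show "\<sigma> B (\<tau> B c) = c" if "c \<in> \<Omega>0" for c
      using that comp[OF BB, of c] fix0[OF BB, of c] unfolding \<Omega>0_def by simp
    show "\<tau> B (\<sigma> B c) = c" if "c \<in> \<Omega>1" for c
      using that comp[OF BB, of c] fix1[OF BB, of c] unfolding \<Omega>1_def by simp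
  qed
  have "(\<Sum>c\<in>\<Omega>1. G c) = (\<Sum>c\<in>\<Omega>0. G (\<tau> B c))" by (rule sum.reindex_bij_betw[OF bij, symmetric])
  also have "\<dots> = (\<Sum>c\<in>\<Omega>0. w * G c)"
    by (rule sum.cong[OF refl]) (use flip[OF BB] fix0[OF BB] in \<open>simp add: \<Omega>0_def\<close>)
  finally have s01: "(\<Sum>c\<in>\<Omega>0. G c) + (\<Sum>c\<in>\<Omega>1. G c) = (1 + w) * (\<Sum>c\<in>\<Omega>0. G c)"
    by (simp add: sum_distrib_left distrib_right sum.distrib)
  have card1: "card \<Omega>1 = card \<Omega>0" using bij_betw_same_card[OF bij] by simp
  have cardun: "card \<Omega> = card \<Omega>0 + card \<Omega>0 + card \<Omega>2"
    unfolding un using fins dis by (simp add: card_Un_disjoint card1)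
  have "card \<Omega> \<le> A * card \<Omega>0"
  proof -
    have "\<Omega> = (\<Union>c'\<in>\<Omega>0. {c\<in>\<Omega>. \<sigma> B c = c'})"
      using cl[OF BB] same[OF BB] unfolding \<Omega>0_def by auto
    then have "card \<Omega> = card (\<Union>c'\<in>\<Omega>0. {c\<in>\<Omega>. \<sigma> B c = c'})" by simp
    also have "\<dots> \<le> (\<Sum>c'\<in>\<Omega>0. card {c\<in>\<Omega>. \<sigma> B c = c'})" by (rule card_UN_le[OF fins(1)])
    also have "\<dots> \<le> (\<Sum>c'\<in>\<Omega>0. A)" using fibre[OF BB] by (intro sum_mono) (simp add: \<Omega>0_def)
    finally show ?thesis by (simp add: mult.commute)
  qed
  then have "real (card \<Omega>) \<le> A * real (card \<Omega>0)" by (metis of_nat_le_iff of_nat_mult)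
  then have "real (card \<Omega>) / A \<le> real (card \<Omega>0)" using A0 by (simp add: divide_le_eq mult.commute)
  then have big: "(2 - norm (1 + w)) * (real (card \<Omega>) / A) \<le> (2 - norm (1 + w)) * real (card \<Omega>0)"
    using w by (intro mult_left_mono) auto
  have "(\<Sum>c\<in>\<Omega>. G c) = ((\<Sum>c\<in>\<Omega>0. G c) + (\<Sum>c\<in>\<Omega>1. G c)) + (\<Sum>c\<in>\<Omega>2. G c)"
    unfolding un using fins dis by (simp add: sum.union_disjoint)
  also have "norm \<dots> \<le> norm (1 + w) * norm (\<Sum>c\<in>\<Omega>0. G c) + norm (\<Sum>c\<in>\<Omega>2. G c)"
    unfolding s01 by (metis norm_mult norm_triangle_ineq)
  also have "\<dots> \<le> norm (1 + w) * (\<rho> ^ B * card \<Omega>0) + \<rho> ^ B * card \<Omega>2"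
    using IH[of "\<lambda>x. x = \<beta> B"] IH[of "\<lambda>x. x \<noteq> \<beta> B \<and> x \<noteq> \<gamma> B"] unfolding \<Omega>0_def \<Omega>2_def
    by (intro add_mono mult_left_mono) auto
  also have "\<dots> = \<rho> ^ B * (real (card \<Omega>) - (2 - norm (1 + w)) * real (card \<Omega>0))"
    unfolding cardun by (simp add: algebra_simps)
  also have "\<dots> \<le> \<rho> ^ B * (real (card \<Omega>) - (2 - norm (1 + w)) * (real (card \<Omega>) / A))"
    using big \<rho>0 by (intro mult_left_mono) auto
  also have "real (card \<Omega>) - (2 - norm (1 + w)) * (real (card \<Omega>) / A) = \<rho> * card \<Omega>"
    by (simp add: \<rho>_def left_diff_distrib)
  also have "\<rho> ^ B * (\<rho> * card \<Omega>) = \<rho> ^ Suc B * card \<Omega>" by simp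
  finally show ?case unfolding \<rho>_def .
qed

text \<open>A digit below \<open>m\<close> would make the position larger than \<open>gi ^ m\<close>
  by \<open>abs_conj_sum_greater\<close>. From \<open>3 \<le> m\<close> one gets
  \<open>gi ^ m < gi * gi\<close>, so the small residue of \<open>- g * gi\<close> already lies in
  the interval of representatives and equals \<open>zpos g\<close>.\<close>

lemma near_imp_zset_subset:
  assumes "near t (int g)" "t \<le> gi ^ m" "3 \<le> m"
  shows "zset g \<subseteq> {m..}"
proof (rule ccontr)
  assume "\<not> zset g \<subseteq> {m..}"
  then obtain x where x: "x \<in> zset g" "x < m" by (meson atLeast_iff not_le subsetI)
  define j where "j = Min (zset g)"
  have j: "j \<in> zset g" "zset g \<subseteq> {j..}"
    unfolding j_def using Min_in[OF zset_props(1), of g] Min_le[OF zset_props(1), of _ g] x(1) by fastforce+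
  have "j \<le> x" using x j by auto
  then have "Suc j \<le> m" using x by simp
  then have "gi ^ m \<le> gi ^ Suc j" using gi_pos gi_less_1 by (intro power_decreasing) auto
  also have "\<dots> < \<bar>zpos g\<bar>" unfolding zpos_def using j zset_props by (intro abs_conj_sum_greater)
  finally have big: "gi ^ m < \<bar>zpos g\<bar>" .
  obtain k :: int where k: "\<bar>real g * gi - of_int k\<bar> \<le> t" using assms(1) unfolding near_def by auto
  have "gi ^ m \<le> gi ^ 3" using assms(3) gi_pos gi_less_1 by (intro power_decreasing) auto
  also have "gi ^ 3 < gi * gi" using gi_pos gi_less_1 by (simp add: power3_eq_cube)
  finally have small: "gi ^ m < gi * gi" .
  moreover have "gi * gi < gi" using gi_pos gi_less_1 by simp
  ultimately have "zpos g = - real g * gi + of_int k"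
    using k assms(2) by (intro zpos_eqI[OF refl]) linarith+
  then have "\<bar>zpos g\<bar> \<le> t" using k by (simp add: abs_minus_commute)
  then show False using big assms(2) by linarith
qed

section \<open>The effect of adding one Fibonacci number\<close>

definition zexp :: "real \<Rightarrow> nat set \<Rightarrow> nat \<Rightarrow> complex" where
  "zexp \<theta> A n = e2pi (\<theta> * real (card (zset n \<inter> A)))"

lemma norm_e2pi [simp]: "norm (e2pi x) = 1"
  by (simp add: e2pi_def)

lemma e2pi_add: "e2pi (x + y) = e2pi x * e2pi y"
  by (simp add: e2pi_def distrib_left exp_add)

lemma norm_zexp [simp]: "norm (zexp \<theta> A n) = 1"
  by (simp add: zexp_def)

lemma fib_pred:
  assumes "2 \<le> i"
  shows "fib (i - 1) + fib (i - 2) = fib i"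
proof -
  obtain j where "i = 2 + j" using le_Suc_ex[OF assms] by auto
  then show ?thesis by simp
qed

lemma zset_fib: "2 \<le> i \<Longrightarrow> zset (fib i) = {i}"
  by (rule zset_eqI) (auto simp: zeck_set_def)

text \<open>If \<open>l < fib (i - 1)\<close>, the digit \<open>i\<close> is simply inserted.
  Otherwise \<open>l\<close> has the digit \<open>i - 1\<close>, which merges with \<open>i\<close>
  into \<open>i + 1\<close> and leaves the number of digits unchanged. The part \<open>g\<close> has
  digits only from \<open>i + 3\<close> on and takes no part in either case.\<close>

lemma zexp_add_fib:
  assumes g: "near t (int g)" "t \<le> gi ^ (i + 3)" and i: "4 \<le> i" "i + 2 \<le> \<mu>" and l: "l < fib i"
  shows "zexp \<theta> {..<\<mu>} (l + g + fib i) = (if l < fib (i - 1) then e2pi \<theta> else 1) * zexp \<theta> {..<\<mu>} (l + g)"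
proof -
  have zg: "zset g \<subseteq> {i + 3..}" using g i by (intro near_imp_zset_subset) auto
  have val: "zexp \<theta> {..<\<mu>} (u + g) = e2pi (\<theta> * real (card (zset u))) * e2pi (\<theta> * real (card (zset g \<inter> {..<\<mu>})))"
    if u: "zset u \<subseteq> {..<i + 2}" for u
  proof -
    have z: "zset (u + g) = zset u \<union> zset g" using u zg by (intro zset_add[of _ "i + 2"]) auto
    have "zset (u + g) \<inter> {..<\<mu>} = zset u \<union> (zset g \<inter> {..<\<mu>})" unfolding z using u i by auto
    moreover have "zset u \<inter> (zset g \<inter> {..<\<mu>}) = {}" using u zg by fastforce
    ultimately have "card (zset (u + g) \<inter> {..<\<mu>}) = card (zset u) + card (zset g \<inter> {..<\<mu>})"
      using zset_props by (simp add: card_Un_disjoint)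
    then show ?thesis unfolding zexp_def by (simp add: distrib_left e2pi_add)
  qed
  have sum: "fib (i - 1) + fib i = fib (i + 1)" "fib (i - 2) + fib (i - 1) = fib i" "fib i + fib (i + 1) = fib (i + 2)"
  proof -
    obtain j where "i = 2 + j" using le_Suc_ex[of 2 i] i by auto
    then show "fib (i - 1) + fib i = fib (i + 1)" "fib (i - 2) + fib (i - 1) = fib i" "fib i + fib (i + 1) = fib (i + 2)"
      by simp_all
  qed
  have zl: "zset l \<subseteq> {..<i}" using l by (rule zset_less)
  have ladd: "l + g + fib i = (l + fib i) + g" by simp
  show ?thesis
  proof (cases "l < fib (i - 1)")
    case True
    then have "zset l \<subseteq> {..<i - 1}" by (rule zset_less)
    then have z: "zset (l + fib i) = zset l \<union> {i}"
      using zset_add[of l "i - 1" "fib i"] zset_fib[of i] i by auto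
    moreover have "i \<notin> zset l" using zl by auto
    ultimately have "card (zset (l + fib i)) = Suc (card (zset l))" using zset_props(1)[of l] by simp
    moreover have "zset (l + fib i) \<subseteq> {..<i + 2}" unfolding z using zl by auto
    moreover have "zset l \<subseteq> {..<i + 2}" using zl by auto
    ultimately show ?thesis using True unfolding ladd by (simp add: val distrib_left e2pi_add mult_ac)
  next
    case False
    define u where "u = l - fib (i - 1)"
    have lu: "l = u + fib (i - 1)" "u < fib (i - 2)" using False l sum unfolding u_def by linarith+
    have zu: "zset u \<subseteq> {..<i - 2}" using lu(2) by (rule zset_less)
    have z1: "zset l = zset u \<union> {i - 1}"
      using zset_add[of u "i - 2" "fib (i - 1)"] zset_fib[of "i - 1"] zu i lu(1) by auto
    have "l + fib i = u + fib (i + 1)" using lu(1) sum by simp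
    then have z2: "zset (l + fib i) = zset u \<union> {i + 1}"
      using zset_add[of u "i - 2" "fib (i + 1)"] zset_fib[of "i + 1"] zu i by auto
    have "i - 1 \<notin> zset u" "i + 1 \<notin> zset u" using zu by auto
    then have "card (zset (l + fib i)) = card (zset l)" using zset_props(1)[of u] z1 z2 by simp
    moreover have "zset (l + fib i) \<subseteq> {..<i + 2}" unfolding z2 using zu by auto
    moreover have "zset l \<subseteq> {..<i + 2}" using zl by auto
    ultimately show ?thesis using False unfolding ladd by (simp add: val)
  qed
qed

text \<open>A shift whose prescribed block has value \<open>p\<close>; \<open>e\<close> collects the
  digits below the block and \<open>g\<close> those above it, which are invisible to the size and to
  the rotation respectively.\<close>

definition pert :: "nat \<Rightarrow> real \<Rightarrow> nat \<Rightarrow> nat \<Rightarrow> bool" where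
  "pert F t p a \<longleftrightarrow> (\<exists>e g. a = p + e + g \<and> e < F \<and> near t (int g))"

definition pert_pair :: "nat \<Rightarrow> real \<Rightarrow> nat \<Rightarrow> nat \<times> nat \<Rightarrow> bool" where
  "pert_pair F t p ab \<longleftrightarrow> pert F t p (fst ab) \<and> pert F t 0 (snd ab)"

text \<open>Adding \<open>fib i\<close> multiplies the function by \<open>e(\<theta>)\<close> at every vertex whose low part stays below
  \<open>fib (i - 1)\<close>, and leaves it unchanged at the single vertex where the low part crosses \<open>fib (i - 1)\<close>.\<close>

lemma box_ratio_generic:
  fixes r :: "nat \<Rightarrow> complex"
  assumes r: "\<And>l g. near T (int g) \<Longrightarrow> l < X \<Longrightarrow> r (l + g) = w" and w: "w * cnj w = 1"
    and "list_all2 (pert_pair F t) ps vs" "near s (int g)" "s + real (length vs) * t \<le> T" "0 \<le> t"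
    and "l + sum_list ps + length vs * F < X"
  shows "box r vs (l + g) = (if vs = [] then w else 1)"
  using assms(3-7)
proof (induction arbitrary: l g s rule: list_all2_induct)
  case Nil
  have "near T (int g)" using Nil.prems by (intro near_mono[OF Nil.prems(1)]) simp
  then show ?case using r[of g l] Nil.prems by simp
next
  case (Cons p ps v vs)
  obtain a b where v: "v = (a, b)" by (cases v)
  have st: "s + real (length (v # vs)) * t = (s + t) + real (length vs) * t" by (simp add: algebra_simps)
  have one: "box r vs (l + g + c) = (if vs = [] then w else 1)" if c: "pert F t p' c" "p' \<le> p" for p' c
  proof -
    obtain e h where e: "c = p' + e + h" "e < F" "near t (int h)" using c(1) unfolding pert_def by blast
    have eq: "l + g + c = (l + p' + e) + (g + h)" using e by simp
    have lt: "l + p' + e + sum_list ps + length vs * F < X" using Cons.prems(4) c(2) e(2) by simp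
    have nr: "near (s + t) (int (g + h))" using near_add[OF Cons.prems(1) e(3)] by simp
    show ?thesis unfolding eq by (rule Cons.IH[OF nr _ Cons.prems(3) lt]) (use Cons.prems(2) st in simp)
  qed
  have ab: "pert F t p a" "pert F t 0 b" using Cons.hyps(1) unfolding v pert_pair_def by simp_all
  show ?case using one[OF ab(1) order_refl] one[OF ab(2)] w unfolding v by simp
qed

text \<open>Only the vertex taking every first shift reaches \<open>X\<close>; a vertex that takes
  some second shift misses one \<open>p\<close>, and the last hypothesis makes it fall short even
  with all the noise. Along the recursion the first half is therefore special again and the second
  is generic. The result is the product of \<open>w\<close> and its conjugates over the cube, which
  is 1 for a nonempty list, divided by the single \<open>w\<close> that became 1.\<close>

lemma box_ratio_special:
  fixes r :: "nat \<Rightarrow> complex"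
  assumes r: "\<And>l g. near T (int g) \<Longrightarrow> l < X \<Longrightarrow> r (l + g) = w" and w: "w * cnj w = 1"
    and r1: "\<And>l g. near T (int g) \<Longrightarrow> X \<le> l \<Longrightarrow> l < X' \<Longrightarrow> r (l + g) = 1"
    and "list_all2 (pert_pair F t) ps vs" "near s (int g)" "s + real (length vs) * t \<le> T" "0 \<le> t"
    and "X \<le> l + sum_list ps" "l + sum_list ps + length vs * F < X'"
    and "\<And>p. p \<in> set ps \<Longrightarrow> l + sum_list ps + length vs * F < X + p"
  shows "box r vs (l + g) = (if vs = [] then 1 else cnj w)"
  using assms(4-10)
proof (induction arbitrary: l g s rule: list_all2_induct)
  case Nil
  have "near T (int g)" using Nil.prems by (intro near_mono[OF Nil.prems(1)]) simp
  then show ?case using r1[of g l] Nil.prems by simp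
next
  case (Cons p ps v vs)
  obtain a b where v: "v = (a, b)" by (cases v)
  have st: "s + real (length (v # vs)) * t = (s + t) + real (length vs) * t" by (simp add: algebra_simps)
  have ab: "pert F t p a" "pert F t 0 b" using Cons.hyps(1) unfolding v pert_pair_def by simp_all
  obtain e h where e: "a = p + e + h" "e < F" "near t (int h)" using ab(1) unfolding pert_def by blast
  obtain e' h' where e': "b = e' + h'" "e' < F" "near t (int h')" using ab(2) unfolding pert_def by auto
  have eqa: "l + g + a = (l + p + e) + (g + h)" and eqb: "l + g + b = (l + e') + (g + h')" using e e' by simp_all
  have nra: "near (s + t) (int (g + h))" "near (s + t) (int (g + h'))"
    using near_add[OF Cons.prems(1) e(3)] near_add[OF Cons.prems(1) e'(3)] by simp_all
  have T: "s + t + real (length vs) * t \<le> T" using Cons.prems(2) st by simp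
  have "box r vs (l + g + a) = (if vs = [] then 1 else cnj w)"
    unfolding eqa
  proof (rule Cons.IH[OF nra(1) T Cons.prems(3)])
    show "X \<le> l + p + e + sum_list ps" using Cons.prems(4) by simp
    show "l + p + e + sum_list ps + length vs * F < X'" using Cons.prems(5) e(2) by simp
    show "l + p + e + sum_list ps + length vs * F < X + p'" if "p' \<in> set ps" for p'
      using Cons.prems(6)[of p'] that e(2) by simp
  qed
  moreover have "box r vs (l + g + b) = (if vs = [] then w else 1)"
    unfolding eqb
  proof (rule box_ratio_generic[where T = T and X = X and s = "s + t" and ps = ps and t = t and F = F])
    show "l + e' + sum_list ps + length vs * F < X" using Cons.prems(6)[of p] e'(2) by simp
    show "r (l + g) = w" if "near T (int g)" "l < X" for l g using that by (rule r)
  qed (fact w Cons.hyps(2) nra(2) T Cons.prems(3))+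
  ultimately show ?case unfolding v by simp
qed

text \<open>The prescribed parts add up exactly to the threshold \<open>fib (i - 1)\<close>, so the
  noise pushes the special vertex onto or above it. The noise fits into the room
  \<open>fib (i - 2)\<close> up to \<open>fib i\<close>, and stays below each \<open>p\<close>, so
  omitting any one \<open>p\<close> leads back below the threshold.\<close>

lemma box_flip:
  assumes ps: "list_all2 (pert_pair F t) ps vs" and vs: "vs \<noteq> []" and a: "pert F t p0 a"
    and t: "real (Suc (length vs)) * t \<le> gi ^ (i + 3)" "0 \<le> t" and i: "4 \<le> i" "i + 2 \<le> \<mu>"
    and total: "p0 + sum_list ps = fib (i - 1)"
    and noise: "Suc (length vs) * F \<le> fib (i - 2)" "\<And>p. p \<in> set ps \<Longrightarrow> Suc (length vs) * F \<le> p"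
  shows "box (zexp \<theta> {..<\<mu>}) ((a + fib i, b) # vs) 0 =
    cnj (e2pi \<theta>) * box (zexp \<theta> {..<\<mu>}) ((a, b) # vs) 0"
proof -
  define f where "f = zexp \<theta> {..<\<mu>}"
  define r where "r n = f (n + fib i) * cnj (f n)" for n
  have unit: "f n * cnj (f n) = 1" for n
    using complex_norm_square[of "f n"] by (simp add: f_def)
  have w: "e2pi \<theta> * cnj (e2pi \<theta>) = 1" using complex_norm_square[of "e2pi \<theta>"] by simp
  have F2: "fib (i - 1) + fib (i - 2) = fib i" using i by (intro fib_pred) simp
  have r_val: "r (l + g) = (if l < fib (i - 1) then e2pi \<theta> else 1)"
    if g: "near (gi ^ (i + 3)) (int g)" and l: "l < fib i" for l g
    unfolding r_def f_def zexp_add_fib[OF g order_refl i l] using unit[of "l + g"] unfolding f_def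
    by (simp add: mult.assoc)
  obtain e g where e: "a = p0 + e + g" "e < F" "near t (int g)" using a unfolding pert_def by blast
  have e1: "e + length vs * F < Suc (length vs) * F" using e(2) by simp
  have "box r vs (p0 + e + g) = (if vs = [] then 1 else cnj (e2pi \<theta>))"
  proof (rule box_ratio_special[where T = "gi ^ (i + 3)" and X = "fib (i - 1)" and X' = "fib i" and s = t])
    show "r (l + g) = e2pi \<theta>" if "near (gi ^ (i + 3)) (int g)" "l < fib (i - 1)" for l g
      using r_val[OF that(1), of l] that(2) F2 by simp
    show "r (l + g) = 1" if "near (gi ^ (i + 3)) (int g)" "fib (i - 1) \<le> l" "l < fib i" for l g
      using r_val[OF that(1,3)] that(2) by simp
    show "t + real (length vs) * t \<le> gi ^ (i + 3)" using t(1) by (simp add: algebra_simps)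
    show "fib (i - 1) \<le> p0 + e + sum_list ps" using total by simp
    show "p0 + e + sum_list ps + length vs * F < fib i" using total e1 noise(1) F2 by simp
    show "p0 + e + sum_list ps + length vs * F < fib (i - 1) + p" if "p \<in> set ps" for p
      using total e1 noise(2)[OF that] by simp
  qed (use w ps e(3) t(2) in auto)
  then have ra: "box r vs a = cnj (e2pi \<theta>)" using vs e(1) by simp
  have "box f vs (a + fib i) = box (\<lambda>n. r n * f n) vs a"
  proof -
    have "f (n + fib i) = r n * f n" for n unfolding r_def using unit[of n] by (simp add: mult.assoc mult.commute[of "cnj (f n)"])
    then have "(\<lambda>n. f (n + fib i)) = (\<lambda>n. r n * f n)" by blast
    then show ?thesis by (metis box_shift)
  qed
  then show ?thesis unfolding f_def[symmetric] by (simp add: box_mult ra)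
qed


section \<open>Overwriting a block of digits\<close>

definition setblk :: "nat \<Rightarrow> nat \<Rightarrow> nat set \<Rightarrow> nat \<Rightarrow> nat" where
  "setblk c W P n = sum fib ((zset n - {c..<c + W}) \<union> P)"

text \<open>Both border positions of the block stay empty, so a pattern can be combined with
  arbitrary digits outside the block without creating adjacent digits.\<close>

definition padded :: "nat \<Rightarrow> nat \<Rightarrow> nat set \<Rightarrow> bool" where
  "padded c W P \<longleftrightarrow> nonadj P \<and> P \<subseteq> {Suc c..<c + W - 1} \<and> 2 \<le> c"

lemma padded_subset: "padded c W P \<Longrightarrow> P \<subseteq> {c..<c + W}"
  by (fastforce simp: padded_def)

lemma padded_finite: "padded c W P \<Longrightarrow> finite P"
  unfolding padded_def using finite_subset by blast

lemma zset_setblk: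
  assumes "padded c W P"
  shows "zset (setblk c W P n) = (zset n - {c..<c + W}) \<union> P"
  unfolding setblk_def
proof (rule zset_sum_fib)
  have P: "nonadj P" "P \<subseteq> {Suc c..<c + W - 1}" "2 \<le> c" using assms by (auto simp: padded_def)
  have "nonadj ((zset n - {c..<c + W}) \<union> P)"
    unfolding nonadj_def
  proof (intro allI impI notI)
    fix i assume i: "Suc i \<in> (zset n - {c..<c + W}) \<union> P" "i \<in> (zset n - {c..<c + W}) \<union> P"
    have "\<not> (Suc i \<in> zset n \<and> i \<in> zset n)" "\<not> (Suc i \<in> P \<and> i \<in> P)"
      using zset_props(2) P(1) by (auto simp: nonadj_def)
    moreover have "i \<in> {c..<c + W} \<and> Suc i \<in> {c..<c + W}" if "i \<in> P \<or> Suc i \<in> P" using that P(2) by fastforce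
    ultimately show False using i by blast
  qed
  then show "zeck_set ((zset n - {c..<c + W}) \<union> P)"
    unfolding zeck_set_iff using zset_props(1,3)[of n] padded_finite[OF assms] P by fastforce
qed

lemma setblk_setblk: "padded c W P \<Longrightarrow> setblk c W Q (setblk c W P n) = setblk c W Q n"
  unfolding setblk_def[of c W Q] zset_setblk using padded_subset[of c W P]
  by (intro arg_cong[where f = "sum fib"]) blast

lemma setblk_same: "setblk c W (zset n \<inter> {c..<c + W}) n = n"
proof -
  have "(zset n - {c..<c + W}) \<union> (zset n \<inter> {c..<c + W}) = zset n" by blast
  then show ?thesis unfolding setblk_def by (simp add: zset(2))
qed

lemma setblk_less:
  assumes "padded c W P" "n < fib Y" "c + W \<le> Y"
  shows "setblk c W P n < fib Y"
proof -
  have "2 \<le> Y" using assms by (auto simp: padded_def)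
  moreover have "zset (setblk c W P n) \<subseteq> {..<Y}"
    unfolding zset_setblk[OF assms(1)] using zset_less[OF assms(2)] padded_subset[OF assms(1)] assms(3) by fastforce
  ultimately show ?thesis by (simp add: zset_subset_iff)
qed

lemma setblk_insert:
  assumes "padded c W (insert i P)" "i \<notin> P"
  shows "setblk c W (insert i P) n = setblk c W P n + fib i"
proof -
  have fin: "finite P" using padded_finite[OF assms(1)] by simp
  have "i \<in> {c..<c + W}" using padded_subset[OF assms(1)] by blast
  then have "(zset n - {c..<c + W}) \<union> insert i P = insert i ((zset n - {c..<c + W}) \<union> P)"
    "i \<notin> (zset n - {c..<c + W}) \<union> P" using assms(2) by auto
  then show ?thesis unfolding setblk_def using fin zset_props(1)[of n] by simp
qed

lemma pert_setblk:
  assumes "padded c W P"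
  shows "pert (fib c) (gi ^ (c + W) * (1 + gi)) (sum fib P) (setblk c W P n)"
proof -
  have c: "2 \<le> c" using assms by (simp add: padded_def)
  have eq: "(zset n - {c..<c + W}) \<union> P = P \<union> ((zset n \<inter> {..<c}) \<union> (zset n \<inter> {c + W..}))" by auto
  have "setblk c W P n = sum fib P + (low c n + high (c + W) n)"
    unfolding setblk_def eq low_def high_def using padded_finite[OF assms] zset_props(1) padded_subset[OF assms]
    by (subst sum.union_disjoint, auto)+
  moreover have "near (gi ^ (c + W) * (1 + gi)) (int (high (c + W) n))"
    using c by (intro near_zset_subset) (auto simp: zset_high)
  ultimately show ?thesis unfolding pert_def using low_less[OF c, of n] by (metis add.assoc)
qed

definition setcfg :: "nat \<Rightarrow> nat \<Rightarrow> (nat set \<times> nat set) list \<Rightarrow> (nat \<times> nat) list \<Rightarrow> (nat \<times> nat) list" where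
  "setcfg c W Ps vs = map2 (\<lambda>P v. (setblk c W (fst P) (fst v), setblk c W (snd P) (snd v))) Ps vs"

definition blkcfg :: "nat \<Rightarrow> nat \<Rightarrow> (nat \<times> nat) list \<Rightarrow> (nat set \<times> nat set) list" where
  "blkcfg c W vs = map (\<lambda>v. (zset (fst v) \<inter> {c..<c + W}, zset (snd v) \<inter> {c..<c + W})) vs"

definition padded_list :: "nat \<Rightarrow> nat \<Rightarrow> (nat set \<times> nat set) list \<Rightarrow> bool" where
  "padded_list c W Ps \<longleftrightarrow> (\<forall>P\<in>set Ps. padded c W (fst P) \<and> padded c W (snd P))"

lemma setcfg_setcfg:
  assumes "padded_list c W Ps" "length Ps = length vs" "length Qs = length vs"
  shows "setcfg c W Qs (setcfg c W Ps vs) = setcfg c W Qs vs"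
  using assms
  by (intro nth_equalityI) (auto simp: setcfg_def setblk_setblk padded_list_def)

lemma setcfg_blkcfg: "setcfg c W (blkcfg c W vs) vs = vs"
  by (intro nth_equalityI) (auto simp: setcfg_def blkcfg_def setblk_same)

lemma blkcfg_setcfg:
  assumes "padded_list c W Ps" "length Ps = length vs"
  shows "blkcfg c W (setcfg c W Ps vs) = Ps"
proof (rule nth_equalityI)
  fix j assume "j < length (blkcfg c W (setcfg c W Ps vs))"
  then have j: "j < length vs" "j < length Ps" using assms(2) by (auto simp: blkcfg_def setcfg_def)
  then have P: "padded c W (fst (Ps ! j))" "padded c W (snd (Ps ! j))"
    using assms(1) by (auto simp: padded_list_def)
  show "blkcfg c W (setcfg c W Ps vs) ! j = Ps ! j"
    using j P padded_subset[OF P(1)] padded_subset[OF P(2)]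
    by (auto simp: blkcfg_def setcfg_def zset_setblk prod_eq_iff)
qed (use assms in \<open>simp add: blkcfg_def setcfg_def\<close>)

lemma blkcfg_setcfg_other:
  assumes "padded_list c W Ps" "length Ps = length vs" "c + W \<le> c' \<or> c' + W \<le> c"
  shows "blkcfg c' W (setcfg c W Ps vs) = blkcfg c' W vs"
proof (rule nth_equalityI)
  fix j assume "j < length (blkcfg c' W (setcfg c W Ps vs))"
  then have j: "j < length vs" "j < length Ps" using assms(2) by (auto simp: blkcfg_def setcfg_def)
  then have P: "padded c W (fst (Ps ! j))" "padded c W (snd (Ps ! j))"
    using assms(1) by (auto simp: padded_list_def)
  have dis: "{c..<c + W} \<inter> {c'..<c' + W} = {}" using assms(3) by auto
  have "((zset n - {c..<c + W}) \<union> P) \<inter> {c'..<c' + W} = zset n \<inter> {c'..<c' + W}" if "padded c W P" for P n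
    using dis padded_subset[OF that] by blast
  then show "blkcfg c' W (setcfg c W Ps vs) ! j = blkcfg c' W vs ! j"
    using j P by (simp add: blkcfg_def setcfg_def zset_setblk)
qed (use assms in \<open>simp add: blkcfg_def setcfg_def\<close>)

lemma tups_iff: "vs \<in> tups Ss \<longleftrightarrow> list_all2 (\<lambda>S v. fst v \<in> S \<and> snd v \<in> S) Ss vs"
  by (induction Ss arbitrary: vs) (auto simp: list_all2_Cons1 image_iff)

lemma setcfg_in_tups:
  assumes "vs \<in> tups (map (\<lambda>Y. {..<fib Y}) Ys)" "padded_list c W Ps" "length Ps = length Ys"
    and "\<And>Y. Y \<in> set Ys \<Longrightarrow> c + W \<le> Y"
  shows "setcfg c W Ps vs \<in> tups (map (\<lambda>Y. {..<fib Y}) Ys)"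
  using assms
  by (auto simp: tups_iff list_all2_conv_all_nth setcfg_def padded_list_def intro!: setblk_less)

text \<open>The overwritten digits together with the result determine the configuration, and they
  consist of two subsets of a block of \<open>W\<close> positions for each of the \<open>k\<close>
  pairs.\<close>

lemma card_setcfg_fibre:
  assumes "padded_list c W Ps" "length Ps = k" "\<And>vs. vs \<in> \<Omega> \<Longrightarrow> length vs = k" 
  shows "card {vs\<in>\<Omega>. setcfg c W Ps vs = us} \<le> 2 ^ (2 * k * W)"
proof -
  let ?S = "{vs\<in>\<Omega>. setcfg c W Ps vs = us}"
  let ?T = "{xs. set xs \<subseteq> Pow {c..<c + W} \<times> Pow {c..<c + W} \<and> length xs = k}"
  have inj: "inj_on (blkcfg c W) ?S"
  proof (rule inj_onI)
    fix v v' assume v: "v \<in> ?S" "v' \<in> ?S" "blkcfg c W v = blkcfg c W v'"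
    have l: "length v = k" "length v' = k" using v assms(3) by auto
    have "v = setcfg c W (blkcfg c W v) (setcfg c W Ps v)"
      using setcfg_setcfg[OF assms(1), of v "blkcfg c W v"] l assms(2) by (simp add: setcfg_blkcfg) (simp add: blkcfg_def)
    also have "\<dots> = setcfg c W (blkcfg c W v') (setcfg c W Ps v')" using v by simp
    also have "\<dots> = v'"
      using setcfg_setcfg[OF assms(1), of v' "blkcfg c W v'"] l assms(2) by (simp add: setcfg_blkcfg) (simp add: blkcfg_def)
    finally show "v = v'" .
  qed
  have "blkcfg c W ` ?S \<subseteq> ?T" using assms(3) by (auto simp: blkcfg_def)
  then have "card ?S \<le> card ?T" using inj by (intro card_inj_on_le[OF inj]) (auto intro: finite_lists_length_eq)
  also have "card ?T = card (Pow {c..<c + W} \<times> Pow {c..<c + W}) ^ k" by (rule card_lists_length_eq) simp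
  also have "\<dots> = 2 ^ (2 * k * W)"
    by (simp add: card_cartesian_product card_Pow power_add[symmetric] power_mult[symmetric] mult_2 algebra_simps)
  finally show ?thesis .
qed

text \<open>Unfolds the recurrence along every second index. It writes the threshold
  \<open>fib (i - 1)\<close> as a sum of \<open>k\<close> Fibonacci numbers, one for each coordinate
  of the box.\<close>

lemma fib_telescope:
  assumes "1 \<le> k" "2 * k \<le> i"
  shows "sum_list (map (\<lambda>j. fib (i - 2 * j)) [1..<k]) + fib (i - 2 * k + 1) = fib (i - 1)"
  using assms
proof (induction k rule: dec_induct)
  case base
  then have "i - 2 + 1 = i - 1" by linarith
  then show ?case by simp
next
  case (step k)
  have "i - 2 * Suc k + 1 = i - 2 * k - 1" "i - 2 * k + 1 = Suc (Suc (i - 2 * k - 1))" "Suc (i - 2 * k - 1) = i - 2 * k"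
    using step.prems by simp_all
  then have "fib (i - 2 * k) + fib (i - 2 * Suc k + 1) = fib (i - 2 * k + 1)" by (metis fib.simps(3))
  then show ?case using step by simp
qed

text \<open>Two further indices at least double a Fibonacci number, so a gap of \<open>2 * k\<close>
  digits absorbs the noise accumulated from \<open>k\<close> coordinates.\<close>

lemma fib_exponential: "k * fib n \<le> fib (n + 2 * k)"
proof -
  have "2 ^ k * fib n \<le> fib (n + 2 * k)"
  proof (induction k)
    case (Suc k)
    have "fib (n + 2 * k) + fib (n + 2 * k) \<le> fib (n + 2 * Suc k)"
      using fib_mono[of "n + 2 * k" "Suc (n + 2 * k)"] by simp
    then show ?case using Suc by simp
  qed simp
  moreover have "k * fib n \<le> 2 ^ k * fib n" by (intro mult_right_mono) (simp_all add: less_imp_le)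
  ultimately show ?thesis by linarith
qed

text \<open>The digits below \<open>2 + B * W\<close> are cut into \<open>B\<close> blocks, which
  \<open>block_induction\<close> treats as independent switches. Switching the digit
  \<open>c b + 4 * k\<close> on in the first shift of the first pair multiplies the box by the
  conjugate of e(\<theta>), by \<open>box_flip\<close>.\<close>

lemma bavg_zexp_bound:
  assumes k: "length Ys = k" "2 \<le> k" and W: "W = 6 * k + 5"
    and Y: "\<And>Y. Y \<in> set Ys \<Longrightarrow> 2 + B * W \<le> Y" and mu: "2 + B * W \<le> \<mu>"
  shows "norm (bavg (map (\<lambda>Y. {..<fib Y}) Ys) (\<lambda>vs. box (zexp \<theta> {..<\<mu>}) vs 0))
    \<le> (1 - (2 - norm (1 + e2pi \<theta>)) / 2 ^ (2 * k * W)) ^ B"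
proof -
  define \<Omega> where "\<Omega> = tups (map (\<lambda>Y. {..<fib Y}) Ys)"
  define c where "c b = 2 + b * W" for b
  \<comment> \<open>With \<open>i = c b + 4 * k\<close>, the first shifts carry the Fibonacci
    numbers of index \<open>i - 2 * j\<close> and \<open>i - 2 * k + 1\<close> from
    \<open>fib_telescope\<close>, and the second shifts nothing. All indices exceed
    \<open>c b + 2 * k\<close>, leaving \<open>2 * k\<close> positions to absorb the noise from
    below.\<close>
  define rest where "rest b = map (\<lambda>j. ({c b + 4 * k - 2 * j}, {} :: nat set)) [1..<k]" for b
  define P0 where "P0 b = ({c b + 2 * k + 1}, {}) # rest b" for b
  define P1 where "P1 b = ({c b + 4 * k, c b + 2 * k + 1}, {}) # rest b" for b
  have pad: "padded (c b) W {}" "padded (c b) W {c b + 2 * k + 1}" "padded (c b) W {c b + 4 * k, c b + 2 * k + 1}"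
    "\<And>j. j \<in> {1..<k} \<Longrightarrow> padded (c b) W {c b + 4 * k - 2 * j}" for b
    using k W by (auto simp: padded_def nonadj_def c_def)
  have padl: "padded_list (c b) W (P0 b)" "padded_list (c b) W (P1 b)" for b
    using pad unfolding padded_list_def P0_def P1_def rest_def by auto
  have len: "length (P0 b) = k" "length (P1 b) = k" for b
    using k unfolding P0_def P1_def rest_def by auto
  have lenv: "length vs = k" if "vs \<in> \<Omega>" for vs using that k length_tups unfolding \<Omega>_def by fastforce
  have cW: "c b + W \<le> 2 + B * W" if "b < B" for b
  proof -
    have "Suc b * W \<le> B * W" using that by (intro mult_right_mono) auto
    then show ?thesis unfolding c_def by simp
  qed
  have cne: "c b + W \<le> c b' \<or> c b' + W \<le> c b" if "b \<noteq> b'" for b b'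
  proof -
    have "Suc b * W \<le> b' * W \<or> Suc b' * W \<le> b * W" using that by (cases b b' rule: linorder_cases) (auto intro!: mult_right_mono simp del: mult_Suc)
    then show ?thesis unfolding c_def by auto
  qed
  have fin: "finite \<Omega>" unfolding \<Omega>_def by (intro finite_tups) auto
  have neO: "\<Omega> \<noteq> {}" unfolding \<Omega>_def
  proof (rule tups_nonempty)
    fix S assume "S \<in> set (map (\<lambda>Y. {..<fib Y}) Ys)"
    then obtain Y where "Y \<in> set Ys" "S = {..<fib Y}" by auto
    moreover from this have "0 < fib Y" using Y[of Y] by (intro fib_neq_0_nat) simp
    ultimately show "S \<noteq> {}" by auto
  qed
  define G where "G vs = box (zexp \<theta> {..<\<mu>}) vs 0" for vs
  have flip: "G (setcfg (c b) W (P1 b) vs) = cnj (e2pi \<theta>) * G (setcfg (c b) W (P0 b) vs)"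
    if b: "b < B" and vs: "vs \<in> \<Omega>" for b vs
  proof -
    obtain v vs' where v: "vs = v # vs'" "length vs' = k - 1" using lenv[OF vs] k by (cases vs) auto
    define C i where "C = c b" and "i = C + 4 * k"
    define us where "us = setcfg C W (rest b) vs'"
    have e0: "setcfg C W (P0 b) vs = (setblk C W {C + 2 * k + 1} (fst v), setblk C W {} (snd v)) # us"
      unfolding P0_def v us_def setcfg_def C_def by simp
    have "setblk C W (insert i {C + 2 * k + 1}) (fst v) = setblk C W {C + 2 * k + 1} (fst v) + fib i"
      using pad(3)[of b] k unfolding i_def C_def by (intro setblk_insert) auto
    then have e1: "setcfg C W (P1 b) vs = (setblk C W {C + 2 * k + 1} (fst v) + fib i, setblk C W {} (snd v)) # us"
      unfolding P1_def v us_def setcfg_def C_def i_def by simp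
    have lus: "length us = k - 1" unfolding us_def setcfg_def rest_def using v by simp
    define t where "t = gi ^ (C + W) * (1 + gi)"
    have "box (zexp \<theta> {..<\<mu>}) ((setblk C W {C + 2 * k + 1} (fst v) + fib i, setblk C W {} (snd v)) # us) 0 =
       cnj (e2pi \<theta>) * box (zexp \<theta> {..<\<mu>}) ((setblk C W {C + 2 * k + 1} (fst v), setblk C W {} (snd v)) # us) 0"
    proof (rule box_flip[where F = "fib C" and t = t and ps = "map (\<lambda>j. fib (i - 2 * j)) [1..<k]"])
      show "list_all2 (pert_pair (fib C) t) (map (\<lambda>j. fib (i - 2 * j)) [1..<k]) us"
        unfolding list_all2_conv_all_nth
      proof (intro conjI allI impI)
        fix j assume "j < length (map (\<lambda>j. fib (i - 2 * j)) [1..<k])"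
        then have j: "j < k - 1" by simp
        then have "us ! j = (setblk C W {C + 4 * k - 2 * Suc j} (fst (vs' ! j)), setblk C W {} (snd (vs' ! j)))"
          unfolding us_def setcfg_def rest_def C_def using v(2) by simp
        moreover have "padded C W {C + 4 * k - 2 * Suc j}" unfolding C_def using j by (intro pad(4)) auto
        ultimately show "pert_pair (fib C) t (map (\<lambda>j. fib (i - 2 * j)) [1..<k] ! j) (us ! j)"
          using pert_setblk[of C W "{C + 4 * k - 2 * Suc j}"] pert_setblk[OF pad(1)[of b]] j
          unfolding pert_pair_def t_def i_def C_def[symmetric] by simp
      qed (use lus in simp)
      show "us \<noteq> []" using lus k by auto
      show "pert (fib C) t (fib (C + 2 * k + 1)) (setblk C W {C + 2 * k + 1} (fst v))"
        using pert_setblk[OF pad(2)[of b]] unfolding t_def C_def by simp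
      show "0 \<le> t" unfolding t_def using gi_pos by simp
      \<comment> \<open>Here the value \<open>W = 6 * k + 5\<close> is used: the block extends
        \<open>2 * Suc k\<close> positions beyond \<open>i + 3\<close>, so that even
        \<open>k\<close> copies of the noise from above stay below
        \<open>gi ^ (i + 3)\<close>.\<close>
      have "t = gi ^ (i + 3) * (gi ^ (2 * Suc k) * (1 + gi))"
      proof -
        have "C + W = (i + 3) + 2 * Suc k" by (simp add: W i_def)
        then show ?thesis unfolding t_def by (simp only: power_add mult.assoc)
      qed
      moreover have "real k * (gi ^ (2 * Suc k) * (1 + gi)) \<le> 1"
      proof -
        have "gi ^ (2 * Suc k) = (gi * gi) ^ Suc k" by (simp add: power_mult power2_eq_square)
        also have "\<dots> \<le> (1 / 2) ^ Suc k" using gi_bounds gi_sq by (intro power_mono) auto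
        finally have "gi ^ (2 * Suc k) * (1 + gi) \<le> (1 / 2) ^ Suc k * 2" using gi_bounds by (intro mult_mono) auto
        then have "real k * (gi ^ (2 * Suc k) * (1 + gi)) \<le> real k * ((1 / 2) ^ Suc k * 2)" by (intro mult_left_mono) auto
        also have "\<dots> = real k / 2 ^ k" by (simp add: power_divide)
        also have "\<dots> \<le> 1" using less_exp[of k] by (simp add: less_imp_le)
        finally show ?thesis .
      qed
      ultimately have "real k * t \<le> gi ^ (i + 3)"
        using mult_left_mono[of "real k * (gi ^ (2 * Suc k) * (1 + gi))" 1 "gi ^ (i + 3)"] gi_pos
        by (simp add: algebra_simps)
      then show "real (Suc (length us)) * t \<le> gi ^ (i + 3)" using lus k by simp
      show "4 \<le> i" unfolding i_def using k by simp
      show "i + 2 \<le> \<mu>" unfolding i_def C_def using cW[OF b] mu W by simp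
      have "i - 2 * k + 1 = C + 2 * k + 1" unfolding i_def by simp
      then show "fib (C + 2 * k + 1) + sum_list (map (\<lambda>j. fib (i - 2 * j)) [1..<k]) = fib (i - 1)"
        using fib_telescope[of k i] k unfolding i_def by (simp only:) linarith
      have noise: "Suc (length us) * fib C \<le> fib m" if "C + 2 * k \<le> m" for m
        using fib_exponential[of k C] fib_mono[OF that] lus k by (metis One_nat_def Suc_le_D diff_Suc_1 le_trans numeral_2_eq_2)
      show "Suc (length us) * fib C \<le> fib (i - 2)" using k by (intro noise) (simp add: i_def)
      show "Suc (length us) * fib C \<le> p" if p: "p \<in> set (map (\<lambda>j. fib (i - 2 * j)) [1..<k])" for p
      proof -
        obtain j where j: "j < k" "p = fib (i - 2 * j)" using p by auto
        show ?thesis unfolding j(2) using j(1) by (intro noise) (simp add: i_def)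
      qed
    qed
    then show ?thesis unfolding G_def C_def[symmetric] e0 e1 .
  qed
  have "norm (\<Sum>vs\<in>\<Omega>. G vs) \<le> (1 - (2 - norm (1 + cnj (e2pi \<theta>))) / real (2 ^ (2 * k * W))) ^ B * card \<Omega>"
  proof (rule block_induction[where \<sigma> = "\<lambda>b. setcfg (c b) W (P0 b)" and \<tau> = "\<lambda>b. setcfg (c b) W (P1 b)"
        and proj = "\<lambda>b. blkcfg (c b) W" and \<beta> = P0 and \<gamma> = P1 and \<Omega> = \<Omega>])
    show "norm (G vs) \<le> 1" for vs unfolding G_def by (intro norm_box_le) simp
    show "setcfg (c b) W (P0 b) vs \<in> \<Omega> \<and> setcfg (c b) W (P1 b) vs \<in> \<Omega>" if "b < B" "vs \<in> \<Omega>" for b vs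
      using that(2) cW[OF that(1)] Y padl len k unfolding \<Omega>_def
      by (intro conjI setcfg_in_tups) (auto intro: order_trans)
    show "blkcfg (c b') W (setcfg (c b) W (P0 b) vs) = blkcfg (c b') W vs \<and>
          blkcfg (c b') W (setcfg (c b) W (P1 b) vs) = blkcfg (c b') W vs"
      if "b < B" "b' < B" "b \<noteq> b'" "vs \<in> \<Omega>" for b b' vs
      using lenv[OF that(4)] len cne[OF that(3)] by (intro conjI blkcfg_setcfg_other padl) auto
    show "blkcfg (c b) W (setcfg (c b) W (P0 b) vs) = P0 b \<and> blkcfg (c b) W (setcfg (c b) W (P1 b) vs) = P1 b"
      if "b < B" "vs \<in> \<Omega>" for b vs
      using lenv[OF that(2)] len by (intro conjI blkcfg_setcfg padl) auto
    show "P0 b \<noteq> P1 b" for b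
    proof
      assume eq: "P0 b = P1 b"
      have "c b + 4 * k \<in> fst (hd (P1 b))" by (simp add: P1_def)
      then have "c b + 4 * k \<in> fst (hd (P0 b))" unfolding eq .
      then have "4 * k = 2 * k + 1" by (simp add: P0_def)
      then show False by presburger
    qed
    show "setcfg (c b) W (P0 b) vs = vs" if "blkcfg (c b) W vs = P0 b" for b vs
      using setcfg_blkcfg[of "c b" W vs] that by simp
    show "setcfg (c b) W (P1 b) vs = vs" if "blkcfg (c b) W vs = P1 b" for b vs
      using setcfg_blkcfg[of "c b" W vs] that by simp
    show "setcfg (c b) W (P1 b) (setcfg (c b) W (P0 b) vs) = setcfg (c b) W (P1 b) vs \<and>
          setcfg (c b) W (P0 b) (setcfg (c b) W (P1 b) vs) = setcfg (c b) W (P0 b) vs"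
      if "b < B" "vs \<in> \<Omega>" for b vs
      using lenv[OF that(2)] len by (intro conjI setcfg_setcfg padl) auto
    show "card {vs\<in>\<Omega>. setcfg (c b) W (P0 b) vs = us} \<le> 2 ^ (2 * k * W)" for b us
      by (rule card_setcfg_fibre[OF padl(1) len(1) lenv])
    have "norm (1 + cnj (e2pi \<theta>)) \<le> norm (1::complex) + norm (cnj (e2pi \<theta>))" by (rule norm_triangle_ineq)
    then show "norm (1 + cnj (e2pi \<theta>)) \<le> 2" by simp
    have "(2::nat) ^ 1 \<le> 2 ^ (2 * k * W)" using k W by (intro power_increasing) auto
    then show "2 \<le> (2::nat) ^ (2 * k * W)" by simp
  qed (use fin flip in auto)
  moreover have "norm (1 + cnj (e2pi \<theta>)) = norm (1 + e2pi \<theta>)"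
    by (metis complex_cnj_add complex_cnj_one complex_mod_cnj)
  moreover have "0 < real (card \<Omega>)" using fin neO by (simp add: card_gt_0_iff)
  ultimately show ?thesis unfolding bavg_def \<Omega>_def[symmetric] G_def[symmetric]
    by (simp add: norm_divide divide_le_eq)
qed

section \<open>Reduction of a fixed modulus to equidistributed shifts\<close>

text \<open>Equidistribution is stated only against step functions, with an error proportional to
  the number of steps and uniform in the base point \<open>n\<close>. The average on the right is
  free of \<open>n\<close>, so the base point can be forgotten as well.\<close>

definition equidist :: "real \<Rightarrow> nat set \<Rightarrow> nat \<Rightarrow> bool" where
  "equidist \<eta> S Y \<longleftrightarrow> finite S \<and> S \<noteq> {} \<and> 0 < Y \<and> (\<forall>(H :: nat \<Rightarrow> complex) n K. step_fun K H \<longrightarrow> (\<forall>n. norm (H n) \<le> 1) \<longrightarrow>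
     norm ((\<Sum>s\<in>S. H (n + s)) / card S - (\<Sum>v<fib Y. H v) / fib Y) \<le> K * \<eta>)"

lemma equidistD:
  fixes H :: "nat \<Rightarrow> complex"
  assumes "equidist \<eta> S Y" "step_fun K H" "\<And>n. norm (H n) \<le> 1"
  shows "norm ((\<Sum>s\<in>S. H (n + s)) / card S - (\<Sum>v<fib Y. H v) / fib Y) \<le> K * \<eta>"
  using assms unfolding equidist_def by simp

lemma equidist_multiples:
  assumes ra: "rat_approx t q" and "0 < M" "0 < Y" "0 < t" and eta: "6 / q + q / M + 6 / fib Y \<le> \<eta>"
  shows "equidist \<eta> ((\<lambda>m. m * t) ` {..<M}) Y"
  unfolding equidist_def
proof (intro conjI allI impI)
  have inj: "inj_on (\<lambda>m. m * t) {..<M}" using assms by (auto simp: inj_on_def)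
  have c: "card ((\<lambda>m. m * t) ` {..<M}) = M" by (simp add: card_image[OF inj])
  fix H :: "nat \<Rightarrow> complex" and n K assume H: "step_fun K H" "\<forall>n. norm (H n) \<le> 1"
  have "norm ((\<Sum>m<M. H (n + m * t)) / M - (\<Sum>v<fib Y. H v) / fib Y) \<le> K * (6 / q + q / M + 6 / fib Y)"
    using H assms by (intro step_fun_equidistribution) auto
  also have "\<dots> \<le> K * \<eta>" using eta by (intro mult_left_mono) auto
  finally show "norm ((\<Sum>s\<in>(\<lambda>m. m * t) ` {..<M}. H (n + s)) / card ((\<lambda>m. m * t) ` {..<M}) - (\<Sum>v<fib Y. H v) / fib Y) \<le> K * \<eta>"
    unfolding c by (simp add: sum.reindex[OF inj])
qed (use assms in auto)

lemma bavg_Cons_swap: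
  "bavg (S # Ss) \<Phi> = bavg Ss (\<lambda>vs. (\<Sum>p\<in>S \<times> S. \<Phi> (p # vs)) / of_nat (card S ^ 2))"
  unfolding bavg_Cons bavg_divide bavg_sum ..

lemma sum_box_pairs:
  "(\<Sum>p\<in>S \<times> S. box g (p # vs) n) / of_nat (card S ^ 2) =
    ((\<Sum>s\<in>S. box g vs (n + s)) / card S) * cnj ((\<Sum>s\<in>S. box g vs (n + s)) / card S)"
proof -
  have "(\<Sum>p\<in>S \<times> S. box g (p # vs) n) = (\<Sum>p\<in>S \<times> S. box g vs (n + fst p) * cnj (box g vs (n + snd p)))"
    by (intro sum.cong[OF refl]) auto
  also have "\<dots> = (\<Sum>s\<in>S. box g vs (n + s)) * cnj (\<Sum>s\<in>S. box g vs (n + s))"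
    by (simp add: sum_product sum.cartesian_product case_prod_unfold)
  finally show ?thesis by (simp add: power2_eq_square)
qed

lemma norm_mult_cnj_diff_le:
  assumes "norm x \<le> 1" "norm y \<le> (1::real)" "norm (x - y) \<le> e"
  shows "norm (x * cnj x - y * cnj (y::complex)) \<le> 2 * e"
proof -
  have "x * cnj x - y * cnj y = (x - y) * cnj x + y * cnj (x - y)" by (simp add: algebra_simps)
  also have "norm \<dots> \<le> norm (x - y) * norm x + norm y * norm (x - y)"
    by (metis norm_triangle_ineq norm_mult complex_mod_cnj)
  also have "\<dots> \<le> e * 1 + 1 * e" using assms by (intro add_mono mult_mono) (auto intro: order_trans[OF norm_ge_zero])
  finally show ?thesis by simp
qed

lemma norm_average_le:
  fixes h :: "nat \<Rightarrow> complex"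
  assumes "finite S" "\<And>s. norm (h s) \<le> 1"
  shows "norm ((\<Sum>s\<in>S. h s) / card S) \<le> 1"
proof -
  have "norm (\<Sum>s\<in>S. h s) \<le> (\<Sum>s\<in>S. 1)" by (intro sum_norm_le assms)
  then show ?thesis by (simp add: norm_divide divide_le_eq)
qed

lemma bavg_replace_head:
  assumes g: "\<And>n. norm (g n) \<le> 1" and "finite S" "finite S'"
    and close: "\<And>vs. vs \<in> tups Ss \<Longrightarrow> norm ((\<Sum>s\<in>S. box g vs (n + s)) / card S - (\<Sum>s\<in>S'. box g vs (n' + s)) / card S') \<le> e"
    and e: "0 \<le> e"
  shows "norm (bavg (S # Ss) (\<lambda>vs. box g vs n) - bavg (S' # Ss) (\<lambda>vs. box g vs n')) \<le> 2 * e"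
  unfolding bavg_Cons_swap sum_box_pairs
  by (intro bavg_diff_le norm_mult_cnj_diff_le norm_average_le assms norm_box_le close) (use e in auto)

lemma bavg_fixed_head:
  assumes "finite S" "S \<noteq> {}"
    and one: "\<And>p. p \<in> S \<times> S \<Longrightarrow> norm (bavg R (\<lambda>vs. box g (p # vs) n) - bavg R' (\<lambda>vs. box g (p # vs) n)) \<le> e"
  shows "norm (bavg (S # R) (\<lambda>vs. box g vs n) - bavg (S # R') (\<lambda>vs. box g vs n)) \<le> e"
proof -
  have "bavg (S # R) (\<lambda>vs. box g vs n) - bavg (S # R') (\<lambda>vs. box g vs n) =
      (\<Sum>p\<in>S \<times> S. bavg R (\<lambda>vs. box g (p # vs) n) - bavg R' (\<lambda>vs. box g (p # vs) n)) / of_nat (card S ^ 2)"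
    by (simp only: bavg_Cons sum_subtractf diff_divide_distrib)
  also have "norm \<dots> \<le> (\<Sum>p\<in>S \<times> S. e) / real (card S ^ 2)"
    unfolding norm_divide norm_of_nat by (intro divide_right_mono sum_norm_le one) auto
  also have "\<dots> = e"
    using assms(1,2) by (simp add: card_cartesian_product power2_eq_square)
  finally show ?thesis .
qed

text \<open>Bounds the number of cells of a box with \<open>l\<close> pairs as in
  \<open>step_fun_box\<close>.\<close>

definition stepk :: "nat \<Rightarrow> nat \<Rightarrow> nat" where
  "stepk K l = (9 * K) ^ (2 ^ l)"

lemma stepk_Suc: "stepk (3 * K * (3 * K)) l = stepk K (Suc l)"
proof -
  have "9 * (3 * K * (3 * K)) = (9 * K) ^ 2" by (simp add: power2_eq_square)
  then show ?thesis unfolding stepk_def by (simp add: power_mult)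
qed

lemma stepk_mono: "1 \<le> K \<Longrightarrow> l \<le> l' \<Longrightarrow> stepk K l \<le> stepk K l'"
  unfolding stepk_def by (intro power_increasing) auto

text \<open>The sets are replaced from the front. With the other shifts fixed, the remaining box is
  a step function of the first shift; once the first set is an interval, each fixed pair is absorbed
  into \<open>g\<close>, which becomes a step function with \<open>3 * K * (3 * K)\<close> cells.
  The last set \<open>L\<close> is kept.\<close>

lemma bavg_equidist_tail:
  assumes "list_all2 (equidist \<eta>) Ss Ys" "step_fun K g" "\<And>n. norm (g n) \<le> 1" "0 \<le> \<eta>" "1 \<le> K"
  shows "norm (bavg (Ss @ [L]) (\<lambda>vs. box g vs n) - bavg (map (\<lambda>Y. {..<fib Y}) Ys @ [L]) (\<lambda>vs. box g vs n))
    \<le> 2 * real (length Ss) * stepk K (Suc (length Ss)) * \<eta>"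
  using assms
proof (induction arbitrary: g K n rule: list_all2_induct)
  case Nil
  then show ?case by simp
next
  case (Cons S Ss Y Ys)
  let ?S' = "{..<fib Y}" and ?R = "Ss @ [L]" and ?R' = "map (\<lambda>Y. {..<fib Y}) Ys @ [L]"
  define k where "k = stepk K (Suc (Suc (length Ss)))"
  have S: "finite S" "S \<noteq> {}" "0 < Y" using Cons.hyps(1) unfolding equidist_def by auto
  have A: "norm (bavg (S # ?R) (\<lambda>vs. box g vs n) - bavg (?S' # ?R) (\<lambda>vs. box g vs n)) \<le> 2 * (k * \<eta>)"
  proof (rule bavg_replace_head)
    fix vs assume "vs \<in> tups ?R"
    then have l: "length vs = Suc (length Ss)" using length_tups by fastforce
    obtain k' where k': "9 * k' \<le> (9 * K) ^ (2 ^ length vs)" "step_fun k' (\<lambda>n. box g vs n)"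
      using step_fun_box[OF Cons.prems(1)] by blast
    \<comment> \<open>The base point \<open>n\<close> must survive on both sides here, so it is
      moved into the step function, at the price of the factor 3 of \<open>step_fun_shift\<close>,
      and equidistribution is applied at 0.\<close>
    have "norm ((\<Sum>s\<in>S. box g vs (0 + s + n)) / card S - (\<Sum>v<fib Y. box g vs (v + n)) / fib Y) \<le> (3 * k') * \<eta>"
      by (rule equidistD[OF Cons.hyps(1) step_fun_shift[OF k'(2)]]) (intro norm_box_le Cons.prems)
    also have "\<dots> \<le> k * \<eta>"
    proof (intro mult_right_mono of_nat_mono)
      have "stepk K (Suc (length Ss)) \<le> k" unfolding k_def by (intro stepk_mono Cons.prems) simp
      then show "3 * k' \<le> k" using k'(1) unfolding l stepk_def by linarith
    qed (use Cons.prems in simp)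
    finally show "norm ((\<Sum>s\<in>S. box g vs (n + s)) / card S - (\<Sum>s<fib Y. box g vs (n + s)) / card {..<fib Y}) \<le> k * \<eta>"
      by (simp add: add.commute)
  qed (simp_all add: Cons.prems(2,3) S)
  have B: "norm (bavg (?S' # ?R) (\<lambda>vs. box g vs n) - bavg (?S' # ?R') (\<lambda>vs. box g vs n)) \<le> 2 * real (length Ss) * k * \<eta>"
  proof -
    have one: "norm (bavg ?R (\<lambda>vs. box g (p # vs) n) - bavg ?R' (\<lambda>vs. box g (p # vs) n)) \<le> 2 * real (length Ss) * k * \<eta>" for p
    proof -
      define h where "h n = g (n + fst p) * cnj (g (n + snd p))" for n
      have "step_fun (3 * K * (3 * K)) (\<lambda>n. (\<lambda>(x, y). x * cnj y) (g (n + fst p), g (n + snd p)))"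
        by (rule step_fun_comp[OF step_fun_pair[OF step_fun_shift[OF Cons.prems(1)] step_fun_shift[OF Cons.prems(1)]]])
      then have st: "step_fun (3 * K * (3 * K)) h" unfolding h_def by simp
      have "norm (h n) \<le> 1" for n unfolding h_def using Cons.prems(2) by (simp add: norm_mult mult_le_one)
      then have "norm (bavg ?R (\<lambda>vs. box h vs n) - bavg ?R' (\<lambda>vs. box h vs n)) \<le>
          2 * real (length Ss) * stepk (3 * K * (3 * K)) (Suc (length Ss)) * \<eta>"
        using Cons.prems by (intro Cons.IH st) auto
      moreover have "box h vs n = box g (p # vs) n" for vs
        unfolding h_def using box_Cons_inner[of g "fst p" "snd p" vs n] by simp
      ultimately show ?thesis unfolding k_def stepk_Suc by simp
    qed
    have "0 < fib Y" using S(3) by (rule fib_neq_0_nat)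
    then show ?thesis by (intro bavg_fixed_head one) auto
  qed
  have "norm (bavg (S # ?R) (\<lambda>vs. box g vs n) - bavg (?S' # ?R') (\<lambda>vs. box g vs n)) \<le> 2 * (k * \<eta>) + 2 * real (length Ss) * k * \<eta>"
    by (rule norm_diff_triangle_le[OF A B])
  then show ?case unfolding k_def by (simp add: algebra_simps)
qed

text \<open>The first variable also absorbs the base point, because it is nearly uniform.\<close>

lemma bavg_equidist:
  assumes S: "equidist \<eta> S Y" and Ss: "list_all2 (equidist \<eta>) Ss Ys" and g: "step_fun K g" "\<And>n. norm (g n) \<le> 1"
    and eta: "0 \<le> \<eta>" and K: "1 \<le> K"
  shows "norm (bavg ((S # Ss) @ [L]) (\<lambda>vs. box g vs n) - bavg (map (\<lambda>Y. {..<fib Y}) (Y # Ys) @ [L]) (\<lambda>vs. box g vs 0))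
    \<le> 2 * real (Suc (length Ss)) * stepk K (Suc (Suc (length Ss))) * \<eta>"
proof -
  define k where "k = stepk K (Suc (Suc (length Ss)))"
  have A: "norm (bavg (S # Ss @ [L]) (\<lambda>vs. box g vs n) - bavg ({..<fib Y} # Ss @ [L]) (\<lambda>vs. box g vs 0)) \<le> 2 * (k * \<eta>)"
  proof (rule bavg_replace_head)
    fix vs assume "vs \<in> tups (Ss @ [L])"
    then have l: "length vs = Suc (length Ss)" using length_tups by fastforce
    obtain k' where k': "9 * k' \<le> (9 * K) ^ (2 ^ length vs)" "step_fun k' (\<lambda>n. box g vs n)"
      using step_fun_box[OF g(1)] by blast
    have "norm ((\<Sum>s\<in>S. box g vs (n + s)) / card S - (\<Sum>v<fib Y. box g vs v) / fib Y) \<le> k' * \<eta>"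
      by (rule equidistD[OF S k'(2)]) (intro norm_box_le g)
    also have "\<dots> \<le> k * \<eta>"
    proof (intro mult_right_mono of_nat_mono)
      have "stepk K (Suc (length Ss)) \<le> k" unfolding k_def by (intro stepk_mono K) simp
      then show "k' \<le> k" using k'(1) unfolding l stepk_def by linarith
    qed (use eta in simp)
    finally show "norm ((\<Sum>s\<in>S. box g vs (n + s)) / card S - (\<Sum>s<fib Y. box g vs (0 + s)) / card {..<fib Y}) \<le> k * \<eta>"
      by simp
  qed (use S in \<open>simp_all add: equidist_def g(2) eta\<close>)
  have B: "norm (bavg ({..<fib Y} # Ss @ [L]) (\<lambda>vs. box g vs 0) -
      bavg ({..<fib Y} # map (\<lambda>Y. {..<fib Y}) Ys @ [L]) (\<lambda>vs. box g vs 0)) \<le> 2 * real (length Ss) * k * \<eta>"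
  proof (rule bavg_fixed_head)
    have "0 < Y" using S by (simp add: equidist_def)
    then have "0 < fib Y" by (rule fib_neq_0_nat)
    then show "{..<fib Y} \<noteq> {}" by auto
    fix p :: "nat \<times> nat"
    define h where "h n = g (n + fst p) * cnj (g (n + snd p))" for n
    have "step_fun (3 * K * (3 * K)) (\<lambda>n. (\<lambda>(x, y). x * cnj y) (g (n + fst p), g (n + snd p)))"
      by (rule step_fun_comp[OF step_fun_pair[OF step_fun_shift[OF g(1)] step_fun_shift[OF g(1)]]])
    then have st: "step_fun (3 * K * (3 * K)) h" unfolding h_def by simp
    have "norm (h n) \<le> 1" for n unfolding h_def using g(2) by (simp add: norm_mult mult_le_one)
    then have "norm (bavg (Ss @ [L]) (\<lambda>vs. box h vs 0) - bavg (map (\<lambda>Y. {..<fib Y}) Ys @ [L]) (\<lambda>vs. box h vs 0)) \<le>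
        2 * real (length Ss) * stepk (3 * K * (3 * K)) (Suc (length Ss)) * \<eta>"
      using Ss eta K by (intro bavg_equidist_tail st) auto
    moreover have "box h vs n = box g (p # vs) n" for vs n
      unfolding h_def using box_Cons_inner[of g "fst p" "snd p" vs n] by simp
    ultimately show "norm (bavg (Ss @ [L]) (\<lambda>vs. box g (p # vs) 0) -
        bavg (map (\<lambda>Y. {..<fib Y}) Ys @ [L]) (\<lambda>vs. box g (p # vs) 0)) \<le> 2 * real (length Ss) * k * \<eta>"
      unfolding k_def stepk_Suc by simp
  qed simp
  have "norm (bavg (S # Ss @ [L]) (\<lambda>vs. box g vs n) - bavg ({..<fib Y} # map (\<lambda>Y. {..<fib Y}) Ys @ [L]) (\<lambda>vs. box g vs 0))
      \<le> 2 * (k * \<eta>) + 2 * real (length Ss) * k * \<eta>"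
    by (rule norm_diff_triangle_le[OF A B])
  then show ?thesis unfolding k_def by (simp add: algebra_simps)
qed

text \<open>The windows \<open>[la 0, \<infinity>)\<close>, \<open>[la 1, la 0)\<close>, \dots, \<open>[\<mu>, la (J - 1))\<close>, \<open>[0, \<mu>)\<close> partition the digits.\<close>

definition window :: "nat \<Rightarrow> (nat \<Rightarrow> nat) \<Rightarrow> nat \<Rightarrow> nat \<Rightarrow> nat set" where
  "window J la \<mu> j = (if j = 0 then {la 0..} else if j < J then {la j..<la (j - 1)} else {\<mu>..<la (J - 1)})"

lemma zexp_Un:
  assumes "A \<inter> B = {}"
  shows "zexp \<theta> (A \<union> B) n = zexp \<theta> A n * zexp \<theta> B n"
proof -
  have "zset n \<inter> (A \<union> B) = (zset n \<inter> A) \<union> (zset n \<inter> B)" by blast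
  moreover have "card ((zset n \<inter> A) \<union> (zset n \<inter> B)) = card (zset n \<inter> A) + card (zset n \<inter> B)"
    using assms zset_props(1) by (intro card_Un_disjoint) auto
  ultimately show ?thesis unfolding zexp_def by (simp add: distrib_left e2pi_add)
qed

lemma zexp_windows:
  assumes "1 \<le> J" and la: "\<And>j. Suc j < J \<Longrightarrow> la (Suc j) \<le> la j" and mu: "\<mu> \<le> la (J - 1)"
  shows "(\<Prod>j<Suc J. zexp \<theta> (window J la \<mu> j) n) * zexp \<theta> {..<\<mu>} n = e2pi (\<theta> * real (zeckendorf_sum n))"
proof -
  have top: "(\<Prod>j<Suc i. zexp \<theta> (window J la \<mu> j) n) = zexp \<theta> {la i..} n" if "i < J" for i
    using that
  proof (induction i)
    case 0
    then show ?case by (simp add: window_def)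
  next
    case (Suc i)
    have "{la (Suc i)..} = {la i..} \<union> {la (Suc i)..<la i}" using la[of i] Suc.prems by auto
    then have "zexp \<theta> {la (Suc i)..} n = zexp \<theta> {la i..} n * zexp \<theta> {la (Suc i)..<la i} n"
      by (simp only:) (rule zexp_Un, auto)
    then show ?case using Suc by (simp add: window_def)
  qed
  obtain i where J: "J = Suc i" using assms(1) by (cases J) auto
  have "(\<Prod>j<Suc J. zexp \<theta> (window J la \<mu> j) n) = zexp \<theta> {la i..} n * zexp \<theta> {\<mu>..<la i} n"
    using top[of i] J by (simp add: window_def)
  also have "\<dots> = zexp \<theta> ({la i..} \<union> {\<mu>..<la i}) n" by (rule zexp_Un[symmetric]) auto
  also have "\<dots> * zexp \<theta> {..<\<mu>} n = zexp \<theta> (({la i..} \<union> {\<mu>..<la i}) \<union> {..<\<mu>}) n"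
    using mu J by (intro zexp_Un[symmetric]) auto
  also have "({la i..} \<union> {\<mu>..<la i}) \<union> {..<\<mu>} = UNIV" using mu J by auto
  finally show ?thesis by (simp add: zexp_def zeckendorf_sum_eq_card)
qed

text \<open>The first \<open>J\<close> coordinates remove the windows above
  \<open>la (J - 1)\<close> by equidistributed multiples of \<open>d\<close>. The last one uses a
  multiple \<open>tJ\<close> that behaves like 1 below \<mu> and preserves the transitional window
  between \<mu> and \<open>la (J - 1)\<close>. What remains is a box average of the digits below
  \<mu> over uniform shifts.\<close>

lemma modulus_bound:
  fixes t :: "nat \<Rightarrow> nat" and tJ M Y' L d N N' J c :: nat
  assumes J: "1 \<le> J" and la: "\<And>j. Suc j < J \<Longrightarrow> la (Suc j) \<le> la j" and mu: "\<mu> \<le> la (J - 1)" "2 \<le> \<mu>"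
    and eq: "\<And>j. j < J \<Longrightarrow> equidist \<eta> ((\<lambda>m. m * t j) ` {..<M}) Y" and eta: "0 \<le> \<eta>"
    and t: "\<And>j. j < J \<Longrightarrow> \<exists>r. t j = r * d \<and> M * r \<le> L" and tJ: "\<exists>r. tJ = r * d \<and> fib Y' * r \<le> L" "0 < tJ"
    and N: "N' \<le> N" "0 < N" and M: "0 < M"
    and hit: "\<And>j m. j < J \<Longrightarrow> m < M \<Longrightarrow> hits d N {n. zexp \<theta> (window J la \<mu> j) (n + m * t j) \<noteq> zexp \<theta> (window J la \<mu> j) n} c"
    and hitJ: "\<And>m. m < fib Y' \<Longrightarrow> hits d N {n. zexp \<theta> {\<mu>..<la (J - 1)} (n + m * tJ) \<noteq> zexp \<theta> {\<mu>..<la (J - 1)} n} c"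
    and last: "\<And>m. m < fib Y' \<Longrightarrow> hits d N {n. zexp \<theta> {..<\<mu>} (n + m * tJ) \<noteq> zexp \<theta> {..<\<mu>} (n + m)} c"
    and W: "W = 6 * Suc J + 5" and B: "2 + B * W \<le> Y'" "Y' \<le> Y" "2 + B * W \<le> \<mu>"
  shows "(norm (\<Sum>n<N'. e2pi (\<theta> * real (zeckendorf_sum (a + n * d)))) / N) ^ (2 ^ Suc J) \<le>
    (1 - (2 - norm (1 + e2pi \<theta>)) / 2 ^ (2 * Suc J * W)) ^ B + 2 * real J * stepk (fib \<mu>) (Suc J) * \<eta>
    + 2 * (real (Suc J + 1) * 2 ^ Suc J * c) / N + 2 ^ Suc J * (4 * real L / real N)"
proof -
  define Ss where "Ss = map (\<lambda>j. (\<lambda>m. m * t j) ` {..<M}) [0..<J]"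
  define T where "T = (\<lambda>m. m * tJ) ` {..<fib Y'}"
  define g where "g = zexp \<theta> {..<\<mu>}"
  have Y0: "0 < fib Y'" using B by (intro fib_neq_0_nat) simp
  have lenS: "length Ss = J" by (simp add: Ss_def)
  have nth: "(Ss @ [T]) ! j = (if j < J then (\<lambda>m. m * t j) ` {..<M} else T)" if "j < Suc J" for j
    using that unfolding Ss_def by (auto simp: nth_append)
  have gs: "step_fun (fib \<mu>) g"
  proof -
    have "step_fun (fib \<mu>) (\<lambda>n. (\<lambda>A. e2pi (\<theta> * real (card A))) (zset n \<inter> {..<\<mu>}))"
      by (rule step_fun_comp[OF step_fun_low_digits[OF mu(2)]])
    then show ?thesis unfolding g_def zexp_def .
  qed
  have bound: "norm (bavg (Ss @ [{..<fib Y'}]) (\<lambda>vs. box g vs n)) \<le>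
      (1 - (2 - norm (1 + e2pi \<theta>)) / 2 ^ (2 * Suc J * W)) ^ B + 2 * real J * stepk (fib \<mu>) (Suc J) * \<eta>" for n
  proof -
    obtain j0 where j0: "J = Suc j0" using J by (cases J) auto
    define R where "R = map (\<lambda>j. (\<lambda>m. m * t j) ` {..<M}) [1..<J]"
    have SR: "Ss = (\<lambda>m. m * t 0) ` {..<M} # R" unfolding Ss_def R_def using J by (simp add: upt_conv_Cons)
    have lR: "length R = j0" unfolding R_def using j0 by simp
    have "R ! i = (\<lambda>m. m * t (Suc i)) ` {..<M}" if "i < j0" for i
      using that j0 unfolding R_def by (simp del: upt_Suc)
    then have "list_all2 (equidist \<eta>) R (replicate j0 Y)"
      unfolding list_all2_conv_all_nth using eq lR j0 by simp
    then have "norm (bavg (Ss @ [{..<fib Y'}]) (\<lambda>vs. box g vs n) - bavg (map (\<lambda>Y. {..<fib Y}) (Y # replicate j0 Y) @ [{..<fib Y'}]) (\<lambda>vs. box g vs 0))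
      \<le> 2 * real (Suc (length R)) * stepk (fib \<mu>) (Suc (Suc (length R))) * \<eta>"
      unfolding SR using eq[of 0] J eta gs mu fib_neq_0_nat[of \<mu>]
      by (intro bavg_equidist) (auto simp: g_def)
    moreover have "norm (bavg (map (\<lambda>Y. {..<fib Y}) (replicate J Y @ [Y'])) (\<lambda>vs. box (zexp \<theta> {..<\<mu>}) vs 0))
       \<le> (1 - (2 - norm (1 + e2pi \<theta>)) / 2 ^ (2 * Suc J * W)) ^ B"
      using J B W by (intro bavg_zexp_bound) auto
    moreover have "map (\<lambda>Y. {..<fib Y}) (Y # replicate j0 Y) @ [{..<fib Y'}] = map (\<lambda>Y. {..<fib Y}) (replicate J Y @ [Y'])"
      unfolding j0 by simp
    moreover have "norm x \<le> b + e" if "norm (x - y) \<le> e" "norm y \<le> b" for x y :: complex and b e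
      using that norm_triangle_sub[of x y] by linarith
    ultimately show ?thesis unfolding lR j0[symmetric] g_def[symmetric] by metis
  qed
  have "(norm (\<Sum>n<N'. (\<Prod>j<Suc J. zexp \<theta> (window J la \<mu> j) (a + n * d)) * g (a + n * d)) / N) ^ (2 ^ Suc J) \<le>
    ((1 - (2 - norm (1 + e2pi \<theta>)) / 2 ^ (2 * Suc J * W)) ^ B + 2 * real J * stepk (fib \<mu>) (Suc J) * \<eta>)
    + 2 * (real (Suc J + 1) * 2 ^ Suc J * c) / N + 2 ^ Suc J * (4 * real L / real N)"
  proof (rule box_reduction[where Ss = Ss and t = tJ and M = "fib Y'"])
    show "finite S \<and> S \<noteq> {} \<and> (\<forall>s\<in>S. \<exists>r\<le>L. s = r * d)" if S: "S \<in> set (Ss @ [(\<lambda>m. m * tJ) ` {..<fib Y'}])" for S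
    proof -
      have gen: "\<exists>r\<le>L. s = r * d" if s: "s = m * (r * d)" "m < X" "X * r \<le> L" for s m r X
      proof -
        have "m * r \<le> X * r" using s(2) by (intro mult_right_mono) auto
        then have "m * r \<le> L" using s(3) by (rule order_trans)
        then show ?thesis using s(1) by (intro exI[of _ "m * r"]) (simp add: mult.assoc)
      qed
      consider j where "j < J" "S = (\<lambda>m. m * t j) ` {..<M}" | "S = (\<lambda>m. m * tJ) ` {..<fib Y'}"
        using S unfolding Ss_def by auto
      then show ?thesis
      proof cases
        case 1
        then obtain r where r: "t j = r * d" "M * r \<le> L" using t by blast
        show ?thesis unfolding 1(2) using gen[OF _ _ r(2)] r(1) M by auto
      next
        case 2
        obtain r where r: "tJ = r * d" "fib Y' * r \<le> L" using tJ(1) by blast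
        show ?thesis unfolding 2 using gen[OF _ _ r(2)] r(1) Y0 by auto
      qed
    qed
    show "hits d N {n. zexp \<theta> (window J la \<mu> j) (n + s) \<noteq> zexp \<theta> (window J la \<mu> j) n} c"
      if j: "j < Suc J" and s: "s \<in> (Ss @ [(\<lambda>m. m * tJ) ` {..<fib Y'}]) ! j" for j s
    proof (cases "j < J")
      case True
      then show ?thesis using s nth[OF j] hit[OF True] unfolding T_def by auto
    next
      case False
      then have "window J la \<mu> j = {\<mu>..<la (J - 1)}" using j J by (simp add: window_def)
      then show ?thesis using False s nth[OF j] hitJ unfolding T_def by auto
    qed
    show "hits d N {n. g (n + m * tJ) \<noteq> g (n + m)} c" if "m < fib Y'" for m
      unfolding g_def by (rule last[OF that])
  qed (use N tJ lenS bound in \<open>auto simp: g_def\<close>)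
  moreover have "(\<Prod>j<Suc J. zexp \<theta> (window J la \<mu> j) n) * g n = e2pi (\<theta> * real (zeckendorf_sum n))" for n
    unfolding g_def using J la mu(1) by (rule zexp_windows)
  ultimately show ?thesis by (simp only:)
qed

section \<open>Exceptional moduli\<close>

definition bohr_hits :: "nat \<Rightarrow> nat \<Rightarrow> real \<Rightarrow> real \<Rightarrow> nat \<Rightarrow> bool" where
  "bohr_hits d N H t c \<longleftrightarrow> hits d N {n. bohr H t (int n)} c"

lemma bohr_hitsI:
  assumes "\<And>r. R1 \<le> r \<Longrightarrow> r \<le> R2 \<Longrightarrow> \<not> bohr (2 * H) (2 * t) (int (r * d))" "1 \<le> R1"
    and "(N div Suc R2 + 1) * R1 \<le> c"
  shows "bohr_hits d N H t c"
  unfolding bohr_hits_def hits_def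
  using card_bohr_progression[OF assms(1,2)] assms(3) by (auto intro: order_trans)

text \<open>For windows well above the shift the decomposition of the shift is trivial:
  \<open>w = 0\<close>, and the whole shift counts as small in size.\<close>

lemma hits_high_digits:
  assumes A: "A \<subseteq> {L..}" "1 \<le> L" and m: "m < M" and c: "bohr_hits d N (real M * real t) (2 * gi ^ L) c"
  shows "hits d N {n. zexp \<theta> A (n + m * t) \<noteq> zexp \<theta> A n} c"
  using c unfolding bohr_hits_def
proof (rule hits_mono)
  show "{n. zexp \<theta> A (n + m * t) \<noteq> zexp \<theta> A n} \<subseteq> {n. bohr (real M * real t) (2 * gi ^ L) (int n)}"
  proof (rule subsetI, rule ccontr)
    fix n assume n: "n \<in> {n. zexp \<theta> A (n + m * t) \<noteq> zexp \<theta> A n}" "n \<notin> {n. bohr (real M * real t) (2 * gi ^ L) (int n)}"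
    have "\<bar>real_of_int (int (m * t))\<bar> \<le> real M * real t" using m by (simp add: mult_right_mono)
    moreover have "gi ^ L * (1 + gi) + 0 \<le> 2 * gi ^ L" using gi_less_1 by simp
    ultimately have "\<not> bohr \<bar>real_of_int (int (m * t))\<bar> (gi ^ L * (1 + gi) + 0) (int n)"
      using n(2) bohr_mono by blast
    then have "zset (n + m * t) \<inter> {L..} = zset (n + 0) \<inter> {L..}"
      using A(2) by (intro high_digits_eq[where t = 0 and h = "int (m * t)"]) auto
    then have "zset (n + m * t) \<inter> A = zset n \<inter> A" using A(1) by auto
    then show False using n(1) by (simp add: zexp_def)
  qed
qed simp

text \<open>All multiples \<open>m * t\<close> with \<open>m < M\<close> are handled by one pair of
  Bohr sets, whose parameters are enlarged by the factor \<open>M\<close>.\<close>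

lemma hits_window:
  assumes dec: "int t = int w + h" and w: "near \<tau> (int w)" and L: "1 \<le> L" and m: "m < M"
    and small: "real M * \<tau> \<le> gi ^ L"
    and cA: "bohr_hits d N (real M * \<bar>of_int h\<bar>) (3 * gi ^ L) cA"
    and cB: "bohr_hits d N (real (fib (L' + 1))) (real M * \<tau>) cB"
  shows "hits d N {n. zexp \<theta> {L..<L'} (n + m * t) \<noteq> zexp \<theta> {L..<L'} n} (cA + cB)"
proof -
  have "hits d N ({n. bohr (real M * \<bar>of_int h\<bar>) (3 * gi ^ L) (int n)} \<union> {n. bohr (real (fib (L' + 1))) (real M * \<tau>) (int n)}) (cA + cB)"
    using cA cB unfolding bohr_hits_def by (rule hits_Un)
  then show ?thesis
  proof (rule hits_mono)
    show "{n. zexp \<theta> {L..<L'} (n + m * t) \<noteq> zexp \<theta> {L..<L'} n} \<subseteq>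
       {n. bohr (real M * \<bar>of_int h\<bar>) (3 * gi ^ L) (int n)} \<union> {n. bohr (real (fib (L' + 1))) (real M * \<tau>) (int n)}"
    proof (rule subsetI, rule ccontr)
      fix n assume n: "n \<in> {n. zexp \<theta> {L..<L'} (n + m * t) \<noteq> zexp \<theta> {L..<L'} n}"
        "n \<notin> {n. bohr (real M * \<bar>of_int h\<bar>) (3 * gi ^ L) (int n)} \<union> {n. bohr (real (fib (L' + 1))) (real M * \<tau>) (int n)}"
      have \<tau>0: "0 \<le> \<tau>" using w by (rule near_nonneg)
      have mM: "real m * \<tau> \<le> real M * \<tau>" using m \<tau>0 by (intro mult_right_mono) auto
      have nw: "near (real m * \<tau>) (int (m * w))" using near_mult[OF w, of m] by simp
      have "\<bar>real_of_int (int m * h)\<bar> \<le> real M * \<bar>of_int h\<bar>"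
        using m by (simp add: abs_mult mult_right_mono)
      moreover have "gi ^ L * (1 + gi) \<le> 2 * gi ^ L" using gi_less_1 by simp
      then have "gi ^ L * (1 + gi) + real m * \<tau> \<le> 3 * gi ^ L" using mM small by linarith
      ultimately have 1: "\<not> bohr \<bar>real_of_int (int m * h)\<bar> (gi ^ L * (1 + gi) + real m * \<tau>) (int n)"
        using n(2) bohr_mono by blast
      have 2: "\<not> bohr (fib (L' + 1)) (real m * \<tau>) (int n)" using n(2) mM bohr_mono[of _ "real m * \<tau>"] by blast
      have "int (n + m * t) = int n + int (m * w) + int m * h" using dec by (simp add: algebra_simps)
      then have "zset (n + m * t) \<inter> {L..<L'} = zset n \<inter> {L..<L'}"
        using nw L 1 2 by (rule window_digits_eq)
      then show False using n(1) by (simp add: zexp_def)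
    qed
  qed simp
qed

text \<open>Since \<open>w\<close> hardly moves the rotation, the shifts \<open>m * (1 + w)\<close>
  and \<open>m\<close> have the same effect on the low digits unless \<open>n + m\<close> is near a
  cut.\<close>

lemma hits_low_digits:
  assumes w: "near \<tau> (int w)" and m: "m < M"
    and cB: "bohr_hits d N (real (fib (L + 1))) (real M * \<tau>) c"
  shows "hits d N {n. zexp \<theta> {..<L} (n + m * (1 + w)) \<noteq> zexp \<theta> {..<L} (n + m)} c"
proof -
  have "hits d N {n. n + m \<in> {n. bohr (real (fib (L + 1))) (real M * \<tau>) (int n)}} c"
    using cB unfolding bohr_hits_def by (rule hits_shift)
  then show ?thesis
  proof (rule hits_mono)
    show "{n. zexp \<theta> {..<L} (n + m * (1 + w)) \<noteq> zexp \<theta> {..<L} (n + m)} \<subseteq>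
       {n. n + m \<in> {n. bohr (real (fib (L + 1))) (real M * \<tau>) (int n)}}"
    proof (rule subsetI, rule ccontr)
      fix n assume n: "n \<in> {n. zexp \<theta> {..<L} (n + m * (1 + w)) \<noteq> zexp \<theta> {..<L} (n + m)}"
        "n \<notin> {n. n + m \<in> {n. bohr (real (fib (L + 1))) (real M * \<tau>) (int n)}}"
      have \<tau>0: "0 \<le> \<tau>" using w by (rule near_nonneg)
      have mM: "real m * \<tau> \<le> real M * \<tau>" using m \<tau>0 by (intro mult_right_mono) auto
      have eq: "int (n + m * (1 + w)) - int (n + m) = int m * int w" by (simp add: algebra_simps)
      have nw: "near (real m * \<tau>) (int (n + m * (1 + w)) - int (n + m))" unfolding eq by (rule near_mult[OF w])
      have "\<not> bohr (fib (L + 1)) (real m * \<tau>) (int (n + m))" using n(2) mM bohr_mono[of _ "real m * \<tau>"] by blast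
      then have "zset (n + m * (1 + w)) \<inter> {..<L} = zset (n + m) \<inter> {..<L}"
        by (rule low_digits_eq[OF nw])
      then show False using n(1) by (simp add: zexp_def)
    qed
  qed simp
qed

section \<open>Suitable multiples of the modulus by Dirichlet approximation\<close>

lemma rat_approx_exists:
  fixes Q Q' t :: nat
  assumes "\<And>q. 1 \<le> q \<Longrightarrow> q \<le> Q \<Longrightarrow> \<not> near (1 / real Q') (int (q * t))" "0 < Q'"
  obtains q where "rat_approx t q" "Q < q" "q \<le> Q'"
proof -
  obtain h k where hk: "coprime h k" "0 < k" "k \<le> int Q'" "\<bar>of_int k * (real t * gi) - of_int h\<bar> < 1 / real Q'"
    by (rule Dirichlet_approx_coprime[OF assms(2)])
  define q where "q = nat k"
  have q: "int q = k" "0 < q" "q \<le> Q'" using hk unfolding q_def by auto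
  then have rk: "real_of_int k = real q" by linarith
  have "Q < q"
  proof (rule ccontr)
    assume "\<not> Q < q"
    then have "\<not> near (1 / real Q') (int (q * t))" using q by (intro assms(1)) auto
    moreover have "\<bar>of_int (int (q * t)) * gi - of_int h\<bar> \<le> 1 / real Q'"
      using hk(4) unfolding rk by (simp add: mult_ac)
    ultimately show False unfolding near_def by blast
  qed
  moreover have "rat_approx t q"
  proof -
    have "real t * gi - of_int h / q = (of_int k * (real t * gi) - of_int h) / q" unfolding rk using q by (simp add: field_simps)
    then have "\<bar>real t * gi - of_int h / q\<bar> = \<bar>of_int k * (real t * gi) - of_int h\<bar> / q" by (simp add: abs_divide)
    also have "\<dots> \<le> (1 / q) / q"
    proof (rule divide_right_mono)
      have "1 / real Q' \<le> 1 / q" using q by (intro divide_left_mono) auto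
      then show "\<bar>of_int k * (real t * gi) - of_int h\<bar> \<le> 1 / q" using hk(4) by linarith
    qed simp
    finally show ?thesis unfolding rat_approx_def using hk(1) q by (auto simp: power2_eq_square)
  qed
  ultimately show ?thesis using that q by blast
qed

text \<open>Simultaneous approximation of the two coordinates of a multiple of \<open>d\<close> in the lattice
  spanned by \<open>(fib k, gi ^ k)\<close> and \<open>(fib (k + 1), - gi ^ (k + 1))\<close>.\<close>

lemma bohr_multiple_exists:
  fixes K k d :: nat
  assumes "0 < K" "1 \<le> k"
  obtains r h where "1 \<le> r" "r \<le> K ^ 2" "\<bar>of_int h\<bar> \<le> 3 * gr ^ k / K" "near (2 * gi ^ k / K) (int (r * d) - h)"
proof -
  \<comment> \<open>These are the real coefficients of \<open>(d, 0)\<close> in the lattice basis,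
    \<open>\<alpha> 0\<close> belonging to \<open>fib (Suc k)\<close> and \<open>\<alpha> 1\<close>
    to \<open>fib k\<close>. Rounding their multiples by a common \<open>r\<close> to integers
    \<open>v\<close> and \<open>u\<close> gives a lattice point close to \<open>(r * d, 0)\<close>
    in both coordinates.\<close>
  define \<alpha> where "\<alpha> i = (if i = 0 then real d / gr ^ k else gi * real d / gr ^ k)" for i :: nat
  obtain q p where q: "0 < q" "q \<le> int (K ^ 2)" and ap: "\<And>i. i < 2 \<Longrightarrow> \<bar>of_int q * \<alpha> i - of_int (p i)\<bar> < 1 / K"
    using Dirichlet_approx_simult[OF assms(1), of 2 \<alpha>] by metis
  obtain j where j: "k = Suc j" using assms(2) by (cases k) auto
  define r where "r = nat q"
  have r: "1 \<le> r" "real_of_int q = real r" using q(1) unfolding r_def by auto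
  have rK: "r \<le> K ^ 2" using q(2) unfolding r_def by (simp only: nat_le_iff)
  define u v where "u = p 1" and "v = p 0"
  have au: "\<bar>real r * (gi * real d / gr ^ k) - of_int u\<bar> \<le> 1 / K" and av: "\<bar>real r * (real d / gr ^ k) - of_int v\<bar> \<le> 1 / K"
    using ap[of 1] ap[of 0] unfolding \<alpha>_def u_def v_def r(2) by auto
  define s where "s = real r * real d / gr ^ k"
  have gk: "0 < gr ^ k" using gr_bounds by simp
  have au: "\<bar>gi * s - of_int u\<bar> \<le> 1 / K" and av: "\<bar>s - of_int v\<bar> \<le> 1 / K"
    using au av unfolding s_def by (simp_all add: mult_ac)
  define h where "h = int (r * d) - (u * int (fib k) + v * int (fib (Suc k)))"
  have lin: "real (fib (Suc k)) + gi * real (fib k) = gr ^ k"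
  proof -
    have "gr ^ k = real (fib k) * (1 + gi) + real (fib j)" using gr_power_Suc[of j] unfolding j gr_eq .
    then show ?thesis unfolding j by (simp add: algebra_simps)
  qed
  have "real r * real d = s * gr ^ k" unfolding s_def using gr_bounds by auto
  also have "\<dots> = s * real (fib (Suc k)) + (gi * s) * real (fib k)" unfolding lin[symmetric] by (simp add: algebra_simps)
  finally have "of_int h = (s - of_int v) * real (fib (Suc k)) + (gi * s - of_int u) * real (fib k)"
    unfolding h_def by (simp add: algebra_simps)
  then have "\<bar>of_int h\<bar> \<le> \<bar>s - of_int v\<bar> * real (fib (Suc k)) + \<bar>gi * s - of_int u\<bar> * real (fib k)"
    using abs_triangle_ineq[of "(s - of_int v) * real (fib (Suc k))" "(gi * s - of_int u) * real (fib k)"]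
    by (simp add: abs_mult)
  also have "\<dots> \<le> (1 / K) * gr ^ k + (1 / K) * gr ^ k"
    using au av fib_Suc_le_gr_power[of k] fib_le_gr_power[of k] by (intro add_mono mult_mono) auto
  also have "\<dots> \<le> 3 * gr ^ k / K" using gk assms(1) by (simp add: field_simps)
  finally have hb: "\<bar>of_int h\<bar> \<le> 3 * gr ^ k / K" .
  have "near (2 * gi ^ k / K) (int (r * d) - h)"
  proof -
    define x where "x = of_int u * (- gi) ^ k + of_int v * (- gi) ^ Suc k"
    have "x = - of_int (int (r * d) - h) * gi + of_int (u * int (fib j) + v * int (fib k))"
    proof -
      have pk: "(- gi) ^ k = - real (fib k) * gi + real (fib j)" unfolding j by (rule neg_gi_power_Suc)
      show ?thesis unfolding x_def h_def pk neg_gi_power_Suc by (simp add: algebra_simps)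
    qed
    moreover have "\<bar>x\<bar> \<le> 2 * gi ^ k / K"
    proof -
      have "x = (- gi) ^ k * ((of_int u - gi * s) + gi * (s - of_int v))" unfolding x_def by (simp add: algebra_simps)
      then have "\<bar>x\<bar> = gi ^ k * \<bar>(of_int u - gi * s) + gi * (s - of_int v)\<bar>"
        using gi_pos by (simp add: abs_mult power_abs)
      also have "\<dots> \<le> gi ^ k * (1 / K + 1 * (1 / K))"
      proof (intro mult_left_mono order_trans[OF abs_triangle_ineq] add_mono)
        show "\<bar>gi * (s - of_int v)\<bar> \<le> 1 * (1 / K)"
          unfolding abs_mult using av gi_pos gi_less_1 by (intro mult_mono) auto
      qed (use au gi_pos in \<open>auto simp: abs_minus_commute\<close>)
      finally show ?thesis by (simp add: mult.commute)
    qed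
    ultimately show ?thesis by (rule nearI)
  qed
  then show ?thesis using that r(1) rK hb by blast
qed

text \<open>Approximate \<open>d * gi\<close> by \<open>p / q\<close> with \<open>Q < q\<close> and
  take \<open>r\<close> inverse to \<open>p\<close> modulo \<open>q\<close>, times the integer part
  of \<open>gi * q\<close>. Then \<open>r * d * gi\<close> is modulo 1 close to
  \<open>r * p / q\<close>, hence to \<open>gi\<close>. The two approximations cost
  \<open>1 / q\<close> each.\<close>

lemma unit_multiple_exists:
  fixes Q Q' d :: nat
  assumes bad: "\<And>q. 1 \<le> q \<Longrightarrow> q \<le> Q \<Longrightarrow> \<not> near (1 / real Q') (int (q * d))" and Q: "0 < Q'" "0 < Q" and d: "0 < d"
  obtains r where "1 \<le> r" "r \<le> Q'" "near (2 / Q) (int (r * d) - 1)"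
proof -
  obtain q where q: "rat_approx d q" "Q < q" "q \<le> Q'"
    using bad Q(1) by (rule rat_approx_exists)
  then obtain p where p: "0 < q" "coprime p (int q)" "\<bar>real d * gi - of_int p / q\<bar> \<le> 1 / q ^ 2"
    unfolding rat_approx_def by auto
  define x where "x = \<lfloor>gi * q\<rfloor>"
  obtain s where s: "[p * s = 1] (mod int q)" using cong_solve_coprime_int[OF p(2)] by blast
  \<comment> \<open>The residue 0 is represented by \<open>q\<close>, so that \<open>r\<close> is
    positive and the multiple of \<open>d\<close> does not vanish.\<close>
  define r where "r = (let r' = nat ((s * x) mod int q) in if r' = 0 then q else r')"
  have r1: "1 \<le> r" "r \<le> q"
    using p(1) pos_mod_bound[of "int q" "s * x"] unfolding r_def Let_def by (auto simp: nat_le_iff less_imp_le)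
  have "[int r = s * x] (mod int q)"
  proof (cases "(s * x) mod int q = 0")
    case True
    then have "r = q" unfolding r_def Let_def by simp
    then have "int r mod int q = 0" by simp
    then show ?thesis unfolding unique_euclidean_semiring_class.cong_def by (rule trans[OF _ sym[OF True]])
  next
    case False
    moreover have "0 \<le> (s * x) mod int q" using p(1) by simp
    ultimately have "int r = (s * x) mod int q" unfolding r_def Let_def by simp
    then show ?thesis unfolding cong_def by simp
  qed
  then have "[p * int r = p * (s * x)] (mod int q)" by (rule cong_scalar_left)
  moreover have "[(p * s) * x = 1 * x] (mod int q)" using s by (rule cong_scalar_right)
  ultimately have "[p * int r = x] (mod int q)" using cong_trans by (simp add: mult.assoc) blast
  then obtain k where k: "p * int r = x + int q * k" by (metis cong_iff_lin cong_sym)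
  have rq: "real_of_int p * real r / q = of_int x / q + of_int k"
  proof -
    have "real_of_int (p * int r) = of_int (x + int q * k)" using k by simp
    then show ?thesis using p(1) by (simp add: field_simps)
  qed
  have e1: "\<bar>real r * (real d * gi) - of_int p * real r / q\<bar> \<le> 1 / q"
  proof -
    have "real r * (real d * gi) - of_int p * real r / q = real r * (real d * gi - of_int p / q)"
      by (simp add: algebra_simps)
    then have "\<bar>real r * (real d * gi) - of_int p * real r / q\<bar> = real r * \<bar>real d * gi - of_int p / q\<bar>"
      by (simp add: abs_mult)
    also have "\<dots> \<le> real q * (1 / q ^ 2)" using r1 p(3) by (intro mult_mono) auto
    finally show ?thesis using p(1) by (simp add: power2_eq_square)
  qed
  have e2: "\<bar>of_int x / q - gi\<bar> \<le> 1 / q"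
  proof -
    have "\<bar>of_int x - gi * q\<bar> \<le> 1" unfolding x_def by linarith
    then have "\<bar>of_int x - gi * q\<bar> / q \<le> 1 / q" by (intro divide_right_mono) auto
    moreover have "of_int x / q - gi = (of_int x - gi * q) / q" using p(1) by (simp add: field_simps)
    ultimately show ?thesis by (simp add: abs_divide)
  qed
  have "\<bar>of_int (int (r * d) - 1) * gi - of_int k\<bar> \<le> 2 / q"
  proof -
    have "of_int (int (r * d) - 1) * gi - of_int k =
       (real r * (real d * gi) - of_int p * real r / q) + (of_int x / q - gi)" unfolding rq by (simp add: algebra_simps)
    then show ?thesis using e1 e2 by linarith
  qed
  also have "2 / real q \<le> 2 / Q" using q(2) Q by (intro divide_left_mono) auto
  finally have "near (2 / Q) (int (r * d) - 1)" unfolding near_def by blast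
  then show ?thesis using that r1 q(3) by force
qed

text \<open>All parameters are powers of \<open>zz = fib l\<close>, which will be a small power of \<open>x\<close>; the exponent
  \<open>E\<close> is so large that \<open>Z = zz ^ E\<close> dominates the number of cells of the step functions in play.\<close>

locale scales =
  fixes J E l zz Z :: nat
  assumes J: "1 \<le> J" and E: "E = 2 ^ (J + 8)" and l: "1 \<le> l"
    and zz: "zz = fib l" and Z: "Z = zz ^ E"
    and large: "10 ^ 8 * 3 ^ (40 * E) * (J + 1) \<le> zz"
begin

text \<open>Consecutive boundaries differ by \<open>E * l\<close> digits, a factor of about
  \<open>Z\<close> in size. They descend from \<open>(39 + J) * E * l\<close>, above all relevant
  moduli, to \<open>40 * E * l\<close> at \<open>J - 1\<close>.\<close>

definition la :: "nat \<Rightarrow> nat" where "la j = (39 + J - j) * E * l"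

text \<open>A compromise: \<open>gr ^ mu\<close> must exceed the powers of \<open>zz\<close> lost at
  this boundary, while \<open>fib mu\<close>, the number of cells of the low digits, must stay below
  \<open>Z\<close> after being raised to the power \<open>2 ^ Suc J\<close>.\<close>

definition mu :: nat where "mu = 10 * l"

definition above :: "nat \<Rightarrow> nat" where "above j = la (j - 1)"

text \<open>Says that the window begins below about the size of the modulus, so that
  \<open>d\<close> itself is too large a shift for it. The margin \<open>Z ^ 16\<close> outweighs
  the losses \<open>Z ^ 6\<close> (number of shifts) and \<open>Z ^ 8\<close> (range of
  \<open>r\<close>) in counting exceptional moduli at the other windows.\<close>

definition small_level :: "nat \<Rightarrow> nat \<Rightarrow> bool" where
  "small_level D j \<longleftrightarrow> gr ^ la j < real Z ^ 16 * real D"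

text \<open>In order: the multiples of \<open>d\<close> are equidistributed; a multiple close to 1
  on the circle exists; at small levels every candidate multiple from
  \<open>bohr_multiple_exists\<close> is equidistributed, where all candidates are quantified
  because the one found depends on \<open>d\<close>; carries are rare for the windows above
  \<open>d\<close>; they are rare at both ends of the windows at small levels; and they are rare for
  the last shift at \<open>mu\<close> and at \<open>la (J - 1)\<close>. The ranges of
  \<open>r\<close> start at the permitted cluster length, and dividing by their end gives the
  permitted density.\<close>

definition good :: "nat \<Rightarrow> nat \<Rightarrow> bool" where
  "good D d \<longleftrightarrow>
    (\<forall>q. 1 \<le> q \<and> q \<le> Z \<longrightarrow> \<not> near (1 / real (Z ^ 5)) (int (q * d))) \<and>
    (\<forall>q. 1 \<le> q \<and> q \<le> Z ^ 84 \<longrightarrow> \<not> near (1 / real (Z ^ 86)) (int (q * d))) \<and>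
    (\<forall>j<J. small_level D j \<longrightarrow> (\<forall>r h q. 1 \<le> r \<and> r \<le> Z ^ 70 \<and> \<bar>real_of_int h\<bar> \<le> 3 * gr ^ above j / real (Z ^ 35) \<and>
        near (2 * gi ^ above j / real (Z ^ 35)) (int (r * d) - h) \<and> 1 \<le> q \<and> q \<le> Z \<longrightarrow>
        \<not> near (1 / real (Z ^ 5)) (int (q * (r * d))))) \<and>
    (\<forall>j<J. \<not> small_level D j \<longrightarrow> (\<forall>r. Z ^ 7 \<le> r \<and> r \<le> Z ^ 8 \<longrightarrow>
        \<not> bohr (2 * (2 * real (Z ^ 6) * D)) (2 * (2 * gi ^ la j)) (int (r * d)))) \<and>
    (\<forall>j<J. small_level D j \<longrightarrow> (\<forall>r. Z ^ 18 \<le> r \<and> r \<le> Z ^ 19 \<longrightarrow>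
        \<not> bohr (2 * (3 * gr ^ above j / real (Z ^ 29))) (2 * (3 * gi ^ la j)) (int (r * d)) \<and>
        \<not> bohr (2 * real (fib (above j + 1))) (2 * (2 * gi ^ above j / real (Z ^ 29))) (int (r * d)))) \<and>
    (\<forall>r. zz ^ 2 \<le> r \<and> r \<le> zz ^ 3 \<longrightarrow> \<not> bohr (2 * real zz) (2 * (3 * gi ^ mu)) (int (r * d))) \<and>
    (\<forall>r. Z ^ 41 \<le> r \<and> r \<le> Z ^ 42 \<longrightarrow>
        \<not> bohr (2 * real (fib (la (J - 1) + 1))) (2 * (2 * real zz / real (Z ^ 84))) (int (r * d)))"

section \<open>Comparison of the scales \<open>zz\<close>, \<open>Z\<close> and powers of the golden
  ratio\<close>

lemma E_ge: "512 \<le> E"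
proof -
  have "(2::nat) ^ 9 \<le> 2 ^ (J + 8)" using J by (intro power_increasing) auto
  then show ?thesis unfolding E by simp
qed

lemma zz_large: "10 ^ 8 \<le> zz" "3 ^ (40 * E) \<le> zz" "J \<le> zz"
proof -
  have p: "1 \<le> (3::nat) ^ (40 * E)" "(1::nat) \<le> 10 ^ 8" "1 \<le> J + 1" by simp_all
  have "10 ^ 8 * 1 * 1 \<le> 10 ^ 8 * 3 ^ (40 * E) * (J + 1)" by (intro mult_le_mono p order_refl)
  then show "10 ^ 8 \<le> zz" using large by simp
  have "1 * 3 ^ (40 * E) * 1 \<le> 10 ^ 8 * 3 ^ (40 * E) * (J + 1)" by (intro mult_le_mono p order_refl)
  then show "3 ^ (40 * E) \<le> zz" using large by simp
  have "1 * 1 * (J + 1) \<le> 10 ^ 8 * 3 ^ (40 * E) * (J + 1)" by (intro mult_le_mono p order_refl)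
  then show "J \<le> zz" using large by simp
qed

lemma zz_le_Z: "zz \<le> Z" and zz_power_le_Z: "a \<le> E \<Longrightarrow> zz ^ a \<le> Z"
proof -
  show p: "a \<le> E \<Longrightarrow> zz ^ a \<le> Z" for a unfolding Z using zz_large by (intro power_increasing) auto
  show "zz \<le> Z" using p[of 1] E_ge by simp
qed

lemma zz_power_le_real_Z: "a \<le> E \<Longrightarrow> real zz ^ a \<le> real Z"
  using of_nat_mono[OF zz_power_le_Z, of a, where 'a = real] by (simp only: of_nat_power)

lemma Z_large: "10 ^ 8 \<le> Z" "3 ^ (40 * E) \<le> Z"
  using zz_large zz_le_Z by linarith+

lemma zz_pos: "0 < zz" "1 \<le> zz"
proof -
  have "0 < (10::nat) ^ 8" by simp
  then show "0 < zz" using zz_large(1) by (rule less_le_trans)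
  then show "1 \<le> zz" by simp
qed

lemma Z_pos: "0 < Z" "1 \<le> Z"
  using zz_pos zz_le_Z by linarith+

lemma Z_power_mono: "a \<le> b \<Longrightarrow> real Z ^ a \<le> real Z ^ b"
  using Z_pos by (intro power_increasing) auto

lemma gr_l: "real zz \<le> gr ^ l" "gr ^ l \<le> 3 * real zz"
proof -
  show "real zz \<le> gr ^ l" unfolding zz by (rule fib_le_gr_power)
  obtain j where j: "l = Suc j" using l by (cases l) auto
  have "fib (l + 2) = fib l + fib l + fib j" unfolding j by simp
  moreover have "fib j \<le> fib l" unfolding j by (rule fib_Suc_mono)
  ultimately have "fib (l + 2) \<le> 3 * fib l" by simp
  then have "real (fib (l + 2)) \<le> 3 * real zz" unfolding zz by linarith
  then show "gr ^ l \<le> 3 * real zz" using gr_power_le_fib[of l] by linarith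
qed

lemma gr_pow_bounds: "real zz ^ k \<le> gr ^ (k * l)" "gr ^ (k * l) \<le> 3 ^ k * real zz ^ k"
proof -
  have "gr ^ (k * l) = (gr ^ l) ^ k" by (simp add: power_mult[symmetric] mult.commute)
  then show "real zz ^ k \<le> gr ^ (k * l)" "gr ^ (k * l) \<le> 3 ^ k * real zz ^ k"
    using power_mono[OF gr_l(1), of k] power_mono[OF gr_l(2), of k] gr_bounds
    by (simp_all add: power_mult_distrib)
qed

lemma gr_Z_bounds: "real Z ^ k \<le> gr ^ (k * E * l)" "gr ^ (k * E * l) \<le> 3 ^ (k * E) * real Z ^ k"
  using gr_pow_bounds[of "k * E"] unfolding Z by (simp_all add: power_mult[symmetric] mult.commute)

lemma above_eq: "0 < j \<Longrightarrow> j < J \<Longrightarrow> above j = la j + E * l"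
proof -
  assume j: "0 < j" "j < J"
  then have "39 + J - (j - 1) = Suc (39 + J - j)" by simp
  then show ?thesis unfolding above_def la_def by (simp add: algebra_simps)
qed

lemma gr_above:
  assumes "0 < j" "j < J"
  shows "gr ^ above j \<le> 3 ^ E * real Z * gr ^ la j" "real Z ^ 40 \<le> gr ^ above j" "gi ^ above j \<le> gi ^ la j"
proof -
  have e: "above j = la j + E * l" using assms by (rule above_eq)
  have "gr ^ above j = gr ^ (1 * E * l) * gr ^ la j" unfolding e by (simp add: power_add)
  also have "\<dots> \<le> (3 ^ (1 * E) * real Z ^ 1) * gr ^ la j"
    using gr_bounds by (intro mult_right_mono gr_Z_bounds) simp
  finally show "gr ^ above j \<le> 3 ^ E * real Z * gr ^ la j" by simp
  have "real Z ^ 40 \<le> real Z ^ (39 + J - (j - 1))" using assms by (intro Z_power_mono) simp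
  also have "\<dots> \<le> gr ^ above j" unfolding above_def la_def by (rule gr_Z_bounds)
  finally show "real Z ^ 40 \<le> gr ^ above j" .
  show "gi ^ above j \<le> gi ^ la j" unfolding e using gi_pos gi_less_1 by (intro power_decreasing) auto
qed

text \<open>The top window starts at size at least \<open>Z ^ (39 + J)\<close>, beyond
  \<open>Z ^ 16 * D\<close>. Hence a window at a small level always has an upper end.\<close>

lemma small_level_pos:
  assumes "small_level D j" "j < J" "real D \<le> real Z ^ (22 + J)"
  shows "0 < j"
proof (rule ccontr)
  assume "\<not> 0 < j"
  then have "la j = (39 + J) * E * l" by (simp add: la_def)
  then have "real Z ^ (39 + J) \<le> gr ^ la j" using gr_Z_bounds(1)[of "39 + J"] by simp
  also have "\<dots> < real Z ^ 16 * real D" using assms(1) by (simp add: small_level_def)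
  also have "\<dots> \<le> real Z ^ 16 * real Z ^ (22 + J)" using assms(3) by (intro mult_left_mono) auto
  also have "\<dots> \<le> real Z ^ (39 + J)" unfolding power_add[symmetric] by (intro Z_power_mono) simp
  finally show False by simp
qed

lemma real_3E_le_Z: "(3::real) ^ E * 10 ^ 8 \<le> real Z"
proof -
  have "(3::nat) ^ E * 10 ^ 8 \<le> 10 ^ 8 * 3 ^ (40 * E) * (J + 1)"
  proof -
    have "(3::nat) ^ E \<le> 3 ^ (40 * E)" by (intro power_increasing) auto
    then have "10 ^ 8 * (3::nat) ^ E * 1 \<le> 10 ^ 8 * 3 ^ (40 * E) * (J + 1)" by (intro mult_le_mono) auto
    then show ?thesis by (simp add: mult.commute)
  qed
  then have "3 ^ E * 10 ^ 8 \<le> Z" using large zz_le_Z by linarith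
  then have "real (3 ^ E * 10 ^ 8) \<le> real Z" by (rule of_nat_mono)
  then show ?thesis by simp
qed

lemma small_level_bound:
  assumes "small_level D j" "0 < j" "j < J"
  shows "gr ^ above j * 10 ^ 8 \<le> real Z ^ 18 * real D"
proof -
  have "gr ^ above j * 10 ^ 8 \<le> (3 ^ E * 10 ^ 8) * real Z * gr ^ la j"
    using gr_above(1)[OF assms(2,3)] by simp
  also have "\<dots> \<le> real Z * real Z * (real Z ^ 16 * real D)"
    using real_3E_le_Z assms(1) gr_bounds unfolding small_level_def by (intro mult_mono) auto
  also have "\<dots> = real Z ^ 18 * real D" by (simp add: power_add[symmetric] power2_eq_square[symmetric] mult.assoc[symmetric] flip: power_Suc)
  finally show ?thesis .
qed

text \<open>Clusters of length \<open>R\<close> once in \<open>R * s\<close> terms have density at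
  most \<open>1 / zz\<close>. The summand \<open>Z ^ 42\<close> accounts for one incomplete period
  and covers all choices of \<open>R\<close>.\<close>

lemma bohr_hits_good:
  assumes sep: "\<And>r. R \<le> r \<Longrightarrow> r \<le> R * s \<Longrightarrow> \<not> bohr (2 * H) (2 * t) (int (r * d))"
    and "zz \<le> s" "1 \<le> R" "R \<le> Z ^ 42"
  shows "bohr_hits d N H t (N div zz + Z ^ 42)"
proof (rule bohr_hitsI[of R "R * s"])
  show "\<not> bohr (2 * H) (2 * t) (int (r * d))" if "R \<le> r" "r \<le> R * s" for r using that by (rule sep)
  have s0: "0 < s" using assms(2) zz_pos by simp
  have "N div Suc (R * s) \<le> N div (s * R)" using assms(3) s0 by (intro div_le_mono2) (auto simp: mult.commute)
  also have "\<dots> = N div s div R" by (rule div_mult2_eq)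
  finally have "N div Suc (R * s) * R \<le> N div s div R * R" by (rule mult_right_mono) simp
  also have "\<dots> \<le> N div s" by simp
  also have "\<dots> \<le> N div zz" using assms(2) zz_pos by (intro div_le_mono2)
  finally show "(N div Suc (R * s) + 1) * R \<le> N div zz + Z ^ 42" using assms(4) by simp
qed fact

lemma bohr_hits_mono: "bohr_hits d N H t c \<Longrightarrow> H' \<le> H \<Longrightarrow> t' \<le> t \<Longrightarrow> c \<le> c' \<Longrightarrow> bohr_hits d N H' t' c'"
  unfolding bohr_hits_def by (erule hits_mono) (auto intro: bohr_mono)

text \<open>A denominator between \<open>Z\<close> and \<open>Z ^ 5\<close> and \<open>Z ^ 6\<close>
  multiples give the errors \<open>6 / Z + 1 / Z\<close>. The model average adds
  \<open>6 / Z\<close>, because \<open>fib (E * l + 2)\<close> is at least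
  \<open>gr ^ (E * l)\<close> and so at least \<open>Z\<close>.\<close>

lemma equidist_good:
  assumes near: "\<And>q. 1 \<le> q \<Longrightarrow> q \<le> Z \<Longrightarrow> \<not> near (1 / real (Z ^ 5)) (int (q * t))" and t: "0 < t"
  shows "equidist (13 / Z) ((\<lambda>m. m * t) ` {..<Z ^ 6}) (E * l + 2)"
proof -
  have Z5: "0 < Z ^ 5" "0 < Z ^ 6" using Z_pos by simp_all
  obtain q where q: "rat_approx t q" "Z < q" "q \<le> Z ^ 5"
    using near Z5(1) by (rule rat_approx_exists)
  have "real Z ^ 1 \<le> real (fib (E * l + 2))"
    using gr_Z_bounds(1)[of 1] gr_power_le_fib[of "E * l"] by simp
  then have a: "6 / real (fib (E * l + 2)) \<le> 6 / Z" using Z_pos by (intro divide_left_mono) auto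
  have b: "6 / real q \<le> 6 / Z" using q Z_pos by (intro divide_left_mono) auto
  have "real q \<le> real (Z ^ 5)" using q(3) by (rule of_nat_mono)
  then have "real q / real (Z ^ 6) \<le> real (Z ^ 5) / real (Z ^ 6)" by (intro divide_right_mono) auto
  also have "\<dots> = 1 / Z" using Z_pos by (simp add: field_simps flip: power_Suc)
  finally have c: "real q / real (Z ^ 6) \<le> 1 / Z" .
  show ?thesis
    by (rule equidist_multiples[OF q(1) Z5(2) _ t]) (use a b c in auto)
qed

text \<open>A window above the modulus uses the shift \<open>d\<close> itself. At a small level,
  \<open>bohr_multiple_exists\<close> at the upper end of the window with \<open>K = Z ^ 35\<close>
  supplies a multiple whose errors remain small after multiplication by the \<open>Z ^ 6\<close>
  factors \<open>m\<close>.\<close>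

lemma good_shift:
  assumes good: "good D d" and d: "D \<le> d" "d < 2 * D" and DZ: "real D \<le> real Z ^ (22 + J)" and j: "j < J"
  shows "\<exists>t. (\<exists>r. t = r * d \<and> Z ^ 6 * r \<le> Z ^ 87) \<and> equidist (13 / Z) ((\<lambda>m. m * t) ` {..<Z ^ 6}) (E * l + 2) \<and>
    (\<forall>m<Z ^ 6. hits d N {n. zexp \<theta> (window J la mu j) (n + m * t) \<noteq> zexp \<theta> (window J la mu j) n} (2 * (N div zz + Z ^ 42)))"
proof (cases "small_level D j")
  case False
  have D0: "0 < d" using d by simp
  have laj: "1 \<le> la j" using j l E_ge unfolding la_def by (simp add: Suc_le_eq)
  have "Z ^ 7 * Z = Z ^ 8" by (simp flip: power_Suc2)
  then have "bohr_hits d N (2 * real (Z ^ 6) * D) (2 * gi ^ la j) (N div zz + Z ^ 42)"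
    using good j False zz_le_Z Z_pos unfolding good_def
    by (intro bohr_hits_good[of "Z ^ 7" Z]) (auto intro: power_increasing)
  moreover have "real (Z ^ 6) * real d \<le> 2 * real (Z ^ 6) * D"
    using mult_left_mono[of "real d" "2 * real D" "real (Z ^ 6)"] d by simp
  ultimately have c: "bohr_hits d N (real (Z ^ 6) * real d) (2 * gi ^ la j) (2 * (N div zz + Z ^ 42))"
    by (elim bohr_hits_mono) auto
  have "hits d N {n. zexp \<theta> (window J la mu j) (n + m * d) \<noteq> zexp \<theta> (window J la mu j) n} (2 * (N div zz + Z ^ 42))"
    if "m < Z ^ 6" for m
    using _ laj that c by (rule hits_high_digits) (use j in \<open>auto simp: window_def\<close>)
  moreover have "equidist (13 / Z) ((\<lambda>m. m * d) ` {..<Z ^ 6}) (E * l + 2)"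
    using good D0 unfolding good_def by (intro equidist_good) auto
  moreover have "Z ^ 6 * 1 \<le> Z ^ 87" using Z_pos by (simp add: power_increasing)
  ultimately show ?thesis by (intro exI[of _ d]) auto
next
  case True
  have j0: "0 < j" using True j DZ by (rule small_level_pos)
  have laj: "1 \<le> la j" "1 \<le> above j" using j l E_ge unfolding la_def above_def by (simp_all add: Suc_le_eq)
  have D0: "0 < D" using d by simp
  have Z35: "0 < Z ^ 35" using Z_pos by simp
  obtain r h where r: "1 \<le> r" "r \<le> (Z ^ 35) ^ 2" and h: "\<bar>of_int h\<bar> \<le> 3 * gr ^ above j / real (Z ^ 35)"
    and w: "near (2 * gi ^ above j / real (Z ^ 35)) (int (r * d) - h)"
    by (rule bohr_multiple_exists[OF Z35 laj(2)])
  have r70: "r \<le> Z ^ 70" using r(2) by (simp add: power_mult[symmetric])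
  have small: "gr ^ above j * 10 ^ 8 \<le> real Z ^ 18 * real D" by (rule small_level_bound[OF True j0 j])
  \<comment> \<open>This makes \<open>h\<close> smaller than \<open>D\<close>, hence than
    \<open>r * d\<close>, so that the near part \<open>r * d - h\<close> is a natural number as
    \<open>hits_window\<close> demands.\<close>
  have "3 * gr ^ above j / real (Z ^ 35) < real D"
  proof -
    have "0 < gr ^ above j" using gr_bounds by simp
    moreover have "gr ^ above j * 100000000 \<le> real Z ^ 18 * real D" using small by simp
    ultimately have "3 * gr ^ above j < real Z ^ 18 * real D" by linarith
    also have "\<dots> \<le> real Z ^ 35 * real D" by (intro mult_right_mono Z_power_mono) auto
    finally show ?thesis using Z_pos by (simp add: divide_less_eq mult.commute)
  qed
  then have "real_of_int h < real D" using h by linarith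
  then have "h < int D" by linarith
  moreover have "int D \<le> int (r * d)"
  proof -
    have "D \<le> r * d" using r(1) d mult_le_mono[of 1 r D d] by simp
    then show ?thesis by (simp only: of_nat_le_iff)
  qed
  ultimately have "0 \<le> int (r * d) - h" by linarith
  then obtain v where v: "int v = int (r * d) - h" by (metis nonneg_int_cases)
  have dec: "int (r * d) = int v + h" using v by simp
  have nv: "near (2 * gi ^ above j / real (Z ^ 35)) (int v)" using w v by simp
  have Z29: "real (Z ^ 6) * (x / real (Z ^ 35)) = x / real (Z ^ 29)" for x
  proof -
    have "real (Z ^ 35) = real (Z ^ 6) * real (Z ^ 29)" by (simp add: power_add[symmetric])
    then show ?thesis using Z_pos by (simp add: field_simps del: of_nat_power)
  qed
  have Zbig: "2 \<le> real (Z ^ 29)"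
  proof -
    have "(2::real) \<le> real Z ^ 1" using Z_large by simp
    also have "\<dots> \<le> real Z ^ 29" by (rule Z_power_mono) simp
    finally show ?thesis by simp
  qed
  have M\<tau>: "real (Z ^ 6) * (2 * gi ^ above j / real (Z ^ 35)) \<le> gi ^ la j"
  proof -
    have "2 * gi ^ above j / real (Z ^ 29) \<le> gi ^ above j"
      using Zbig mult_left_mono[of 2 "real (Z ^ 29)" "gi ^ above j"] gi_pos by (simp add: divide_le_eq mult.commute)
    then show ?thesis unfolding Z29 using gr_above(3)[OF j0 j] by linarith
  qed
  have ZZ: "Z ^ 18 * Z = Z ^ 19" "1 \<le> Z ^ 18" "Z ^ 18 \<le> Z ^ 42" using Z_pos by (simp_all flip: power_Suc2 add: power_increasing)
  have A: "bohr_hits d N (3 * gr ^ above j / real (Z ^ 29)) (3 * gi ^ la j) (N div zz + Z ^ 42)"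
    using good j True zz_le_Z ZZ unfolding good_def by (intro bohr_hits_good[of "Z ^ 18" Z]) auto
  have Mh: "real (Z ^ 6) * \<bar>of_int h\<bar> \<le> 3 * gr ^ above j / real (Z ^ 29)"
    using mult_left_mono[OF h, of "real (Z ^ 6)"] unfolding Z29 by simp
  have cA: "bohr_hits d N (real (Z ^ 6) * \<bar>of_int h\<bar>) (3 * gi ^ la j) (N div zz + Z ^ 42)"
    by (rule bohr_hits_mono[OF A Mh]) auto
  have cB: "bohr_hits d N (real (fib (above j + 1))) (real (Z ^ 6) * (2 * gi ^ above j / real (Z ^ 35))) (N div zz + Z ^ 42)"
    unfolding Z29 using good j True zz_le_Z ZZ unfolding good_def by (intro bohr_hits_good[of "Z ^ 18" Z]) auto
  have win: "window J la mu j = {la j..<above j}" using j j0 by (simp add: window_def above_def)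
  have "hits d N {n. zexp \<theta> (window J la mu j) (n + m * (r * d)) \<noteq> zexp \<theta> (window J la mu j) n} (2 * (N div zz + Z ^ 42))"
    if "m < Z ^ 6" for m
    using hits_window[OF dec nv laj(1) that M\<tau> cA cB] unfolding win by (simp only: mult_2)
  moreover have "equidist (13 / Z) ((\<lambda>m. m * (r * d)) ` {..<Z ^ 6}) (E * l + 2)"
  proof (rule equidist_good)
    show "0 < r * d" using r(1) d by simp
    show "\<not> near (1 / real (Z ^ 5)) (int (q * (r * d)))" if "1 \<le> q" "q \<le> Z" for q
      using good j True r(1) r70 h w that unfolding good_def by blast
  qed
  moreover have "Z ^ 6 * r \<le> Z ^ 87"
  proof -
    have "Z ^ 6 * r \<le> Z ^ 6 * Z ^ 70" by (intro mult_left_mono r70) simp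
    also have "\<dots> = Z ^ 76" by (simp add: power_add[symmetric])
    also have "\<dots> \<le> Z ^ 87" using Z_pos by (intro power_increasing) auto
    finally show ?thesis .
  qed
  ultimately show ?thesis by (intro exI[of _ "r * d"] conjI exI[of _ r] allI impI refl; blast)
qed

text \<open>The multiple is written \<open>1 + w\<close> with \<open>w\<close> near 0. Thus
  \<open>h = 1\<close>, and multiples by \<open>m < zz\<close> have size error at most
  \<open>zz\<close>, which is negligible against the digits from \<open>mu\<close> on.\<close>

lemma good_last_shift:
  assumes good: "good D d" and d: "0 < d"
  shows "\<exists>t. 0 < t \<and> (\<exists>r. t = r * d \<and> fib l * r \<le> Z ^ 87) \<and>
    (\<forall>m<fib l. hits d N {n. zexp \<theta> {mu..<la (J - 1)} (n + m * t) \<noteq> zexp \<theta> {mu..<la (J - 1)} n} (2 * (N div zz + Z ^ 42)) \<and>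
       hits d N {n. zexp \<theta> {..<mu} (n + m * t) \<noteq> zexp \<theta> {..<mu} (n + m)} (2 * (N div zz + Z ^ 42)))"
proof -
  have Zp: "0 < Z ^ 86" "0 < Z ^ 84" using Z_pos by simp_all
  obtain r where r: "1 \<le> r" "r \<le> Z ^ 86" "near (2 / real (Z ^ 84)) (int (r * d) - 1)"
  proof (rule unit_multiple_exists[of "Z ^ 84" "Z ^ 86" d])
    show "\<not> near (1 / real (Z ^ 86)) (int (q * d))" if "1 \<le> q" "q \<le> Z ^ 84" for q
      using good that unfolding good_def by blast
  qed (use Zp d in auto)
  have rd: "0 < r * d" using r(1) d by simp
  then obtain w where w: "r * d = 1 + w" by (metis Suc_pred' plus_1_eq_Suc)
  have nw: "near (2 / real (Z ^ 84)) (int w)" using r(3) unfolding w by simp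
  have dec: "int (r * d) = int w + 1" using w by simp
  have M\<tau>: "real zz * (2 / real (Z ^ 84)) \<le> gi ^ mu"
  proof -
    have "2 * real zz * gr ^ mu \<le> 2 * real zz * (3 ^ 10 * real zz ^ 10)"
      using gr_pow_bounds(2)[of 10] unfolding mu_def by (intro mult_left_mono) auto
    also have "\<dots> = (2 * 3 ^ 10) * real zz ^ 11" by (simp flip: power_Suc)
    also have "\<dots> \<le> real zz * real zz ^ 11" using zz_large(1) by (intro mult_right_mono) auto
    also have "\<dots> = real zz ^ 12" by (simp flip: power_Suc)
    also have "\<dots> \<le> real Z ^ 1" using zz_power_le_real_Z[of 12] E_ge by simp
    also have "\<dots> \<le> real Z ^ 84" by (intro Z_power_mono) simp
    finally have "2 * real zz * gr ^ mu \<le> real Z ^ 84" .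
    moreover have "0 < gr ^ mu" using gr_bounds by simp
    ultimately show ?thesis unfolding gi_power using Z_pos by (simp add: field_simps)
  qed
  have mu1: "1 \<le> mu" using l by (simp add: mu_def)
  have zz23: "zz ^ 2 * zz = zz ^ 3" "1 \<le> zz ^ 2" "zz ^ 2 \<le> Z ^ 42"
  proof -
    show "zz ^ 2 * zz = zz ^ 3" "1 \<le> zz ^ 2" using zz_pos by (simp_all flip: power_Suc2)
    have "zz ^ 2 \<le> Z ^ 1" using zz_power_le_Z[of 2] E_ge by simp
    also have "\<dots> \<le> Z ^ 42" using Z_pos by (intro power_increasing) auto
    finally show "zz ^ 2 \<le> Z ^ 42" .
  qed
  have ZZ: "Z ^ 41 * Z = Z ^ 42" "1 \<le> Z ^ 41" "Z ^ 41 \<le> Z ^ 42" using Z_pos by (simp_all flip: power_Suc2 add: power_increasing)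
  have cA: "bohr_hits d N (real zz * \<bar>of_int 1\<bar>) (3 * gi ^ mu) (N div zz + Z ^ 42)"
    using good zz23 unfolding good_def by (intro bohr_hits_good[of "zz ^ 2" zz]) auto
  have cB: "bohr_hits d N (real (fib (la (J - 1) + 1))) (real zz * (2 / real (Z ^ 84))) (N div zz + Z ^ 42)"
    using good ZZ zz_le_Z unfolding good_def by (intro bohr_hits_good[of "Z ^ 41" Z]) (auto simp: mult_ac)
  have "mu \<le> la (J - 1)"
  proof -
    have "10 * l \<le> (39 + J - (J - 1)) * E * l" using J E_ge by (intro mult_right_mono) auto
    then show ?thesis unfolding mu_def la_def .
  qed
  then have "fib (mu + 1) \<le> fib (la (J - 1) + 1)" by (intro fib_mono) simp
  then have cC: "bohr_hits d N (real (fib (mu + 1))) (real zz * (2 / real (Z ^ 84))) (2 * (N div zz + Z ^ 42))"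
    by (intro bohr_hits_mono[OF cB]) auto
  have "hits d N {n. zexp \<theta> {mu..<la (J - 1)} (n + m * (r * d)) \<noteq> zexp \<theta> {mu..<la (J - 1)} n} (2 * (N div zz + Z ^ 42))"
    if "m < fib l" for m
    using hits_window[OF dec nw mu1 _ M\<tau> cA cB, of m] that unfolding zz by (simp only: mult_2)
  moreover have "hits d N {n. zexp \<theta> {..<mu} (n + m * (r * d)) \<noteq> zexp \<theta> {..<mu} (n + m)} (2 * (N div zz + Z ^ 42))"
    if "m < fib l" for m
    using hits_low_digits[OF nw _ cC, of m] that unfolding w zz by simp
  moreover have "fib l * r \<le> Z ^ 87"
  proof -
    have "fib l * r \<le> Z * Z ^ 86" using zz_le_Z r(2) unfolding zz by (intro mult_le_mono)
    then show ?thesis by (simp flip: power_Suc)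
  qed
  ultimately show ?thesis using rd by (intro exI[of _ "r * d"] conjI exI[of _ r] allI impI refl; blast)
qed

text \<open>Explains the size of \<open>E\<close>: the base \<open>9 * fib mu\<close> is at most
  \<open>zz ^ 11\<close>, so the number of cells times \<open>zz\<close> is at most
  \<open>zz ^ (11 * 2 ^ Suc J + 1)\<close>, and this is at most \<open>Z = zz ^ E\<close> because
  \<open>E = 256 * 2 ^ J\<close>.\<close>

lemma stepk_bound: "real (stepk (fib mu) (Suc J)) * (13 / Z) \<le> 13 / zz"
proof -
  have "real (fib mu) \<le> 3 ^ 10 * real zz ^ 10"
    using fib_le_gr_power[of mu] gr_pow_bounds(2)[of 10] unfolding mu_def by linarith
  then have "real (9 * fib mu) \<le> (9 * 3 ^ 10) * real zz ^ 10" by simp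
  also have "\<dots> \<le> real zz * real zz ^ 10" using zz_large(1) by (intro mult_right_mono) auto
  also have "\<dots> = real zz ^ 11" by (simp flip: power_Suc)
  finally have "real (9 * fib mu) \<le> real zz ^ 11" .
  then have "real (9 * fib mu) ^ (2 ^ Suc J) \<le> (real zz ^ 11) ^ (2 ^ Suc J)" by (intro power_mono) auto
  then have "real (stepk (fib mu) (Suc J)) * zz \<le> (real zz ^ 11) ^ (2 ^ Suc J) * real zz"
    unfolding stepk_def by (simp add: mult_right_mono)
  also have "\<dots> = real zz ^ (11 * 2 ^ Suc J + 1)" by (simp add: power_mult[symmetric])
  also have "\<dots> \<le> real zz ^ E"
  proof (intro power_increasing)
    have "E = 256 * 2 ^ J" unfolding E by (simp add: power_add)
    moreover have "(1::nat) \<le> 2 ^ J" by simp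
    ultimately show "11 * 2 ^ Suc J + 1 \<le> E" by simp
  qed (use zz_pos in auto)
  also have "\<dots> = real Z" unfolding Z by (simp only: of_nat_power)
  finally have b: "real (stepk (fib mu) (Suc J)) * zz \<le> real Z" .
  have "s * (13 / y) \<le> 13 / z" if "s * z \<le> y" "0 < z" "0 < y" for s y z :: real
    using that by (simp add: field_simps)
  from this[OF b] show ?thesis using Z_pos(1) zz_pos(1) by (simp only: of_nat_0_less_iff)
qed

text \<open>Every error term is a multiple of \<open>1 / zz\<close>. The shifts have length
  \<open>Z ^ 87\<close> and the clusters \<open>Z ^ 42\<close>, both negligible against
  \<open>N\<close>, which is at least \<open>Z ^ 100\<close>; only the density \<open>1 / zz\<close>
  of carries and the step function error remain.\<close>

lemma good_bound:
  assumes good: "good D d" and d: "D \<le> d" "d < 2 * D" and DZ: "real D \<le> real Z ^ (22 + J)"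
    and N: "N' \<le> N" "Z ^ 100 \<le> N" and W: "W = 6 * Suc J + 5" and B: "2 + B * W \<le> l"
  shows "(norm (\<Sum>n<N'. e2pi (\<theta> * real (zeckendorf_sum (a + n * d)))) / N) ^ (2 ^ Suc J) \<le>
    (1 - (2 - norm (1 + e2pi \<theta>)) / 2 ^ (2 * Suc J * W)) ^ B + (26 * real J + (8 * (real J + 2) + 4) * 2 ^ Suc J) / zz"
proof -
  have D0: "0 < d" using d by simp
  define P where "P j t \<longleftrightarrow> (\<exists>r. t = r * d \<and> Z ^ 6 * r \<le> Z ^ 87) \<and> equidist (13 / Z) ((\<lambda>m. m * t) ` {..<Z ^ 6}) (E * l + 2) \<and>
    (\<forall>m<Z ^ 6. hits d N {n. zexp \<theta> (window J la mu j) (n + m * t) \<noteq> zexp \<theta> (window J la mu j) n} (2 * (N div zz + Z ^ 42)))" for j t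
  define t where "t j = (SOME t. P j t)" for j
  have t: "(\<exists>r. t j = r * d \<and> Z ^ 6 * r \<le> Z ^ 87) \<and> equidist (13 / Z) ((\<lambda>m. m * t j) ` {..<Z ^ 6}) (E * l + 2) \<and>
    (\<forall>m<Z ^ 6. hits d N {n. zexp \<theta> (window J la mu j) (n + m * t j) \<noteq> zexp \<theta> (window J la mu j) n} (2 * (N div zz + Z ^ 42)))" if "j < J" for j
  proof -
    have "\<exists>t. P j t" unfolding P_def by (rule good_shift[OF good d DZ that])
    then have "P j (t j)" unfolding t_def by (rule someI_ex)
    then show ?thesis unfolding P_def .
  qed
  from good_last_shift[OF good D0]
  obtain tJ where tJ: "0 < tJ" "\<exists>r. tJ = r * d \<and> fib l * r \<le> Z ^ 87"
    and tJh: "\<And>m. m < fib l \<Longrightarrow> hits d N {n. zexp \<theta> {mu..<la (J - 1)} (n + m * tJ) \<noteq> zexp \<theta> {mu..<la (J - 1)} n} (2 * (N div zz + Z ^ 42)) \<and>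
       hits d N {n. zexp \<theta> {..<mu} (n + m * tJ) \<noteq> zexp \<theta> {..<mu} (n + m)} (2 * (N div zz + Z ^ 42))"
    by blast
  have N0: "0 < N" using N(2) Z_pos by (meson less_le_trans zero_less_power)
  define c where "c = 2 * (N div zz + Z ^ 42)"
  have main: "(norm (\<Sum>n<N'. e2pi (\<theta> * real (zeckendorf_sum (a + n * d)))) / N) ^ (2 ^ Suc J) \<le>
    (1 - (2 - norm (1 + e2pi \<theta>)) / 2 ^ (2 * Suc J * W)) ^ B + 2 * real J * stepk (fib mu) (Suc J) * (13 / Z)
    + 2 * (real (Suc J + 1) * 2 ^ Suc J * c) / N + 2 ^ Suc J * (4 * real (Z ^ 87) / real N)"
  proof (rule modulus_bound[where t = t and tJ = tJ and M = "Z ^ 6" and Y' = l and Y = "E * l + 2" and la = la])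
    show "la (Suc j) \<le> la j" if "Suc j < J" for j unfolding la_def by (intro mult_right_mono) auto
    have "10 * l \<le> (39 + J - (J - 1)) * E * l" using J E_ge by (intro mult_right_mono) auto
    then show "mu \<le> la (J - 1)" unfolding mu_def la_def .
    show "2 \<le> mu" using l by (simp add: mu_def)
    show "equidist (13 / real Z) ((\<lambda>m. m * t j) ` {..<Z ^ 6}) (E * l + 2)" if "j < J" for j using t[OF that] by blast
    show "\<exists>r. t j = r * d \<and> Z ^ 6 * r \<le> Z ^ 87" if "j < J" for j using t[OF that] by blast
    show "hits d N {n. zexp \<theta> (window J la mu j) (n + m * t j) \<noteq> zexp \<theta> (window J la mu j) n} c" if "j < J" "m < Z ^ 6" for j m
      using t[OF that(1)] that(2) unfolding c_def by blast
    show "hits d N {n. zexp \<theta> {mu..<la (J - 1)} (n + m * tJ) \<noteq> zexp \<theta> {mu..<la (J - 1)} n} c" if "m < fib l" for m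
      using tJh[OF that] unfolding c_def by blast
    show "hits d N {n. zexp \<theta> {..<mu} (n + m * tJ) \<noteq> zexp \<theta> {..<mu} (n + m)} c" if "m < fib l" for m
      using tJh[OF that] unfolding c_def by blast
    have "1 * l \<le> E * l" using E_ge by (intro mult_right_mono) auto
    then show "l \<le> E * l + 2" by linarith
    show "2 + B * W \<le> mu" using B unfolding mu_def by simp
    show "0 \<le> 13 / real Z" by simp
    show "0 < Z ^ 6" using Z_pos by simp
  qed (rule J tJ N(1) N0 W B)+
  have rN: "real zz * real (Z ^ 87) \<le> real N"
  proof -
    have "zz * Z ^ 87 \<le> Z * Z ^ 87" using zz_le_Z by simp
    also have "\<dots> = Z ^ 88" by (simp flip: power_Suc)
    also have "\<dots> \<le> Z ^ 100" using Z_pos by (intro power_increasing) auto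
    also have "\<dots> \<le> N" by (rule N)
    finally have "real (zz * Z ^ 87) \<le> real N" by (rule of_nat_mono)
    then show ?thesis by simp
  qed
  have L: "real (Z ^ 87) / N \<le> 1 / zz" using rN N0 zz_pos by (simp add: field_simps)
  have "real (Z ^ 42) \<le> real (Z ^ 87)" using Z_power_mono[of 42 87] by simp
  then have "real (Z ^ 42) / N \<le> real (Z ^ 87) / N" by (intro divide_right_mono) auto
  then have L': "real (Z ^ 42) / N \<le> 1 / zz" using L by linarith
  have "real (N div zz) \<le> real N / zz" using zz_pos by (simp add: of_nat_div_le_of_nat)
  then have "real (N div zz) / N \<le> (real N / zz) / N" by (intro divide_right_mono) auto
  also have "\<dots> = 1 / zz" using N0 by simp
  finally have C: "real c / N \<le> 4 / zz" using L' unfolding c_def by (simp add: add_divide_distrib distrib_left)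
  have e1: "2 * real J * stepk (fib mu) (Suc J) * (13 / Z) \<le> 26 * real J / zz"
  proof -
    have "2 * real J * stepk (fib mu) (Suc J) * (13 / Z) = 2 * real J * (stepk (fib mu) (Suc J) * (13 / Z))"
      by (simp only: mult.assoc)
    also have "\<dots> \<le> 2 * real J * (13 / zz)" by (intro mult_left_mono stepk_bound) simp
    finally show ?thesis by simp
  qed
  have e2: "2 * (real (Suc J + 1) * 2 ^ Suc J * c) / N \<le> 8 * (real J + 2) * 2 ^ Suc J / zz"
  proof -
    have "2 * (real (Suc J + 1) * 2 ^ Suc J * c) / N = 2 * (real J + 2) * 2 ^ Suc J * (real c / N)"
      by simp
    also have "\<dots> \<le> 2 * (real J + 2) * 2 ^ Suc J * (4 / zz)" by (intro mult_left_mono C) simp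
    also have "\<dots> = 8 * (real J + 2) * 2 ^ Suc J / zz"
    proof -
      have "2 * u * v * (4 / w) = 8 * u * v / w" for u v w :: real by simp
      then show ?thesis .
    qed
    finally show ?thesis .
  qed
  have e3: "2 ^ Suc J * (4 * real (Z ^ 87) / real N) \<le> 4 * 2 ^ Suc J / zz"
  proof -
    have "2 ^ Suc J * (4 * real (Z ^ 87) / real N) = 4 * 2 ^ Suc J * (real (Z ^ 87) / real N)" by simp
    also have "\<dots> \<le> 4 * 2 ^ Suc J * (1 / zz)" by (intro mult_left_mono L) simp
    finally show ?thesis by simp
  qed
  have "26 * real J / zz + 8 * (real J + 2) * 2 ^ Suc J / zz + 4 * 2 ^ Suc J / zz =
      (26 * real J + (8 * (real J + 2) + 4) * 2 ^ Suc J) / zz" by (simp add: add_divide_distrib[symmetric] algebra_simps)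
  then show ?thesis using main e1 e2 e3 by linarith
qed

end

section \<open>Counting the moduli that are not good\<close>

context scales begin

text \<open>The heights are the at most \<open>3 * H\<close> integers up to \<open>H\<close>. From
  \<open>H < R1 * D\<close> it follows that no multiple \<open>r * d\<close> in range can equal a
  height, as \<open>card_exceptional_moduli\<close> requires, and also that \<open>H\<close> is
  dominated by \<open>D * R2\<close>.\<close>

lemma bohr_count:
  assumes div: "\<And>m::nat. 0 < m \<Longrightarrow> m \<le> 2 * D * R2 \<Longrightarrow> real (card {d. d dvd m}) \<le> zz"
    and H: "1 \<le> H" "H < real R1 * real D" and R: "1 \<le> R1" "R1 \<le> R2" and t: "0 \<le> t"
  shows "real (card {d\<in>{D..<2*D}. \<exists>r. R1 \<le> r \<and> r \<le> R2 \<and> bohr H t (int (r * d))}) \<le> 108 * (H * t * real R2) * (real D * real zz)"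
proof -
  let ?HH = "{- \<lfloor>H\<rfloor>..\<lfloor>H\<rfloor>}"
  let ?X = "{d\<in>{D..<2*D}. \<exists>r\<in>{1..R2}. \<exists>h\<in>?HH. int (r * d) \<noteq> h \<and> near t (int (r * d) - h)}"
  have "{d\<in>{D..<2*D}. \<exists>r. R1 \<le> r \<and> r \<le> R2 \<and> bohr H t (int (r * d))} \<subseteq> ?X"
  proof
    fix d assume "d \<in> {d\<in>{D..<2*D}. \<exists>r. R1 \<le> r \<and> r \<le> R2 \<and> bohr H t (int (r * d))}"
    then obtain r h where r: "D \<le> d" "d < 2 * D" "R1 \<le> r" "r \<le> R2" "\<bar>real_of_int h\<bar> \<le> H" "near t (int (r * d) - h)"
      unfolding bohr_def by auto
    have "real R1 * real D \<le> real r * real d" using r by (intro mult_mono) auto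
    then have "real_of_int h < real_of_int (int (r * d))" using r(5) H(2) by simp
    then have "int (r * d) \<noteq> h" by linarith
    moreover have "h \<in> ?HH" using r(5) by simp linarith
    ultimately show "d \<in> ?X" using r R(1) by fastforce
  qed
  then have "card {d\<in>{D..<2*D}. \<exists>r. R1 \<le> r \<and> r \<le> R2 \<and> bohr H t (int (r * d))} \<le> card ?X"
    by (intro card_mono) auto
  then have "real (card {d\<in>{D..<2*D}. \<exists>r. R1 \<le> r \<and> r \<le> R2 \<and> bohr H t (int (r * d))}) \<le> real (card ?X)"
    by (rule of_nat_mono)
  also have "\<dots> \<le> real (card ?HH) * (12 * t * (2 * real D * real R2 + H)) * real zz"
    using H t div by (intro card_exceptional_moduli) (auto, linarith+)
  also have "\<dots> \<le> (3 * H) * (12 * t * (3 * (real D * real R2))) * real zz"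
  proof (intro mult_right_mono mult_mono)
    have "0 \<le> \<lfloor>H\<rfloor>" using H(1) by simp
    then have "real (card ?HH) = 2 * of_int \<lfloor>H\<rfloor> + 1" by simp
    also have "\<dots> \<le> 3 * H" using H(1) of_int_floor_le[of H] by linarith
    finally show "real (card ?HH) \<le> 3 * H" .
    have "real R1 * real D \<le> real R2 * real D" using R by (intro mult_right_mono) auto
    then have "H \<le> real D * real R2" using H(2) by (simp add: mult.commute)
    then show "2 * real D * real R2 + H \<le> 3 * (real D * real R2)" by simp
  qed (use t H in auto)
  also have "\<dots> = 108 * (H * t * real R2) * (real D * real zz)" by simp
  finally show ?thesis .
qed

lemma zz_over_Z: "1 \<le> k \<Longrightarrow> real zz / real Z ^ k \<le> 1 / real zz"
proof -
  assume k: "1 \<le> k"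
  have "real zz ^ 2 \<le> real Z ^ 1" using zz_power_le_real_Z[of 2] E_ge by simp
  also have "\<dots> \<le> real Z ^ k" using k by (rule Z_power_mono)
  finally have "real zz * real zz \<le> real Z ^ k" by (simp add: power2_eq_square)
  then show ?thesis using zz_pos Z_pos by (simp add: field_simps)
qed

text \<open>A saving of one power of \<open>Z\<close> pays for the divisor bound \<open>zz\<close>
  and still leaves a factor \<open>1 / zz\<close>, since \<open>zz\<^sup>2 \<le> Z\<close>.\<close>

lemma count_le:
  assumes "x \<le> c * y * (real D * real zz)" "y \<le> 1 / real Z ^ k" "1 \<le> k" "0 \<le> c"
  shows "x \<le> c * (real D / real zz)"
proof -
  have "c * y * (real D * real zz) \<le> c * (1 / real Z ^ k) * (real D * real zz)"
    using assms by (intro mult_right_mono mult_left_mono) auto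
  also have "\<dots> = c * real D * (real zz / real Z ^ k)" by simp
  also have "\<dots> \<le> c * real D * (1 / real zz)" using assms by (intro mult_left_mono zz_over_Z) auto
  finally show ?thesis using assms(1) by simp
qed

lemma not_good_cases:
  assumes "\<not> good D d"
  shows "(\<exists>r\<in>{1..Z}. near (1 / real (Z ^ 5)) (int (r * d))) \<or> (\<exists>r\<in>{1..Z ^ 84}. near (1 / real (Z ^ 86)) (int (r * d))) \<or>
    (\<exists>r. zz ^ 2 \<le> r \<and> r \<le> zz ^ 3 \<and> bohr (2 * real zz) (2 * (3 * gi ^ mu)) (int (r * d))) \<or>
    (\<exists>r. Z ^ 41 \<le> r \<and> r \<le> Z ^ 42 \<and> bohr (2 * real (fib (la (J - 1) + 1))) (2 * (2 * real zz / real (Z ^ 84))) (int (r * d))) \<or>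
    (\<exists>j<J. (\<not> small_level D j \<and> (\<exists>r. Z ^ 7 \<le> r \<and> r \<le> Z ^ 8 \<and> bohr (2 * (2 * real (Z ^ 6) * D)) (2 * (2 * gi ^ la j)) (int (r * d)))) \<or>
      (small_level D j \<and> ((\<exists>r. Z ^ 18 \<le> r \<and> r \<le> Z ^ 19 \<and> bohr (2 * (3 * gr ^ above j / real (Z ^ 29))) (2 * (3 * gi ^ la j)) (int (r * d))) \<or>
        (\<exists>r. Z ^ 18 \<le> r \<and> r \<le> Z ^ 19 \<and> bohr (2 * real (fib (above j + 1))) (2 * (2 * gi ^ above j / real (Z ^ 29))) (int (r * d))) \<or>
        (\<exists>r h q. 1 \<le> r \<and> r \<le> Z ^ 70 \<and> \<bar>real_of_int h\<bar> \<le> 3 * gr ^ above j / real (Z ^ 35) \<and>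
        near (2 * gi ^ above j / real (Z ^ 35)) (int (r * d) - h) \<and> 1 \<le> q \<and> q \<le> Z \<and>
        near (1 / real (Z ^ 5)) (int (q * (r * d)))))))"
proof (rule ccontr)
  assume c: "\<not> ?thesis"
  note c' = c[unfolded Bex_def atLeastAtMost_iff]
  have "good D d" unfolding good_def by (intro conjI allI impI notI; insert c'; blast)
  then show False using assms by blast
qed

lemma near_count:
  assumes div: "\<And>m::nat. 0 < m \<Longrightarrow> m \<le> 2 * D * R \<Longrightarrow> real (card {d. d dvd m}) \<le> zz"
    and "0 \<le> t" "t * real R \<le> 1 / real Z ^ k" "1 \<le> k"
  shows "real (card {d\<in>{D..<2*D}. \<exists>r\<in>{1..R}. near t (int (r * d))}) \<le> 24 * (real D / real zz)"
proof -
  let ?X = "{d\<in>{D..<2*D}. \<exists>r\<in>{1..R}. \<exists>h\<in>{0}. int (r * d) \<noteq> h \<and> near t (int (r * d) - h)}"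
  have "{d\<in>{D..<2*D}. \<exists>r\<in>{1..R}. near t (int (r * d))} \<subseteq> ?X" by auto
  then have "real (card {d\<in>{D..<2*D}. \<exists>r\<in>{1..R}. near t (int (r * d))}) \<le> real (card ?X)"
    by (intro of_nat_mono card_mono) auto
  also have "\<dots> \<le> real (card {0::int}) * (12 * t * (2 * real D * real R + 0)) * real zz"
    using assms by (intro card_exceptional_moduli) auto
  also have "\<dots> = 24 * (t * real R) * (real D * real zz)" by simp
  finally show ?thesis by (rule count_le[OF _ assms(3,4)]) simp
qed

text \<open>A plain count over all heights would save nothing, since here the height, the distance
  and the range \<open>Z ^ 70\<close> multiply to a constant. But if both \<open>r * d - h\<close>
  and \<open>q * r * d\<close> are near 0, then so is \<open>q * h\<close>, which restricts
  \<open>h\<close> to about \<open>H / Z ^ 3\<close> values and the value 0. The latter is harmless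
  because of the assumption \<open>Z ^ 40 \<le> G\<close>.\<close>

lemma approx_count:
  assumes div: "\<And>m::nat. 0 < m \<Longrightarrow> m \<le> 2 * D * Z ^ 70 \<Longrightarrow> real (card {d. d dvd m}) \<le> zz"
    and G: "G = gr ^ a" "real Z ^ 40 \<le> G" "3 * G / real (Z ^ 35) < real D"
  shows "real (card {d\<in>{D..<2*D}. \<exists>r h q. 1 \<le> r \<and> r \<le> Z ^ 70 \<and> \<bar>real_of_int h\<bar> \<le> 3 * gr ^ a / real (Z ^ 35) \<and>
        near (2 * gi ^ a / real (Z ^ 35)) (int (r * d) - h) \<and> 1 \<le> q \<and> q \<le> Z \<and>
        near (1 / real (Z ^ 5)) (int (q * (r * d)))}) \<le> 6000 * (real D / real zz)" (is "real (card ?B) \<le> _")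
proof -
  define H where "H = 3 * G / real (Z ^ 35)"
  define t where "t = 2 * gi ^ a / real (Z ^ 35)"
  define b where "b = 1 / real Z ^ 5"
  define HH where "HH = {h::int. \<bar>real_of_int h\<bar> \<le> H \<and> (\<exists>q\<in>{1..Z}. near (2 * b) (int q * h))}"
  have Zr: "0 < real Z" using Z_pos by simp
  have G0: "0 < G" using G(1) gr_bounds by simp
  have gG: "gi ^ a = 1 / G" unfolding G(1) by (rule gi_power)
  have H0: "0 \<le> H" unfolding H_def using G0 by simp
  have t0: "0 \<le> t" unfolding t_def using gi_pos by simp
  have b0: "0 \<le> b" unfolding b_def by simp
  have tb: "real Z * t \<le> b"
  proof -
    have "2 * real Z ^ 6 \<le> real Z * real Z ^ 6" using Z_large(1) by (intro mult_right_mono) auto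
    also have "\<dots> = real Z ^ 7" by (simp flip: power_Suc)
    also have "\<dots> \<le> real Z ^ 35 * G"
    proof -
      have "real Z ^ 7 \<le> real Z ^ 40" by (rule Z_power_mono) simp
      also have "\<dots> \<le> G" by (rule G)
      also have "\<dots> \<le> real Z ^ 35 * G" using G0 Z_power_mono[of 0 35] by simp
      finally show ?thesis .
    qed
    finally have "2 * real Z ^ 6 \<le> real Z ^ 35 * G" .
    then have "2 * real Z * real Z ^ 5 \<le> real Z ^ 35 * G" by (simp flip: power_Suc add: mult.assoc)
    then show ?thesis unfolding t_def gG b_def using Zr G0 by (simp add: field_simps)
  qed
  have fin: "finite HH" "card HH \<le> card (insert 0 (\<Union>q\<in>{1..Z}. {h::int. h \<noteq> 0 \<and> \<bar>real_of_int h\<bar> \<le> H \<and> near (2 * b) (int q * h)}))"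
    "real (card HH) \<le> 1 + real Z * (24 * b * (real Z * H))"
  proof -
    define S where "S q = {h::int. h \<noteq> 0 \<and> \<bar>real_of_int h\<bar> \<le> H \<and> near (2 * b) (int q * h)}" for q :: nat
    have S: "finite (S q)" "real (card (S q)) \<le> 24 * b * (real Z * H)" if q: "q \<in> {1..Z}" for q
    proof -
      let ?W = "{w::int. w \<noteq> 0 \<and> \<bar>of_int w\<bar> \<le> real Z * H \<and> near (2 * b) w}"
      have W: "finite ?W" "real (card ?W) \<le> 12 * (2 * b) * (real Z * H)"
        using card_near[of "real Z * H" "2 * b"] H0 b0 by auto
      have inj: "inj_on (\<lambda>h. int q * h) (S q)" using q by (auto simp: inj_on_def)
      have sub: "(\<lambda>h. int q * h) ` S q \<subseteq> ?W"
      proof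
        fix w assume "w \<in> (\<lambda>h. int q * h) ` S q"
        then obtain h where h: "w = int q * h" "h \<noteq> 0" "\<bar>real_of_int h\<bar> \<le> H" "near (2 * b) (int q * h)" unfolding S_def by auto
        have "real q * \<bar>real_of_int h\<bar> \<le> real Z * H" using q h(3) by (intro mult_mono) auto
        then show "w \<in> ?W" using h q by (simp add: abs_mult)
      qed
      show "finite (S q)" using inj sub W(1) by (rule inj_on_finite)
      have "card (S q) \<le> card ?W" by (rule card_inj_on_le[OF inj sub W(1)])
      then show "real (card (S q)) \<le> 24 * b * (real Z * H)" using W(2) by linarith
    qed
    have sub: "HH \<subseteq> insert 0 (\<Union>q\<in>{1..Z}. S q)" unfolding HH_def S_def by auto
    have finU: "finite (insert 0 (\<Union>q\<in>{1..Z}. S q))" using S(1) by auto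
    show "finite HH" using sub finU by (rule finite_subset)
    show c: "card HH \<le> card (insert 0 (\<Union>q\<in>{1..Z}. {h::int. h \<noteq> 0 \<and> \<bar>real_of_int h\<bar> \<le> H \<and> near (2 * b) (int q * h)}))"
      using card_mono[OF finU sub] unfolding S_def .
    have "card HH \<le> 1 + card (\<Union>q\<in>{1..Z}. S q)" using card_mono[OF finU sub] card_insert_le_m1 by (metis add.commute card_insert_if finU finite_insert le_SucI order_trans plus_1_eq_Suc order_refl)
    also have "\<dots> \<le> 1 + (\<Sum>q\<in>{1..Z}. card (S q))" by (intro add_left_mono card_UN_le) simp
    finally have "real (card HH) \<le> 1 + (\<Sum>q\<in>{1..Z}. real (card (S q)))" by (simp flip: of_nat_sum)
    also have "\<dots> \<le> 1 + (\<Sum>q\<in>{1..Z}. 24 * b * (real Z * H))" by (intro add_left_mono sum_mono S)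
    finally show "real (card HH) \<le> 1 + real Z * (24 * b * (real Z * H))" by simp
  qed
  let ?X = "{d\<in>{D..<2*D}. \<exists>r\<in>{1..Z ^ 70}. \<exists>h\<in>HH. int (r * d) \<noteq> h \<and> near t (int (r * d) - h)}"
  have "?B \<subseteq> ?X"
  proof
    fix d assume "d \<in> ?B"
    then obtain r h q where r: "D \<le> d" "d < 2 * D" "1 \<le> r" "r \<le> Z ^ 70" "\<bar>real_of_int h\<bar> \<le> H" "near t (int (r * d) - h)"
      "1 \<le> q" "q \<le> Z" "near b (int (q * (r * d)))"
      unfolding H_def t_def b_def G(1) by auto
    have "near (b + real q * t) (int (q * (r * d)) - int q * (int (r * d) - h))"
      by (intro near_diff r near_mult)
    moreover have "int (q * (r * d)) - int q * (int (r * d) - h) = int q * h" by (simp add: algebra_simps)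
    moreover have "real q * t \<le> real Z * t" using r(8) t0 by (intro mult_right_mono) auto
    then have "b + real q * t \<le> 2 * b" using tb by linarith
    ultimately have "near (2 * b) (int q * h)" using near_mono by metis
    then have "h \<in> HH" unfolding HH_def using r by auto
    moreover have "int (r * d) \<noteq> h"
    proof
      assume "int (r * d) = h"
      then have "real_of_int h = real (r * d)" by (metis of_int_of_nat_eq)
      moreover have "real D \<le> real (r * d)"
      proof -
        have "D \<le> r * d" using r(1,3) mult_le_mono[of 1 r D d] by simp
        then show ?thesis by (rule of_nat_mono)
      qed
      ultimately show False using r(5) G(3) unfolding H_def by linarith
    qed
    ultimately show "d \<in> ?X" using r by auto
  qed
  then have "real (card ?B) \<le> real (card ?X)" by (intro of_nat_mono card_mono) auto
  also have "\<dots> \<le> real (card HH) * (12 * t * (2 * real D * real (Z ^ 70) + H)) * real zz"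
    using fin(1) t0 H0 div by (intro card_exceptional_moduli) (auto simp: HH_def)
  also have "\<dots> \<le> (1 + real Z * (24 * b * (real Z * H))) * (12 * t * (3 * (real D * real (Z ^ 70)))) * real zz"
  proof (intro mult_right_mono mult_mono fin(3))
    have "H \<le> real D * 1" using G(3) unfolding H_def by simp
    also have "\<dots> \<le> real D * real (Z ^ 70)" using Z_power_mono[of 0 70] by (intro mult_left_mono) auto
    finally show "2 * real D * real (Z ^ 70) + H \<le> 3 * (real D * real (Z ^ 70))" by simp
  qed (use t0 H0 b0 in auto)
  also have "\<dots> = 72 * (1 / G) * real Z ^ 35 * (real D * real zz) + 5184 * (1 / real Z ^ 3) * (real D * real zz)"
  proof -
    have e: "real (Z ^ 70) = real Z ^ 35 * real Z ^ 35" "real Z ^ 5 = real Z ^ 3 * (real Z * real Z)"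
      by (simp_all add: power_add[symmetric] power_numeral_reduce)
    show ?thesis unfolding t_def b_def H_def gG e using Zr G0 by (simp add: field_simps)
  qed
  also have "\<dots> \<le> 72 * (real D / real zz) + 5184 * (real D / real zz)"
  proof (intro add_mono)
    have "real Z * real Z ^ 35 = real Z ^ 36" by (simp flip: power_Suc)
    also have "\<dots> \<le> real Z ^ 40" by (rule Z_power_mono) simp
    finally have "real Z * real Z ^ 35 \<le> real Z ^ 40" .
    then have "(1 / G) * real Z ^ 35 \<le> 1 / real Z ^ 1" using G(2) G0 Zr by (simp add: field_simps)
    then show "72 * (1 / G) * real Z ^ 35 * (real D * real zz) \<le> 72 * (real D / real zz)"
      by (intro count_le[where y = "(1 / G) * real Z ^ 35" and k = 1]) auto
    show "5184 * (1 / real Z ^ 3) * (real D * real zz) \<le> 5184 * (real D / real zz)"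
      by (intro count_le[where y = "1 / real Z ^ 3" and k = 3]) auto
  qed
  also have "\<dots> \<le> 6000 * (real D / real zz)"
  proof -
    have h: "72 * u + 5184 * u \<le> 6000 * u" if "0 \<le> u" for u :: real using that by simp
    have "0 \<le> real D / real zz" by simp
    then show ?thesis by (rule h)
  qed
  finally show ?thesis .
qed

lemma bohr_count_le:
  assumes div: "\<And>m::nat. 0 < m \<Longrightarrow> m \<le> 2 * D * R2 \<Longrightarrow> real (card {d. d dvd m}) \<le> zz"
    and H: "1 \<le> H" "H < real R1 * real D" and R: "1 \<le> R1" "R1 \<le> R2" and t: "0 \<le> t"
    and y: "H * t * real R2 \<le> c * (1 / real Z ^ k)" "0 \<le> c" "1 \<le> k"
  shows "real (card {d\<in>{D..<2*D}. \<exists>r. R1 \<le> r \<and> r \<le> R2 \<and> bohr H t (int (r * d))}) \<le> 108 * c * (real D / real zz)"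
proof -
  have "real (card {d\<in>{D..<2*D}. \<exists>r. R1 \<le> r \<and> r \<le> R2 \<and> bohr H t (int (r * d))}) \<le> 108 * (H * t * real R2) * (real D * real zz)"
    using div H R t by (rule bohr_count)
  also have "\<dots> \<le> 108 * (c * (1 / real Z ^ k)) * (real D * real zz)"
    using y by (intro mult_right_mono mult_left_mono) auto
  finally show ?thesis using y by (intro count_le[where y = "1 / real Z ^ k" and k = k]) (auto simp: mult.assoc)
qed

text \<open>Each way of failing to be good is counted separately, by \<open>near_count\<close>,
  \<open>bohr_count_le\<close> or \<open>approx_count\<close>, and only the conditions attached to
  windows are multiplied by \<open>J\<close>.\<close>

lemma bad_count:
  assumes D: "1 \<le> D" and DZ: "real D \<le> real Z ^ (22 + J)"
    and div: "\<And>m::nat. 0 < m \<Longrightarrow> m \<le> 2 * D * Z ^ 84 \<Longrightarrow> real (card {d. d dvd m}) \<le> zz"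
  shows "real (card {d\<in>{D..<2*D}. \<not> good D d}) \<le> 20000 * (real J + 1) * (real D / real zz)"
proof -
  define U where "U = real D / real zz"
  define X where "X = real Z"
  have U0: "0 \<le> U" unfolding U_def by simp
  have X8: "100000000 \<le> X" unfolding X_def using of_nat_mono[OF Z_large(1), where 'a = real] by simp
  have X0: "0 < X" using X8 by linarith
  have D0: "1 \<le> real D" using D by simp
  have zz8: "100000000 \<le> real zz" using of_nat_mono[OF zz_large(1), where 'a = real] by simp
  have Xm: "X ^ a \<le> X ^ b" if "a \<le> b" for a b unfolding X_def using that by (rule Z_power_mono)
  have div': "real (card {d. d dvd m}) \<le> zz" if "0 < m" "m \<le> 2 * D * R" "R \<le> Z ^ 84" for m R
    using that by (intro div) (auto intro: order_trans mult_le_mono2)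
  have ZZ: "Z ^ a \<le> Z ^ b" if "a \<le> b" for a b using that Z_pos by (intro power_increasing) auto
  have Z1: "Z \<le> Z ^ 84" using ZZ[of 1 84] by simp
  define P1 where "P1 = {d\<in>{D..<2*D}. \<exists>r\<in>{1..Z}. near (1 / real (Z ^ 5)) (int (r * d))}"
  define P2 where "P2 = {d\<in>{D..<2*D}. \<exists>r\<in>{1..Z ^ 84}. near (1 / real (Z ^ 86)) (int (r * d))}"
  define P3 where "P3 = {d\<in>{D..<2*D}. \<exists>r. zz ^ 2 \<le> r \<and> r \<le> zz ^ 3 \<and> bohr (2 * real zz) (2 * (3 * gi ^ mu)) (int (r * d))}"
  define P4 where "P4 = {d\<in>{D..<2*D}. \<exists>r. Z ^ 41 \<le> r \<and> r \<le> Z ^ 42 \<and>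
    bohr (2 * real (fib (la (J - 1) + 1))) (2 * (2 * real zz / real (Z ^ 84))) (int (r * d))}"
  define Q1 where "Q1 j = {d\<in>{D..<2*D}. \<exists>r. Z ^ 7 \<le> r \<and> r \<le> Z ^ 8 \<and>
    bohr (2 * (2 * real (Z ^ 6) * D)) (2 * (2 * gi ^ la j)) (int (r * d))}" for j
  define Q2 where "Q2 j = {d\<in>{D..<2*D}. \<exists>r. Z ^ 18 \<le> r \<and> r \<le> Z ^ 19 \<and>
    bohr (2 * (3 * gr ^ above j / real (Z ^ 29))) (2 * (3 * gi ^ la j)) (int (r * d))}" for j
  define Q3 where "Q3 j = {d\<in>{D..<2*D}. \<exists>r. Z ^ 18 \<le> r \<and> r \<le> Z ^ 19 \<and>
    bohr (2 * real (fib (above j + 1))) (2 * (2 * gi ^ above j / real (Z ^ 29))) (int (r * d))}" for j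
  define Q4 where "Q4 j = {d\<in>{D..<2*D}. \<exists>r h q. 1 \<le> r \<and> r \<le> Z ^ 70 \<and> \<bar>real_of_int h\<bar> \<le> 3 * gr ^ above j / real (Z ^ 35) \<and>
        near (2 * gi ^ above j / real (Z ^ 35)) (int (r * d) - h) \<and> 1 \<le> q \<and> q \<le> Z \<and>
        near (1 / real (Z ^ 5)) (int (q * (r * d)))}" for j
  define Q where "Q j = (if small_level D j then Q2 j \<union> Q3 j \<union> Q4 j else Q1 j)" for j
  have c1: "real (card P1) \<le> 24 * U" unfolding P1_def U_def
    by (rule near_count[where k = 4])
      (use div' Z1 Z_pos in \<open>auto simp: power_numeral_reduce\<close>)
  have c2: "real (card P2) \<le> 24 * U" unfolding P2_def U_def
  proof (rule near_count[where k = 2])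
    have "X ^ 86 = X ^ 84 * X ^ 2" by (simp flip: power_add)
    then show "1 / real (Z ^ 86) * real (Z ^ 84) \<le> 1 / real Z ^ 2"
      using X0 unfolding of_nat_power X_def[symmetric] by (simp add: field_simps)
  qed (use div in auto)
  \<comment> \<open>At the boundary \<open>mu\<close> all scales are powers of \<open>zz\<close>
    rather than of \<open>Z\<close>, so the saving is read off directly: the sixth power of
    \<open>zz\<close> that arises is below \<open>gr ^ mu\<close>.\<close>
  have c3: "real (card P3) \<le> 108 * 12 * U"
  proof -
    have g: "0 < gr ^ mu" using gr_bounds by simp
    have "real (card P3) \<le> 108 * (2 * real zz * (2 * (3 * gi ^ mu)) * real (zz ^ 3)) * (real D * real zz)" unfolding P3_def
    proof (rule bohr_count)
      show "real (card {d. d dvd m}) \<le> zz" if "0 < m" "m \<le> 2 * D * zz ^ 3" for m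
        using zz_power_le_Z[of 3] E_ge Z1 by (intro div'[OF that]) linarith
      show "1 \<le> 2 * real zz" using zz8 by linarith
      have "2 * real zz < real zz * real zz" using zz8 by simp
      also have "\<dots> \<le> real zz * real zz * real D" using D0 zz8 by simp
      finally show "2 * real zz < real (zz ^ 2) * real D" by (simp add: power2_eq_square)
      show "1 \<le> zz ^ 2" using zz_pos by simp
      show "zz ^ 2 \<le> zz ^ 3" using zz_pos by (intro power_increasing) auto
      show "0 \<le> 2 * (3 * gi ^ mu)" using gi_pos by simp
    qed
    also have "\<dots> = 108 * 12 * (real zz ^ 6 * gi ^ mu) * U"
      unfolding U_def using zz8 by (simp add: field_simps power_numeral_reduce)
    also have "\<dots> \<le> 108 * 12 * 1 * U"
    proof (intro mult_right_mono mult_left_mono U0)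
      have "real zz ^ 6 \<le> real zz ^ 10" using zz8 by (intro power_increasing) auto
      also have "\<dots> \<le> gr ^ mu" unfolding mu_def by (rule gr_pow_bounds)
      finally show "real zz ^ 6 * gi ^ mu \<le> 1" unfolding gi_power using g by (simp add: field_simps)
    qed auto
    finally show ?thesis by simp
  qed
  have c4: "real (card P4) \<le> 108 * 40 * U" unfolding P4_def U_def
  proof (rule bohr_count_le[where k = 1])
    have f: "real (fib (la (J - 1) + 1)) \<le> 3 ^ (40 * E) * X ^ 40"
    proof -
      have "39 + J - (J - 1) = 40" using J by simp
      then have "la (J - 1) = 40 * E * l" unfolding la_def by simp
      then show ?thesis using fib_Suc_le_gr_power[of "la (J - 1)"] gr_Z_bounds(2)[of 40] unfolding X_def by simp
    qed
    \<comment> \<open>The assumption \<open>large\<close> contains \<open>3 ^ (40 * E)\<close> for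
      this purpose: it is the loss in comparing \<open>gr ^ (40 * E * l)\<close> with
      \<open>Z ^ 40\<close> at the boundary \<open>la (J - 1)\<close>.\<close>
    have "2 * 3 ^ (40 * E) \<le> zz"
    proof -
      have "2 * 3 ^ (40 * E) * 1 \<le> 10 ^ 8 * 3 ^ (40 * E) * (J + 1)" by (intro mult_le_mono) auto
      then show ?thesis using large by simp
    qed
    then have "real (2 * 3 ^ (40 * E)) \<le> real zz" by (rule of_nat_mono)
    then have "2 * 3 ^ (40 * E) * X ^ 40 \<le> real zz * X ^ 40" using X0 by (intro mult_right_mono) auto
    then have H: "2 * real (fib (la (J - 1) + 1)) \<le> real zz * X ^ 40" using f by linarith
    have z4: "real zz ^ 2 \<le> X" using zz_power_le_real_Z[of 2] E_ge unfolding X_def by simp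
    have "real zz * 1 < real zz * real zz" using zz8 by (intro mult_strict_left_mono) auto
    then have "real zz < X" using z4 by (simp add: power2_eq_square)
    then have "real zz * X ^ 40 < X * X ^ 40" using X0 by (intro mult_strict_right_mono) auto
    also have "\<dots> = X ^ 41" by (simp flip: power_Suc)
    also have "\<dots> \<le> X ^ 41 * real D" using D0 X0 by simp
    finally show "2 * real (fib (la (J - 1) + 1)) < real (Z ^ 41) * real D" using H unfolding of_nat_power X_def by linarith
    have "fib (la (J - 1) + 1) \<noteq> 0" using fib_neq_0_nat[of "la (J - 1) + 1"] by simp
    then show "1 \<le> 2 * real (fib (la (J - 1) + 1))" by linarith
    have "2 * real (fib (la (J - 1) + 1)) * (2 * (2 * real zz / real (Z ^ 84))) * real (Z ^ 42)
      \<le> (real zz * X ^ 40) * (2 * (2 * real zz / real (Z ^ 84))) * real (Z ^ 42)"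
      using H by (intro mult_right_mono) auto
    also have "\<dots> = 4 * (real zz ^ 2 * X ^ 82 / X ^ 84)"
      unfolding of_nat_power X_def[symmetric] by (simp add: power2_eq_square flip: power_add)
    also have "\<dots> \<le> 4 * (X * X ^ 82 / X ^ 84)"
      using z4 X0 by (intro mult_left_mono divide_right_mono mult_right_mono) auto
    also have "\<dots> = 4 * (1 / X ^ 1)"
    proof -
      have "X ^ 84 = X * X ^ 82 * X" by (simp flip: power_Suc power_Suc2)
      then show ?thesis using X0 by simp
    qed
    also have "\<dots> \<le> 40 * (1 / X ^ 1)" using X0 by (intro mult_right_mono) auto
    finally show "2 * real (fib (la (J - 1) + 1)) * (2 * (2 * real zz / real (Z ^ 84))) * real (Z ^ 42) \<le> 40 * (1 / real Z ^ 1)"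
      unfolding X_def .
  qed (use div' ZZ Z_pos in auto)
  have q1: "real (card (Q1 j)) \<le> 108 * 40 * U" if j: "j < J" "\<not> small_level D j" for j unfolding Q1_def U_def
  proof (rule bohr_count_le[where k = 1])
    have "1 * 1 \<le> X ^ 6 * real D" using D0 Xm[of 0 6] by (intro mult_mono) auto
    then show "1 \<le> 2 * (2 * real (Z ^ 6) * D)" unfolding of_nat_power X_def[symmetric] by linarith
    have X7: "X * X ^ 6 = X ^ 7" by (simp flip: power_Suc)
    have "4 * X ^ 6 < X * X ^ 6" using X8 by (intro mult_strict_right_mono) auto
    then have "4 * X ^ 6 * real D < X * X ^ 6 * real D" by (rule mult_strict_right_mono) (use D0 in linarith)
    moreover have "2 * (2 * X ^ 6 * real D) = 4 * X ^ 6 * real D" by simp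
    ultimately show "2 * (2 * real (Z ^ 6) * D) < real (Z ^ 7) * real D"
      unfolding of_nat_power X_def[symmetric] by (simp only: X7)
    have g: "0 < gr ^ la j" using gr_bounds by simp
    have s: "X ^ 16 * real D \<le> gr ^ la j" using j(2) unfolding small_level_def X_def by simp
    have "X ^ 14 * X \<le> X ^ 16" using Xm[of 15 16] by (simp flip: power_Suc2)
    then have "X ^ 14 * X * real D \<le> X ^ 16 * real D" by (intro mult_right_mono) auto
    then have "X ^ 14 * real D * X \<le> gr ^ la j" using s by (simp add: mult_ac)
    then have e: "X ^ 14 * real D * gi ^ la j \<le> 1 / X ^ 1" unfolding gi_power using g X0 by (simp add: field_simps)
    have "2 * (2 * X ^ 6 * D) * (2 * (2 * gi ^ la j)) * X ^ 8 = 16 * (X ^ 14 * real D * gi ^ la j)"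
      by (simp flip: power_add)
    also have "\<dots> \<le> 40 * (1 / X ^ 1)" using e X0 gi_pos by (intro mult_mono) auto
    finally show "2 * (2 * real (Z ^ 6) * D) * (2 * (2 * gi ^ la j)) * real (Z ^ 8) \<le> 40 * (1 / real Z ^ 1)"
      unfolding of_nat_power X_def .
  qed (use div' ZZ Z_pos gi_pos in auto)
  have q234: "real (card (Q2 j)) \<le> 108 * 40 * U" "real (card (Q3 j)) \<le> 108 * 40 * U" "real (card (Q4 j)) \<le> 6000 * U"
    if j: "j < J" "small_level D j" for j
  proof -
    define G where "G = gr ^ above j"
    have j0: "0 < j" using j(2,1) DZ by (rule small_level_pos)
    have G0: "0 < G" unfolding G_def using gr_bounds by simp
    have G40: "X ^ 40 \<le> G" unfolding G_def X_def using j0 j(1) by (rule gr_above(2))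
    have GD: "G * 10 ^ 8 \<le> X ^ 18 * real D" unfolding G_def X_def using j(2) j0 j(1) by (rule small_level_bound)
    have gG: "gi ^ above j = 1 / G" unfolding G_def by (rule gi_power)
    have X29: "1 \<le> X ^ 29" "1 \<le> X ^ 35" "1 \<le> X ^ 17" using Xm[of 0] by auto
    show "real (card (Q2 j)) \<le> 108 * 40 * U" unfolding Q2_def U_def
    proof (rule bohr_count_le[where k = 1])
      have "X ^ 29 \<le> G" using G40 Xm[of 29 40] by simp
      then have "1 \<le> G / X ^ 29" using X0 by simp
      then show "1 \<le> 2 * (3 * gr ^ above j / real (Z ^ 29))" unfolding of_nat_power X_def[symmetric] G_def[symmetric] by simp
      have "G / X ^ 29 \<le> G" using X29 G0 X0 by (simp add: divide_le_eq)
      then have "6 * (G / X ^ 29) < X ^ 18 * real D" using GD G0 by simp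
      then show "2 * (3 * gr ^ above j / real (Z ^ 29)) < real (Z ^ 18) * real D"
        unfolding of_nat_power X_def[symmetric] G_def[symmetric] by simp
      have g: "0 < gr ^ la j" using gr_bounds by simp
      have "G \<le> 3 ^ E * X * gr ^ la j" unfolding G_def X_def using j0 j(1) by (rule gr_above(1))
      then have "G * gi ^ la j \<le> 3 ^ E * X" unfolding gi_power using g by (simp add: field_simps)
      also have "\<dots> \<le> X * X"
      proof (rule mult_right_mono)
        have "3 ^ E * 1 \<le> 3 ^ E * (10 ^ 8 :: real)" by (intro mult_left_mono) auto
        then show "3 ^ E \<le> X" using real_3E_le_Z unfolding X_def by linarith
      qed (use X0 in simp)
      finally have e: "G * gi ^ la j \<le> X * X" .
      have "2 * (3 * G / X ^ 29) * (2 * (3 * gi ^ la j)) * X ^ 19 = 36 * ((G * gi ^ la j) * (X ^ 19 / X ^ 29))"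
        by simp
      also have "\<dots> \<le> 40 * (X * X * (X ^ 19 / X ^ 29))"
      proof -
        have "(G * gi ^ la j) * (X ^ 19 / X ^ 29) \<le> X * X * (X ^ 19 / X ^ 29)" using e X0 by (intro mult_right_mono) auto
        moreover have "0 \<le> X * X * (X ^ 19 / X ^ 29)" using X0 by simp
        moreover have "36 * u \<le> 40 * w" if "u \<le> w" "0 \<le> w" for u w :: real using that by linarith
        ultimately show ?thesis by blast
      qed
      also have "\<dots> = 40 * (X ^ 21 / X ^ 29)"
      proof -
        have "X * X * X ^ 19 = X ^ 21"
          by ((simp flip: power2_eq_square power_add; fail) | (simp add: eval_nat_numeral mult.assoc; fail))
        then show ?thesis by (simp only: times_divide_eq_right)
      qed
      also have "\<dots> \<le> 40 * (1 / X ^ 1)"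
      proof -
        have "X ^ 21 * X \<le> X ^ 29" using Xm[of 22 29] by (simp flip: power_Suc2)
        then show ?thesis using X0 by (simp add: field_simps)
      qed
      finally show "2 * (3 * gr ^ above j / real (Z ^ 29)) * (2 * (3 * gi ^ la j)) * real (Z ^ 19) \<le> 40 * (1 / real Z ^ 1)"
        unfolding of_nat_power X_def G_def .
    qed (use div' ZZ Z_pos gi_pos in auto)
    show "real (card (Q3 j)) \<le> 108 * 40 * U" unfolding Q3_def U_def
    proof (rule bohr_count_le[where k = 1])
      have "fib (above j + 1) \<noteq> 0" using fib_neq_0_nat[of "above j + 1"] by simp
      then show "1 \<le> 2 * real (fib (above j + 1))" by linarith
      have H: "real (fib (above j + 1)) \<le> G" unfolding G_def using fib_Suc_le_gr_power[of "above j"] by simp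
      have "2 * G < X ^ 18 * real D" using GD G0 by simp
      then show "2 * real (fib (above j + 1)) < real (Z ^ 18) * real D"
        using H unfolding of_nat_power X_def[symmetric] by linarith
      have "2 * real (fib (above j + 1)) * (2 * (2 * (1 / G) / X ^ 29)) * X ^ 19 \<le> 2 * G * (2 * (2 * (1 / G) / X ^ 29)) * X ^ 19"
        using H G0 X0 by (intro mult_right_mono) auto
      also have "\<dots> = 8 * (X ^ 19 / X ^ 29)" using G0 by simp
      also have "\<dots> \<le> 40 * (1 / X ^ 1)"
      proof -
        have "X ^ 19 * X \<le> X ^ 29" using Xm[of 20 29] by (simp flip: power_Suc2)
        then have "X ^ 19 / X ^ 29 \<le> 1 / X ^ 1" using X0 by (simp add: field_simps)
        then show ?thesis using X0 by (intro mult_mono) auto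
      qed
      finally show "2 * real (fib (above j + 1)) * (2 * (2 * gi ^ above j / real (Z ^ 29))) * real (Z ^ 19) \<le> 40 * (1 / real Z ^ 1)"
        unfolding of_nat_power X_def gG .
    qed (use div' ZZ Z_pos gi_pos in auto)
    show "real (card (Q4 j)) \<le> 6000 * U" unfolding Q4_def U_def
    proof (rule approx_count[where G = G])
      have "3 * G < X ^ 18 * real D" using GD G0 by simp
      also have "\<dots> \<le> X ^ 35 * real D" by (intro mult_right_mono Xm) auto
      finally show "3 * G / real (Z ^ 35) < real D"
        unfolding of_nat_power X_def[symmetric] using X0 by (simp add: field_simps)
    qed (use div' ZZ G_def G40 X_def in auto)
  qed
  have q: "real (card (Q j)) \<le> 18000 * U" if j: "j < J" for j
  proof (cases "small_level D j")
    case True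
    have "card (Q j) \<le> card (Q2 j) + card (Q3 j) + card (Q4 j)" unfolding Q_def using True
      by (simp add: order_trans[OF card_Un_le] card_Un_le add_mono)
    then have "real (card (Q j)) \<le> real (card (Q2 j)) + real (card (Q3 j)) + real (card (Q4 j))" by linarith
    then show ?thesis using q234[OF j True] U0 by linarith
  next
    case False
    then show ?thesis using q1[OF j False] U0 unfolding Q_def by simp
  qed
  have fin: "finite P1" "finite P2" "finite P3" "finite P4" "finite (Q j)" for j
    unfolding P1_def P2_def P3_def P4_def Q_def Q1_def Q2_def Q3_def Q4_def by auto
  have "{d\<in>{D..<2*D}. \<not> good D d} \<subseteq> P1 \<union> P2 \<union> P3 \<union> P4 \<union> (\<Union>j<J. Q j)"
  proof
    fix d assume "d \<in> {d\<in>{D..<2*D}. \<not> good D d}"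
    then have d: "d \<in> {D..<2*D}" and g: "\<not> good D d" by auto
    consider "d \<in> P1" | "d \<in> P2" | "d \<in> P3" | "d \<in> P4" | j where "j < J" "d \<in> Q j"
      using not_good_cases[OF g] d unfolding P1_def P2_def P3_def P4_def Q_def Q1_def Q2_def Q3_def Q4_def mem_Collect_eq
      by (elim disjE exE conjE) (fastforce split: if_splits)+
    then show "d \<in> P1 \<union> P2 \<union> P3 \<union> P4 \<union> (\<Union>j<J. Q j)" by cases auto
  qed
  then have "card {d\<in>{D..<2*D}. \<not> good D d} \<le> card (P1 \<union> P2 \<union> P3 \<union> P4 \<union> (\<Union>j<J. Q j))"
    using fin by (intro card_mono) auto
  also have "\<dots> \<le> card P1 + card P2 + card P3 + card P4 + (\<Sum>j<J. card (Q j))"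
    by (intro order_trans[OF card_Un_le] add_mono card_UN_le card_Un_le order_refl) auto
  finally have "real (card {d\<in>{D..<2*D}. \<not> good D d}) \<le> real (card P1 + card P2 + card P3 + card P4 + (\<Sum>j<J. card (Q j)))"
    by (rule of_nat_mono)
  also have "\<dots> = real (card P1) + real (card P2) + real (card P3) + real (card P4) + (\<Sum>j<J. real (card (Q j)))" by simp
  also have "\<dots> \<le> 24 * U + 24 * U + 108 * 12 * U + 108 * 40 * U + (\<Sum>j<J. 18000 * U)"
    by (intro add_mono c1 c2 c3 c4 sum_mono) (auto intro: q)
  also have "\<dots> \<le> 20000 * (real J + 1) * U"
    using U0 by (simp add: algebra_simps)
  finally show ?thesis unfolding U_def .
qed

end

section \<open>From single moduli to dyadic ranges, and the rate of decay\<close>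

definition max_sum :: "real \<Rightarrow> real \<Rightarrow> nat \<Rightarrow> real" where
  "max_sum \<theta> x d = (SUP (y::real, z::real)\<in>{(y, z). 0 \<le> y \<and> 0 \<le> z \<and> z - y \<le> x}.
     MAX a\<in>{0..<d}.
       norm (\<Sum>n::nat | y \<le> real n \<and> real n < z \<and> [n = a] (mod d).
               e2pi (\<theta> * real (zeckendorf_sum n))))"

text \<open>The residue class in the interval is the progression starting at its least element, with
  at most \<open>x / d + 1\<close> terms. Bounds for progressions that are uniform in the starting
  point therefore cover all \<open>a\<close>, \<open>y\<close> and \<open>z\<close>.\<close>

lemma progression_sum_le:
  fixes f :: "nat \<Rightarrow> complex" and x y z K :: real and N a d :: nat
  assumes d: "1 \<le> d" and yz: "0 \<le> y" "0 \<le> z" "z - y \<le> x" and N: "x / d + 1 \<le> real N"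
    and bnd: "\<And>a N'. N' \<le> N \<Longrightarrow> norm (\<Sum>n<N'. f (a + n * d)) \<le> K"
  shows "norm (\<Sum>n | y \<le> real n \<and> real n < z \<and> [n = a] (mod d). f n) \<le> K"
proof -
  define S where "S = {n. y \<le> real n \<and> real n < z \<and> [n = a] (mod d)}"
  have Siff: "n \<in> S \<longleftrightarrow> y \<le> real n \<and> real n < z \<and> n mod d = a mod d" for n
    unfolding S_def by (simp add: unique_euclidean_semiring_class.cong_def)
  have fin: "finite S"
  proof (rule finite_subset)
    show "S \<subseteq> {..nat \<lceil>z\<rceil>}" using yz(2) by (auto simp: Siff le_nat_iff) linarith
  qed simp
  have "norm (sum f S) \<le> K"
  proof (cases "S = {}")
    case True
    then show ?thesis using bnd[of 0] by simp
  next
    case False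
    define m where "m = Min S"
    define M where "M = Max S"
    have mM: "m \<in> S" "M \<in> S" unfolding m_def M_def using fin False by auto
    have le: "m \<le> n" "n \<le> M" if "n \<in> S" for n unfolding m_def M_def using fin that by auto
    define N' where "N' = Suc ((M - m) div d)"
    have S: "S = (\<lambda>n. m + n * d) ` {..<N'}"
    proof
      show "S \<subseteq> (\<lambda>n. m + n * d) ` {..<N'}"
      proof
        fix n assume n: "n \<in> S"
        have "m mod d = n mod d" using n mM(1) unfolding Siff by simp
        then have "d dvd n - m" using le(1)[OF n] mod_eq_dvd_iff_nat by metis
        then have "(n - m) div d * d = n - m" by simp
        then have e: "n = m + (n - m) div d * d" using le(1)[OF n] by simp
        have "(n - m) div d \<le> (M - m) div d" using le(2)[OF n] by (intro div_le_mono) simp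
        then have "(n - m) div d \<in> {..<N'}" unfolding N'_def by simp
        with e show "n \<in> (\<lambda>n. m + n * d) ` {..<N'}" by (rule image_eqI)
      qed
      show "(\<lambda>n. m + n * d) ` {..<N'} \<subseteq> S"
      proof
        fix w assume "w \<in> (\<lambda>n. m + n * d) ` {..<N'}"
        then obtain n where w: "w = m + n * d" "n < N'" by auto
        have "n * d \<le> (M - m) div d * d" using w(2) unfolding N'_def by (intro mult_right_mono) auto
        also have "\<dots> \<le> M - m" by simp
        finally have "w \<le> M" "m \<le> w" using w(1) le(1)[OF mM(2)] by linarith+
        then have "real w \<le> real M" "real m \<le> real w" by simp_all
        moreover have "w mod d = a mod d" using mM(1) unfolding w(1) Siff by simp
        ultimately show "w \<in> S" using mM unfolding Siff by linarith
      qed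
    qed
    have "real ((M - m) div d) \<le> real (M - m) / d" by (rule of_nat_div_le_of_nat)
    also have "\<dots> \<le> x / d"
    proof (rule divide_right_mono)
      have "real (M - m) = real M - real m" using le(1)[OF mM(2)] by (rule of_nat_diff)
      then show "real (M - m) \<le> x" using mM yz(3) unfolding Siff by linarith
    qed simp
    finally have "real N' \<le> real N" using N unfolding N'_def by simp
    then have N': "N' \<le> N" by simp
    have "inj_on (\<lambda>n. m + n * d) {..<N'}" using d by (auto simp: inj_on_def)
    then have "sum f S = (\<Sum>n<N'. f (m + n * d))" unfolding S by (simp add: sum.reindex)
    then show ?thesis using bnd[OF N', of m] by simp
  qed
  then show ?thesis unfolding S_def .
qed

lemma max_sum_le:
  assumes d: "1 \<le> d" and x: "0 \<le> x" and N: "x / d + 1 \<le> real N"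
    and bnd: "\<And>a N'. N' \<le> N \<Longrightarrow> norm (\<Sum>n<N'. e2pi (\<theta> * real (zeckendorf_sum (a + n * d)))) \<le> K"
  shows "max_sum \<theta> x d \<le> K"
  unfolding max_sum_def
proof (rule cSUP_least)
  have "(0, 0) \<in> {(y::real, z::real). 0 \<le> y \<and> 0 \<le> z \<and> z - y \<le> x}" using x by simp
  then show "{(y::real, z::real). 0 \<le> y \<and> 0 \<le> z \<and> z - y \<le> x} \<noteq> {}" by blast
next
  fix p :: "real \<times> real" assume p: "p \<in> {(y, z). 0 \<le> y \<and> 0 \<le> z \<and> z - y \<le> x}"
  obtain y z where yz: "p = (y, z)" by (cases p)
  have "norm (\<Sum>n::nat | y \<le> real n \<and> real n < z \<and> [n = a] (mod d). e2pi (\<theta> * real (zeckendorf_sum n))) \<le> K" for a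
    by (rule progression_sum_le[OF d _ _ _ N]) (use p yz bnd in auto)
  then have "(MAX a\<in>{0..<d}. norm (\<Sum>n::nat | y \<le> real n \<and> real n < z \<and> [n = a] (mod d). e2pi (\<theta> * real (zeckendorf_sum n)))) \<le> K"
    using d by (subst Max_le_iff) auto
  then show "(case p of (y, z) \<Rightarrow> MAX a\<in>{0..<d}. norm (\<Sum>n::nat | y \<le> real n \<and> real n < z \<and> [n = a] (mod d). e2pi (\<theta> * real (zeckendorf_sum n)))) \<le> K"
    unfolding yz by simp
qed

lemma norm_sum_e2pi_le: "norm (\<Sum>n<N. e2pi (f n)) \<le> real N"
proof -
  have "norm (\<Sum>n<N. e2pi (f n)) \<le> (\<Sum>n<N. 1)" by (rule sum_norm_le) (simp add: norm_e2pi)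
  then show ?thesis by simp
qed

lemma max_sum_trivial:
  assumes "1 \<le> d" "0 \<le> x" "x / d + 1 \<le> real N"
  shows "max_sum \<theta> x d \<le> real N"
proof (rule max_sum_le[OF assms])
  fix a N' assume "N' \<le> N"
  then show "norm (\<Sum>n<N'. e2pi (\<theta> * real (zeckendorf_sum (a + n * d)))) \<le> real N"
    using norm_sum_e2pi_le[of "\<lambda>n. \<theta> * real (zeckendorf_sum (a + n * d))" N'] by linarith
qed

text \<open>Replacing \<open>M d\<close> by \<open>max 0 (M d)\<close> makes it harmless to enlarge
  \<open>S\<close> to full dyadic ranges.\<close>

lemma dyadic_sum_le:
  fixes M :: "nat \<Rightarrow> real"
  assumes fin: "finite S" "finite I" and cover: "\<And>d. d \<in> S \<Longrightarrow> \<exists>i\<in>I. 2 ^ i \<le> d \<and> d < 2 * 2 ^ i"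
    and T: "\<And>i. i \<in> I \<Longrightarrow> (\<Sum>d\<in>{2 ^ i..<2 * 2 ^ i}. max 0 (M d)) \<le> T"
  shows "sum M S \<le> real (card I) * T"
proof -
  define b :: "nat \<Rightarrow> nat set" where "b i = {2 ^ i..<2 * 2 ^ i}" for i
  have "sum M S \<le> (\<Sum>d\<in>S. \<Sum>i\<in>I. if d \<in> b i then max 0 (M d) else 0)"
  proof (rule sum_mono)
    fix d assume "d \<in> S"
    then obtain i where i: "i \<in> I" "d \<in> b i" using cover unfolding b_def by fastforce
    have "M d \<le> (if d \<in> b i then max 0 (M d) else 0)" using i by simp
    also have "\<dots> \<le> (\<Sum>i\<in>I. if d \<in> b i then max 0 (M d) else 0)"
      by (rule member_le_sum[OF i(1) _ fin(2)]) auto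
    finally show "M d \<le> (\<Sum>i\<in>I. if d \<in> b i then max 0 (M d) else 0)" .
  qed
  also have "\<dots> = (\<Sum>i\<in>I. \<Sum>d\<in>S. if d \<in> b i then max 0 (M d) else 0)" by (rule sum.swap)
  also have "\<dots> \<le> (\<Sum>i\<in>I. T)"
  proof (rule sum_mono)
    fix i assume i: "i \<in> I"
    have "(\<Sum>d\<in>S. if d \<in> b i then max 0 (M d) else 0) = (\<Sum>d\<in>S \<inter> b i. max 0 (M d))"
      using fin(1) by (rule sum.inter_restrict[symmetric])
    also have "\<dots> \<le> (\<Sum>d\<in>b i. max 0 (M d))" by (rule sum_mono2) (auto simp: b_def)
    also have "\<dots> \<le> T" unfolding b_def by (rule T[OF i])
    finally show "(\<Sum>d\<in>S. if d \<in> b i then max 0 (M d) else 0) \<le> T" .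
  qed
  finally show ?thesis by simp
qed

lemma dist_nearest_int_bounds: "0 \<le> dist_nearest_int \<theta>" "dist_nearest_int \<theta> \<le> 1 / 2"
  using of_int_round_abs_le[of \<theta>] by (simp_all add: dist_nearest_int_eq abs_minus_commute)

lemma dist_nearest_int_sq: "(dist_nearest_int \<theta>)\<^sup>2 \<le> 1 / 4" "0 \<le> (dist_nearest_int \<theta>)\<^sup>2"
  using power_mono[OF dist_nearest_int_bounds(2,1), of \<theta> 2] by (simp_all add: power2_eq_square)

text \<open>With \<open>s\<close> the signed distance from \<theta> to the nearest integer and
  \<open>n\<close> the norm, \<open>n\<^sup>2\<close> is
  \<open>4 - 4 * (sin (pi * s))\<^sup>2\<close>. A Maclaurin estimate gives a sine of at least
  \<open>\<bar>s\<bar>\<close> in modulus, and \<open>4 - n\<^sup>2 = (2 - n) * (2 + n)\<close> is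
  at most \<open>4 * (2 - n)\<close>.\<close>

lemma two_minus_norm_e2pi: "(dist_nearest_int \<theta>)\<^sup>2 \<le> 2 - norm (1 + e2pi \<theta>)"
proof -
  define s where "s = \<theta> - of_int (round \<theta>)"
  define n where "n = norm (1 + e2pi \<theta>)"
  define u where "u = pi * \<bar>s\<bar>"
  have t: "dist_nearest_int \<theta> = \<bar>s\<bar>" by (simp add: dist_nearest_int_eq s_def)
  have s: "\<bar>s\<bar> \<le> 1 / 2" using dist_nearest_int_bounds(2)[of \<theta>] t by simp
  have "2 * pi * \<theta> = 2 * pi * s + 2 * pi * of_int (round \<theta>)" by (simp add: s_def algebra_simps)
  then have "cis (2 * pi * \<theta>) = cis (2 * pi * s) * cis (2 * pi * of_int (round \<theta>))" by (simp only: cis_mult)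
  also have "\<dots> = cis (2 * pi * s)" by simp
  finally have e: "e2pi \<theta> = cis (2 * pi * s)" unfolding e2pi_def cis_conv_exp by (simp add: mult_ac)
  have n2: "0 \<le> n" "n \<le> 2"
  proof -
    show "0 \<le> n" unfolding n_def by simp
    have "n \<le> norm (1::complex) + norm (e2pi \<theta>)" unfolding n_def by (rule norm_triangle_ineq)
    then show "n \<le> 2" by (simp add: norm_e2pi)
  qed
  have "n\<^sup>2 = (1 + cos (2 * pi * s))\<^sup>2 + (sin (2 * pi * s))\<^sup>2" unfolding n_def e by (simp add: cmod_power2)
  also have "\<dots> = 2 + 2 * cos (2 * pi * s)" unfolding sin_squared_eq by (simp add: power2_eq_square algebra_simps)
  also have "\<dots> = 4 - 4 * (sin (pi * s))\<^sup>2" using cos_double_sin[of "pi * s"] by (simp add: mult.assoc)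
  finally have n: "n\<^sup>2 = 4 - 4 * (sin (pi * s))\<^sup>2" .
  have u: "0 \<le> u" "u \<le> 2"
  proof -
    show "0 \<le> u" unfolding u_def by simp
    have "pi * \<bar>s\<bar> \<le> 4 * (1 / 2)" using s pi_less_4 by (intro mult_mono) auto
    then show "u \<le> 2" unfolding u_def by simp
  qed
  have "\<bar>sin u - (\<Sum>m<3. sin_coeff m * u ^ m)\<bar> \<le> inverse (fact 3) * \<bar>u\<bar> ^ 3" by (rule Maclaurin_sin_bound)
  moreover have "(\<Sum>m<3. sin_coeff m * u ^ m) = u" by (simp add: sin_coeff_def numeral_3_eq_3)
  moreover have "inverse (fact 3) * \<bar>u\<bar> ^ 3 \<le> 2 / 3 * u"
  proof -
    have "u * u \<le> 2 * 2" using u by (intro mult_mono) auto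
    then have "u * u * u \<le> 4 * u" using u by (intro mult_right_mono) auto
    then show ?thesis using u by (simp add: numeral_3_eq_3)
  qed
  ultimately have "u / 3 \<le> sin u" by linarith
  moreover have "\<bar>s\<bar> \<le> u / 3"
  proof -
    have "3 * \<bar>s\<bar> \<le> pi * \<bar>s\<bar>" using pi_gt3 by (intro mult_right_mono) auto
    then show ?thesis unfolding u_def by simp
  qed
  ultimately have "\<bar>s\<bar> \<le> sin u" by linarith
  then have "\<bar>s\<bar>\<^sup>2 \<le> (sin u)\<^sup>2" by (intro power_mono) auto
  moreover have "(sin u)\<^sup>2 = (sin (pi * s))\<^sup>2" unfolding u_def by (cases "0 \<le> s") simp_all
  ultimately have "4 * \<bar>s\<bar>\<^sup>2 \<le> 4 - n\<^sup>2" using n by linarith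
  also have "\<dots> = (2 - n) * (2 + n)" by (simp add: power2_eq_square algebra_simps)
  also have "\<dots> \<le> (2 - n) * 4" using n2 by (intro mult_left_mono) auto
  finally show ?thesis unfolding t n_def by simp
qed

context scales begin

text \<open>Here \<open>v\<close> is the rate of decay per digit. The factor \<open>exp 3\<close>
  pays for rounding \<open>l\<close> down to complete blocks, as \<open>l\<close> is at most
  \<open>B + 3\<close> times \<open>W\<close>. The errors of size \<open>1 / zz\<close> decay no
  more slowly, because \<open>zz\<close> grows like \<open>gr ^ l\<close> and \<open>v\<close> is at
  most 1/4, below the logarithm of \<open>gr\<close>.\<close>

lemma decay:
  fixes v q :: real
  assumes W: "1 \<le> W" and l2: "2 \<le> l" and q: "2 \<le> q" and v: "v = (dist_nearest_int \<theta>)\<^sup>2 / (q * real W)"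
  shows "(1 - (2 - norm (1 + e2pi \<theta>)) / q) ^ ((l - 2) div W) \<le> exp 3 * exp (- (v * l))"
    and "1 / real zz \<le> 3 * exp (- (v * l))" and "0 \<le> v"
proof -
  define \<rho> where "\<rho> = 2 - norm (1 + e2pi \<theta>)"
  define t where "t = (dist_nearest_int \<theta>)\<^sup>2"
  define B where "B = (l - 2) div W"
  have t: "0 \<le> t" "t \<le> 1 / 4" "t \<le> \<rho>" "\<rho> \<le> 2"
    unfolding t_def \<rho>_def using dist_nearest_int_sq two_minus_norm_e2pi by auto
  have W1: "1 \<le> real W" using W by simp
  have tq: "0 \<le> t / q" "t / q \<le> 1" "t / q \<le> \<rho> / q" "\<rho> / q \<le> 1"
    using t q by (auto simp: divide_right_mono)
  have vW: "v * real W = t / q" unfolding v t_def[symmetric] using W1 by simp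
  show v0: "0 \<le> v" unfolding v t_def[symmetric] using t q by simp
  have v1: "v \<le> 1 / 4"
  proof -
    have "1 * 1 \<le> q * real W" using q W1 by (intro mult_mono) auto
    then have "t / (q * real W) \<le> t / 1" using t by (intro divide_left_mono) auto
    then have "v \<le> t" unfolding v t_def[symmetric] by simp
    then show ?thesis using t by linarith
  qed
  have "(l - 2) mod W < W" using W by simp
  moreover have "l - 2 = B * W + (l - 2) mod W" unfolding B_def by simp
  ultimately have "l \<le> B * W + W + 2" using l2 by linarith
  then have "real l \<le> real (B * W + W + 2)" by (rule of_nat_mono)
  then have "real l \<le> (real B + 3) * real W" using W1 by (simp add: algebra_simps)
  then have "v * real l \<le> v * ((real B + 3) * real W)" using v0 by (rule mult_left_mono)
  also have "\<dots> = (real B + 3) * (v * real W)" by (simp only: mult_ac)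
  also have "\<dots> = (real B + 3) * (t / q)" unfolding vW ..
  also have "\<dots> = real B * (t / q) + 3 * (t / q)" by (rule distrib_right)
  also have "\<dots> \<le> real B * (\<rho> / q) + 3 * 1" using tq by (intro add_mono mult_left_mono) auto
  finally have vl: "v * real l \<le> real B * (\<rho> / q) + 3" by simp
  have "1 - \<rho> / q \<le> exp (- (\<rho> / q))" using exp_ge_add_one_self[of "- (\<rho> / q)"] by simp
  then have "(1 - \<rho> / q) ^ B \<le> exp (- (\<rho> / q)) ^ B" using tq by (intro power_mono) auto
  also have "\<dots> = exp (real B * - (\<rho> / q))" by (rule exp_of_nat_mult[symmetric])
  also have "\<dots> \<le> exp (3 + - (v * l))" using vl by simp
  also have "\<dots> = exp 3 * exp (- (v * l))" by (rule exp_add)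
  finally show "(1 - (2 - norm (1 + e2pi \<theta>)) / q) ^ ((l - 2) div W) \<le> exp 3 * exp (- (v * l))"
    unfolding \<rho>_def B_def .
  have "3 / 4 \<le> exp (- v)" using exp_ge_add_one_self[of "- v"] v1 by linarith
  then have "5 / 8 \<le> exp (- v)" by linarith
  then have "5 / 8 * gr \<le> exp (- v) * gr" using gr_bounds by (intro mult_right_mono) auto
  then have "1 \<le> exp (- v) * gr" using gr_bounds by linarith
  then have "1 ^ l \<le> (exp (- v) * gr) ^ l" by (intro power_mono) auto
  then have "1 \<le> exp (- v) ^ l * gr ^ l" by (simp add: power_mult_distrib)
  also have "exp (- v) ^ l = exp (- (v * l))" by (simp flip: exp_of_nat_mult add: mult.commute)
  also have "exp (- (v * l)) * gr ^ l \<le> exp (- (v * l)) * (3 * real zz)" by (intro mult_left_mono gr_l) simp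
  finally show "1 / real zz \<le> 3 * exp (- (v * l))" using zz_pos by (simp add: field_simps)
qed

text \<open>Good moduli contribute \<open>N * g\<close> and the others trivially \<open>N\<close>,
  but the latter form only a proportion of order \<open>1 / zz\<close> of the range. The length
  \<open>N\<close> is taken for the smallest modulus \<open>D\<close> and used for all, at the cost
  of a constant.\<close>

lemma block_bound:
  assumes D: "1 \<le> D" "real D \<le> x" and DZ: "real D \<le> real Z ^ (22 + J)"
    and div: "\<And>m::nat. 0 < m \<Longrightarrow> m \<le> 2 * D * Z ^ 84 \<Longrightarrow> real (card {d. d dvd m}) \<le> zz"
    and N: "real Z ^ 100 \<le> x / D" and W: "W = 6 * Suc J + 5" and l2: "2 \<le> l"
    and g: "0 \<le> g" "(1 - (2 - norm (1 + e2pi \<theta>)) / 2 ^ (2 * Suc J * W)) ^ ((l - 2) div W) +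
      (26 * real J + (8 * (real J + 2) + 4) * 2 ^ Suc J) / zz \<le> g ^ (2 ^ Suc J)"
  shows "(\<Sum>d\<in>{D..<2*D}. max 0 (max_sum \<theta> x d)) \<le> 3 * x * (g + 20000 * (real J + 1) / zz)"
proof -
  define N where "N = nat \<lceil>x / D\<rceil> + 1"
  have D0: "0 < real D" using D by simp
  have x0: "0 \<le> x" using D by linarith
  have xD: "1 \<le> x / D" using D D0 by simp
  have N1: "x / D + 1 \<le> real N" "real N \<le> x / D + 2" unfolding N_def using xD by linarith+
  have N3: "real N * real D \<le> 3 * x"
  proof -
    have "real N * real D \<le> (3 * (x / D)) * real D" using N1 xD by (intro mult_right_mono) auto
    then show ?thesis using D0 by simp
  qed
  have NN: "Z ^ 100 \<le> N"
  proof -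
    have "real (Z ^ 100) \<le> real N" using N N1 unfolding of_nat_power by linarith
    then show ?thesis by (simp only: of_nat_le_iff)
  qed
  have B: "2 + (l - 2) div W * W \<le> l"
  proof -
    have "(l - 2) div W * W \<le> l - 2" by simp
    then show ?thesis using l2 by linarith
  qed
  have pw: "max 0 (max_sum \<theta> x d) \<le> N * g + (if good D d then 0 else real N)" if d: "d \<in> {D..<2*D}" for d
  proof -
    have d1: "D \<le> d" "d < 2 * D" "1 \<le> d" using d D by auto
    have "x / d \<le> x / D" using x0 D0 d1 by (intro divide_left_mono) auto
    then have Nd: "x / d + 1 \<le> real N" using N1 by linarith
    have Ng: "0 \<le> N * g" using g by simp
    show ?thesis
    proof (cases "good D d")
      case True
      have "max_sum \<theta> x d \<le> N * g"
      proof (rule max_sum_le[OF d1(3) x0 Nd])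
        fix a N' assume N': "N' \<le> N"
        define S where "S = norm (\<Sum>n<N'. e2pi (\<theta> * real (zeckendorf_sum (a + n * d))))"
        have "(S / N) ^ (2 ^ Suc J) \<le> g ^ (2 ^ Suc J)"
          unfolding S_def by (rule order_trans[OF good_bound[OF True d1(1,2) DZ N' NN W B] g(2)])
        moreover have "0 \<le> S / N" unfolding S_def by simp
        moreover have "0 < (2::nat) ^ Suc J" by simp
        ultimately have "S / N \<le> g" using g(1) power_mono_iff by blast
        moreover have "0 < real N" unfolding N_def by simp
        ultimately show "norm (\<Sum>n<N'. e2pi (\<theta> * real (zeckendorf_sum (a + n * d)))) \<le> N * g"
          unfolding S_def[symmetric] by (simp add: divide_le_eq mult.commute)
      qed
      then show ?thesis using True Ng by simp
    next
      case False
      have "max_sum \<theta> x d \<le> real N" by (rule max_sum_trivial[OF d1(3) x0 Nd])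
      then show ?thesis using False Ng by simp
    qed
  qed
  have "(\<Sum>d\<in>{D..<2*D}. max 0 (max_sum \<theta> x d)) \<le> (\<Sum>d\<in>{D..<2*D}. N * g + (if good D d then 0 else real N))"
    by (intro sum_mono pw)
  also have "\<dots> = real D * (N * g) + real (card {d\<in>{D..<2*D}. \<not> good D d}) * real N"
  proof -
    have "(\<Sum>d\<in>{D..<2*D}. if good D d then 0 else real N) = (\<Sum>d\<in>{d\<in>{D..<2*D}. \<not> good D d}. real N)"
      by (rule sum.mono_neutral_cong_right) auto
    then show ?thesis by (simp add: sum.distrib)
  qed
  also have "\<dots> \<le> real D * (N * g) + (20000 * (real J + 1) * (real D / real zz)) * real N"
    by (intro add_left_mono mult_right_mono bad_count[OF D(1) DZ div]) auto
  also have "\<dots> = (real N * real D) * (g + 20000 * (real J + 1) / zz)"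
  proof -
    have "b * (a * g) + u * (b / w) * a = a * b * (g + u / w)" for a b u w :: real by (simp add: algebra_simps)
    then show ?thesis .
  qed
  also have "\<dots> \<le> 3 * x * (g + 20000 * (real J + 1) / zz)" using g by (intro mult_right_mono N3) auto
  finally show ?thesis .
qed

text \<open>The scale is fixed by \<open>x\<close> being about
  \<open>gr ^ (100 * E * k * l)\<close>: then \<open>x powr (1 / k)\<close>, a lower bound for
  \<open>x / D\<close>, is at least \<open>Z ^ 100\<close>. The numbers whose divisors are counted
  are at most \<open>2 * D * Z ^ 84\<close>, hence at most \<open>Z ^ (107 + J)\<close>. There are
  at most \<open>3 * log_plus x\<close> dyadic ranges.\<close>

lemma total_bound:
  fixes k :: nat and S :: "nat set" and c v x :: real
  assumes k: "1 \<le> k" "J = 300 * k" and x: "gr ^ (100 * E * k * l) \<le> x" "x < gr ^ (100 * E * k * (l + 1))"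
    and l2: "2 \<le> l" and div: "\<And>m::nat. 0 < m \<Longrightarrow> real m \<le> real Z ^ (107 + J) \<Longrightarrow> real (card {d. d dvd m}) \<le> zz"
    and W: "W = 6 * Suc J + 5" and v: "v = (dist_nearest_int \<theta>)\<^sup>2 / (2 ^ (2 * Suc J * W) * real W)"
    and c: "c = exp 3 + 3 * (26 * real J + (8 * (real J + 2) + 4) * 2 ^ Suc J)"
    and S: "\<And>d. d \<in> S \<Longrightarrow> 1 \<le> d \<and> real d \<le> x powr (1 - 1 / k)"
  shows "sum (max_sum \<theta> x) S \<le> 3 * log_plus x * (3 * x * ((c + 60000 * (real J + 1)) * exp (- (v * l) / 2 ^ Suc J)))"
proof -
  define K :: nat where "K = 2 ^ Suc J"
  define e where "e = exp (- (v * l) / real K)"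
  define g where "g = c * e"
  define T where "T = 3 * x * ((c + 60000 * (real J + 1)) * e)"
  have q2: "(2::real) \<le> 2 ^ (2 * Suc J * W)"
  proof -
    have "(2::real) ^ 1 \<le> 2 ^ (2 * Suc J * W)" unfolding W by (intro power_increasing) auto
    then show ?thesis by simp
  qed
  have W1: "1 \<le> W" unfolding W by simp
  note dc = decay[OF W1 l2 q2 v]
  have K1: "1 \<le> K" unfolding K_def by simp
  have c1: "1 \<le> c" unfolding c using exp_ge_add_one_self[of 3] by (simp add: add_increasing2)
  have e0: "0 < e" unfolding e_def by simp
  have eK: "e ^ K = exp (- (v * l))"
  proof -
    have "e ^ K = exp (real K * (- (v * l) / real K))" unfolding e_def by (rule exp_of_nat_mult[symmetric])
    then show ?thesis using K1 by simp
  qed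
  have vl: "0 \<le> v * l" using dc(3) by simp
  have e_le: "exp (- (v * l)) \<le> e"
  proof -
    have "v * l / real K \<le> v * l / 1" using vl K1 by (intro divide_left_mono) auto
    then show ?thesis unfolding e_def by simp
  qed
  have e1: "e \<le> 1" unfolding e_def using vl by simp
  have g0: "0 \<le> g" unfolding g_def using c1 e0 by simp
  define \<kappa> where "\<kappa> = 26 * real J + (8 * (real J + 2) + 4) * 2 ^ Suc J"
  have \<kappa>0: "0 \<le> \<kappa>" unfolding \<kappa>_def by simp
  have gK: "(1 - (2 - norm (1 + e2pi \<theta>)) / 2 ^ (2 * Suc J * W)) ^ ((l - 2) div W) + \<kappa> / zz \<le> g ^ (2 ^ Suc J)"
  proof -
    have "\<kappa> / zz = \<kappa> * (1 / zz)" by simp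
    also have "\<dots> \<le> \<kappa> * (3 * exp (- (v * l)))" using dc(2) \<kappa>0 by (rule mult_left_mono)
    finally have "(1 - (2 - norm (1 + e2pi \<theta>)) / 2 ^ (2 * Suc J * W)) ^ ((l - 2) div W) + \<kappa> / zz
      \<le> exp 3 * exp (- (v * l)) + \<kappa> * (3 * exp (- (v * l)))" using dc(1) by linarith
    also have "\<dots> = c * exp (- (v * l))" unfolding c \<kappa>_def[symmetric] by (simp add: algebra_simps)
    also have "\<dots> \<le> c ^ K * exp (- (v * l))"
    proof (rule mult_right_mono)
      have "0 < K" using K1 by simp
      then show "c \<le> c ^ K" using c1 by (intro self_le_power)
    qed simp
    also have "\<dots> = g ^ (2 ^ Suc J)" unfolding g_def eK[symmetric] K_def[symmetric] by (simp add: power_mult_distrib)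
    finally show ?thesis .
  qed
  have gr1: "1 \<le> gr" using gr_bounds by simp
  have "1 \<le> gr ^ (100 * E * k * l)" using gr1 by (rule one_le_power)
  then have x1: "1 \<le> x" using x by linarith
  \<comment> \<open>Since \<open>gr ^ Suc l\<close> is at most \<open>zz ^ 2\<close>, the upper
    bound on \<open>x\<close> gives at most \<open>Z ^ (200 * k)\<close>. This is what
    \<open>J = 300 * k\<close> is made for: the windows reach beyond every modulus.\<close>
  have xZ: "x \<le> real Z ^ (22 + J)"
  proof -
    have "gr ^ Suc l = gr * gr ^ l" by simp
    also have "\<dots> \<le> 2 * (3 * real zz)" using gr_bounds gr_l by (intro mult_mono) auto
    also have "\<dots> \<le> real zz * real zz"
    proof -
      have "6 \<le> zz" using zz_large(1) by simp
      then show ?thesis by (simp add: mult_right_mono)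
    qed
    also have "\<dots> = real zz ^ 2" by (simp add: power2_eq_square)
    finally have "(gr ^ Suc l) ^ (100 * E * k) \<le> (real zz ^ 2) ^ (100 * E * k)" using gr1 by (intro power_mono) auto
    then have "x \<le> (real zz ^ 2) ^ (100 * E * k)" 
    proof -
      have "(gr ^ Suc l) ^ (100 * E * k) = gr ^ (100 * E * k * (l + 1))"
        by (simp only: power_mult[symmetric] mult.commute[of "100 * E * k"] Suc_eq_plus1)
      then show ?thesis using \<open>(gr ^ Suc l) ^ (100 * E * k) \<le> (real zz ^ 2) ^ (100 * E * k)\<close> x(2) by linarith
    qed
    also have "\<dots> = real zz ^ (2 * (100 * E * k))" by (rule power_mult[symmetric])
    also have "\<dots> \<le> real zz ^ (E * (22 + J))"
    proof (rule power_increasing)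
      have "E * (200 * k) \<le> E * (22 + J)" unfolding k by (intro mult_left_mono) auto
      then show "2 * (100 * E * k) \<le> E * (22 + J)" by (simp only: mult_ac; simp)
      show "1 \<le> real zz" using zz_pos by simp
    qed
    also have "\<dots> = real Z ^ (22 + J)" unfolding Z by (simp only: power_mult of_nat_power)
    finally show ?thesis .
  qed
  define I where "I = {i::nat. 2 ^ i \<le> x powr (1 - 1 / k)}"
  have k0: "0 < real k" using k by simp
  have xk: "x powr (1 - 1 / k) \<le> x" using powr_mono[of "1 - 1 / k" 1 x] x1 by simp
  have Isub: "I \<subseteq> {..nat \<lfloor>2 * ln x\<rfloor>}"
  proof
    fix i assume "i \<in> I"
    then have "2 ^ i \<le> x" using xk unfolding I_def by simp
    then have "ln (2 ^ i) \<le> ln x" using x1 by (subst ln_le_cancel_iff) auto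
    then have "real i * ln 2 \<le> ln x" by (simp add: ln_realpow)
    moreover have "real i * (1 / 2) \<le> real i * ln 2" using ln2_ge_two_thirds by (intro mult_left_mono) auto
    ultimately have "real i \<le> 2 * ln x" by linarith
    then show "i \<in> {..nat \<lfloor>2 * ln x\<rfloor>}" by (simp add: le_nat_floor)
  qed
  have finI: "finite I" using Isub by (rule finite_subset) simp
  have "card I \<le> card {..nat \<lfloor>2 * ln x\<rfloor>}" using Isub by (intro card_mono) auto
  then have "real (card I) \<le> real (Suc (nat \<lfloor>2 * ln x\<rfloor>))" by simp
  also have "\<dots> \<le> 2 * ln x + 1"
  proof -
    have "0 \<le> ln x" using x1 by simp
    then show ?thesis by simp
  qed
  also have "\<dots> \<le> 3 * log_plus x" using x1 unfolding log_plus_def by auto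
  finally have cI: "real (card I) \<le> 3 * log_plus x" .
  have T0: "0 \<le> T" unfolding T_def using x1 c1 e0 by simp
  have finS: "finite S"
  proof (rule finite_subset)
    show "S \<subseteq> {..nat \<lfloor>x\<rfloor>}"
    proof
      fix d assume "d \<in> S"
      then have "real d \<le> x" using S xk by force
      then show "d \<in> {..nat \<lfloor>x\<rfloor>}" by (simp add: le_nat_floor)
    qed
  qed simp
  have "sum (max_sum \<theta> x) S \<le> real (card I) * T"
  proof (rule dyadic_sum_le[OF finS finI])
    fix d assume d: "d \<in> S"
    have "1 \<le> d" using S[OF d] by simp
    then obtain i where i: "2 ^ i \<le> d" "d < 2 ^ (i + 1)" using ex_power_ivl1[of 2 d] by auto
    have "real (2 ^ i) \<le> real d" using i(1) by (rule of_nat_mono)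
    moreover have "real (2 ^ i) = 2 ^ i" by simp
    ultimately have "2 ^ i \<le> x powr (1 - 1 / k)" using S[OF d] by linarith
    then show "\<exists>i\<in>I. 2 ^ i \<le> d \<and> d < 2 * 2 ^ i" using i unfolding I_def by (intro bexI[of _ i]) auto
  next
    fix i assume "i \<in> I"
    then have iI: "2 ^ i \<le> x powr (1 - 1 / k)" unfolding I_def by simp
    define D :: nat where "D = 2 ^ i"
    have rD: "real D = 2 ^ i" unfolding D_def by simp
    have D1: "1 \<le> D" unfolding D_def by simp
    have D0: "0 < real D" using D1 by simp
    have Dx: "real D \<le> x" using iI xk rD by linarith
    have DZ: "real D \<le> real Z ^ (22 + J)" using Dx xZ by linarith
    have "(\<Sum>d\<in>{D..<2*D}. max 0 (max_sum \<theta> x d)) \<le> 3 * x * (g + 20000 * (real J + 1) / zz)"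
    proof (rule block_bound[OF D1 Dx DZ _ _ W l2 g0 gK[unfolded \<kappa>_def]])
      fix m :: nat assume m: "0 < m" "m \<le> 2 * D * Z ^ 84"
      have "real m \<le> real (2 * D * Z ^ 84)" using m(2) by (rule of_nat_mono)
      also have "\<dots> = 2 * real D * real Z ^ 84" by simp
      also have "\<dots> \<le> real Z * real Z ^ (22 + J) * real Z ^ 84"
      proof (intro mult_right_mono mult_mono DZ)
        have "2 \<le> Z" using Z_large(1) by simp
        then show "2 \<le> real Z" by simp
      qed auto
      also have "\<dots> = real Z ^ (107 + J)" by (simp add: power_add[symmetric] flip: power_Suc)
      finally show "real (card {d. d dvd m}) \<le> zz" using m(1) by (intro div)
    next
      have y: "0 < gr ^ (100 * E * l)" using gr_bounds by simp
      have "gr ^ (100 * E * l) = (gr ^ (100 * E * l)) powr (real k * (1 / k))" using k0 y by simp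
      also have "\<dots> = ((gr ^ (100 * E * l)) powr real k) powr (1 / k)" by (rule powr_powr[symmetric])
      also have "(gr ^ (100 * E * l)) powr real k = (gr ^ (100 * E * l)) ^ k" using y by (rule powr_realpow)
      also have "\<dots> = gr ^ (100 * E * k * l)" by (simp add: power_mult[symmetric] mult_ac)
      also have "(gr ^ (100 * E * k * l)) powr (1 / k) \<le> x powr (1 / k)" using x(1) gr_bounds by (intro powr_mono2) auto
      finally have a: "gr ^ (100 * E * l) \<le> x powr (1 / k)" .
      have "real D * x powr (1 / k) \<le> x powr (1 - 1 / k) * x powr (1 / k)" using iI rD by (intro mult_right_mono) auto
      also have "\<dots> = x" using x1 by (simp add: powr_add[symmetric])
      finally have "x powr (1 / k) \<le> x / D" using D0 by (simp add: le_divide_eq mult.commute)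
      then show "real Z ^ 100 \<le> x / D" using a gr_Z_bounds(1)[of 100] by linarith
    qed
    also have "\<dots> \<le> T"
      unfolding T_def
    proof (rule mult_left_mono)
      have "20000 * (real J + 1) / zz = 20000 * (real J + 1) * (1 / zz)" by simp
      also have "\<dots> \<le> 20000 * (real J + 1) * (3 * e)" using dc(2) e_le by (intro mult_left_mono) auto
      finally show "g + 20000 * (real J + 1) / zz \<le> (c + 60000 * (real J + 1)) * e"
        unfolding g_def by (simp add: algebra_simps)
    qed (use x1 in simp)
    finally show "(\<Sum>d\<in>{2 ^ i..<2 * 2 ^ i}. max 0 (max_sum \<theta> x d)) \<le> T" unfolding D_def .
  qed
  also have "\<dots> \<le> 3 * log_plus x * T" using cI T0 by (rule mult_right_mono)
  finally show ?thesis unfolding T_def e_def K_def by simp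
qed

end

section \<open>Small \<open>x\<close>, the choice of the scale, and the final constants\<close>

lemma sum_max_sum_trivial:
  assumes x: "1 \<le> x" "x \<le> X" and S: "\<And>d. d \<in> S \<Longrightarrow> 1 \<le> d \<and> real d \<le> x"
  shows "sum (max_sum \<theta> x) S \<le> 4 * X\<^sup>2"
proof -
  have sub: "S \<subseteq> {1..nat \<lfloor>x\<rfloor>}" using S by (auto simp: le_nat_floor Suc_le_eq)
  have "card S \<le> card {1..nat \<lfloor>x\<rfloor>}" using sub by (intro card_mono) auto
  then have "real (card S) \<le> real (nat \<lfloor>x\<rfloor>)" by simp
  also have "\<dots> \<le> X" using x by linarith
  finally have cS: "real (card S) \<le> X" .
  have "sum (max_sum \<theta> x) S \<le> (\<Sum>d\<in>S. 4 * X)"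
  proof (rule sum_mono)
    fix d assume d: "d \<in> S"
    then have d1: "1 \<le> d" using S by blast
    have "x / d \<le> x / 1" using x d1 by (intro divide_left_mono) auto
    then have "x / d + 1 \<le> real (nat \<lceil>x\<rceil> + 1)" using x by linarith
    then have "max_sum \<theta> x d \<le> real (nat \<lceil>x\<rceil> + 1)" using x d1 by (intro max_sum_trivial) auto
    also have "\<dots> \<le> 4 * X" using x by linarith
    finally show "max_sum \<theta> x d \<le> 4 * X" .
  qed
  also have "\<dots> = real (card S) * (4 * X)" by simp
  also have "\<dots> \<le> X * (4 * X)" using cS x by (intro mult_right_mono) auto
  finally show ?thesis by (simp add: power2_eq_square)
qed

lemma ln_gr: "0 < ln gr" "ln gr \<le> 1"
proof -
  show "0 < ln gr" using gr_bounds by simp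
  show "ln gr \<le> 1" using ln_le_minus_one[of gr] gr_bounds by simp
qed

lemma fib_ge_linear: "n \<le> 2 * fib (n + 2)"
proof -
  have "real n * (1 / 2) + 1 \<le> (1 / 2 + 1) ^ n" by (rule linear_plus_1_le_power) simp
  also have "\<dots> \<le> gr ^ n" using gr_bounds by (intro power_mono) auto
  also have "\<dots> \<le> real (fib (n + 2))" by (rule gr_power_le_fib)
  finally have "real n \<le> real (2 * fib (n + 2))" by simp
  then show ?thesis by (simp only: of_nat_le_iff)
qed

text \<open>The last conclusion turns decay in \<open>l\<close> into decay in \<open>ln x\<close>;
  it uses \<open>ln gr \<le> 1\<close> to drop the factor \<open>ln gr\<close>.\<close>

lemma gr_power_between:
  assumes "1 \<le> x" "1 \<le> A"
  shows "\<exists>l. gr ^ (A * l) \<le> x \<and> x < gr ^ (A * (l + 1)) \<and> ln x / A \<le> real l + 1"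
proof -
  define b where "b = real A * ln gr"
  have b: "0 < b" "b \<le> real A" unfolding b_def using assms ln_gr by (simp_all add: mult_left_le)
  define l where "l = nat \<lfloor>ln x / b\<rfloor>"
  have lx: "0 \<le> ln x" using assms by simp
  have p0: "0 \<le> ln x / b" using lx b by simp
  then have l: "real l \<le> ln x / b" "ln x / b < real l + 1" unfolding l_def by linarith+
  have gp: "gr ^ (A * m) = exp (real m * b)" for m
  proof -
    have "gr ^ (A * m) = exp (ln gr) ^ (A * m)" using gr_bounds by simp
    also have "\<dots> = exp (real (A * m) * ln gr)" by (rule exp_of_nat_mult[symmetric])
    finally show ?thesis unfolding b_def by (simp add: mult_ac)
  qed
  have xe: "x = exp (ln x)" using assms by simp
  have "real l * b \<le> ln x" using l(1) b by (simp add: le_divide_eq)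
  then have "exp (real l * b) \<le> exp (ln x)" by simp
  then have a1: "gr ^ (A * l) \<le> x" unfolding gp using xe by simp
  have "ln x < (real l + 1) * b" using l(2) b by (simp add: divide_less_eq)
  then have "exp (ln x) < exp (real (l + 1) * b)" by (simp add: add.commute)
  then have a2: "x < gr ^ (A * (l + 1))" unfolding gp using xe by simp
  have "ln x / A \<le> ln x / b" using b lx assms by (intro divide_left_mono) auto
  then show ?thesis using a1 a2 l(2) by (intro exI[of _ l]) auto
qed

theorem theorem2p4:
  fixes \<epsilon> :: real
  assumes "\<epsilon> > 0"
  shows "\<exists>c\<^sub>1 C :: real. c\<^sub>1 > 0 \<and> C > 0 \<and>
    (\<forall>(\<theta>::real) (x::real). x \<ge> 1 \<longrightarrow>
      (\<Sum>d::nat | 1 \<le> d \<and> real d \<le> x powr (1 - \<epsilon>).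
         SUP (y::real, z::real)\<in>{(y, z). 0 \<le> y \<and> 0 \<le> z \<and> z - y \<le> x}.
           MAX a\<in>{0..<d}.
             norm (\<Sum>n::nat | y \<le> real n \<and> real n < z \<and> [n = a] (mod d).
                     e2pi (\<theta> * real (zeckendorf_sum n))))
      \<le> C * log_plus x powr (11/4) * x powr (1 - c\<^sub>1 * (dist_nearest_int \<theta>)\<^sup>2))"
proof -
  define k where "k = nat \<lceil>1 / \<epsilon>\<rceil>"
  have "0 < 1 / \<epsilon>" using assms by simp
  then have ke: "1 / \<epsilon> \<le> real k" "1 \<le> k" unfolding k_def by linarith+
  have k0: "0 < real k" using ke(2) by simp
  have k\<epsilon>: "1 / real k \<le> \<epsilon>" using ke(1) k0 assms by (simp add: field_simps)
  define J where "J = 300 * k"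
  define E :: nat where "E = 2 ^ (J + 8)"
  define A where "A = 100 * E * k"
  define W where "W = 6 * Suc J + 5"
  define q :: real where "q = 2 ^ (2 * Suc J * W)"
  \<comment> \<open>Divisors are counted for integers up to
    \<open>Z ^ (107 + J) = zz ^ (E * (107 + J))\<close>; this exponent turns that bound into
    \<open>sqrt zz\<close>.\<close>
  define p :: real where "p = 1 / (2 * real E * (107 + real J))"
  have J1: "1 \<le> J" unfolding J_def using ke(2) by simp
  have E1: "1 \<le> E" unfolding E_def by simp
  have A1: "1 \<le> A" unfolding A_def using ke(2) E1 by (simp add: Suc_le_eq)
  have p0: "0 < p" unfolding p_def using E1 by simp
  obtain Cd where Cd: "Cd > 0" "\<And>m::nat. m > 0 \<Longrightarrow> real (card {d. d dvd m}) \<le> Cd * real m powr p"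
    using divisor_bound[OF p0] by blast
  \<comment> \<open>The second summand forces \<open>Cd \<le> sqrt zz\<close>, so that the constant
    of the divisor bound and the power of \<open>m\<close> together stay below \<open>zz\<close>;
    the first is the assumption \<open>large\<close>.\<close>
  define M where "M = 10 ^ 8 * 3 ^ (40 * E) * (J + 1) + nat \<lceil>Cd\<^sup>2\<rceil>"
  \<comment> \<open>By \<open>fib_ge_linear\<close> the index \<open>l\<close> is at most
    \<open>2 * fib l + 2\<close>, so \<open>L \<le> l\<close> yields
    \<open>M \<le> fib l\<close>.\<close>
  define L where "L = 2 * M + 2"
  define X where "X = gr ^ (A * L)"
  define c where "c = exp 3 + 3 * (26 * real J + (8 * (real J + 2) + 4) * 2 ^ Suc J)"
  \<comment> \<open>The factor \<open>q * W\<close> is the loss per digit in \<open>decay\<close>,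
    \<open>2 ^ Suc J\<close> is the root to be extracted after van der Corput, and \<open>A\<close>
    converts \<open>l\<close> into \<open>ln x\<close>.\<close>
  define c\<^sub>1 where "c\<^sub>1 = 1 / (real A * (q * real W * 2 ^ Suc J))"
  define G where "G = c + 60000 * (real J + 1)"
  \<comment> \<open>The first summand serves the bounded \<open>x\<close> with \<open>l < L\<close>
    by the trivial estimate. In the second, the 9 collects the two factors 3 of
    \<open>total_bound\<close>, and \<open>exp 1\<close> pays for \<open>l + 1\<close> in place of
    \<open>l\<close>.\<close>
  define C where "C = 4 * X\<^sup>2 + 9 * G * exp 1"
  have q1: "1 \<le> q" unfolding q_def by (rule one_le_power) simp
  have W1: "1 \<le> real W" unfolding W_def by simp
  define H where "H = q * real W * 2 ^ Suc J"
  have "1 * 1 * 1 \<le> q * real W * 2 ^ Suc J" using q1 W1 by (intro mult_mono one_le_power) auto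
  then have H1: "1 \<le> H" unfolding H_def by simp
  have "1 * 1 \<le> real A * H" using A1 H1 by (intro mult_mono) auto
  then have AH: "1 \<le> real A * H" "0 < real A * H" by linarith+
  have c1: "0 < c\<^sub>1" "c\<^sub>1 \<le> 1"
    unfolding c\<^sub>1_def H_def[symmetric] using AH by (simp_all only: zero_less_divide_1_iff divide_le_eq_1_pos)
  have X0: "0 < X" unfolding X_def using gr_bounds by simp
  have c0: "0 \<le> c" unfolding c_def by (intro add_nonneg_nonneg mult_nonneg_nonneg) auto
  have G0: "0 \<le> G" unfolding G_def using c0 by simp
  have C0: "0 < C" unfolding C_def using X0 G0 by (intro add_pos_nonneg) auto
  have main: "sum (max_sum \<theta> x) {d::nat. 1 \<le> d \<and> real d \<le> x powr (1 - \<epsilon>)}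
      \<le> C * log_plus x powr (11/4) * x powr (1 - c\<^sub>1 * (dist_nearest_int \<theta>)\<^sup>2)" if x: "1 \<le> x" for \<theta> x :: real
  proof -
    define t where "t = (dist_nearest_int \<theta>)\<^sup>2"
    have t: "0 \<le> t" "t \<le> 1 / 4" unfolding t_def using dist_nearest_int_sq by auto
    define S where "S = {d::nat. 1 \<le> d \<and> real d \<le> x powr (1 - \<epsilon>)}"
    have S: "1 \<le> d \<and> real d \<le> x powr (1 - 1 / k)" if "d \<in> S" for d
    proof -
      have "x powr (1 - \<epsilon>) \<le> x powr (1 - 1 / k)" using x k\<epsilon> by (intro powr_mono) auto
      then show ?thesis using that unfolding S_def by simp
    qed
    have lp: "1 \<le> log_plus x" unfolding log_plus_def by simp
    \<comment> \<open>The dyadic ranges cost one factor \<open>log_plus x\<close>; being at least 1,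
      it is at most its power 11/4.\<close>
    have lp2: "log_plus x \<le> log_plus x powr (11/4)" using powr_mono[of 1 "11/4" "log_plus x"] lp by simp
    define R where "R = x powr (1 - c\<^sub>1 * t)"
    have R: "R = x * exp (- (c\<^sub>1 * t * ln x))"
    proof -
      have "R = exp (ln x + - (c\<^sub>1 * t * ln x))" unfolding R_def using x by (simp add: powr_def algebra_simps)
      also have "\<dots> = exp (ln x) * exp (- (c\<^sub>1 * t * ln x))" by (rule exp_add)
      finally show ?thesis using x by simp
    qed
    have "c\<^sub>1 * t \<le> 1 * 1" using c1 t by (intro mult_mono) auto
    then have R1: "1 \<le> R" unfolding R_def using x by (intro ge_one_powr_ge_zero) auto
    obtain l where lx: "gr ^ (A * l) \<le> x" "x < gr ^ (A * (l + 1))" "ln x / A \<le> real l + 1"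
      using gr_power_between[OF x A1] by blast
    have "sum (max_sum \<theta> x) S \<le> C * log_plus x * R"
    proof (cases "L \<le> l")
      case False
      have "gr ^ (A * (l + 1)) \<le> X" unfolding X_def using False gr_bounds by (intro power_increasing mult_left_mono) auto
      then have xX: "x \<le> X" using lx(2) by linarith
      have "x powr (1 - 1 / k) \<le> x" using powr_mono[of "1 - 1 / k" 1 x] x by simp
      then have "sum (max_sum \<theta> x) S \<le> 4 * X\<^sup>2" using S by (intro sum_max_sum_trivial[OF x xX]) force
      also have "\<dots> \<le> C * 1 * 1" unfolding C_def using G0 by simp
      also have "\<dots> \<le> C * log_plus x * R" using C0 lp R1 by (intro mult_mono) auto
      finally show ?thesis .
    next
      case True
      define zz where "zz = fib l"
      define Z where "Z = zz ^ E"
      have l2: "2 \<le> l" using True unfolding L_def by simp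
      have Mz: "M \<le> zz"
      proof -
        have "l - 2 + 2 = l" using l2 by simp
        then have "l - 2 \<le> 2 * zz" using fib_ge_linear[of "l - 2"] unfolding zz_def by (simp only:)
        then show ?thesis using True l2 unfolding L_def by linarith
      qed
      interpret scales J E l zz Z
      proof
        show "10 ^ 8 * 3 ^ (40 * E) * (J + 1) \<le> zz" using Mz unfolding M_def by linarith
      qed (use J1 l2 in \<open>auto simp: E_def zz_def Z_def\<close>)
      have zz0: "0 < real zz" using zz_pos by simp
      have dv: "real (card {d. d dvd m}) \<le> zz" if m: "0 < m" "real m \<le> real Z ^ (107 + J)" for m
      proof -
        have "real m powr p \<le> (real Z ^ (107 + J)) powr p" using m p0 by (intro powr_mono2) auto
        also have "real Z ^ (107 + J) = real zz ^ (E * (107 + J))" unfolding Z_def by (simp only: power_mult of_nat_power)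
        also have "\<dots> = real zz powr (real (E * (107 + J)))" using zz0 by (rule powr_realpow[symmetric])
        also have "(real zz powr (real (E * (107 + J)))) powr p = real zz powr (real (E * (107 + J)) * p)" by (rule powr_powr)
        also have "real (E * (107 + J)) * p = 1 / 2"
        proof -
          have "a * b * (1 / (2 * a * b)) = 1 / 2" if "a \<noteq> 0" "b \<noteq> 0" for a b :: real using that by simp
          moreover have "real (E * (107 + J)) = real E * (107 + real J)" by simp
          moreover have "real E \<noteq> 0" "107 + real J \<noteq> 0" using E1 by simp_all
          ultimately show ?thesis unfolding p_def by presburger
        qed
        also have "real zz powr (1 / 2) = sqrt (real zz)" using zz0 by (simp add: powr_half_sqrt)
        finally have a: "real m powr p \<le> sqrt (real zz)" .
        have "Cd\<^sup>2 \<le> real M" unfolding M_def by linarith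
        then have "Cd\<^sup>2 \<le> real zz" using Mz by linarith
        then have b: "Cd \<le> sqrt (real zz)" by (rule real_le_rsqrt)
        have "Cd * real m powr p \<le> sqrt (real zz) * sqrt (real zz)" using a b Cd(1) by (intro mult_mono) auto
        then show ?thesis using Cd(2)[OF m(1)] by simp
      qed
      define v where "v = (dist_nearest_int \<theta>)\<^sup>2 / (2 ^ (2 * Suc J * W) * real W)"
      have tot: "sum (max_sum \<theta> x) S \<le> 3 * log_plus x * (3 * x * (G * exp (- (v * l) / 2 ^ Suc J)))"
        unfolding G_def using ke(2) J_def lx(1,2)[unfolded A_def] l2 dv W_def v_def c_def S by (rule total_bound)
      have "v * l / 2 ^ Suc J = t * l / H" unfolding v_def t_def H_def q_def by simp
      moreover have "c\<^sub>1 * t * ln x = t / H * (ln x / A)" unfolding c\<^sub>1_def H_def[symmetric] by simp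
      moreover have "t / H * (ln x / A) \<le> t / H * (real l + 1)" using lx(3) t H1 by (intro mult_left_mono) auto
      moreover have "t / H * (real l + 1) = t * l / H + t / H" by (simp add: add_divide_distrib distrib_left)
      moreover have "t / H \<le> 1" using t H1 by (simp add: divide_le_eq)
      ultimately have "- (v * l) / 2 ^ Suc J \<le> 1 + - (c\<^sub>1 * t * ln x)" by simp
      then have "exp (- (v * l) / 2 ^ Suc J) \<le> exp (1 + - (c\<^sub>1 * t * ln x))" by (subst exp_le_cancel_iff)
      also have "\<dots> = exp 1 * exp (- (c\<^sub>1 * t * ln x))" by (rule exp_add)
      finally have ex: "exp (- (v * l) / 2 ^ Suc J) \<le> exp 1 * exp (- (c\<^sub>1 * t * ln x))" .
      have "3 * log_plus x * (3 * x * (G * exp (- (v * l) / 2 ^ Suc J)))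
          \<le> 3 * log_plus x * (3 * x * (G * (exp 1 * exp (- (c\<^sub>1 * t * ln x)))))"
        using ex G0 lp x by (intro mult_left_mono) auto
      also have "\<dots> = 9 * G * exp 1 * log_plus x * R" unfolding R by simp
      also have "\<dots> \<le> C * log_plus x * R" unfolding C_def using lp R1 by (intro mult_right_mono) auto
      finally show ?thesis using tot by linarith
    qed
    also have "\<dots> \<le> C * log_plus x powr (11/4) * R" using C0 lp2 R1 by (intro mult_right_mono mult_left_mono) auto
    finally show ?thesis unfolding S_def R_def t_def .
  qed
  have "\<forall>(\<theta>::real) (x::real). x \<ge> 1 \<longrightarrow> sum (max_sum \<theta> x) {d::nat. 1 \<le> d \<and> real d \<le> x powr (1 - \<epsilon>)}
      \<le> C * log_plus x powr (11/4) * x powr (1 - c\<^sub>1 * (dist_nearest_int \<theta>)\<^sup>2)"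
    using main by blast
  then show ?thesis unfolding max_sum_def using c1(1) C0 by (intro exI[of _ c\<^sub>1] exI[of _ C] conjI)
qed

end
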